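(* Let $d\ge 1$, let $\Omega\subset\mathbb{R}^d$ be an open set with smooth boundary ($\mathcal{C}^2$ is sufficient), and let $f\in\mathcal{C}^1(\mathbb{R};\mathbb{R}^d)$. Let $v\in \mathcal{C}^0((0,+\infty);L^1(\Omega))\cap L^\infty((0,+\infty)\times\Omega)$ be an entropy solution of $$\partial_t u+\mathrm{div}_x(f(u))=0\quad\text{in }(0,+\infty)\times\Omega$$ (without reference to any initial data), and let $u_0\in L^\infty(\Omega)$. Suppose that both $u_0$ and $v$ take values (almost everywhere) in a segment $I\subset\mathbb{R}$ such that $(f,\Omega,I)$ satisfies the replacement condition in time $\mathfrak{t}>0$. Suppose also that the flux $f$ is non degenerate. Then for any times $T_1$ and $T_2$ larger than $\mathfrak{t}$, there exists an entropy solution $u$ of $\partial_t u+\mathrm{div}_x(f(u))=0$ in $(0,+\infty)\times\Omega$ satisfying $$u(0,x)=u_0(x),\qquad u(T_1,x)=v(T_2,x)\qquad\text{for almost every }x\in\Omega .$$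
   Context: Notation: $\mathrm{sign}(u)=1$ if $u>0$, $0$ if $u=0$, $-1$ if $u<0$; $\langle\cdot|\cdot\rangle$ is the Euclidean scalar product on $\mathbb{R}^d$; $\mathcal{L}$ is the Lebesgue measure on $\mathbb{R}$. Entropy solution with initial datum: given $u_0\in L^\infty(\Omega)$, a function $u\in L^\infty([0,+\infty)\times\Omega)$ is an entropy solution of $\partial_t u+\mathrm{div}_x(f(u))=0$ in $(0,+\infty)\times\Omega$ with $u(0,\cdot)=u_0$ on $\Omega$ if for every $k\in\mathbb{R}$ and every non negative $\phi\in\mathcal{C}^1_c([0,+\infty)\times\Omega)$ $$\int_{(0,+\infty)\times\Omega}\Big(|u-k|\,\partial_t\phi+\mathrm{sign}(u-k)\langle f(u)-f(k)|\nabla\phi\rangle\Big)\,dt\,dx+\int_\Omega|u_0(x)-k|\,\phi(0,x)\,dx\ge 0 .$$ (No boundary condition on $\partial\Omega$ is part of this definition: the boundary data act as controls.) Entropy solution without reference to initial data: the same inequality is required for every $k\in\mathbb{R}$ and every non negative $\phi\in\mathcal{C}^1_c((0,+\infty)\times\Omega)$ (so the initial term vanishes). The value $u(T_1,\cdot)$ of an entropy solution at a fixed time is understood through its representative that is continuous in time with values in $L^1_{loc}(\Omega)$. Replacement condition: for $I$ a segment of $\mathbb{R}$, the triple $(f,\Omega,I)$ satisfies the replacement condition in time $\mathfrak{t}>0$ if there exist a vector $w\in\mathbb{R}^d$ and a number $c>0$ such that $L:=\sup_{x\in\Omega}\langle w|x\rangle-\inf_{x\in\Omega}\langle w|x\rangle<+\infty$,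 $\langle f'(u)|w\rangle\ge c$ for all $u\in I$, and $\mathfrak{t}=L/c$. Non degenerate flux: $f$ is non degenerate if for every $(\tau,\zeta)\in(\mathbb{R}\times\mathbb{R}^d)\setminus\{(0,0)\}$ one has $\mathcal{L}(\{z\in\mathbb{R}:\ \tau+\langle\zeta|f'(z)\rangle=0\})=0$. *)

theory Defs
  imports "HOL-Analysis.Analysis"
begin

text \<open>Functions on a set \<open>A\<close> are total functions of which only the restriction to \<open>A\<close> matters;
  measurability is Lebesgue measurability on \<open>A\<close>.\<close>

definition L_infinity :: "'b::euclidean_space set \<Rightarrow> ('b \<Rightarrow> real) \<Rightarrow> bool" where
  "L_infinity A g \<longleftrightarrow>
     g \<in> borel_measurable (lebesgue_on A) \<and>
     (\<exists>C. AE x in lebesgue_on A. \<bar>g x\<bar> \<le> C)"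

definition continuous_in_L1 ::
    "real set \<Rightarrow> 'a::euclidean_space set \<Rightarrow> (real \<Rightarrow> 'a \<Rightarrow> real) \<Rightarrow> bool" where
  "continuous_in_L1 J A u \<longleftrightarrow>
     (\<forall>t\<in>J. integrable (lebesgue_on A) (u t) \<and>
        ((\<lambda>s. \<integral>x. \<bar>u s x - u t x\<bar> \<partial>lebesgue_on A) \<longlongrightarrow> 0) (at t within J))"

definition continuous_in_L1_loc ::
    "real set \<Rightarrow> 'a::euclidean_space set \<Rightarrow> (real \<Rightarrow> 'a \<Rightarrow> real) \<Rightarrow> bool" where
  "continuous_in_L1_loc J \<Omega> u \<longleftrightarrow>
     (\<forall>K. compact K \<and> K \<subseteq> \<Omega> \<longrightarrow> continuous_in_L1 J K u)"

text \<open>\<open>D\<close> and \<open>H\<close> are the gradient and the Hessian of \<open>g\<close>.\<close>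

definition C2_function :: "('a::euclidean_space \<Rightarrow> real) \<Rightarrow> bool" where
  "C2_function g \<longleftrightarrow>
     (\<exists>(D :: 'a \<Rightarrow> 'a) (H :: 'a \<Rightarrow> 'a \<Rightarrow>\<^sub>L 'a).
        (\<forall>y. (g has_derivative (\<lambda>h. inner (D y) h)) (at y)) \<and>
        (\<forall>y. (D has_derivative blinfun_apply (H y)) (at y)) \<and>
        continuous_on UNIV H)"

text \<open>Near each boundary point, \<open>\<Omega>\<close> is the strict epigraph, in some unit direction \<open>\<nu>\<close>, of a
  \<open>C\<^sup>2\<close> function on the hyperplane orthogonal to \<open>\<nu>\<close>. A function on that hyperplane is
  represented by a function \<open>\<gamma>\<close> on the whole space evaluated at the orthogonal projection.\<close>

definition C2_boundary :: "'a::euclidean_space set \<Rightarrow> bool" where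
  "C2_boundary \<Omega> \<longleftrightarrow>
     (\<forall>p\<in>frontier \<Omega>. \<exists>r>0. \<exists>\<nu> \<gamma>. norm \<nu> = 1 \<and> C2_function \<gamma> \<and>
        \<Omega> \<inter> ball p r = {x \<in> ball p r. \<gamma> (x - inner x \<nu> *\<^sub>R \<nu>) < inner x \<nu>})"

text \<open>\<open>\<phi>\<close> is a nonnegative \<open>C\<^sup>1\<close> function with compact support in \<open>S\<close>, and \<open>G\<close> is its
  (time, space) gradient on \<open>S\<close>. The derivative is taken within \<open>S\<close>: for \<open>S = {0<..} \<times> \<Omega>\<close> with
  \<open>\<Omega>\<close> open it is the usual one, and for \<open>S = {0..} \<times> \<Omega>\<close> it is one-sided in time at \<open>t = 0\<close>, so
  that \<open>\<phi>\<close> need not vanish there.\<close>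

definition test_function ::
    "(real \<times> 'a::euclidean_space) set \<Rightarrow> (real \<times> 'a \<Rightarrow> real) \<Rightarrow> (real \<times> 'a \<Rightarrow> real \<times> 'a) \<Rightarrow> bool"
  where
  "test_function S \<phi> G \<longleftrightarrow>
     (\<forall>p\<in>S. (\<phi> has_derivative (\<lambda>h. inner (G p) h)) (at p within S)) \<and>
     continuous_on S G \<and>
     (\<exists>K. compact K \<and> K \<subseteq> S \<and> (\<forall>p\<in>S - K. \<phi> p = 0)) \<and>
     (\<forall>p\<in>S. 0 \<le> \<phi> p)"

definition kruzhkov_integral ::
    "(real \<Rightarrow> 'a::euclidean_space) \<Rightarrow> 'a set \<Rightarrow> (real \<Rightarrow> 'a \<Rightarrow> real) \<Rightarrow> real \<Rightarrow>
     (real \<times> 'a \<Rightarrow> real \<times> 'a) \<Rightarrow> real" where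
  "kruzhkov_integral f \<Omega> u k G =
     (\<integral>(t, x). \<bar>u t x - k\<bar> * fst (G (t, x))
              + sgn (u t x - k) * inner (f (u t x) - f k) (snd (G (t, x)))
        \<partial>lebesgue_on ({0<..} \<times> \<Omega>))"

definition entropy_solution ::
    "(real \<Rightarrow> 'a::euclidean_space) \<Rightarrow> 'a set \<Rightarrow> (real \<Rightarrow> 'a \<Rightarrow> real) \<Rightarrow> bool" where
  "entropy_solution f \<Omega> u \<longleftrightarrow>
     L_infinity ({0<..} \<times> \<Omega>) (\<lambda>(t, x). u t x) \<and>
     (\<forall>k \<phi> G. test_function ({0<..} \<times> \<Omega>) \<phi> G \<longrightarrow> 0 \<le> kruzhkov_integral f \<Omega> u k G)"

definition entropy_solution_from ::
    "(real \<Rightarrow> 'a::euclidean_space) \<Rightarrow> 'a set \<Rightarrow> ('a \<Rightarrow> real) \<Rightarrow> (real \<Rightarrow> 'a \<Rightarrow> real) \<Rightarrow> bool" where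
  "entropy_solution_from f \<Omega> u0 u \<longleftrightarrow>
     L_infinity ({0..} \<times> \<Omega>) (\<lambda>(t, x). u t x) \<and>
     (\<forall>k \<phi> G. test_function ({0..} \<times> \<Omega>) \<phi> G \<longrightarrow>
        0 \<le> kruzhkov_integral f \<Omega> u k G
             + (\<integral>x. \<bar>u0 x - k\<bar> * \<phi> (0, x) \<partial>lebesgue_on \<Omega>))"

text \<open>The oscillation \<open>L\<close> is computed in the extended reals, so that its finiteness is a genuine
  condition.\<close>

definition replacement_condition ::
    "(real \<Rightarrow> 'a::euclidean_space) \<Rightarrow> 'a set \<Rightarrow> real set \<Rightarrow> real \<Rightarrow> bool" where
  "replacement_condition f \<Omega> I \<tau> \<longleftrightarrow>
     0 < \<tau> \<and>
     (\<exists>w c. 0 < c \<and>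
        (let L = (SUP x\<in>\<Omega>. ereal (inner w x)) - (INF x\<in>\<Omega>. ereal (inner w x))
         in L < \<infinity> \<and>
            (\<forall>z\<in>I. c \<le> inner (vector_derivative f (at z)) w) \<and>
            ereal \<tau> = L / ereal c))"

definition nondegenerate_flux :: "(real \<Rightarrow> 'a::euclidean_space) \<Rightarrow> bool" where
  "nondegenerate_flux f \<longleftrightarrow>
     (\<forall>\<sigma> \<zeta>. (\<sigma>, \<zeta>) \<noteq> (0, 0) \<longrightarrow>
        {z. \<sigma> + inner \<zeta> (vector_derivative f (at z)) = 0} \<in> null_sets lebesgue)"

end

theory Submission
  imports Defs "HOL-Complex_Analysis.Great_Picard"
begin

text \<open>The replacement condition provides a hyperplane front \<open>t = \<theta> x = p \<bullet> x + q\<close> that every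
  characteristic with speed \<open>f' \<xi>\<close>, \<open>\<xi> \<in> I\<close>, crosses in the same direction, since
  \<open>p \<bullet> f' \<xi> \<ge> 1 + \<kappa>\<close>, and that sweeps \<open>\<Omega>\<close> during the time interval between
  \<open>max 0 (T1 - T2)\<close> and \<open>T1\<close>. Behind the front \<open>u\<close> is the shifted solution
  \<open>v (t + T2 - T1)\<close>, which gives \<open>u T1 = v T2\<close>. Ahead of it \<open>u\<close> solves the problem in the whole
  space with initial datum \<open>u0\<close> and with the trace of \<open>v\<close> as datum on the front, where all
  characteristics enter.

  That problem is solved by Brenier's transport-collapse scheme. One step of it contracts
  \<open>L\<^sup>1\<close>, and data enter only through a layer behind the front whose width is a multiple of the
  step, so that each point contributes during boundedly many steps; comparison with the scheme
  for continuous data then gives compactness. Its discrete kinetic entropy inequality passes to the limit and leaves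
  a flux term on the front. For almost every \<open>q\<close> the solution \<open>v\<close> attains its values on the
  front strongly, so that its entropy inequality behind the front has the opposite flux term, and
  the two inequalities add up.\<close>

section \<open>Transport and collapse\<close>

text \<open>The datum on the front is merely measurable, so no bounded variation or uniform modulus
  is at hand. Equicontinuity is therefore proved for a fixed continuous datum \<open>G i\<close>,
  uniformly in the step, and carried over to the moving datum by L1 stability. The strict
  inequalities \<open>\<tau> < T1\<close> and \<open>\<tau> < T2\<close> are spent twice. The front
  may move slightly slower than all characteristics, which gives \<open>\<kappa> > 0\<close>: a
  backward characteristic then meets the front within a controlled time, while \<open>N\<close>
  bounds the speed relative to the front and so the width of the data layer. And the position
  \<open>q\<close> stays free in an open interval. The freedom in \<open>q\<close> resolves the main
  obstacle, the trace of \<open>v\<close>. The flux is nonlinear, so the inequality behind the front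
  needs the values of \<open>v\<close> on the front in a strong sense. Integrated over
  \<open>q\<close>, the oscillation next to the front becomes an L1 norm of a small time translation
  of \<open>v\<close>; scales for which these norms are summable then work for almost every
  \<open>q\<close>. Time is kept continuous in the scheme, so that every estimate is a change of
  variables for Lebesgue measure.\<close>

lemma nn_integral_lborel_shift:
  fixes f :: "'a::euclidean_space \<Rightarrow> ennreal"
  assumes [measurable]: "f \<in> borel_measurable borel"
  shows "(\<integral>\<^sup>+x. f (x + v) \<partial>lborel) = (\<integral>\<^sup>+x. f x \<partial>lborel)"
proof -
  have "(\<integral>\<^sup>+x. f x \<partial>lborel) = (\<integral>\<^sup>+x. f x \<partial>distr lborel borel ((+) v))"
    by (simp add: lborel_distr_plus)
  also have "\<dots> = (\<integral>\<^sup>+x. f (v + x) \<partial>lborel)"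
    by (subst nn_integral_distr) auto
  finally show ?thesis by (simp add: add.commute)
qed

lemma cball_measurable [measurable]: "cball x r \<in> sets (borel :: 'a::metric_space measure)"
  by (simp add: borel_closed)

lemma borel_fst_snd [measurable]:
  "fst \<in> (borel :: ('a::topological_space \<times> 'b::topological_space) measure) \<rightarrow>\<^sub>M borel"
  "snd \<in> (borel :: ('a \<times> 'b) measure) \<rightarrow>\<^sub>M borel"
  by (intro borel_measurable_continuous_onI continuous_intros)+

text \<open>This is |1_{\<xi> < u} - 1_{\<xi> < k}|, the indicator of the levels between
  \<open>u\<close> and \<open>k\<close>. Integrated in \<open>\<xi>\<close> it gives |u - k|, and
  weighted by the speed it gives Kruzhkov's entropy flux.\<close>

definition sep :: "real \<Rightarrow> real \<Rightarrow> real \<Rightarrow> real" where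
  "sep \<xi> u k = (if (\<xi> < u) = (\<xi> < k) then 0 else 1)"

lemma sep_bounds: "0 \<le> sep \<xi> u k" "sep \<xi> u k \<le> 1"
  by (auto simp: sep_def)

lemma sep_measurable [measurable (raw)]:
  assumes [measurable]: "f \<in> borel_measurable M" "u \<in> borel_measurable M" "k \<in> borel_measurable M"
  shows "(\<lambda>x. sep (f x) (u x) (k x)) \<in> borel_measurable M"
  unfolding sep_def by measurable

text \<open>\<open>c\<close> will be the derivative of the flux. \<open>M\<close> bounds the speed
  of values in {a..b} and makes domains of dependence finite.\<close>

locale kinetic =
  fixes c :: "real \<Rightarrow> 'a::euclidean_space" and a b M :: real
  assumes c_cont: "continuous_on UNIV c"
    and ab: "a \<le> b"
    and c_le: "\<And>\<xi>. \<xi> \<in> {a..b} \<Longrightarrow> norm (c \<xi>) \<le> M"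
    and M_nonneg: "0 \<le> M"
begin

lemma c_measurable [measurable]: "c \<in> borel_measurable borel"
  using c_cont by (rule borel_measurable_continuous_onI)

lemma nn_integral_sep:
  assumes "u \<in> {a..b}" "k \<in> {a..b}"
  shows "(\<integral>\<^sup>+\<xi>. indicator {a..b} \<xi> * ennreal (sep \<xi> u k) \<partial>lborel) = ennreal \<bar>u - k\<bar>"
proof -
  have "(\<integral>\<^sup>+\<xi>. indicator {a..b} \<xi> * ennreal (sep \<xi> u k) \<partial>lborel)
      = (\<integral>\<^sup>+\<xi>. indicator {min u k..<max u k} \<xi> \<partial>lborel)"
    using assms by (intro nn_integral_cong) (auto simp: sep_def indicator_def)
  also have "\<dots> = ennreal (max u k - min u k)"
    by simp
  finally show ?thesis by (simp add: max_def min_def abs_if split: if_splits)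
qed

text \<open>The subgraph of \<open>\<alpha>\<close> is transported along the characteristics for a time \<open>h\<close>; the length
  of its fibre over \<open>x\<close> is the new value at \<open>x\<close>.\<close>

definition collapse :: "real \<Rightarrow> ('a \<Rightarrow> real) \<Rightarrow> 'a \<Rightarrow> real" where
  "collapse h \<alpha> x = a + (\<integral>\<xi>. indicator {a..b} \<xi> * indicator {\<xi>. \<xi> < \<alpha> (x - h *\<^sub>R c \<xi>)} \<xi> \<partial>lborel)"

lemma integrable_section:
  assumes [measurable]: "\<alpha> \<in> borel_measurable borel"
  shows "integrable lborel (\<lambda>\<xi>. indicator {a..b} \<xi> * indicator {\<xi>. \<xi> < \<alpha> (x - h *\<^sub>R c \<xi>)} \<xi> :: real)"
proof (rule Bochner_Integration.integrable_bound[where f="indicator {a..b} :: real \<Rightarrow> real"])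
  show "integrable lborel (indicator {a..b} :: real \<Rightarrow> real)"
    using ab by (simp add: integrable_indicator_iff)
qed (auto simp: indicator_def)

lemma collapse_mono:
  assumes [measurable]: "\<alpha> \<in> borel_measurable borel" "\<beta> \<in> borel_measurable borel"
    and le: "\<And>\<xi>. \<xi> \<in> {a..b} \<Longrightarrow> \<alpha> (x - h *\<^sub>R c \<xi>) \<le> \<beta> (x - h *\<^sub>R c \<xi>)"
  shows "collapse h \<alpha> x \<le> collapse h \<beta> x"
  unfolding collapse_def
proof (intro add_left_mono integral_mono integrable_section)
  fix \<xi> :: real
  show "indicator {a..b} \<xi> * indicator {\<xi>. \<xi> < \<alpha> (x - h *\<^sub>R c \<xi>)} \<xi>
      \<le> (indicator {a..b} \<xi> * indicator {\<xi>. \<xi> < \<beta> (x - h *\<^sub>R c \<xi>)} \<xi> :: real)"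
    using le[of \<xi>] by (auto simp: indicator_def)
qed measurable

lemma collapse_const:
  assumes "k \<in> {a..b}"
  shows "collapse h (\<lambda>_. k) x = k"
proof -
  have "(\<integral>\<xi>. indicator {a..b} \<xi> * indicator {\<xi>. \<xi> < k} \<xi> \<partial>lborel) = (\<integral>\<xi>. indicator {a..<k} \<xi> \<partial>lborel :: real)"
    using assms by (intro Bochner_Integration.integral_cong) (auto simp: indicator_def)
  then show ?thesis using assms by (simp add: collapse_def)
qed

lemma collapse_le:
  assumes [measurable]: "\<alpha> \<in> borel_measurable borel"
    and le: "\<And>\<xi>. \<xi> \<in> {a..b} \<Longrightarrow> \<alpha> (x - h *\<^sub>R c \<xi>) \<le> k" and k: "k \<in> {a..b}"
  shows "collapse h \<alpha> x \<le> k"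
  using collapse_mono[of \<alpha> "\<lambda>_. k" x h] le collapse_const[OF k] by simp

lemma collapse_ge:
  assumes [measurable]: "\<alpha> \<in> borel_measurable borel"
    and le: "\<And>\<xi>. \<xi> \<in> {a..b} \<Longrightarrow> k \<le> \<alpha> (x - h *\<^sub>R c \<xi>)" and k: "k \<in> {a..b}"
  shows "k \<le> collapse h \<alpha> x"
  using collapse_mono[of "\<lambda>_. k" \<alpha> x h] le collapse_const[OF k] by simp

lemma collapse_range:
  assumes [measurable]: "\<alpha> \<in> borel_measurable borel" and "\<And>x. \<alpha> x \<in> {a..b}"
  shows "collapse h \<alpha> x \<in> {a..b}"
  using collapse_le[where \<alpha>=\<alpha> and k=b] collapse_ge[where \<alpha>=\<alpha> and k=a] assms ab by auto

lemma collapse_near: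
  assumes [measurable]: "\<alpha> \<in> borel_measurable borel" and I: "\<And>x. \<alpha> x \<in> {a..b}"
    and near: "\<And>\<xi>. \<xi> \<in> {a..b} \<Longrightarrow> \<bar>\<alpha> (x - h *\<^sub>R c \<xi>) - k\<bar> \<le> e"
    and k: "k \<in> {a..b}" and e: "0 \<le> e"
  shows "\<bar>collapse h \<alpha> x - k\<bar> \<le> e"
proof -
  \<comment> \<open>The bounds are clipped to {a..b} because \<open>collapse_le\<close> and
    \<open>collapse_ge\<close> accept only constants of that interval.\<close>
  have le: "\<alpha> (x - h *\<^sub>R c \<xi>) \<le> min b (k + e)" "max a (k - e) \<le> \<alpha> (x - h *\<^sub>R c \<xi>)"
    if "\<xi> \<in> {a..b}" for \<xi>
    using near[OF that] I[of "x - h *\<^sub>R c \<xi>"] by (auto simp: abs_le_iff)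
  have "collapse h \<alpha> x \<le> min b (k + e)"
    by (rule collapse_le) (use le k e in auto)
  moreover have "max a (k - e) \<le> collapse h \<alpha> x"
    by (rule collapse_ge) (use le k e in auto)
  ultimately show ?thesis by auto
qed

text \<open>Two fibre lengths differ by at most the measure of the levels lying in exactly one of
  the transported subgraphs. The bound is kept pointwise in \<open>x\<close>: integrated it gives
  the L1 contraction, and with constant \<open>\<beta>\<close> it gives the discrete entropy
  inequality.\<close>

lemma collapse_diff_le:
  assumes [measurable]: "\<alpha> \<in> borel_measurable borel" "\<beta> \<in> borel_measurable borel"
  shows "ennreal \<bar>collapse h \<alpha> x - collapse h \<beta> x\<bar> \<le>
    (\<integral>\<^sup>+\<xi>. indicator {a..b} \<xi> * ennreal (sep \<xi> (\<alpha> (x - h *\<^sub>R c \<xi>)) (\<beta> (x - h *\<^sub>R c \<xi>))) \<partial>lborel)"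
proof -
  let ?F = "\<lambda>\<alpha> \<xi>. indicator {a..b} \<xi> * indicator {\<xi>. \<xi> < \<alpha> (x - h *\<^sub>R c \<xi>)} \<xi> :: real"
  have int: "integrable lborel (\<lambda>\<xi>. ?F \<alpha> \<xi> - ?F \<beta> \<xi>)"
    by (intro Bochner_Integration.integrable_diff integrable_section) measurable
  have "collapse h \<alpha> x - collapse h \<beta> x = (\<integral>\<xi>. ?F \<alpha> \<xi> - ?F \<beta> \<xi> \<partial>lborel)"
    unfolding collapse_def
    by (subst Bochner_Integration.integral_diff) (use integrable_section assms in auto)
  then have "ennreal \<bar>collapse h \<alpha> x - collapse h \<beta> x\<bar> = ennreal (norm (\<integral>\<xi>. ?F \<alpha> \<xi> - ?F \<beta> \<xi> \<partial>lborel))"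
    by (simp only: real_norm_def)
  also have "\<dots> \<le> (\<integral>\<^sup>+\<xi>. norm (?F \<alpha> \<xi> - ?F \<beta> \<xi>) \<partial>lborel)"
    by (rule integral_norm_bound_ennreal[OF int])
  also have "\<dots> = (\<integral>\<^sup>+\<xi>. indicator {a..b} \<xi> * ennreal (sep \<xi> (\<alpha> (x - h *\<^sub>R c \<xi>)) (\<beta> (x - h *\<^sub>R c \<xi>))) \<partial>lborel)"
    by (intro nn_integral_cong) (auto simp: indicator_def sep_def)
  finally show ?thesis .
qed

text \<open>For fixed \<open>\<xi>\<close> the transport is a translation in \<open>x\<close> and
  preserves Lebesgue measure. After Fubini the levels between \<open>\<alpha>\<close> and
  \<open>\<beta>\<close> are counted at their departure points, which all lie in
  \<open>E'\<close>.\<close>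

lemma collapse_contraction:
  assumes [measurable]: "\<alpha> \<in> borel_measurable borel" "\<beta> \<in> borel_measurable borel"
    "E \<in> sets borel" "E' \<in> sets borel"
    and I: "\<And>x. \<alpha> x \<in> {a..b}" "\<And>x. \<beta> x \<in> {a..b}"
    and E': "\<And>x \<xi>. \<xi> \<in> {a..b} \<Longrightarrow> x + h *\<^sub>R c \<xi> \<in> E \<Longrightarrow> x \<in> E'"
  shows "(\<integral>\<^sup>+x. indicator E x * ennreal \<bar>collapse h \<alpha> x - collapse h \<beta> x\<bar> \<partial>lborel)
       \<le> (\<integral>\<^sup>+x. indicator E' x * ennreal \<bar>\<alpha> x - \<beta> x\<bar> \<partial>lborel)"
proof -
  have "(\<integral>\<^sup>+x. indicator E x * ennreal \<bar>collapse h \<alpha> x - collapse h \<beta> x\<bar> \<partial>lborel)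
    \<le> (\<integral>\<^sup>+x. indicator E x * (\<integral>\<^sup>+\<xi>. indicator {a..b} \<xi> * ennreal (sep \<xi> (\<alpha> (x - h *\<^sub>R c \<xi>)) (\<beta> (x - h *\<^sub>R c \<xi>))) \<partial>lborel) \<partial>lborel)"
    by (intro nn_integral_mono mult_left_mono collapse_diff_le) auto
  also have "\<dots> = (\<integral>\<^sup>+x. (\<integral>\<^sup>+\<xi>. indicator E x * (indicator {a..b} \<xi> * ennreal (sep \<xi> (\<alpha> (x - h *\<^sub>R c \<xi>)) (\<beta> (x - h *\<^sub>R c \<xi>)))) \<partial>lborel) \<partial>lborel)"
    by (intro nn_integral_cong nn_integral_cmult[symmetric]) auto
  also have "\<dots> = (\<integral>\<^sup>+\<xi>. (\<integral>\<^sup>+x. indicator E x * (indicator {a..b} \<xi> * ennreal (sep \<xi> (\<alpha> (x - h *\<^sub>R c \<xi>)) (\<beta> (x - h *\<^sub>R c \<xi>)))) \<partial>lborel) \<partial>lborel)"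
    by (rule lborel_pair.Fubini') measurable
  also have "\<dots> = (\<integral>\<^sup>+\<xi>. (\<integral>\<^sup>+x. indicator E (x + h *\<^sub>R c \<xi>) * (indicator {a..b} \<xi> * ennreal (sep \<xi> (\<alpha> x) (\<beta> x))) \<partial>lborel) \<partial>lborel)"
  proof (rule nn_integral_cong)
    fix \<xi> :: real
    show "(\<integral>\<^sup>+x. indicator E x * (indicator {a..b} \<xi> * ennreal (sep \<xi> (\<alpha> (x - h *\<^sub>R c \<xi>)) (\<beta> (x - h *\<^sub>R c \<xi>)))) \<partial>lborel)
      = (\<integral>\<^sup>+x. indicator E (x + h *\<^sub>R c \<xi>) * (indicator {a..b} \<xi> * ennreal (sep \<xi> (\<alpha> x) (\<beta> x))) \<partial>lborel)"
      using nn_integral_lborel_shift[of "\<lambda>x. indicator E x * (indicator {a..b} \<xi> * ennreal (sep \<xi> (\<alpha> (x - h *\<^sub>R c \<xi>)) (\<beta> (x - h *\<^sub>R c \<xi>))))" "h *\<^sub>R c \<xi>"]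
      by simp
  qed
  also have "\<dots> \<le> (\<integral>\<^sup>+\<xi>. (\<integral>\<^sup>+x. indicator E' x * (indicator {a..b} \<xi> * ennreal (sep \<xi> (\<alpha> x) (\<beta> x))) \<partial>lborel) \<partial>lborel)"
    by (intro nn_integral_mono) (use E' in \<open>auto simp: indicator_def split: if_splits\<close>)
  also have "\<dots> = (\<integral>\<^sup>+x. (\<integral>\<^sup>+\<xi>. indicator E' x * (indicator {a..b} \<xi> * ennreal (sep \<xi> (\<alpha> x) (\<beta> x))) \<partial>lborel) \<partial>lborel)"
    by (rule lborel_pair.Fubini') measurable
  also have "\<dots> = (\<integral>\<^sup>+x. indicator E' x * ennreal \<bar>\<alpha> x - \<beta> x\<bar> \<partial>lborel)"
    by (intro nn_integral_cong, subst nn_integral_cmult) (use I in \<open>auto simp: nn_integral_sep\<close>)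
  finally show ?thesis .
qed

text \<open>The collapsed function itself depends on the parameter, because the scheme has to be
  jointly measurable in time and space.\<close>

lemma collapse_measurable_pair:
  fixes T :: "'z \<Rightarrow> 'a \<Rightarrow> real" and X :: "'z \<Rightarrow> 'a"
  assumes [measurable]: "(\<lambda>w. T (fst w) (snd w)) \<in> borel_measurable (M' \<Otimes>\<^sub>M borel)"
    "X \<in> measurable M' borel"
  shows "(\<lambda>z. collapse h (T z) (X z)) \<in> borel_measurable M'"
proof -
  have W: "(\<lambda>w. (fst w, X (fst w) - h *\<^sub>R c (snd w))) \<in> M' \<Otimes>\<^sub>M borel \<rightarrow>\<^sub>M M' \<Otimes>\<^sub>M borel"
    by measurable
  have T: "(\<lambda>w. T (fst w) (X (fst w) - h *\<^sub>R c (snd w))) \<in> borel_measurable (M' \<Otimes>\<^sub>M borel)"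
    using measurable_compose[OF W assms(1)] by simp
  have *: "(\<lambda>(z,\<xi>). indicator {a..b} \<xi> * indicator {\<xi>. \<xi> < T z (X z - h *\<^sub>R c \<xi>)} \<xi> :: real)
     = (\<lambda>w. if snd w \<in> {a..b} \<and> snd w < T (fst w) (X (fst w) - h *\<^sub>R c (snd w)) then 1 else 0)"
    by (auto simp: indicator_def)
  have "(\<lambda>(z,\<xi>). indicator {a..b} \<xi> * indicator {\<xi>. \<xi> < T z (X z - h *\<^sub>R c \<xi>)} \<xi> :: real)
      \<in> borel_measurable (M' \<Otimes>\<^sub>M lborel)"
    unfolding * using T by measurable
  from lborel.borel_measurable_lebesgue_integral[OF this] show ?thesis
    unfolding collapse_def by (intro borel_measurable_add) auto
qed

end

section \<open>The scheme ahead of a front\<close>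

text \<open>Along a characteristic \<open>\<theta> x - t\<close> grows at the rate
  \<open>p \<bullet> c \<xi> - 1\<close>, which lies between \<open>\<kappa>\<close> and
  \<open>N\<close>. The lower bound limits the travel time back to the front, the upper bound the
  width of the data layer used by one step.\<close>

locale front = kinetic c a b M for c :: "real \<Rightarrow> 'a::euclidean_space" and a b M +
  fixes p :: 'a and q \<kappa> N :: real
  assumes kappa_pos: "0 < \<kappa>" and N_nonneg: "0 \<le> N"
    and p_ge: "\<And>\<xi>. \<xi> \<in> {a..b} \<Longrightarrow> 1 + \<kappa> \<le> p \<bullet> c \<xi>"
    and p_le: "\<And>\<xi>. \<xi> \<in> {a..b} \<Longrightarrow> p \<bullet> c \<xi> \<le> 1 + N"
begin

definition \<theta> :: "'a \<Rightarrow> real" where "\<theta> x = p \<bullet> x + q"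

lemma theta_measurable [measurable]: "\<theta> \<in> borel_measurable borel"
  unfolding \<theta>_def by measurable

text \<open>The weight of \<open>d x\<close> bounds the number of steps in which \<open>x\<close> lies in the layer of width
  \<open>h * N\<close> behind the front from which the scheme takes its data.\<close>

lemma comparison_aux:
  assumes h: "0 < h"
    and [measurable]: "\<And>t. \<alpha> t \<in> borel_measurable borel" "\<And>t. \<beta> t \<in> borel_measurable borel"
      "d \<in> borel_measurable borel"
    and I: "\<And>t x. \<alpha> t x \<in> {a..b}" "\<And>t x. \<beta> t x \<in> {a..b}"
    and rec: "\<And>t x. T0 < t \<Longrightarrow> t < p \<bullet> x + q' \<Longrightarrow> \<alpha> t x = collapse h (\<alpha> (t - h)) x"
      "\<And>t x. T0 < t \<Longrightarrow> t < p \<bullet> x + q' \<Longrightarrow> \<beta> t x = collapse h (\<beta> (t - h)) x"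
    and near: "\<And>t x. T0 - h < t \<Longrightarrow> t \<le> Tm \<Longrightarrow> t \<le> T0 \<or> (p \<bullet> x + q' \<le> t \<and> t < p \<bullet> x + q' + h * N) \<Longrightarrow>
      norm x \<le> R0 \<Longrightarrow> ennreal \<bar>\<alpha> t x - \<beta> t x\<bar> \<le> d x"
  shows "T0 - h < t \<Longrightarrow> t \<le> Tm \<Longrightarrow> t \<le> T0 + real n * h \<Longrightarrow> R + M * (t - T0 + h) \<le> R0 \<Longrightarrow>
    (\<integral>\<^sup>+x. indicator (cball 0 R \<inter> {x. t < p \<bullet> x + q'}) x * ennreal \<bar>\<alpha> t x - \<beta> t x\<bar> \<partial>lborel)
    \<le> (\<integral>\<^sup>+x. indicator (cball 0 R0) x * (d x * ennreal (1 + min (N + 1) (max 0 ((t - (p \<bullet> x + q')) / h)))) \<partial>lborel)"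
proof (induction n arbitrary: t R)
  case 0
  have "R \<le> R0" using 0 M_nonneg by (smt (verit) mult_nonneg_nonneg)
  show ?case
  proof (intro nn_integral_mono)
    fix x :: 'a
    have "ennreal \<bar>\<alpha> t x - \<beta> t x\<bar> \<le> d x" if "norm x \<le> R0"
      using near[of t x] that 0 by auto
    moreover have "d x \<le> d x * ennreal (1 + min (N + 1) (max 0 ((t - (p \<bullet> x + q')) / h)))"
      using mult_left_mono[of 1 "ennreal (1 + min (N + 1) (max 0 ((t - (p \<bullet> x + q')) / h)))" "d x"] N_nonneg
      by simp
    ultimately show "indicator (cball 0 R \<inter> {x. t < p \<bullet> x + q'}) x * ennreal \<bar>\<alpha> t x - \<beta> t x\<bar>
      \<le> indicator (cball 0 R0) x * (d x * ennreal (1 + min (N + 1) (max 0 ((t - (p \<bullet> x + q')) / h))))"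
      using \<open>R \<le> R0\<close> by (auto simp: indicator_def intro: order_trans)
  qed
next
  case (Suc n)
  let ?w = "\<lambda>t x. 1 + min (N + 1) (max 0 ((t - (p \<bullet> x + q')) / h))"
  show ?case
  proof (cases "t \<le> T0 + real n * h")
    case True
    then show ?thesis using Suc by blast
  next
    case False
    then have t: "T0 < t" using h by (smt (verit) mult_nonneg_nonneg of_nat_0_le_iff)
    let ?R = "R + M * h"
    have R: "?R + M * ((t - h) - T0 + h) \<le> R0"
      using Suc.prems(4) by (simp add: algebra_simps)
    have RR: "?R \<le> R0" using R t M_nonneg by (smt (verit) mult_nonneg_nonneg)
    let ?E = "cball 0 R \<inter> {x. t < p \<bullet> x + q'}"
    \<comment> \<open>A departure point is at most \<open>M * h\<close> away from its arrival point.
      Since a step changes \<open>p \<bullet> x\<close> by at most \<open>h * (1 + N)\<close> and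
      time by \<open>h\<close>, it lies less than \<open>h * N\<close> behind the front.\<close>
    let ?E' = "cball 0 ?R \<inter> {x. t - h < p \<bullet> x + q' + h * N}"
    let ?S = "{x. p \<bullet> x + q' \<le> t - h \<and> t - h < p \<bullet> x + q' + h * N}"
    have "(\<integral>\<^sup>+x. indicator ?E x * ennreal \<bar>\<alpha> t x - \<beta> t x\<bar> \<partial>lborel)
      = (\<integral>\<^sup>+x. indicator ?E x * ennreal \<bar>collapse h (\<alpha> (t - h)) x - collapse h (\<beta> (t - h)) x\<bar> \<partial>lborel)"
      using rec t by (intro nn_integral_cong) (auto simp: indicator_def)
    also have "\<dots> \<le> (\<integral>\<^sup>+x. indicator ?E' x * ennreal \<bar>\<alpha> (t - h) x - \<beta> (t - h) x\<bar> \<partial>lborel)"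
    proof (rule collapse_contraction)
      fix x \<xi> assume xi: "\<xi> \<in> {a..b}" and x: "x + h *\<^sub>R c \<xi> \<in> ?E"
      have "norm x \<le> norm (x + h *\<^sub>R c \<xi>) + norm (h *\<^sub>R c \<xi>)"
        by (metis add_diff_cancel_right' norm_triangle_ineq4)
      also have "\<dots> \<le> R + M * h"
        using x c_le[OF xi] h by (auto simp: mult.commute intro!: add_mono mult_right_mono)
      finally have "norm x \<le> ?R" .
      moreover have "h * (p \<bullet> c \<xi>) \<le> h * (1 + N)"
        using h p_le[OF xi] by (intro mult_left_mono) auto
      ultimately show "x \<in> ?E'"
        using x by (auto simp: inner_add_right algebra_simps)
    qed (use I in auto)
    also have "\<dots> \<le> (\<integral>\<^sup>+x. indicator (cball 0 ?R \<inter> {x. t - h < p \<bullet> x + q'}) x * ennreal \<bar>\<alpha> (t - h) x - \<beta> (t - h) x\<bar>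
        + indicator (cball 0 R0) x * (d x * indicator ?S x) \<partial>lborel)"
    proof (intro nn_integral_mono)
      fix x :: 'a
      show "indicator ?E' x * ennreal \<bar>\<alpha> (t - h) x - \<beta> (t - h) x\<bar> \<le> 
        indicator (cball 0 ?R \<inter> {x. t - h < p \<bullet> x + q'}) x * ennreal \<bar>\<alpha> (t - h) x - \<beta> (t - h) x\<bar>
        + indicator (cball 0 R0) x * (d x * indicator ?S x)"
        using near[of "t - h" x] t RR Suc.prems(2) h by (auto simp: indicator_def)
    qed
    also have "\<dots> = (\<integral>\<^sup>+x. indicator (cball 0 ?R \<inter> {x. t - h < p \<bullet> x + q'}) x * ennreal \<bar>\<alpha> (t - h) x - \<beta> (t - h) x\<bar> \<partial>lborel)
        + (\<integral>\<^sup>+x. indicator (cball 0 R0) x * (d x * indicator ?S x) \<partial>lborel)"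
      by (rule nn_integral_add; measurable)
    also have "\<dots> \<le> (\<integral>\<^sup>+x. indicator (cball 0 R0) x * (d x * ennreal (?w (t - h) x)) \<partial>lborel)
        + (\<integral>\<^sup>+x. indicator (cball 0 R0) x * (d x * indicator ?S x) \<partial>lborel)"
      using Suc.prems t R h by (intro add_right_mono Suc.IH) (auto simp: algebra_simps)
    also have "\<dots> = (\<integral>\<^sup>+x. indicator (cball 0 R0) x * (d x * ennreal (?w (t - h) x))
        + indicator (cball 0 R0) x * (d x * indicator ?S x) \<partial>lborel)"
      by (rule nn_integral_add[symmetric]; measurable)
    also have "\<dots> \<le> (\<integral>\<^sup>+x. indicator (cball 0 R0) x * (d x * ennreal (?w t x)) \<partial>lborel)"
    proof (intro nn_integral_mono)
      fix x :: 'a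
      let ?r = "(t - h - (p \<bullet> x + q')) / h"
      have r: "(t - (p \<bullet> x + q')) / h = ?r + 1"
        using h by (simp add: field_simps)
      \<comment> \<open>Inside the layer \<open>?r\<close> is below \<open>N\<close>, so the cap
        \<open>N + 1\<close> is not reached within this step and the weight gains a full unit; this
        unit pays for the contribution of the layer.\<close>
      have le: "?w (t - h) x + indicator ?S x \<le> ?w t x"
      proof (cases "x \<in> ?S")
        case True
        then have "0 \<le> ?r" "?r < N" using h by (auto simp: field_simps)
        then show ?thesis using True unfolding r by (auto simp: min_def max_def)
      next
        case False
        then show ?thesis unfolding r by (auto simp: min_def max_def)
      qed
      have "ennreal (?w (t - h) x) + indicator ?S x = ennreal (?w (t - h) x + indicator ?S x)"
        using N_nonneg by (subst ennreal_plus) (auto simp: indicator_def)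
      also have "\<dots> \<le> ennreal (?w t x)" using le by (rule ennreal_leI)
      finally show "indicator (cball 0 R0) x * (d x * ennreal (?w (t - h) x))
        + indicator (cball 0 R0) x * (d x * indicator ?S x) \<le> indicator (cball 0 R0) x * (d x * ennreal (?w t x))"
        by (simp add: distrib_left[symmetric] mult_left_mono del: ennreal_plus)
    qed
    finally show ?thesis .
  qed
qed

text \<open>The weight never exceeds \<open>N + 2\<close>, which removes the number of steps and
  \<open>h\<close> from the bound. The level \<open>q'\<close> and the starting time
  \<open>T0\<close> are free, because for translates the recursion holds for both functions only
  past a delayed start and ahead of a lowered front.\<close>

lemma comparison:
  assumes h: "0 < h"
    and [measurable]: "\<And>t. \<alpha> t \<in> borel_measurable borel" "\<And>t. \<beta> t \<in> borel_measurable borel"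
      "d \<in> borel_measurable borel"
    and I: "\<And>t x. \<alpha> t x \<in> {a..b}" "\<And>t x. \<beta> t x \<in> {a..b}"
    and rec: "\<And>t x. T0 < t \<Longrightarrow> t < p \<bullet> x + q' \<Longrightarrow> \<alpha> t x = collapse h (\<alpha> (t - h)) x"
      "\<And>t x. T0 < t \<Longrightarrow> t < p \<bullet> x + q' \<Longrightarrow> \<beta> t x = collapse h (\<beta> (t - h)) x"
    and near: "\<And>t x. T0 - h < t \<Longrightarrow> t \<le> Tm \<Longrightarrow> t \<le> T0 \<or> (p \<bullet> x + q' \<le> t \<and> t < p \<bullet> x + q' + h * N) \<Longrightarrow>
      norm x \<le> R0 \<Longrightarrow> ennreal \<bar>\<alpha> t x - \<beta> t x\<bar> \<le> d x"
    and t: "T0 - h < t" "t \<le> Tm" and R: "R + M * (t - T0 + h) \<le> R0"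
  shows "(\<integral>\<^sup>+x. indicator (cball 0 R \<inter> {x. t < p \<bullet> x + q'}) x * ennreal \<bar>\<alpha> t x - \<beta> t x\<bar> \<partial>lborel)
    \<le> ennreal (N + 2) * (\<integral>\<^sup>+x. indicator (cball 0 R0) x * d x \<partial>lborel)"
proof -
  obtain n :: nat where "(t - T0) / h \<le> real n" using real_arch_simple by blast
  then have n: "t \<le> T0 + real n * h" using h by (simp add: field_simps)
  have "(\<integral>\<^sup>+x. indicator (cball 0 R \<inter> {x. t < p \<bullet> x + q'}) x * ennreal \<bar>\<alpha> t x - \<beta> t x\<bar> \<partial>lborel)
    \<le> (\<integral>\<^sup>+x. indicator (cball 0 R0) x * (d x * ennreal (1 + min (N + 1) (max 0 ((t - (p \<bullet> x + q')) / h)))) \<partial>lborel)"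
    by (rule comparison_aux[where \<alpha>=\<alpha> and \<beta>=\<beta> and d=d and n=n, OF h assms(2-4) I rec near]) (use t n R in auto)
  also have "\<dots> \<le> (\<integral>\<^sup>+x. ennreal (N + 2) * (indicator (cball 0 R0) x * d x) \<partial>lborel)"
  proof (intro nn_integral_mono)
    fix x :: 'a
    have "ennreal (1 + min (N + 1) (max 0 ((t - (p \<bullet> x + q')) / h))) \<le> ennreal (N + 2)"
      by (intro ennreal_leI) auto
    then have "(indicator (cball 0 R0) x * d x) * ennreal (1 + min (N + 1) (max 0 ((t - (p \<bullet> x + q')) / h)))
      \<le> (indicator (cball 0 R0) x * d x) * ennreal (N + 2)"
      by (intro mult_left_mono) auto
    then show "indicator (cball 0 R0) x * (d x * ennreal (1 + min (N + 1) (max 0 ((t - (p \<bullet> x + q')) / h))))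
      \<le> ennreal (N + 2) * (indicator (cball 0 R0) x * d x)"
      by (simp add: mult_ac)
  qed
  also have "\<dots> = ennreal (N + 2) * (\<integral>\<^sup>+x. indicator (cball 0 R0) x * d x \<partial>lborel)"
    by (rule nn_integral_cmult; measurable)
  finally show ?thesis .
qed

section \<open>Definition, measurability and range of the scheme\<close>

text \<open>Times are not confined to a grid: each class of times modulo \<open>h\<close> runs its
  own scheme. \<open>G\<close> supplies the values at nonpositive times and on or behind the front.
  For \<open>h \<le> 0\<close> the recursion stops at once, which keeps the function total.\<close>

function sol :: "real \<Rightarrow> (real \<times> 'a \<Rightarrow> real) \<Rightarrow> real \<Rightarrow> 'a \<Rightarrow> real" where
  "sol h G t = (if 0 < h \<and> 0 < t then (\<lambda>x. if t < \<theta> x then collapse h (sol h G (t - h)) x else G (t, x))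
     else (\<lambda>x. G (t, x)))"
  by pat_completeness auto
termination
proof (relation "Wellfounded.measure (\<lambda>(h, G, t). nat \<lceil>t / h\<rceil>)")
  fix h t :: real and G :: "real \<times> 'a \<Rightarrow> real"
  assume "0 < h \<and> 0 < t"
  \<comment> \<open>The quotient is positive and drops by exactly 1, so its rounded value strictly
    decreases as a natural number.\<close>
  then have "0 < t / h" "(t - h) / h = t / h - 1" by (auto simp: field_simps)
  then show "((h, G, t - h), h, G, t) \<in> Wellfounded.measure (\<lambda>(h, G, t). nat \<lceil>t / h\<rceil>)"
    by simp
qed auto

declare sol.simps [simp del]

lemma sol_ahead: "0 < h \<Longrightarrow> 0 < t \<Longrightarrow> t < \<theta> x \<Longrightarrow> sol h G t x = collapse h (sol h G (t - h)) x"
  by (simp add: sol.simps)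

lemma sol_data: "t \<le> 0 \<or> \<theta> x \<le> t \<Longrightarrow> sol h G t x = G (t, x)"
  by (subst sol.simps) auto

text \<open>The recursion depth is unbounded over all times, so the scheme is truncated at time
  \<open>real n * h\<close> and treated by induction on \<open>n\<close>; the value \<open>a\<close>
  beyond that time is a filler.\<close>

lemma sol_measurable_aux:
  assumes h: "0 < h" and [measurable]: "G \<in> borel_measurable borel"
  shows "(\<lambda>z. if fst z \<le> real n * h then sol h G (fst z) (snd z) else a) \<in> borel_measurable borel"
proof (induction n)
  case 0
  have "(\<lambda>z. if fst z \<le> real 0 * h then sol h G (fst z) (snd z) else a) = (\<lambda>z. if fst z \<le> 0 then G z else a)"
    by (auto simp: sol_data)
  then show ?case by (simp only:) measurable
next
  case (Suc n)
  let ?S = "\<lambda>z. if fst z \<le> real n * h then sol h G (fst z) (snd z) else a"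
  have eq: "(\<lambda>z. if fst z \<le> real (Suc n) * h then sol h G (fst z) (snd z) else a) =
    (\<lambda>z. if fst z \<le> real (Suc n) * h then
       (if 0 < fst z \<and> fst z < \<theta> (snd z) then collapse h (\<lambda>y. ?S (fst z - h, y)) (snd z) else G z) else a)"
    using h by (auto simp: sol_ahead sol_data fun_eq_iff algebra_simps not_less)
  have "(\<lambda>w. (fst (fst w) - h, snd w)) \<in> (borel :: (real \<times> 'a) measure) \<Otimes>\<^sub>M (borel :: 'a measure) \<rightarrow>\<^sub>M borel"
    by (subst borel_prod[symmetric]) measurable
  from measurable_compose[OF this Suc]
  have "(\<lambda>z. collapse h (\<lambda>y. ?S (fst z - h, y)) (snd z)) \<in> borel_measurable (borel :: (real \<times> 'a) measure)"
    by (intro collapse_measurable_pair) (simp_all add: borel_prod[symmetric])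
  then show ?case unfolding eq by measurable
qed

lemma sol_measurable:
  assumes h: "0 < h" and [measurable]: "G \<in> borel_measurable borel"
  shows "(\<lambda>z. sol h G (fst z) (snd z)) \<in> borel_measurable borel"
proof (rule borel_measurable_LIMSEQ_real)
  fix n
  show "(\<lambda>z. if fst z \<le> real n * h then sol h G (fst z) (snd z) else a) \<in> borel_measurable borel"
    using assms by (rule sol_measurable_aux)
next
  fix z :: "real \<times> 'a"
  obtain m :: nat where "fst z / h \<le> real m" using real_arch_simple by blast
  then have m: "fst z \<le> real m * h" using h by (simp add: field_simps)
  have "\<forall>\<^sub>F n in sequentially. (if fst z \<le> real n * h then sol h G (fst z) (snd z) else a) = sol h G (fst z) (snd z)"
    unfolding eventually_sequentially
  proof (intro exI[of _ m] allI impI)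
    fix n assume "m \<le> n"
    then have "real m * h \<le> real n * h" using h by (intro mult_right_mono) auto
    then show "(if fst z \<le> real n * h then sol h G (fst z) (snd z) else a) = sol h G (fst z) (snd z)"
      using m by simp
  qed
  then show "(\<lambda>n. if fst z \<le> real n * h then sol h G (fst z) (snd z) else a) \<longlonglongrightarrow> sol h G (fst z) (snd z)"
    by (rule tendsto_eventually)
qed

lemma sol_slice_measurable:
  assumes h: "0 < h" and [measurable]: "G \<in> borel_measurable borel"
  shows "sol h G t \<in> borel_measurable borel"
proof -
  have "(\<lambda>x. (t, x)) \<in> (borel :: 'a measure) \<rightarrow>\<^sub>M borel"
    by (intro borel_measurable_continuous_onI continuous_intros)
  from measurable_compose[OF this sol_measurable[OF assms]] show ?thesis by simp
qed

text \<open>Induction along strides of length \<open>h\<close> in real time. The hypothesis on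
  earlier times is offered only for \<open>0 < t\<close>, so nonpositive times form the base
  case.\<close>

lemma time_induct [consumes 1, case_names step]:
  assumes h: "0 < (h::real)"
    and step: "\<And>t. (\<And>s. 0 < t \<Longrightarrow> s \<le> t - h \<Longrightarrow> P s) \<Longrightarrow> P t"
  shows "P t"
proof -
  have "t \<le> real n * h \<Longrightarrow> P t" for n t
  proof (induction n arbitrary: t)
    case 0
    show ?case by (rule step) (use 0 in auto)
  next
    case (Suc n)
    show ?case by (rule step) (use Suc in \<open>auto simp: algebra_simps\<close>)
  qed
  moreover obtain n :: nat where "t / h \<le> real n" using real_arch_simple by blast
  ultimately show ?thesis using h by (simp add: field_simps)
qed

lemma sol_range:
  assumes h: "0 < h" and [measurable]: "G \<in> borel_measurable borel" and G: "\<And>z. G z \<in> {a..b}"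
  shows "sol h G t x \<in> {a..b}"
  using h
proof (induction t arbitrary: x rule: time_induct)
  case (step t)
  show ?case
  proof (cases "0 < t \<and> t < \<theta> x")
    case True
    then show ?thesis
      using step[of "t - h"] by (subst sol_ahead[OF h]) (auto intro!: collapse_range sol_slice_measurable[OF h] simp del: atLeastAtMost_iff)
  next
    case False
    then show ?thesis using G by (subst sol_data) auto
  qed
qed

end

section \<open>Compactness for local \<open>L\<^sup>1\<close> distances\<close>

lemma emeasure_cball_lt_top: "emeasure lborel (cball (x::'b::euclidean_space) R) < \<infinity>"
  using emeasure_lborel_cball_finite[of x R] by (simp add: top.not_eq_extremum)

lemma nn_integral_abs_triangle:
  fixes f g k :: "'b \<Rightarrow> real" and w :: "'b \<Rightarrow> ennreal"
  assumes [measurable]: "f \<in> borel_measurable M" "g \<in> borel_measurable M" "k \<in> borel_measurable M"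
    "w \<in> borel_measurable M"
  shows "(\<integral>\<^sup>+z. w z * ennreal \<bar>f z - k z\<bar> \<partial>M) \<le>
    (\<integral>\<^sup>+z. w z * ennreal \<bar>f z - g z\<bar> \<partial>M) + (\<integral>\<^sup>+z. w z * ennreal \<bar>g z - k z\<bar> \<partial>M)"
proof -
  have "(\<integral>\<^sup>+z. w z * ennreal \<bar>f z - k z\<bar> \<partial>M) \<le>
    (\<integral>\<^sup>+z. w z * ennreal \<bar>f z - g z\<bar> + w z * ennreal \<bar>g z - k z\<bar> \<partial>M)"
  proof (intro nn_integral_mono)
    fix z
    have "ennreal \<bar>f z - k z\<bar> \<le> ennreal \<bar>f z - g z\<bar> + ennreal \<bar>g z - k z\<bar>"
      using ennreal_leI[of "\<bar>f z - k z\<bar>" "\<bar>f z - g z\<bar> + \<bar>g z - k z\<bar>"] by simp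
    then show "w z * ennreal \<bar>f z - k z\<bar> \<le> w z * ennreal \<bar>f z - g z\<bar> + w z * ennreal \<bar>g z - k z\<bar>"
      unfolding distrib_left[symmetric] by (rule mult_left_mono) simp
  qed
  also have "\<dots> = (\<integral>\<^sup>+z. w z * ennreal \<bar>f z - g z\<bar> \<partial>M) + (\<integral>\<^sup>+z. w z * ennreal \<bar>g z - k z\<bar> \<partial>M)"
    by (rule nn_integral_add; measurable)
  finally show ?thesis .
qed

lemma L1_loc_tendsto:
  fixes f :: "nat \<Rightarrow> 'b::euclidean_space \<Rightarrow> real"
  assumes [measurable]: "\<And>j. f j \<in> borel_measurable borel" "F \<in> borel_measurable borel"
    and bd: "\<And>j z. \<bar>f j z\<bar> \<le> C" and lim: "AE z in lborel. (\<lambda>j. f j z) \<longlonglongrightarrow> F z"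
  shows "(\<lambda>j. \<integral>\<^sup>+z. indicator (cball 0 R) z * ennreal \<bar>f j z - F z\<bar> \<partial>lborel) \<longlonglongrightarrow> 0"
proof -
  have "(\<lambda>j. \<integral>\<^sup>+z. indicator (cball 0 R) z * ennreal \<bar>f j z - F z\<bar> \<partial>lborel) \<longlonglongrightarrow> (\<integral>\<^sup>+(z::'b). 0 \<partial>lborel)"
  proof (rule nn_integral_dominated_convergence[where w="\<lambda>z. indicator (cball 0 R) z * ennreal (2 * C)"])
    show "AE z in lborel. indicator (cball 0 R) z * ennreal \<bar>f j z - F z\<bar> \<le> indicator (cball 0 R) z * ennreal (2 * C)" for j
      using lim
    proof eventually_elim
      case (elim z)
      have "\<bar>F z\<bar> \<le> C"
        by (rule LIMSEQ_le_const2[OF tendsto_rabs[OF elim]]) (use bd in auto)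
      then have "\<bar>f j z - F z\<bar> \<le> 2 * C" using bd[of j z] by linarith
      then show ?case by (intro mult_left_mono ennreal_leI) auto
    qed
    show "(\<integral>\<^sup>+z. indicator (cball 0 R) (z::'b) * ennreal (2 * C) \<partial>lborel) < \<infinity>"
      using emeasure_cball_lt_top[of "0::'b" R]
      by (subst nn_integral_multc) (auto simp: ennreal_mult_less_top)
    show "AE z in lborel. (\<lambda>j. indicator (cball 0 R) z * ennreal \<bar>f j z - F z\<bar>) \<longlonglongrightarrow> 0"
      using lim
    proof eventually_elim
      case (elim z)
      have "(\<lambda>j. \<bar>f j z - F z\<bar>) \<longlonglongrightarrow> 0"
        using tendsto_rabs[OF tendsto_diff[OF elim tendsto_const[of "F z"]]] by simp
      then have "(\<lambda>j. ennreal \<bar>f j z - F z\<bar>) \<longlonglongrightarrow> ennreal 0" by (rule tendsto_ennrealI)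
      then show ?case by (cases "z \<in> cball 0 R") (auto simp: indicator_def)
    qed
  qed auto
  then show ?thesis by simp
qed

lemma L1_loc_Cauchy:
  fixes f :: "nat \<Rightarrow> 'b::euclidean_space \<Rightarrow> real"
  assumes m [measurable]: "\<And>j. f j \<in> borel_measurable borel" "F \<in> borel_measurable borel"
    and bd: "\<And>j z. \<bar>f j z\<bar> \<le> C" and lim: "AE z in lborel. (\<lambda>j. f j z) \<longlonglongrightarrow> F z" and \<epsilon>: "0 < \<epsilon>"
  shows "\<exists>J. \<forall>i\<ge>J. \<forall>j\<ge>J. (\<integral>\<^sup>+z. indicator (cball 0 R) z * ennreal \<bar>f i z - f j z\<bar> \<partial>lborel) \<le> ennreal \<epsilon>"
proof -
  have "\<forall>\<^sub>F j in sequentially. (\<integral>\<^sup>+z. indicator (cball 0 R) z * ennreal \<bar>f j z - F z\<bar> \<partial>lborel) < ennreal (\<epsilon> / 2)"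
    by (rule order_tendstoD(2)[OF L1_loc_tendsto[OF m bd lim]]) (use \<epsilon> in auto)
  then obtain J where J: "\<And>j. j \<ge> J \<Longrightarrow> (\<integral>\<^sup>+z. indicator (cball 0 R) z * ennreal \<bar>f j z - F z\<bar> \<partial>lborel) < ennreal (\<epsilon> / 2)"
    unfolding eventually_sequentially by blast
  show ?thesis
  proof (intro exI allI impI)
    fix i j assume ij: "J \<le> i" "J \<le> j"
    have "(\<integral>\<^sup>+z. indicator (cball 0 R) z * ennreal \<bar>f i z - f j z\<bar> \<partial>lborel)
       \<le> (\<integral>\<^sup>+z. indicator (cball 0 R) z * ennreal \<bar>f i z - F z\<bar> \<partial>lborel) + (\<integral>\<^sup>+z. indicator (cball 0 R) z * ennreal \<bar>F z - f j z\<bar> \<partial>lborel)"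
      by (rule nn_integral_abs_triangle) auto
    also have "\<dots> \<le> ennreal (\<epsilon> / 2) + ennreal (\<epsilon> / 2)"
      using J[OF ij(1)] J[OF ij(2)] by (intro add_mono) (auto simp: abs_minus_commute)
    also have "\<dots> = ennreal \<epsilon>" using \<epsilon> by (subst ennreal_plus[symmetric]) auto
    finally show "(\<integral>\<^sup>+z. indicator (cball 0 R) z * ennreal \<bar>f i z - f j z\<bar> \<partial>lborel) \<le> ennreal \<epsilon>" .
  qed
qed

text \<open>The Riesz-Fischer argument, with balls that grow along the subsequence: successive
  differences are summable in L1 over \<open>cball 0 (real n)\<close>, so a single subsequence
  serves all radii and converges almost everywhere.\<close>

lemma L1_loc_complete_AE:
  fixes f :: "nat \<Rightarrow> 'b::euclidean_space \<Rightarrow> real"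
  assumes [measurable]: "\<And>j. f j \<in> borel_measurable borel"
    and I: "\<And>j z. f j z \<in> {a..b}"
    and cau: "\<And>R \<epsilon>. 0 < \<epsilon> \<Longrightarrow> \<exists>J. \<forall>i\<ge>J. \<forall>j\<ge>J.
      (\<integral>\<^sup>+z. indicator (cball 0 R) z * ennreal \<bar>f i z - f j z\<bar> \<partial>lborel) \<le> ennreal \<epsilon>"
  shows "\<exists>r F. strict_mono (r :: nat \<Rightarrow> nat) \<and> F \<in> borel_measurable borel \<and> (\<forall>z. F z \<in> {a..b}) \<and>
    (AE z in lborel. (\<lambda>j. f (r j) z) \<longlonglongrightarrow> F z)"
proof -
  have "\<exists>J. \<forall>i\<ge>J. \<forall>j\<ge>J. (\<integral>\<^sup>+z. indicator (cball 0 (real n)) z * ennreal \<bar>f i z - f j z\<bar> \<partial>lborel) \<le> ennreal ((1/2)^n)" for n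
    by (rule cau) simp
  then obtain J where J: "\<And>n i j. i \<ge> J n \<Longrightarrow> j \<ge> J n \<Longrightarrow>
     (\<integral>\<^sup>+z. indicator (cball 0 (real n)) z * ennreal \<bar>f i z - f j z\<bar> \<partial>lborel) \<le> ennreal ((1/2)^n)"
    by metis
  \<comment> \<open>Partial sums dominate each \<open>J n\<close>, and the summand \<open>n\<close>
    makes the sequence strictly increasing.\<close>
  define r where "r n = (\<Sum>k\<le>n. J k) + n" for n
  have r: "strict_mono r" unfolding strict_mono_Suc_iff r_def by simp
  have rJ: "J n \<le> r n" for n
    unfolding r_def using member_le_sum[of n "{..n}" J] by (simp add: trans_le_add1)
  have rJ': "J n \<le> r (Suc n)" for n using rJ[of n] r by (meson lessI less_imp_le order_trans strict_mono_less_eq)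
  let ?d = "\<lambda>n z. indicator (cball 0 (real n)) z * ennreal \<bar>f (r (Suc n)) z - f (r n) z\<bar>"
  have "(\<integral>\<^sup>+z. (\<Sum>n. ?d n z) \<partial>lborel) = (\<Sum>n. \<integral>\<^sup>+z. ?d n z \<partial>lborel)"
    by (rule nn_integral_suminf) measurable
  also have "\<dots> \<le> (\<Sum>n. ennreal ((1/2)^n))"
    by (intro suminf_le J rJ rJ') auto
  also have "\<dots> = ennreal (\<Sum>n. (1/2)^n)"
    by (intro suminf_ennreal2) (auto intro: summable_geometric)
  also have "\<dots> < \<infinity>" by simp
  finally have "AE z in lborel. (\<Sum>n. ?d n z) \<noteq> \<infinity>"
    by (intro nn_integral_PInf_AE) auto
  then have conv: "AE z in lborel. convergent (\<lambda>n. f (r n) z)"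
  proof eventually_elim
    case (elim z)
    \<comment> \<open>From index \<open>n0\<close> on, the point \<open>z\<close> lies in every
      ball, so the indicators drop out of the tail of the series.\<close>
    obtain n0 :: nat where n0: "norm z \<le> real n0" using real_arch_simple by blast
    have "(\<Sum>n. ennreal \<bar>f (r (Suc (n + n0))) z - f (r (n + n0)) z\<bar>) = (\<Sum>n. ?d (n + n0) z)"
      using n0 by (intro suminf_cong) (auto simp: indicator_def)
    also have "\<dots> \<le> (\<Sum>n. ?d n z)"
      by (subst suminf_offset[of "\<lambda>n. ?d n z" n0]) auto
    also have "\<dots> < \<infinity>" using elim by (simp add: top.not_eq_extremum)
    finally have "(\<Sum>n. ennreal \<bar>f (r (Suc (n + n0))) z - f (r (n + n0)) z\<bar>) \<noteq> \<infinity>" by simp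
    then have "summable (\<lambda>n. \<bar>f (r (Suc (n + n0))) z - f (r (n + n0)) z\<bar>)"
      by (intro summable_suminf_not_top) auto
    then have "summable (\<lambda>n. f (r (Suc (n + n0))) z - f (r (n + n0)) z)"
      by (rule summable_rabs_cancel)
    then have "summable (\<lambda>n. f (r (Suc n)) z - f (r n) z)"
      using summable_iff_shift[of "\<lambda>n. f (r (Suc n)) z - f (r n) z" n0] by simp
    then have "convergent (\<lambda>n. \<Sum>k<n. f (r (Suc k)) z - f (r k) z)"
      by (rule summable_iff_convergent[THEN iffD1])
    then have "convergent (\<lambda>n. f (r n) z - f (r 0) z)"
      by (simp only: sum_lessThan_telescope[of "\<lambda>n. f (r n) z"])
    then show ?case by (simp add: convergent_diff_const_right_iff)
  qed
  have [measurable]: "(\<lambda>z. lim (\<lambda>n. f (r n) z)) \<in> borel_measurable borel"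
    by (rule borel_measurable_lim_metric) simp
  \<comment> \<open>Where the limit is missing or meaningless, \<open>f 0 z\<close> is substituted,
    so that the range condition holds at every point and not just almost everywhere.\<close>
  define F where "F z = (if lim (\<lambda>n. f (r n) z) \<in> {a..b} then lim (\<lambda>n. f (r n) z) else f 0 z)" for z
  have [measurable]: "F \<in> borel_measurable borel"
    unfolding F_def by measurable
  have "F z \<in> {a..b}" for z using I[of 0 z] by (simp add: F_def)
  have lim: "(\<lambda>n. f (r n) z) \<longlonglongrightarrow> F z" if "convergent (\<lambda>n. f (r n) z)" for z
  proof -
    have l: "(\<lambda>n. f (r n) z) \<longlonglongrightarrow> lim (\<lambda>n. f (r n) z)"
      using that by (simp add: convergent_LIMSEQ_iff)
    have "lim (\<lambda>n. f (r n) z) \<in> {a..b}"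
      by (rule closed_sequentially[OF closed_atLeastAtMost _ l]) (use I in auto)
    then show ?thesis using l by (simp add: F_def)
  qed
  note \<open>\<And>z. F z \<in> {a..b}\<close>
  moreover have "AE z in lborel. (\<lambda>j. f (r j) z) \<longlonglongrightarrow> F z"
    using conv by eventually_elim (rule lim)
  ultimately show ?thesis using r by (intro exI[of _ r] exI[of _ F]) auto
qed

text \<open>The limit comes from a subsequence that converges almost everywhere; the Cauchy property
  then extends the L1 convergence to the full sequence.\<close>

lemma L1_loc_complete:
  fixes f :: "nat \<Rightarrow> 'b::euclidean_space \<Rightarrow> real"
  assumes m [measurable]: "\<And>j. f j \<in> borel_measurable borel"
    and I: "\<And>j z. f j z \<in> {a..b}"
    and cau: "\<And>R \<epsilon>. 0 < \<epsilon> \<Longrightarrow> \<exists>J. \<forall>i\<ge>J. \<forall>j\<ge>J.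
      (\<integral>\<^sup>+z. indicator (cball 0 R) z * ennreal \<bar>f i z - f j z\<bar> \<partial>lborel) \<le> ennreal \<epsilon>"
  shows "\<exists>F. F \<in> borel_measurable borel \<and> (\<forall>z. F z \<in> {a..b}) \<and>
    (\<forall>R \<epsilon>. 0 < \<epsilon> \<longrightarrow> (\<exists>J. \<forall>j\<ge>J. (\<integral>\<^sup>+z. indicator (cball 0 R) z * ennreal \<bar>f j z - F z\<bar> \<partial>lborel) \<le> ennreal \<epsilon>))"
proof -
  obtain r F where r: "strict_mono (r :: nat \<Rightarrow> nat)" and Fm [measurable]: "F \<in> borel_measurable borel"
    and FI: "\<forall>z. F z \<in> {a..b}" and lim: "AE z in lborel. (\<lambda>j. f (r j) z) \<longlonglongrightarrow> F z"
    using L1_loc_complete_AE[OF m I cau] by blast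
  have "\<exists>J. \<forall>j\<ge>J. (\<integral>\<^sup>+z. indicator (cball 0 R) z * ennreal \<bar>f j z - F z\<bar> \<partial>lborel) \<le> ennreal \<epsilon>"
    if \<epsilon>: "0 < \<epsilon>" for R \<epsilon>
  proof -
    have C: "\<bar>f (r j) z\<bar> \<le> max \<bar>a\<bar> \<bar>b\<bar>" for j z using I[of "r j" z] by auto
    have "\<forall>\<^sub>F j in sequentially. (\<integral>\<^sup>+z. indicator (cball 0 R) z * ennreal \<bar>f (r j) z - F z\<bar> \<partial>lborel) < ennreal (\<epsilon> / 2)"
      by (rule order_tendstoD(2)[OF L1_loc_tendsto[where f="\<lambda>j. f (r j)", OF m Fm C lim]]) (use \<epsilon> in auto)
    then obtain J1 where J1: "\<And>j. j \<ge> J1 \<Longrightarrow> (\<integral>\<^sup>+z. indicator (cball 0 R) z * ennreal \<bar>f (r j) z - F z\<bar> \<partial>lborel) < ennreal (\<epsilon> / 2)"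
      unfolding eventually_sequentially by blast
    obtain J2 where J2: "\<And>i j. i \<ge> J2 \<Longrightarrow> j \<ge> J2 \<Longrightarrow>
      (\<integral>\<^sup>+z. indicator (cball 0 R) z * ennreal \<bar>f i z - f j z\<bar> \<partial>lborel) \<le> ennreal (\<epsilon> / 2)"
      using cau[of "\<epsilon> / 2" R] \<epsilon> by auto
    show ?thesis
    proof (intro exI[of _ J2] allI impI)
      fix j assume j: "J2 \<le> j"
      let ?k = "max J1 J2"
      have "J2 \<le> r ?k" using seq_suble[OF r, of ?k] by simp
      have "(\<integral>\<^sup>+z. indicator (cball 0 R) z * ennreal \<bar>f j z - F z\<bar> \<partial>lborel)
        \<le> (\<integral>\<^sup>+z. indicator (cball 0 R) z * ennreal \<bar>f j z - f (r ?k) z\<bar> \<partial>lborel) + (\<integral>\<^sup>+z. indicator (cball 0 R) z * ennreal \<bar>f (r ?k) z - F z\<bar> \<partial>lborel)"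
        by (rule nn_integral_abs_triangle) auto
      also have "\<dots> \<le> ennreal (\<epsilon> / 2) + ennreal (\<epsilon> / 2)"
        by (intro add_mono J2 j \<open>J2 \<le> r ?k\<close> less_imp_le[OF J1]) simp
      also have "\<dots> = ennreal \<epsilon>" using \<epsilon> by (subst ennreal_plus[symmetric]) auto
      finally show "(\<integral>\<^sup>+z. indicator (cball 0 R) z * ennreal \<bar>f j z - F z\<bar> \<partial>lborel) \<le> ennreal \<epsilon>" .
    qed
  qed
  then show ?thesis using Fm FI by blast
qed

lemma ennreal_abs_integral_le:
  fixes f :: "'b::euclidean_space \<Rightarrow> real"
  assumes "integrable lborel f"
  shows "ennreal \<bar>integral\<^sup>L lborel f\<bar> \<le> (\<integral>\<^sup>+y. ennreal \<bar>f y\<bar> \<partial>lborel)"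
  using integral_norm_bound_ennreal[OF assms] by simp

text \<open>The Kolmogorov-Riesz criterion. Averages over small balls are equicontinuous, converge
  along a subsequence at every point, and are uniformly L1 close to the functions by the translation
  hypothesis, so the subsequence is Cauchy in L1 on balls.\<close>

lemma L1_loc_precompact:
  fixes f :: "nat \<Rightarrow> 'b::euclidean_space \<Rightarrow> real"
  assumes [measurable]: "\<And>j. f j \<in> borel_measurable borel"
    and I: "\<And>j z. f j z \<in> {a..b}"
    and equi: "\<And>R \<epsilon>. 0 < \<epsilon> \<Longrightarrow> \<exists>\<delta>>0. \<exists>J. \<forall>j\<ge>J. \<forall>y. norm y < \<delta> \<longrightarrow>
      (\<integral>\<^sup>+z. indicator (cball 0 R) z * ennreal \<bar>f j (z + y) - f j z\<bar> \<partial>lborel) \<le> ennreal \<epsilon>"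
  shows "\<exists>r F. strict_mono (r :: nat \<Rightarrow> nat) \<and> F \<in> borel_measurable borel \<and> (\<forall>z. F z \<in> {a..b}) \<and>
    (AE z in lborel. (\<lambda>j. f (r j) z) \<longlonglongrightarrow> F z)"
proof -
  define B where "B m = cball (0::'b) (1 / (real m + 1))" for m :: nat
  define v where "v m = measure lborel (B m)" for m
  have [measurable]: "B m \<in> sets borel" for m by (simp add: B_def)
  have Bfin: "emeasure lborel (B m) < \<infinity>" for m unfolding B_def by (rule emeasure_cball_lt_top)
  have Bint [simp]: "integrable lborel (indicator (B m) :: 'b \<Rightarrow> real)" for m
    using Bfin[of m] by (subst integrable_indicator_iff) auto
  have Ble: "norm y \<le> 1" if "y \<in> B m" for y m
  proof -
    have "norm y \<le> 1 / (real m + 1)" using that by (simp add: B_def)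
    also have "\<dots> \<le> 1" by simp
    finally show ?thesis .
  qed
  have vE: "emeasure lborel (B m) = ennreal (v m)" for m
    unfolding v_def using Bfin[of m] by (simp add: emeasure_eq_ennreal_measure top.not_eq_extremum)
  have v: "0 < v m" for m
    unfolding v_def B_def by (rule content_cball_pos) simp
  define C where "C = max \<bar>a\<bar> \<bar>b\<bar>"
  have C: "\<bar>f j z\<bar> \<le> C" for j z using I[of j z] by (auto simp: C_def)
  \<comment> \<open>The averages are left unnormalised and compared with \<open>v m * f j\<close>;
    the division by the volume \<open>v m\<close> is postponed to the last line.\<close>
  define V where "V j m z = (\<integral>y. indicator (B m) y * f j (z + y) \<partial>lborel)" for j m z
  have int: "integrable lborel (\<lambda>y. indicator (B m) y * f j (z + y))" for j m z
  proof (rule Bochner_Integration.integrable_bound)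
    show "integrable lborel (\<lambda>y. C * indicator (B m) y)" by (intro integrable_mult_right Bint)
    show "AE y in lborel. norm (indicator (B m) y * f j (z + y)) \<le> norm (C * indicator (B m) y)"
      by (auto simp: indicator_def intro: order_trans[OF C abs_ge_self])
  qed measurable
  have Vm [measurable]: "V j m \<in> borel_measurable borel" for j m
    unfolding V_def by measurable
  have VC: "\<bar>V j m z\<bar> \<le> C * v m" for j m z
  proof -
    have "\<bar>V j m z\<bar> \<le> (\<integral>y. \<bar>indicator (B m) y * f j (z + y)\<bar> \<partial>lborel)"
      unfolding V_def by (rule integral_abs_bound)
    also have "\<dots> \<le> (\<integral>y. C * indicator (B m) y \<partial>lborel)"
    proof (rule integral_mono)
      show "integrable lborel (\<lambda>y. \<bar>indicator (B m) y * f j (z + y)\<bar>)"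
        using int by (rule integrable_abs)
      show "integrable lborel (\<lambda>y. C * indicator (B m) y)" by (intro integrable_mult_right Bint)
    qed (use C in \<open>auto simp: indicator_def\<close>)
    finally show ?thesis by (simp add: v_def)
  qed
  have C0: "0 \<le> C" using C[of 0 0] by linarith
  have vle: "v m \<le> v 0" for m
    unfolding v_def B_def by (rule measure_mono_fmeasurable) (use Ble[of _ m] in \<open>auto intro!: fmeasurable_compact simp: B_def\<close>)
  have VC0: "norm (V j (fst s) (snd s)) \<le> C * v 0" for j s
    using order_trans[OF VC mult_left_mono[OF vle C0]] by simp
  obtain D :: "'b set" where D: "countable D" "\<And>U. open U \<Longrightarrow> U \<noteq> {} \<Longrightarrow> \<exists>d\<in>D. d \<in> U"
    using countable_dense_setE by blast
  have "countable ((UNIV :: nat set) \<times> D)" using D(1) by auto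
  \<comment> \<open>A diagonal argument: one subsequence along which the averages converge at all
    points of the dense set \<open>D\<close> and for all \<open>m\<close> at once.\<close>
  then obtain k where k: "strict_mono (k :: nat \<Rightarrow> nat)"
    "\<And>s. s \<in> UNIV \<times> D \<Longrightarrow> \<exists>l. (\<lambda>n. V (k n) (fst s) (snd s)) \<longlonglongrightarrow> l"
    by (rule function_convergent_subsequence[where f="\<lambda>j s. V j (fst s) (snd s)", OF _ VC0]) blast
  have kge: "n \<le> k n" for n using k(1) by (rule seq_suble)
  \<comment> \<open>The averages inherit their modulus of continuity from L1 translations of
    \<open>f j\<close>. The radius \<open>norm d + 1\<close> suffices because every
    \<open>B m\<close> lies in the unit ball.\<close>
  have shift: "ennreal \<bar>V j m z - V j m d\<bar> \<le> (\<integral>\<^sup>+w. indicator (cball 0 (norm d + 1)) w * ennreal \<bar>f j (w + (z - d)) - f j w\<bar> \<partial>lborel)" for j m z d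
  proof -
    have "V j m z - V j m d = (\<integral>y. indicator (B m) y * f j (z + y) - indicator (B m) y * f j (d + y) \<partial>lborel)"
      unfolding V_def using int by simp
    then have "ennreal \<bar>V j m z - V j m d\<bar> \<le> (\<integral>\<^sup>+y. ennreal \<bar>indicator (B m) y * f j (z + y) - indicator (B m) y * f j (d + y)\<bar> \<partial>lborel)"
      using int by (simp only:) (intro ennreal_abs_integral_le Bochner_Integration.integrable_diff)
    also have "\<dots> \<le> (\<integral>\<^sup>+y. indicator (cball 0 (norm d + 1)) (y + d) * ennreal \<bar>f j ((y + d) + (z - d)) - f j (y + d)\<bar> \<partial>lborel)"
    proof (intro nn_integral_mono)
      fix y
      have "norm (y + d) \<le> norm d + 1" if "y \<in> B m"
      proof -
        have "norm y \<le> 1" using that by (rule Ble)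
        then show ?thesis using norm_triangle_ineq[of y d] by simp
      qed
      then show "ennreal \<bar>indicator (B m) y * f j (z + y) - indicator (B m) y * f j (d + y)\<bar> \<le>
        indicator (cball 0 (norm d + 1)) (y + d) * ennreal \<bar>f j ((y + d) + (z - d)) - f j (y + d)\<bar>"
        by (auto simp: indicator_def add.commute)
    qed
    also have "\<dots> = (\<integral>\<^sup>+w. indicator (cball 0 (norm d + 1)) w * ennreal \<bar>f j (w + (z - d)) - f j w\<bar> \<partial>lborel)"
      by (rule nn_integral_lborel_shift[where f="\<lambda>w. indicator (cball 0 (norm d + 1)) w * ennreal \<bar>f j (w + (z - d)) - f j w\<bar>"]) measurable
    finally show ?thesis .
  qed
  have Vconv: "convergent (\<lambda>n. V (k n) m z)" for m z
  proof -
    have "Cauchy (\<lambda>n. V (k n) m z)"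
    proof (rule metric_CauchyI)
      fix e :: real assume e: "0 < e"
      obtain \<delta> J where \<delta>: "0 < \<delta>" "\<And>j y. j \<ge> J \<Longrightarrow> norm y < \<delta> \<Longrightarrow>
        (\<integral>\<^sup>+w. indicator (cball 0 (norm z + 2)) w * ennreal \<bar>f j (w + y) - f j w\<bar> \<partial>lborel) \<le> ennreal (e / 4)"
        using equi[of "e / 4" "norm z + 2"] e by auto
      have "\<exists>d\<in>D. d \<in> ball z (min 1 \<delta>)" by (rule D(2)) (use \<delta> in auto)
      then obtain d where d: "d \<in> D" "dist z d < 1" "dist z d < \<delta>" by auto
      have nd: "norm d + 1 \<le> norm z + 2" using d(2) norm_triangle_ineq2[of d z] by (simp add: dist_norm norm_minus_commute)
      have close: "\<bar>V j m z - V j m d\<bar> \<le> e / 4" if "j \<ge> J" for j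
      proof -
        have "ennreal \<bar>V j m z - V j m d\<bar> \<le> (\<integral>\<^sup>+w. indicator (cball 0 (norm d + 1)) w * ennreal \<bar>f j (w + (z - d)) - f j w\<bar> \<partial>lborel)"
          by (rule shift)
        also have "\<dots> \<le> (\<integral>\<^sup>+w. indicator (cball 0 (norm z + 2)) w * ennreal \<bar>f j (w + (z - d)) - f j w\<bar> \<partial>lborel)"
          using nd by (intro nn_integral_mono) (auto simp: indicator_def)
        also have "\<dots> \<le> ennreal (e / 4)" by (rule \<delta>(2)) (use that d in \<open>auto simp: dist_norm\<close>)
        finally show ?thesis using e by simp
      qed
      obtain l where "(\<lambda>n. V (k n) m d) \<longlonglongrightarrow> l" using k(2)[of "(m, d)"] d by auto
      then have "Cauchy (\<lambda>n. V (k n) m d)" by (rule LIMSEQ_imp_Cauchy)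
      from metric_CauchyD[OF this, of "e / 4"] e obtain n0 where
        n0: "\<And>i j. i \<ge> n0 \<Longrightarrow> j \<ge> n0 \<Longrightarrow> dist (V (k i) m d) (V (k j) m d) < e / 4" by auto
      show "\<exists>M. \<forall>i\<ge>M. \<forall>j\<ge>M. dist (V (k i) m z) (V (k j) m z) < e"
      proof (intro exI[of _ "max n0 J"] allI impI)
        fix i j assume "max n0 J \<le> i" "max n0 J \<le> j"
        then have "\<bar>V (k i) m z - V (k i) m d\<bar> \<le> e / 4" "\<bar>V (k j) m z - V (k j) m d\<bar> \<le> e / 4"
          "\<bar>V (k i) m d - V (k j) m d\<bar> < e / 4"
          using close kge[of i] kge[of j] n0[of i j] by (auto simp: dist_real_def)
        then show "dist (V (k i) m z) (V (k j) m z) < e" unfolding dist_real_def using e by linarith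
      qed
    qed
    then show ?thesis by (rule Cauchy_convergent)
  qed
  \<comment> \<open>By Fubini the distance between a function and its ball average is at most the
    mean of its translation errors over the ball.\<close>
  have avg: "(\<integral>\<^sup>+z. indicator (cball 0 R) z * ennreal \<bar>v m * f j z - V j m z\<bar> \<partial>lborel) \<le> ennreal (v m * \<epsilon>)"
    if \<epsilon>: "0 \<le> \<epsilon>" and le: "\<And>y. y \<in> B m \<Longrightarrow> (\<integral>\<^sup>+z. indicator (cball 0 R) z * ennreal \<bar>f j (z + y) - f j z\<bar> \<partial>lborel) \<le> ennreal \<epsilon>" for R \<epsilon> m j
  proof -
    have "(\<integral>\<^sup>+z. indicator (cball 0 R) z * ennreal \<bar>v m * f j z - V j m z\<bar> \<partial>lborel) \<le>
       (\<integral>\<^sup>+z. (\<integral>\<^sup>+y. indicator (cball 0 R) z * (indicator (B m) y * ennreal \<bar>f j (z + y) - f j z\<bar>) \<partial>lborel) \<partial>lborel)"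
    proof (intro nn_integral_mono)
      fix z
      have i2: "integrable lborel (\<lambda>y. indicator (B m) y * f j z)" using Bfin by auto
      have "V j m z - v m * f j z = (\<integral>y. indicator (B m) y * f j (z + y) - indicator (B m) y * f j z \<partial>lborel)"
        using int i2 unfolding V_def by (subst Bochner_Integration.integral_diff) (auto simp: v_def)
      then have "ennreal \<bar>V j m z - v m * f j z\<bar> \<le> (\<integral>\<^sup>+y. ennreal \<bar>indicator (B m) y * f j (z + y) - indicator (B m) y * f j z\<bar> \<partial>lborel)"
        using int i2 by (simp only:) (intro ennreal_abs_integral_le Bochner_Integration.integrable_diff)
      also have "\<dots> = (\<integral>\<^sup>+y. indicator (B m) y * ennreal \<bar>f j (z + y) - f j z\<bar> \<partial>lborel)"
        by (intro nn_integral_cong) (auto simp: indicator_def)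
      finally show "indicator (cball 0 R) z * ennreal \<bar>v m * f j z - V j m z\<bar> \<le>
        (\<integral>\<^sup>+y. indicator (cball 0 R) z * (indicator (B m) y * ennreal \<bar>f j (z + y) - f j z\<bar>) \<partial>lborel)"
        by (auto simp: indicator_def abs_minus_commute)
    qed
    also have "\<dots> = (\<integral>\<^sup>+y. (\<integral>\<^sup>+z. indicator (cball 0 R) z * (indicator (B m) y * ennreal \<bar>f j (z + y) - f j z\<bar>) \<partial>lborel) \<partial>lborel)"
      by (rule lborel_pair.Fubini') measurable
    also have "\<dots> = (\<integral>\<^sup>+y. indicator (B m) y * (\<integral>\<^sup>+z. indicator (cball 0 R) z * ennreal \<bar>f j (z + y) - f j z\<bar> \<partial>lborel) \<partial>lborel)"
      by (intro nn_integral_cong, subst nn_integral_cmult[symmetric]) (auto simp: mult_ac)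
    also have "\<dots> \<le> (\<integral>\<^sup>+y. indicator (B m) y * ennreal \<epsilon> \<partial>lborel)"
    proof (intro nn_integral_mono)
      fix y :: 'b
      show "indicator (B m) y * (\<integral>\<^sup>+z. indicator (cball 0 R) z * ennreal \<bar>f j (z + y) - f j z\<bar> \<partial>lborel) \<le> indicator (B m) y * ennreal \<epsilon>"
        using le[of y] by (cases "y \<in> B m") simp_all
    qed
    also have "\<dots> = ennreal (v m * \<epsilon>)"
      using vE \<epsilon> v[of m] by (subst nn_integral_multc) (auto simp: ennreal_mult)
    finally show ?thesis .
  qed
  have "\<exists>r F. strict_mono (r :: nat \<Rightarrow> nat) \<and> F \<in> borel_measurable borel \<and> (\<forall>z. F z \<in> {a..b}) \<and>
    (AE z in lborel. (\<lambda>j. f (k (r j)) z) \<longlonglongrightarrow> F z)"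
  proof (rule L1_loc_complete_AE[where f="\<lambda>n. f (k n)"])
    fix R \<epsilon> :: real assume \<epsilon>: "0 < \<epsilon>"
    obtain \<delta> J where \<delta>: "0 < \<delta>" "\<And>j y. j \<ge> J \<Longrightarrow> norm y < \<delta> \<Longrightarrow>
        (\<integral>\<^sup>+w. indicator (cball 0 R) w * ennreal \<bar>f j (w + y) - f j w\<bar> \<partial>lborel) \<le> ennreal (\<epsilon> / 3)"
      using equi[of "\<epsilon> / 3" R] \<epsilon> by auto
    obtain m :: nat where m: "1 / (real m + 1) < \<delta>"
      using reals_Archimedean[OF \<delta>(1)] by (auto simp: inverse_eq_divide add.commute)
    have vV: "(\<integral>\<^sup>+z. indicator (cball 0 R) z * ennreal \<bar>v m * f j z - V j m z\<bar> \<partial>lborel) \<le> ennreal (v m * (\<epsilon> / 3))" if "j \<ge> J" for j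
      by (rule avg) (use \<delta> that m \<epsilon> in \<open>auto simp: B_def\<close>)
    have "\<exists>n0. \<forall>i\<ge>n0. \<forall>j\<ge>n0. (\<integral>\<^sup>+z. indicator (cball 0 R) z * ennreal \<bar>V (k i) m z - V (k j) m z\<bar> \<partial>lborel) \<le> ennreal (v m * (\<epsilon> / 3))"
      by (rule L1_loc_Cauchy[where F="\<lambda>z. lim (\<lambda>n. V (k n) m z)" and C="C * v m"])
         (use VC Vconv v \<epsilon> in \<open>auto simp: convergent_LIMSEQ_iff[symmetric]\<close>)
    then obtain n0 where n0: "\<And>i j. i \<ge> n0 \<Longrightarrow> j \<ge> n0 \<Longrightarrow>
       (\<integral>\<^sup>+z. indicator (cball 0 R) z * ennreal \<bar>V (k i) m z - V (k j) m z\<bar> \<partial>lborel) \<le> ennreal (v m * (\<epsilon> / 3))" by blast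
    show "\<exists>J. \<forall>i\<ge>J. \<forall>j\<ge>J. (\<integral>\<^sup>+z. indicator (cball 0 R) z * ennreal \<bar>f (k i) z - f (k j) z\<bar> \<partial>lborel) \<le> ennreal \<epsilon>"
    proof (intro exI[of _ "max n0 J"] allI impI)
      fix i j assume ij: "max n0 J \<le> i" "max n0 J \<le> j"
      let ?w = "indicator (cball 0 R) :: 'b \<Rightarrow> ennreal"
      have "ennreal (v m) * (\<integral>\<^sup>+z. ?w z * ennreal \<bar>f (k i) z - f (k j) z\<bar> \<partial>lborel)
         = (\<integral>\<^sup>+z. ?w z * ennreal \<bar>v m * f (k i) z - v m * f (k j) z\<bar> \<partial>lborel)"
        using v[of m] by (subst nn_integral_cmult[symmetric])
          (auto intro!: nn_integral_cong simp: indicator_def abs_mult ennreal_mult right_diff_distrib[symmetric])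
      also have "\<dots> \<le> (\<integral>\<^sup>+z. ?w z * ennreal \<bar>v m * f (k i) z - V (k i) m z\<bar> \<partial>lborel)
          + (\<integral>\<^sup>+z. ?w z * ennreal \<bar>V (k i) m z - v m * f (k j) z\<bar> \<partial>lborel)"
        by (rule nn_integral_abs_triangle) auto
      also have "\<dots> \<le> (\<integral>\<^sup>+z. ?w z * ennreal \<bar>v m * f (k i) z - V (k i) m z\<bar> \<partial>lborel)
          + ((\<integral>\<^sup>+z. ?w z * ennreal \<bar>V (k i) m z - V (k j) m z\<bar> \<partial>lborel) + (\<integral>\<^sup>+z. ?w z * ennreal \<bar>V (k j) m z - v m * f (k j) z\<bar> \<partial>lborel))"
        by (intro add_left_mono nn_integral_abs_triangle) auto
      also have "\<dots> \<le> ennreal (v m * (\<epsilon> / 3)) + (ennreal (v m * (\<epsilon> / 3)) + ennreal (v m * (\<epsilon> / 3)))"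
        using ij kge[of i] kge[of j] vV[of "k i"] vV[of "k j"] n0[of i j]
        by (intro add_mono) (auto simp: abs_minus_commute)
      also have "\<dots> = ennreal (v m) * ennreal \<epsilon>"
        using v[of m] \<epsilon> by (simp add: ennreal_plus[symmetric] ennreal_mult[symmetric] del: ennreal_plus)
      finally show "(\<integral>\<^sup>+z. ?w z * ennreal \<bar>f (k i) z - f (k j) z\<bar> \<partial>lborel) \<le> ennreal \<epsilon>"
        using v[of m] by (simp add: ennreal_mult_le_mult_iff)
    qed
  qed (use I in auto)
  then obtain r F where rF: "strict_mono (r :: nat \<Rightarrow> nat)" "F \<in> borel_measurable borel" "\<forall>z. F z \<in> {a..b}"
    "AE z in lborel. (\<lambda>j. f (k (r j)) z) \<longlonglongrightarrow> F z" by blast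
  show ?thesis
    using rF strict_mono_compose[OF k(1) rF(1)] by (intro exI[of _ "\<lambda>n. k (r n)"] exI[of _ F] conjI)
qed

lemma nn_integral_indicator_mono:
  assumes "A \<subseteq> B" "(\<integral>\<^sup>+x. indicator B x * f x \<partial>lborel) \<le> e"
  shows "(\<integral>\<^sup>+x. indicator A x * f x \<partial>lborel) \<le> e"
  by (rule order_trans[OF nn_integral_mono assms(2)]) (use assms(1) in \<open>auto simp: indicator_def\<close>)

lemma nn_integral_abs_triangle3:
  fixes f1 f2 f3 f4 :: "'b \<Rightarrow> real" and w :: "'b \<Rightarrow> ennreal"
  assumes [measurable]: "f1 \<in> borel_measurable M'" "f2 \<in> borel_measurable M'" "f3 \<in> borel_measurable M'"
    "f4 \<in> borel_measurable M'" "w \<in> borel_measurable M'"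
    and le: "(\<integral>\<^sup>+z. w z * ennreal \<bar>f1 z - f2 z\<bar> \<partial>M') \<le> ennreal (e / 3)"
      "(\<integral>\<^sup>+z. w z * ennreal \<bar>f2 z - f3 z\<bar> \<partial>M') \<le> ennreal (e / 3)"
      "(\<integral>\<^sup>+z. w z * ennreal \<bar>f3 z - f4 z\<bar> \<partial>M') \<le> ennreal (e / 3)" and e: "0 \<le> e"
  shows "(\<integral>\<^sup>+z. w z * ennreal \<bar>f1 z - f4 z\<bar> \<partial>M') \<le> ennreal e"
proof -
  have "(\<integral>\<^sup>+z. w z * ennreal \<bar>f1 z - f4 z\<bar> \<partial>M') \<le>
    (\<integral>\<^sup>+z. w z * ennreal \<bar>f1 z - f2 z\<bar> \<partial>M') + (\<integral>\<^sup>+z. w z * ennreal \<bar>f2 z - f4 z\<bar> \<partial>M')"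
    by (rule nn_integral_abs_triangle; measurable)
  also have "\<dots> \<le> (\<integral>\<^sup>+z. w z * ennreal \<bar>f1 z - f2 z\<bar> \<partial>M') + ((\<integral>\<^sup>+z. w z * ennreal \<bar>f2 z - f3 z\<bar> \<partial>M')
     + (\<integral>\<^sup>+z. w z * ennreal \<bar>f3 z - f4 z\<bar> \<partial>M'))"
    by (rule add_left_mono, rule nn_integral_abs_triangle; measurable)
  also have "\<dots> \<le> ennreal (e / 3) + (ennreal (e / 3) + ennreal (e / 3))"
    by (intro add_mono le)
  also have "\<dots> = ennreal e"
    using e by (simp add: ennreal_plus[symmetric] del: ennreal_plus)
  finally show ?thesis .
qed

lemma nn_integral_spacetime:
  fixes f :: "'b::euclidean_space \<times> 'c::euclidean_space \<Rightarrow> ennreal"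
  assumes "f \<in> borel_measurable borel"
  shows "(\<integral>\<^sup>+z. f z \<partial>lborel) = (\<integral>\<^sup>+t. \<integral>\<^sup>+x. f (t, x) \<partial>lborel \<partial>lborel)"
  unfolding lborel_prod[symmetric]
  by (rule lborel.nn_integral_fst[symmetric]) (use assms in \<open>simp add: lborel_prod\<close>)

section \<open>Translation estimates for the scheme\<close>

context front
begin

text \<open>Backwards along characteristics, a point ahead of the front reaches the front within a time
  \<open>(\<theta> x - t) / \<kappa>\<close>, hence data that are nearly constant around \<open>z0\<close> are the only ones seen.\<close>

lemma sol_near_aux:
  assumes h: "0 < h" and G [measurable]: "G \<in> borel_measurable borel" and I: "\<And>z. G z \<in> {a..b}"
    and e: "0 \<le> e" and near: "\<And>z. dist z z0 \<le> r \<Longrightarrow> \<bar>G z - G z0\<bar> \<le> e"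
  shows "min t ((\<theta> x - t) / \<kappa>) \<le> real n * h \<Longrightarrow> dist (t, x) z0 + real n * (h * (1 + M)) \<le> r \<Longrightarrow>
    \<bar>sol h G t x - G z0\<bar> \<le> e"
proof (induction n arbitrary: t x)
  case 0
  then have "t \<le> 0 \<or> \<theta> x \<le> t"
    using kappa_pos by (auto simp: min_def divide_le_0_iff split: if_splits)
  then show ?case using 0 near by (simp add: sol_data)
next
  case (Suc n)
  show ?case
  proof (cases "0 < t \<and> t < \<theta> x")
    case False
    moreover have "0 \<le> real (Suc n) * (h * (1 + M))"
      using h M_nonneg by (intro mult_nonneg_nonneg) auto
    ultimately show ?thesis using near Suc.prems by (subst sol_data) auto
  next
    case True
    show ?thesis
      unfolding sol_ahead[OF h conjunct1[OF True] conjunct2[OF True]]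
    proof (rule collapse_near)
      fix \<xi> assume xi: "\<xi> \<in> {a..b}"
      show "\<bar>sol h G (t - h) (x - h *\<^sub>R c \<xi>) - G z0\<bar> \<le> e"
      proof (rule Suc.IH)
        \<comment> \<open>One step backwards lowers \<open>\<theta> x - t\<close> by at least
          \<open>h * \<kappa>\<close>, so the bound on the remaining travel time to the front drops
          by \<open>h\<close>.\<close>
        have "h * (1 + \<kappa>) \<le> h * (p \<bullet> c \<xi>)" using h p_ge[OF xi] by (intro mult_left_mono) auto
        then have "\<theta> (x - h *\<^sub>R c \<xi>) - (t - h) \<le> (\<theta> x - t) - h * \<kappa>"
          by (simp add: \<theta>_def inner_diff_right algebra_simps)
        then have "(\<theta> (x - h *\<^sub>R c \<xi>) - (t - h)) / \<kappa> \<le> ((\<theta> x - t) - h * \<kappa>) / \<kappa>"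
          using kappa_pos by (intro divide_right_mono) auto
        also have "\<dots> = (\<theta> x - t) / \<kappa> - h" using kappa_pos by (simp add: field_simps)
        finally show "min (t - h) ((\<theta> (x - h *\<^sub>R c \<xi>) - (t - h)) / \<kappa>) \<le> real n * h"
          using Suc.prems(1) by (auto simp: algebra_simps min_def split: if_splits)
        have "dist (t - h, x - h *\<^sub>R c \<xi>) (t, x) = norm (h, h *\<^sub>R c \<xi>)"
          by (simp add: dist_Pair_Pair dist_norm norm_Pair)
        also have "\<dots> \<le> norm h + norm (h *\<^sub>R c \<xi>)" by (rule norm_Pair_le)
        also have "\<dots> \<le> h + h * M" using h c_le[OF xi] by auto
        finally have "dist (t - h, x - h *\<^sub>R c \<xi>) z0 \<le> h * (1 + M) + dist (t, x) z0"
          using dist_triangle[of "(t - h, x - h *\<^sub>R c \<xi>)" z0 "(t, x)"] by (simp add: algebra_simps)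
        then show "dist (t - h, x - h *\<^sub>R c \<xi>) z0 + real n * (h * (1 + M)) \<le> r"
          using Suc.prems(2) by (simp add: algebra_simps)
      qed
    qed (use I e in \<open>auto intro!: sol_slice_measurable[OF h] sol_range[OF h] simp del: atLeastAtMost_iff\<close>)
  qed
qed

text \<open>\<open>r\<close> bounds the travel time back to the data, through time 0 or through the
  front. The number of steps is \<open>r / h\<close> rounded up, whence the additional
  \<open>h\<close> in the distance \<open>(r + h) * (1 + M)\<close>.\<close>

lemma sol_near:
  assumes h: "0 < h" and G [measurable]: "G \<in> borel_measurable borel" and I: "\<And>z. G z \<in> {a..b}"
    and e: "0 \<le> e" and near: "\<And>z. dist z (t, x) \<le> \<delta> \<Longrightarrow> \<bar>G z - G (t, x)\<bar> \<le> e"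
    and r: "0 \<le> r" "min t ((\<theta> x - t) / \<kappa>) \<le> r" and \<delta>: "(r + h) * (1 + M) \<le> \<delta>"
  shows "\<bar>sol h G t x - G (t, x)\<bar> \<le> e"
proof (rule sol_near_aux[OF h G I e near, where n="nat \<lceil>r / h\<rceil>"])
  have n: "r / h \<le> real (nat \<lceil>r / h\<rceil>)" "real (nat \<lceil>r / h\<rceil>) \<le> r / h + 1"
    using r(1) h by (auto intro: real_nat_ceiling_ge)
  then have n': "r \<le> real (nat \<lceil>r / h\<rceil>) * h" "real (nat \<lceil>r / h\<rceil>) * h \<le> r + h"
    using h by (auto simp: field_simps)
  then show "min t ((\<theta> x - t) / \<kappa>) \<le> real (nat \<lceil>r / h\<rceil>) * h" using r by (meson order_trans)
  have "real (nat \<lceil>r / h\<rceil>) * h * (1 + M) \<le> (r + h) * (1 + M)"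
    using n' M_nonneg by (intro mult_right_mono) auto
  then show "dist (t, x) (t, x) + real (nat \<lceil>r / h\<rceil>) * (h * (1 + M)) \<le> \<delta>"
    using \<delta> by (simp add: mult.assoc)
qed auto

text \<open>The comparison with the true front and starting time 0. Data in the layer are addressed
  by their delay \<open>r\<close> behind the front, so that one function \<open>d\<close> of
  \<open>x\<close> alone serves all times.\<close>

lemma sol_compare:
  assumes h: "0 < h" and [measurable]: "G \<in> borel_measurable borel" "G' \<in> borel_measurable borel"
      "d \<in> borel_measurable borel"
    and I: "\<And>z. G z \<in> {a..b}" "\<And>z. G' z \<in> {a..b}"
    and init: "\<And>t x. norm x \<le> R0 \<Longrightarrow> t \<le> 0 \<Longrightarrow> ennreal \<bar>G (t, x) - G' (t, x)\<bar> \<le> d x"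
    and side: "\<And>r x. norm x \<le> R0 \<Longrightarrow> 0 \<le> r \<Longrightarrow> r \<le> h * N \<Longrightarrow> ennreal \<bar>G (\<theta> x + r, x) - G' (\<theta> x + r, x)\<bar> \<le> d x"
    and R: "R + M * max 0 (t + h) \<le> R0"
  shows "(\<integral>\<^sup>+x. indicator (cball 0 R \<inter> {x. t < \<theta> x}) x * ennreal \<bar>sol h G t x - sol h G' t x\<bar> \<partial>lborel)
    \<le> ennreal (N + 2) * (\<integral>\<^sup>+x. indicator (cball 0 R0) x * d x \<partial>lborel)"
proof (cases "t \<le> -h")
  \<comment> \<open>The comparison starts only after time \<open>-h\<close>; up to then the scheme
    is equal to its data.\<close>
  case True
  then have "max 0 (t + h) = 0" by simp
  then have R: "R \<le> R0" using assms(9) by simp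
  have "(\<integral>\<^sup>+x. indicator (cball 0 R \<inter> {x. t < \<theta> x}) x * ennreal \<bar>sol h G t x - sol h G' t x\<bar> \<partial>lborel)
    \<le> (\<integral>\<^sup>+x. indicator (cball 0 R0) x * d x \<partial>lborel)"
    using True h init[of _ t] R by (intro nn_integral_mono) (auto simp: indicator_def sol_data)
  also have "\<dots> = 1 * (\<integral>\<^sup>+x. indicator (cball 0 R0) x * d x \<partial>lborel)" by simp
  also have "\<dots> \<le> ennreal (N + 2) * (\<integral>\<^sup>+x. indicator (cball 0 R0) x * d x \<partial>lborel)"
    using N_nonneg ennreal_leI[of 1 "N + 2"] by (intro mult_right_mono) (auto simp del: ennreal_plus)
  finally show ?thesis .
next
  case False
  show ?thesis
    unfolding \<theta>_def
  proof (rule comparison[where Tm=t])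
    show "0 - h < t" using False by simp
    show "R + M * (t - 0 + h) \<le> R0" using R False by (simp add: max_def split: if_splits)
    show "ennreal \<bar>sol h G t x - sol h G' t x\<bar> \<le> d x"
      if "t \<le> 0 \<or> (p \<bullet> x + q \<le> t \<and> t < p \<bullet> x + q + h * N)" "norm x \<le> R0" for t x
      using that init[of x t] side[of x "t - \<theta> x"] by (auto simp: sol_data \<theta>_def)
  qed (use h I in \<open>auto intro!: sol_slice_measurable sol_range sol_ahead simp: \<theta>_def simp del: atLeastAtMost_iff\<close>)
qed

text \<open>Transport and collapse commute with translations, so the scheme can be compared with its
  own translate wherever both follow the recursion. Elsewhere each value is read off from, or lies
  within a short travel time of, the uniformly continuous datum. The modulus \<open>\<delta>\<close>
  does not depend on the step.\<close>

lemma sol_translation: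
  assumes G: "continuous_on UNIV G" and I: "\<And>z. G z \<in> {a..b}" and \<epsilon>: "0 < \<epsilon>"
  shows "\<exists>\<delta>>0. \<forall>h \<tau> y t. 0 < h \<longrightarrow> h < \<delta> \<longrightarrow> \<bar>\<tau>\<bar> < \<delta> \<longrightarrow> norm y < \<delta> \<longrightarrow> \<bar>t\<bar> \<le> T \<longrightarrow>
    (\<integral>\<^sup>+x. indicator (cball 0 R) x * ennreal \<bar>sol h G (t + \<tau>) (x + y) - sol h G t x\<bar> \<partial>lborel) \<le> ennreal \<epsilon>"
proof -
  have Gm [measurable]: "G \<in> borel_measurable borel" using G by (rule borel_measurable_continuous_onI)
  define R0 where "R0 = \<bar>R\<bar> + M * (\<bar>T\<bar> + 1)"
  have R0: "R \<le> R0" "0 \<le> R0" using mult_nonneg_nonneg[OF M_nonneg, of "\<bar>T\<bar> + 1"] by (auto simp: R0_def)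
  define V where "V = measure lborel (cball (0::'a) R0)"
  have V0: "0 \<le> V" by (simp add: V_def)
  have VE: "emeasure lborel (cball (0::'a) R0) = ennreal V"
    unfolding V_def using emeasure_cball_lt_top[of "0::'a" R0] by (simp add: emeasure_eq_ennreal_measure top.not_eq_extremum)
  \<comment> \<open>The error \<open>e\<close> is paid once outside the comparison region and with
    factor \<open>N + 2\<close> inside it, on a ball of volume \<open>V\<close>; the summand 1 in
    \<open>V + 1\<close> avoids a division by zero.\<close>
  define e where "e = \<epsilon> / ((N + 3) * (V + 1))"
  have e: "0 < e" using \<epsilon> N_nonneg V0 by (auto simp: e_def)
  have ee: "(N + 3) * (e * V) \<le> \<epsilon>"
  proof -
    have "N + 3 \<noteq> 0" using N_nonneg by simp
    then have "(N + 3) * (e * V) = \<epsilon> * (V / (V + 1))" by (simp add: e_def)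
    also have "\<dots> \<le> \<epsilon> * 1" using \<epsilon> V0 by (intro mult_left_mono) auto
    finally show ?thesis by simp
  qed
  have uc: "uniformly_continuous_on (cball 0 (R0 + \<bar>T\<bar> + 5)) G"
    by (rule compact_uniformly_continuous[OF continuous_on_subset[OF G subset_UNIV] compact_cball])
  have "0 < e / 3" using e by simp
  from uc[unfolded uniformly_continuous_on_def, THEN spec, THEN mp, OF this]
  obtain \<eta> where \<eta>0: "0 < \<eta>" "\<forall>z\<in>cball 0 (R0 + \<bar>T\<bar> + 5). \<forall>z'\<in>cball 0 (R0 + \<bar>T\<bar> + 5). dist z' z < \<eta> \<longrightarrow> dist (G z') (G z) < e / 3"
    by (elim exE conjE) rule
  have \<eta>: "0 < \<eta>" "\<And>z z'. norm z \<le> R0 + \<bar>T\<bar> + 5 \<Longrightarrow> norm z' \<le> R0 + \<bar>T\<bar> + 5 \<Longrightarrow> dist z' z < \<eta> \<Longrightarrow> \<bar>G z' - G z\<bar> < e / 3"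
    using \<eta>0 by (auto simp: dist_real_def)
  \<comment> \<open>Chosen so that \<open>r + h \<le> \<delta> * C\<close> for the travel time
    \<open>r\<close> defined below. The fraction comes from a level difference of at most
    \<open>\<delta> * (norm p + 1)\<close>, crossed at relative speed at least
    \<open>\<kappa>\<close>.\<close>
  define C where "C = 2 + (norm p + 1) / \<kappa>"
  have C: "2 \<le> C" using kappa_pos by (simp add: C_def)
  define \<eta>' where "\<eta>' = min 1 (\<eta> / 2)"
  have \<eta>': "0 < \<eta>'" "\<eta>' \<le> 1" "\<eta>' < \<eta>" using \<eta> by (auto simp: \<eta>'_def min_def)
  define \<delta> where "\<delta> = \<eta>' / (C * (1 + M))"
  have CM: "2 \<le> C * (1 + M)" using C M_nonneg mult_mono[of 2 C 1 "1 + M"] by auto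
  have \<delta>: "0 < \<delta>" "2 * \<delta> \<le> \<eta>'"
  proof -
    show "0 < \<delta>" using \<eta>' CM by (simp add: \<delta>_def)
    have "2 * \<delta> \<le> (C * (1 + M)) * \<delta>" using CM \<open>0 < \<delta>\<close> by (intro mult_right_mono) auto
    also have "\<dots> = \<eta>'" using C M_nonneg by (simp add: \<delta>_def)
    finally show "2 * \<delta> \<le> \<eta>'" .
  qed
  have \<delta>1: "\<delta> \<le> 1" using \<delta> \<eta>' by auto
  show ?thesis
  proof (intro exI conjI allI impI)
    show "0 < \<delta>" by fact
    fix h \<tau> :: real and y :: 'a and t :: real
    assume h: "0 < h" "h < \<delta>" and \<tau>: "\<bar>\<tau>\<bar> < \<delta>" and y: "norm y < \<delta>" and t: "\<bar>t\<bar> \<le> T"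
    \<comment> \<open>After \<open>T0\<close> both \<open>s\<close> and \<open>s + \<tau>\<close>
      are positive; below the level \<open>q'\<close> both \<open>x\<close> and \<open>x + y\<close>
      are ahead of the front at their respective times. Hence both functions obey the recursion
      there.\<close>
    define T0 where "T0 = max 0 (-\<tau>)"
    define q' where "q' = q + min 0 (p \<bullet> y - \<tau>)"
    define r where "r = \<delta> * (1 + (norm p + 1) / \<kappa>)"
    have py: "\<bar>p \<bullet> y - \<tau>\<bar> \<le> \<delta> * (norm p + 1)"
    proof -
      have "\<bar>p \<bullet> y\<bar> \<le> norm p * norm y" by (rule Cauchy_Schwarz_ineq2)
      also have "\<dots> \<le> norm p * \<delta>" using y by (intro mult_left_mono) auto
      finally show ?thesis using \<tau> by (auto simp: algebra_simps)
    qed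
    have r0: "0 \<le> r" using \<delta> kappa_pos by (auto simp: r_def)
    have r1: "\<delta> \<le> r" "\<delta> * (norm p + 1) / \<kappa> \<le> r"
      using \<delta> kappa_pos by (auto simp: r_def algebra_simps)
    have "(r + h) \<le> \<delta> * C" using h by (simp add: r_def C_def algebra_simps)
    then have "(r + h) * (1 + M) \<le> \<delta> * C * (1 + M)" using M_nonneg by (intro mult_right_mono) auto
    also have "\<dots> = \<eta>'" using C M_nonneg by (simp add: \<delta>_def)
    finally have rh: "(r + h) * (1 + M) \<le> \<eta>'" .
    have near: "\<bar>sol h G s z - G (s, z)\<bar> \<le> e / 3"
      if "\<bar>s\<bar> \<le> \<bar>T\<bar> + 2" "norm z \<le> R0 + 1" "s \<le> r \<or> \<theta> z - s \<le> \<delta> * (norm p + 1)" for s z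
    proof (rule sol_near[OF h(1) Gm I _ _ r0 _ rh])
      show "0 \<le> e / 3" using e by simp
      have "(\<theta> z - s) / \<kappa> \<le> r" if "\<theta> z - s \<le> \<delta> * (norm p + 1)"
        using divide_right_mono[OF that, of \<kappa>] kappa_pos r1(2) by simp
      then show "min s ((\<theta> z - s) / \<kappa>) \<le> r" using that(3) by auto
      fix w assume w: "dist w (s, z) \<le> \<eta>'"
      have "norm (s, z) \<le> \<bar>T\<bar> + 2 + (R0 + 1)" using norm_Pair_le[of s z] that by auto
      moreover have "norm w \<le> norm (s, z) + dist w (s, z)" by (metis dist_norm norm_triangle_sub)
      ultimately show "\<bar>G w - G (s, z)\<bar> \<le> e / 3"
        using \<eta>(2)[of "(s, z)" w] w \<eta>' by auto
    qed
    \<comment> \<open>Three errors of \<open>e / 3\<close>: from each scheme value to its own datum,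
      since both points are within travel time \<open>r\<close> of the data, and between the two
      data by uniform continuity.\<close>
    have D: "\<bar>sol h G (s + \<tau>) (x + y) - sol h G s x\<bar> \<le> e"
      if "\<bar>s\<bar> \<le> \<bar>T\<bar> + 1" "norm x \<le> R0" "s \<le> T0 \<or> p \<bullet> x + q' \<le> s" for s x
    proof -
      have xy: "norm (x + y) \<le> R0 + 1" using norm_triangle_ineq[of x y] that y \<delta>1 by auto
      have c1: "s \<le> r \<or> \<theta> x - s \<le> \<delta> * (norm p + 1)"
        using that(3) \<tau> py r1 \<delta> unfolding T0_def q'_def \<theta>_def by auto
      have c2: "s + \<tau> \<le> r \<or> \<theta> (x + y) - (s + \<tau>) \<le> \<delta> * (norm p + 1)"
        using that(3) \<tau> py r1 \<delta> unfolding T0_def q'_def \<theta>_def by (auto simp: inner_add_right)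
      have 1: "\<bar>sol h G (s + \<tau>) (x + y) - G (s + \<tau>, x + y)\<bar> \<le> e / 3"
        using that xy c2 \<tau> \<delta>1 by (intro near) auto
      have 2: "\<bar>sol h G s x - G (s, x)\<bar> \<le> e / 3"
        using that c1 by (intro near) auto
      have "norm (\<tau>, y) \<le> 2 * \<delta>" using norm_Pair_le[of \<tau> y] \<tau> y by simp
      then have "dist (s + \<tau>, x + y) (s, x) < \<eta>"
        using \<delta> \<eta>' by (simp add: dist_Pair_Pair dist_norm norm_Pair)
      then have 3: "\<bar>G (s + \<tau>, x + y) - G (s, x)\<bar> \<le> e / 3"
      proof -
        have "norm (s + \<tau>, x + y) \<le> R0 + \<bar>T\<bar> + 5" "norm (s, x) \<le> R0 + \<bar>T\<bar> + 5"
          using norm_Pair_le[of s x] norm_Pair_le[of "s + \<tau>" "x + y"] that(1,2) xy \<tau> \<delta>1 by auto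
        then show ?thesis
          using \<eta>(2)[of "(s, x)" "(s + \<tau>, x + y)"] \<open>dist _ _ < \<eta>\<close> by auto
      qed
      show ?thesis using 1 2 3 by linarith
    qed
    let ?D = "\<lambda>x. ennreal \<bar>sol h G (t + \<tau>) (x + y) - sol h G t x\<bar>"
    have [measurable]: "sol h G s \<in> borel_measurable borel" for s
      by (rule sol_slice_measurable[OF h(1) Gm])
    have ie: "(\<integral>\<^sup>+x. indicator (cball (0::'a) R0) x * ennreal e \<partial>lborel) = ennreal (e * V)"
      using VE e V0 by (subst nn_integral_multc) (auto simp: ennreal_mult mult.commute)
    have rest: "(\<integral>\<^sup>+x. indicator (cball 0 R) x * (indicator {x. t \<le> T0 \<or> p \<bullet> x + q' \<le> t} x * ?D x) \<partial>lborel) \<le> ennreal (e * V)"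
      unfolding ie[symmetric] using D[of t] t R0 by (intro nn_integral_mono) (auto simp: indicator_def intro: ennreal_leI)
    have main: "(\<integral>\<^sup>+x. indicator (cball 0 R \<inter> {x. t < p \<bullet> x + q'}) x * ?D x \<partial>lborel) \<le> ennreal ((N + 2) * (e * V))" if "T0 < t"
    proof -
      have "(\<integral>\<^sup>+x. indicator (cball 0 R \<inter> {x. t < p \<bullet> x + q'}) x * ?D x \<partial>lborel) \<le>
         ennreal (N + 2) * (\<integral>\<^sup>+x. indicator (cball (0::'a) R0) x * ennreal e \<partial>lborel)"
      proof (rule comparison[where Tm=t and ?T0.0=T0, OF h(1)])
        show "R + M * (t - T0 + h) \<le> R0"
          unfolding R0_def using t h \<delta>1 M_nonneg T0_def by (intro add_mono mult_left_mono) auto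
        show "sol h G (s + \<tau>) (x + y) = collapse h (\<lambda>x. sol h G (s - h + \<tau>) (x + y)) x"
          if "T0 < s" "s < p \<bullet> x + q'" for s x
        proof -
          have "sol h G (s + \<tau>) (x + y) = collapse h (sol h G (s + \<tau> - h)) (x + y)"
            by (rule sol_ahead) (use that h in \<open>auto simp: T0_def q'_def \<theta>_def inner_add_right\<close>)
          then show ?thesis by (simp add: collapse_def algebra_simps)
        qed
        show "sol h G s x = collapse h (sol h G (s - h)) x"
          if "T0 < s" "s < p \<bullet> x + q'" for s x
          by (rule sol_ahead) (use that h in \<open>auto simp: T0_def q'_def \<theta>_def\<close>)
        show "ennreal \<bar>sol h G (s + \<tau>) (x + y) - sol h G s x\<bar> \<le> ennreal e"
          if "T0 - h < s" "s \<le> t" "s \<le> T0 \<or> (p \<bullet> x + q' \<le> s \<and> s < p \<bullet> x + q' + h * N)" "norm x \<le> R0" for s x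
          using that t h \<delta>1 by (intro ennreal_leI D) (auto simp: T0_def)
        show "T0 - h < t" using that h by simp
      qed (use I in \<open>auto intro!: sol_range[OF h(1)] simp del: atLeastAtMost_iff\<close>)
      also have "\<dots> = ennreal ((N + 2) * (e * V))"
        unfolding ie using N_nonneg e V0 by (subst ennreal_mult) auto
      finally show ?thesis .
    qed
    have "(\<integral>\<^sup>+x. indicator (cball 0 R) x * ?D x \<partial>lborel) \<le>
      (\<integral>\<^sup>+x. (if T0 < t then indicator (cball 0 R \<inter> {x. t < p \<bullet> x + q'}) x * ?D x else 0)
        + indicator (cball 0 R) x * (indicator {x. t \<le> T0 \<or> p \<bullet> x + q' \<le> t} x * ?D x) \<partial>lborel)"
      by (intro nn_integral_mono) (auto simp: indicator_def)
    also have "\<dots> = (\<integral>\<^sup>+x. (if T0 < t then indicator (cball 0 R \<inter> {x. t < p \<bullet> x + q'}) x * ?D x else 0) \<partial>lborel)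
        + (\<integral>\<^sup>+x. indicator (cball 0 R) x * (indicator {x. t \<le> T0 \<or> p \<bullet> x + q' \<le> t} x * ?D x) \<partial>lborel)"
      by (rule nn_integral_add) auto
    also have "\<dots> \<le> ennreal ((N + 2) * (e * V)) + ennreal (e * V)"
      using main rest by (intro add_mono) (cases "T0 < t", simp_all)
    also have "\<dots> = ennreal ((N + 3) * (e * V))"
      using N_nonneg e V0 by (subst ennreal_plus[symmetric]) (auto simp: algebra_simps)
    also have "\<dots> \<le> ennreal \<epsilon>" using ee by (rule ennreal_leI)
    finally show "(\<integral>\<^sup>+x. indicator (cball 0 R) x * ?D x \<partial>lborel) \<le> ennreal \<epsilon>" .
  qed
qed

end

section \<open>Limit of the scheme for measurable data\<close>

text \<open>The step \<open>h j\<close> resolves the continuous data \<open>G i\<close> for all \<open>i \<le> j\<close>, so that the scheme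
  for \<open>G j\<close> can be compared with the one for a fixed \<open>G i\<close> with the same step.\<close>

locale approx = front c a b M p q \<kappa> N
  for c :: "real \<Rightarrow> 'a::euclidean_space" and a b M p q \<kappa> N +
  fixes G :: "nat \<Rightarrow> real \<times> 'a \<Rightarrow> real" and u0s :: "nat \<Rightarrow> 'a \<Rightarrow> real" and h :: "nat \<Rightarrow> real"
    and U0 g :: "'a \<Rightarrow> real" and Gl :: "real \<times> 'a \<Rightarrow> real"
  assumes G_cont: "\<And>j. continuous_on UNIV (G j)"
    and G_range: "\<And>j z. G j z \<in> {a..b}"
    and G_init: "\<And>j t x. t \<le> 0 \<Longrightarrow> G j (t, x) = u0s j x"
    and U0_meas [measurable]: "U0 \<in> borel_measurable borel"
    and g_meas [measurable]: "g \<in> borel_measurable borel"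
    and Gl_meas [measurable]: "Gl \<in> borel_measurable borel"
    and U0_lim: "AE x in lborel. (\<lambda>j. u0s j x) \<longlonglongrightarrow> U0 x"
    and g_lim: "AE x in lborel. (\<lambda>j. G j (\<theta> x, x)) \<longlonglongrightarrow> g x"
    and Gl_lim: "AE z in lborel. (\<lambda>j. G j z) \<longlonglongrightarrow> Gl z"
    and h_pos: "\<And>j. 0 < h j" and h_le: "\<And>j. h j \<le> 1 / (real j + 1)"
    and h_fine: "\<And>i j x r. i \<le> j \<Longrightarrow> norm x \<le> real j \<Longrightarrow> 0 \<le> r \<Longrightarrow> r \<le> h j * N \<Longrightarrow>
      \<bar>G i (\<theta> x + r, x) - G i (\<theta> x, x)\<bar> \<le> 1 / (real j + 1)"
begin

lemma G_meas [measurable]: "G j \<in> borel_measurable borel"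
  using G_cont by (rule borel_measurable_continuous_onI)

lemma u0s_eq: "u0s j x = G j (0, x)"
  by (simp add: G_init)

lemma u0s_meas [measurable]: "u0s j \<in> borel_measurable borel"
  unfolding u0s_eq[abs_def] by measurable

lemma G_front_meas [measurable]: "(\<lambda>x. G j (\<theta> x, x)) \<in> borel_measurable borel"
  by measurable

definition W :: "nat \<Rightarrow> nat \<Rightarrow> real \<Rightarrow> 'a \<Rightarrow> real" where
  "W i j = sol (h j) (G i)"

lemma W_meas [measurable]: "W i j t \<in> borel_measurable borel"
  unfolding W_def by (rule sol_slice_measurable[OF h_pos G_meas])

lemma W_meas_joint [measurable]: "(\<lambda>z. W i j (fst z) (snd z)) \<in> borel_measurable borel"
  unfolding W_def by (rule sol_measurable[OF h_pos G_meas])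

lemma W_range: "W i j t x \<in> {a..b}"
  unfolding W_def by (rule sol_range[OF h_pos G_meas G_range])

lemma abs_le_of_range: "u \<in> {a..b} \<Longrightarrow> \<bar>u\<bar> \<le> max \<bar>a\<bar> \<bar>b\<bar>" for u :: real
  by auto

text \<open>With equal steps the two schemes differ only through their data. In the layer behind the
  front the data are replaced by their values on the front, at a cost of
  \<open>1 / (real j + 1)\<close> each thanks to \<open>h_fine\<close>, and those values form a
  Cauchy sequence in L1 on balls.\<close>

lemma approx_close:
  assumes \<epsilon>: "0 < \<epsilon>"
  shows "\<exists>i0. \<forall>i\<ge>i0. \<forall>j\<ge>i. \<forall>t\<le>T.
    (\<integral>\<^sup>+x. indicator (cball 0 R \<inter> {x. t < \<theta> x}) x * ennreal \<bar>W j j t x - W i j t x\<bar> \<partial>lborel) \<le> ennreal \<epsilon>"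
proof -
  define R0 where "R0 = \<bar>R\<bar> + M * (\<bar>T\<bar> + 1)"
  define V where "V = measure lborel (cball (0::'a) R0)"
  have V0: "0 \<le> V" by (simp add: V_def)
  have VE: "emeasure lborel (cball (0::'a) R0) = ennreal V"
    unfolding V_def using emeasure_cball_lt_top[of "0::'a" R0] by (simp add: emeasure_eq_ennreal_measure top.not_eq_extremum)
  define e where "e = \<epsilon> / (3 * (N + 2))"
  have e: "0 < e" using \<epsilon> N_nonneg by (auto simp: e_def)
  have "\<exists>J. \<forall>i\<ge>J. \<forall>j\<ge>J. (\<integral>\<^sup>+z. indicator (cball 0 R0) z * ennreal \<bar>u0s i z - u0s j z\<bar> \<partial>lborel) \<le> ennreal e"
    by (rule L1_loc_Cauchy[OF u0s_meas U0_meas _ U0_lim e]) (rule abs_le_of_range, simp only: u0s_eq G_range)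
  then obtain J1 where J1: "\<And>i j. i \<ge> J1 \<Longrightarrow> j \<ge> J1 \<Longrightarrow> (\<integral>\<^sup>+z. indicator (cball 0 R0) z * ennreal \<bar>u0s i z - u0s j z\<bar> \<partial>lborel) \<le> ennreal e"
    by blast
  have "\<exists>J. \<forall>i\<ge>J. \<forall>j\<ge>J. (\<integral>\<^sup>+z. indicator (cball 0 R0) z * ennreal \<bar>G i (\<theta> z, z) - G j (\<theta> z, z)\<bar> \<partial>lborel) \<le> ennreal e"
    by (rule L1_loc_Cauchy[OF G_front_meas g_meas _ g_lim e]) (rule abs_le_of_range, simp only: G_range)
  then obtain J2 where J2: "\<And>i j. i \<ge> J2 \<Longrightarrow> j \<ge> J2 \<Longrightarrow> (\<integral>\<^sup>+z. indicator (cball 0 R0) z * ennreal \<bar>G i (\<theta> z, z) - G j (\<theta> z, z)\<bar> \<partial>lborel) \<le> ennreal e"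
    by blast
  \<comment> \<open>Two demands in one: \<open>j\<close> exceeds the radius \<open>R0\<close>, as
    \<open>h_fine\<close> requires, and the constant error \<open>2 / (real j + 1)\<close> has
    integral at most \<open>e\<close> over a ball of volume \<open>V\<close>.\<close>
  obtain J3 :: nat where J3: "R0 + 2 * V / e \<le> real J3" using real_arch_simple by blast
  have R0: "R \<le> R0" "0 \<le> R0" using mult_nonneg_nonneg[OF M_nonneg, of "\<bar>T\<bar> + 1"] by (auto simp: R0_def)
  have Ve: "0 \<le> V / e" using V0 e by simp
  show ?thesis
  proof (intro exI[of _ "max J1 (max J2 J3)"] allI impI)
    fix i j t assume i: "max J1 (max J2 J3) \<le> i" and ij: "i \<le> j" and t: "t \<le> T"
    have j: "J1 \<le> j" "J2 \<le> j" "real J3 \<le> real j" using i ij by auto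
    let ?du = "\<lambda>x. ennreal \<bar>u0s j x - u0s i x\<bar>"
    let ?dg = "\<lambda>x. ennreal \<bar>G j (\<theta> x, x) - G i (\<theta> x, x)\<bar>"
    let ?d = "\<lambda>x. ?du x + ?dg x + ennreal (2 / (real j + 1))"
    have h1: "h j \<le> 1" using h_le[of j] by (rule order_trans) simp
    let ?w = "indicator (cball 0 R0) :: 'a \<Rightarrow> ennreal"
    have "(\<integral>\<^sup>+x. ?w x * ?d x \<partial>lborel) = (\<integral>\<^sup>+x. (?w x * ?du x + ?w x * ?dg x) + ?w x * ennreal (2 / (real j + 1)) \<partial>lborel)"
      by (simp only: distrib_left)
    also have "\<dots> = (\<integral>\<^sup>+x. ?w x * ?du x + ?w x * ?dg x \<partial>lborel) + (\<integral>\<^sup>+x. ?w x * ennreal (2 / (real j + 1)) \<partial>lborel)"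
      by (rule nn_integral_add; measurable)
    also have "(\<integral>\<^sup>+x. ?w x * ?du x + ?w x * ?dg x \<partial>lborel) = (\<integral>\<^sup>+x. ?w x * ?du x \<partial>lborel) + (\<integral>\<^sup>+x. ?w x * ?dg x \<partial>lborel)"
      by (rule nn_integral_add; measurable)
    also have "(\<integral>\<^sup>+x. ?w x * ?du x \<partial>lborel) + (\<integral>\<^sup>+x. ?w x * ?dg x \<partial>lborel)
       + (\<integral>\<^sup>+x. ?w x * ennreal (2 / (real j + 1)) \<partial>lborel) \<le> ennreal e + ennreal e + ennreal e"
    proof (rule add_mono[OF add_mono])
      show "(\<integral>\<^sup>+x. indicator (cball 0 R0) x * ?du x \<partial>lborel) \<le> ennreal e"
        by (rule J1) (use i j in auto)
      show "(\<integral>\<^sup>+x. indicator (cball 0 R0) x * ?dg x \<partial>lborel) \<le> ennreal e"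
        by (rule J2) (use i j in auto)
      have "2 * V / e \<le> real j + 1" using J3 j(3) R0 by linarith
      then have "V * (2 / (real j + 1)) \<le> e" using e by (simp add: field_simps)
      then show "(\<integral>\<^sup>+x. indicator (cball (0::'a) R0) x * ennreal (2 / (real j + 1)) \<partial>lborel) \<le> ennreal e"
        using VE V0 by (subst nn_integral_multc) (auto simp: ennreal_mult[symmetric] intro!: ennreal_leI)
    qed
    also have "\<dots> = ennreal (3 * e)" using e by (simp add: ennreal_plus[symmetric] del: ennreal_plus)
    finally have d: "(\<integral>\<^sup>+x. indicator (cball 0 R0) x * ?d x \<partial>lborel) \<le> ennreal (3 * e)" .
    have "(\<integral>\<^sup>+x. indicator (cball 0 R \<inter> {x. t < \<theta> x}) x * ennreal \<bar>W j j t x - W i j t x\<bar> \<partial>lborel)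
      \<le> ennreal (N + 2) * (\<integral>\<^sup>+x. indicator (cball 0 R0) x * ?d x \<partial>lborel)"
      unfolding W_def
    proof (rule sol_compare[OF h_pos G_meas G_meas _ G_range G_range])
      show "ennreal \<bar>G j (t, x) - G i (t, x)\<bar> \<le> ?d x" if "t \<le> 0" for t x
        using that by (simp add: G_init add.assoc)
      show "ennreal \<bar>G j (\<theta> x + r, x) - G i (\<theta> x + r, x)\<bar> \<le> ?d x"
        if "norm x \<le> R0" "0 \<le> r" "r \<le> h j * N" for r x
      proof -
        have nx: "norm x \<le> real j" using that(1) J3 j(3) Ve by auto
        have "\<bar>G j (\<theta> x + r, x) - G i (\<theta> x + r, x)\<bar> \<le> \<bar>G j (\<theta> x, x) - G i (\<theta> x, x)\<bar> + 2 / (real j + 1)"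
          using h_fine[of j j x r] h_fine[OF ij nx that(2,3)] nx that by simp
        then have "ennreal \<bar>G j (\<theta> x + r, x) - G i (\<theta> x + r, x)\<bar> \<le> ?dg x + ennreal (2 / (real j + 1))"
          by (subst ennreal_plus[symmetric]) (auto intro!: ennreal_leI simp del: ennreal_plus)
        also have "\<dots> \<le> ?d x" by (simp add: add.assoc)
        finally show ?thesis .
      qed
      have "max 0 (t + h j) \<le> \<bar>T\<bar> + 1" using t h1 by auto
      then show "R + M * max 0 (t + h j) \<le> R0"
        unfolding R0_def using M_nonneg by (intro add_mono mult_left_mono) auto
    qed measurable
    also have "\<dots> \<le> ennreal (N + 2) * ennreal (3 * e)"
      by (rule mult_left_mono[OF d]) simp
    also have "\<dots> = ennreal ((N + 2) * (3 * e))"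
      using N_nonneg e by (subst ennreal_mult) auto
    also have "(N + 2) * (3 * e) = \<epsilon>"
    proof -
      have "3 * (N + 2) \<noteq> 0" using N_nonneg by simp
      then have "3 * (N + 2) * e = \<epsilon>"
        by (simp only: e_def times_divide_eq_right nonzero_mult_div_cancel_left not_False_eq_True)
      then show ?thesis by (simp add: mult_ac)
    qed
    finally show "(\<integral>\<^sup>+x. indicator (cball 0 R \<inter> {x. t < \<theta> x}) x * ennreal \<bar>W j j t x - W i j t x\<bar> \<partial>lborel) \<le> ennreal \<epsilon>" .
  qed
qed

text \<open>Passage through \<open>W i j\<close> with a fixed continuous datum \<open>G i\<close>,
  where \<open>sol_translation\<close> is uniform in the step. Only points ahead of the front at
  both times are compared, since \<open>approx_close\<close> speaks only of those.\<close>

lemma slice_shift_close: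
  assumes \<epsilon>: "0 < \<epsilon>"
  shows "\<exists>\<delta>>0. \<exists>J. \<forall>j\<ge>J. \<forall>t s. \<bar>t\<bar> \<le> T \<longrightarrow> \<bar>s - t\<bar> < \<delta> \<longrightarrow>
    (\<integral>\<^sup>+x. indicator (cball 0 R \<inter> {x. t < \<theta> x \<and> s < \<theta> x}) x * ennreal \<bar>W j j s x - W j j t x\<bar> \<partial>lborel) \<le> ennreal \<epsilon>"
proof -
  have e3: "0 < \<epsilon> / 3" using \<epsilon> by simp
  from approx_close[OF e3, of "T + 1" R] obtain i where
    i: "\<And>j t. j \<ge> i \<Longrightarrow> t \<le> T + 1 \<Longrightarrow>
      (\<integral>\<^sup>+x. indicator (cball 0 R \<inter> {x. t < \<theta> x}) x * ennreal \<bar>W j j t x - W i j t x\<bar> \<partial>lborel) \<le> ennreal (\<epsilon> / 3)"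
    by blast
  from sol_translation[OF G_cont[of i] G_range[of i] e3, of T R] obtain \<delta> where \<delta>: "0 < \<delta>"
    "\<And>h \<tau> y t. 0 < h \<Longrightarrow> h < \<delta> \<Longrightarrow> \<bar>\<tau>\<bar> < \<delta> \<Longrightarrow> norm y < \<delta> \<Longrightarrow> \<bar>t\<bar> \<le> T \<Longrightarrow>
      (\<integral>\<^sup>+x. indicator (cball 0 R) x * ennreal \<bar>sol h (G i) (t + \<tau>) (x + y) - sol h (G i) t x\<bar> \<partial>lborel) \<le> ennreal (\<epsilon> / 3)"
    by blast
  obtain J :: nat where J: "1 / (real J + 1) < \<delta>"
    using reals_Archimedean[OF \<delta>(1)] by (auto simp: inverse_eq_divide add.commute)
  show ?thesis
  proof (intro exI[of _ "min 1 \<delta>"] exI[of _ "max i J"] conjI allI impI)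
    show "0 < min 1 \<delta>" using \<delta>(1) by simp
    fix j t s assume j: "max i J \<le> j" and t: "\<bar>t\<bar> \<le> T" and s: "\<bar>s - t\<bar> < min 1 \<delta>"
    have ts: "t \<le> T + 1" "s \<le> T + 1" using t s by auto
    have "1 / (real j + 1) \<le> 1 / (real J + 1)" using j by (intro divide_left_mono) auto
    then have hj: "h j < \<delta>" using h_le[of j] J by linarith
    let ?w = "indicator (cball 0 R \<inter> {x. t < \<theta> x \<and> s < \<theta> x}) :: 'a \<Rightarrow> ennreal"
    show "(\<integral>\<^sup>+x. ?w x * ennreal \<bar>W j j s x - W j j t x\<bar> \<partial>lborel) \<le> ennreal \<epsilon>"
    proof (rule nn_integral_abs_triangle3[where ?f2.0="W i j s" and ?f3.0="W i j t"])
      show "(\<integral>\<^sup>+x. ?w x * ennreal \<bar>W j j s x - W i j s x\<bar> \<partial>lborel) \<le> ennreal (\<epsilon> / 3)"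
        by (rule nn_integral_indicator_mono[OF _ i[of j s]]) (use ts j in auto)
      have "(\<integral>\<^sup>+x. ?w x * ennreal \<bar>W j j t x - W i j t x\<bar> \<partial>lborel) \<le> ennreal (\<epsilon> / 3)"
        by (rule nn_integral_indicator_mono[OF _ i[of j t]]) (use ts j in auto)
      then show "(\<integral>\<^sup>+x. ?w x * ennreal \<bar>W i j t x - W j j t x\<bar> \<partial>lborel) \<le> ennreal (\<epsilon> / 3)"
        by (simp add: abs_minus_commute)
      have "(\<integral>\<^sup>+x. indicator (cball 0 R) x * ennreal \<bar>W i j s x - W i j t x\<bar> \<partial>lborel) \<le> ennreal (\<epsilon> / 3)"
        using \<delta>(2)[OF h_pos hj, of "s - t" 0 t] s t \<delta>(1) by (simp add: W_def)
      then show "(\<integral>\<^sup>+x. ?w x * ennreal \<bar>W i j s x - W i j t x\<bar> \<partial>lborel) \<le> ennreal (\<epsilon> / 3)"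
        by (rule nn_integral_indicator_mono[rotated]) auto
    qed (use \<epsilon> in auto)
  qed
qed

lemma nn_integral_slices_le:
  fixes f :: "real \<times> 'a \<Rightarrow> ennreal"
  assumes [measurable]: "f \<in> borel_measurable borel" and R: "0 \<le> R" and e: "0 \<le> e"
    and le: "\<And>t. \<bar>t\<bar> \<le> R \<Longrightarrow> (\<integral>\<^sup>+x. indicator (cball 0 R) x * f (t, x) \<partial>lborel) \<le> ennreal e"
  shows "(\<integral>\<^sup>+z. indicator (cball 0 R) z * f z \<partial>lborel) \<le> ennreal (2 * R * e)"
proof -
  have "(\<integral>\<^sup>+z. indicator (cball 0 R) z * f z \<partial>lborel) = (\<integral>\<^sup>+t. \<integral>\<^sup>+x. indicator (cball 0 R) (t, x) * f (t, x) \<partial>lborel \<partial>lborel)"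
    by (rule nn_integral_spacetime) measurable
  also have "\<dots> \<le> (\<integral>\<^sup>+t. indicator {-R..R} t * ennreal e \<partial>lborel)"
  proof (intro nn_integral_mono)
    fix t :: real
    show "(\<integral>\<^sup>+x. indicator (cball 0 R) (t, x) * f (t, x) \<partial>lborel) \<le> indicator {-R..R} t * ennreal e"
    proof (cases "\<bar>t\<bar> \<le> R")
      case True
      have "(\<integral>\<^sup>+x. indicator (cball 0 R) (t, x) * f (t, x) \<partial>lborel) \<le> (\<integral>\<^sup>+x. indicator (cball 0 R) x * f (t, x) \<partial>lborel)"
        using order_trans[OF norm_snd_le] by (intro nn_integral_mono) (fastforce simp: indicator_def)
      then show ?thesis using le[OF True] True by (auto simp: abs_le_iff)
    next
      case False
      have "indicator (cball 0 R) (t, x) = (0 :: ennreal)" for x :: 'a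
        using False norm_fst_le[of t x] by (auto simp: indicator_def)
      then show ?thesis by simp
    qed
  qed
  also have "\<dots> = ennreal (2 * R * e)"
    using R e by (subst nn_integral_multc) (auto simp: ennreal_mult)
  finally show ?thesis .
qed

text \<open>Where \<open>t < \<theta> x\<close> the estimate on slices is integrated in time;
  elsewhere the scheme coincides with its datum, and the data converge in L1 on balls of
  space-time.\<close>

lemma joint_close:
  assumes \<epsilon>: "0 < \<epsilon>"
  shows "\<exists>i0. \<forall>i\<ge>i0. \<forall>j\<ge>i.
    (\<integral>\<^sup>+z. indicator (cball 0 R) z * ennreal \<bar>W j j (fst z) (snd z) - W i j (fst z) (snd z)\<bar> \<partial>lborel) \<le> ennreal \<epsilon>"
proof -
  define R' where "R' = \<bar>R\<bar> + 1"
  define e where "e = \<epsilon> / (4 * R')"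
  have R': "0 < R'" "R \<le> R'" by (auto simp: R'_def)
  have e: "0 < e" using \<epsilon> R' by (simp add: e_def)
  have e2: "0 < \<epsilon> / 2" using \<epsilon> by simp
  obtain i1 where i1: "\<And>i j t. i \<ge> i1 \<Longrightarrow> j \<ge> i \<Longrightarrow> t \<le> R' \<Longrightarrow>
    (\<integral>\<^sup>+x. indicator (cball 0 R' \<inter> {x. t < \<theta> x}) x * ennreal \<bar>W j j t x - W i j t x\<bar> \<partial>lborel) \<le> ennreal e"
    using approx_close[OF e, of R' R'] by blast
  have "\<exists>J. \<forall>i\<ge>J. \<forall>j\<ge>J. (\<integral>\<^sup>+z. indicator (cball 0 R') z * ennreal \<bar>G i z - G j z\<bar> \<partial>lborel) \<le> ennreal (\<epsilon> / 2)"
    by (rule L1_loc_Cauchy[OF G_meas Gl_meas _ Gl_lim e2]) (rule abs_le_of_range, rule G_range)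
  then obtain J where J: "\<And>i j. i \<ge> J \<Longrightarrow> j \<ge> J \<Longrightarrow> (\<integral>\<^sup>+z. indicator (cball 0 R') z * ennreal \<bar>G i z - G j z\<bar> \<partial>lborel) \<le> ennreal (\<epsilon> / 2)"
    by blast
  show ?thesis
  proof (intro exI[of _ "max i1 J"] allI impI)
    fix i j assume ij: "max i1 J \<le> i" "i \<le> j"
    let ?D = "\<lambda>z. ennreal \<bar>W j j (fst z) (snd z) - W i j (fst z) (snd z)\<bar>"
    have s: "(\<integral>\<^sup>+z. indicator (cball 0 R') z * (indicator {z. fst z < \<theta> (snd z)} z * ?D z) \<partial>lborel) \<le> ennreal (2 * R' * e)"
    proof (rule nn_integral_slices_le)
      fix t :: real assume "\<bar>t\<bar> \<le> R'"
      then have "(\<integral>\<^sup>+x. indicator (cball 0 R' \<inter> {x. t < \<theta> x}) x * ennreal \<bar>W j j t x - W i j t x\<bar> \<partial>lborel) \<le> ennreal e"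
        using i1 ij by auto
      then show "(\<integral>\<^sup>+x. indicator (cball 0 R') x * (indicator {z. fst z < \<theta> (snd z)} (t, x) * ?D (t, x)) \<partial>lborel) \<le> ennreal e"
        by (rule order_trans[rotated]) (auto intro!: nn_integral_mono simp: indicator_def)
    qed (use R' e in auto)
    have "(\<integral>\<^sup>+z. indicator (cball 0 R) z * ?D z \<partial>lborel) \<le>
      (\<integral>\<^sup>+z. indicator (cball 0 R') z * (indicator {z. fst z < \<theta> (snd z)} z * ?D z)
        + indicator (cball 0 R') z * ennreal \<bar>G j z - G i z\<bar> \<partial>lborel)"
    proof (intro nn_integral_mono)
      fix z :: "real \<times> 'a"
      have "?D z = ennreal \<bar>G j z - G i z\<bar>" if "\<not> fst z < \<theta> (snd z)"
        using that by (simp add: W_def sol_data not_less)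
      then show "indicator (cball 0 R) z * ?D z \<le> indicator (cball 0 R') z * (indicator {z. fst z < \<theta> (snd z)} z * ?D z)
        + indicator (cball 0 R') z * ennreal \<bar>G j z - G i z\<bar>"
        using R' by (auto simp: indicator_def)
    qed
    also have "\<dots> = (\<integral>\<^sup>+z. indicator (cball 0 R') z * (indicator {z. fst z < \<theta> (snd z)} z * ?D z) \<partial>lborel)
        + (\<integral>\<^sup>+z. indicator (cball 0 R') z * ennreal \<bar>G j z - G i z\<bar> \<partial>lborel)"
      by (rule nn_integral_add; measurable)
    also have "\<dots> \<le> ennreal (2 * R' * e) + ennreal (\<epsilon> / 2)"
      by (intro add_mono s J) (use ij in auto)
    also have "\<dots> = ennreal \<epsilon>"
      using R' e \<epsilon> by (subst ennreal_plus[symmetric]) (auto simp: e_def)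
    finally show "(\<integral>\<^sup>+z. indicator (cball 0 R) z * ?D z \<partial>lborel) \<le> ennreal \<epsilon>" .
  qed
qed

text \<open>The equicontinuity required for compactness in space-time, again through a fixed datum.
  It holds only for large \<open>j\<close>, both because the datum index must lie below
  \<open>j\<close> and because the step must be small; the enlarged radius \<open>R'\<close>
  contains the translated ball.\<close>

lemma joint_shift_close:
  assumes \<epsilon>: "0 < \<epsilon>"
  shows "\<exists>\<delta>>0. \<exists>J. \<forall>j\<ge>J. \<forall>y. norm y < \<delta> \<longrightarrow>
    (\<integral>\<^sup>+z. indicator (cball 0 R) z * ennreal \<bar>W j j (fst (z + y)) (snd (z + y)) - W j j (fst z) (snd z)\<bar> \<partial>lborel) \<le> ennreal \<epsilon>"
proof -
  define R' where "R' = \<bar>R\<bar> + 1"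
  have R': "0 < R'" "R \<le> R'" "R + 1 \<le> R'" by (auto simp: R'_def)
  have e3: "0 < \<epsilon> / 3" using \<epsilon> by simp
  define e where "e = \<epsilon> / (6 * R')"
  have e: "0 < e" using \<epsilon> R' by (simp add: e_def)
  obtain i where i: "\<And>j. j \<ge> i \<Longrightarrow> (\<integral>\<^sup>+z. indicator (cball 0 R') z * ennreal \<bar>W j j (fst z) (snd z) - W i j (fst z) (snd z)\<bar> \<partial>lborel) \<le> ennreal (\<epsilon> / 3)"
    using joint_close[OF e3, of R'] by blast
  from sol_translation[OF G_cont[of i] G_range[of i] e, of R' R'] obtain \<delta> where \<delta>: "0 < \<delta>"
    "\<And>h \<tau> y t. 0 < h \<Longrightarrow> h < \<delta> \<Longrightarrow> \<bar>\<tau>\<bar> < \<delta> \<Longrightarrow> norm y < \<delta> \<Longrightarrow> \<bar>t\<bar> \<le> R' \<Longrightarrow>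
      (\<integral>\<^sup>+x. indicator (cball 0 R') x * ennreal \<bar>sol h (G i) (t + \<tau>) (x + y) - sol h (G i) t x\<bar> \<partial>lborel) \<le> ennreal e"
    by blast
  obtain J :: nat where J: "1 / (real J + 1) < \<delta>"
    using reals_Archimedean[OF \<delta>(1)] by (auto simp: inverse_eq_divide add.commute)
  show ?thesis
  proof (intro exI[of _ "min 1 \<delta>"] exI[of _ "max i J"] conjI allI impI)
    show "0 < min 1 \<delta>" using \<delta>(1) by simp
    fix j and y :: "real \<times> 'a" assume j: "max i J \<le> j" and y: "norm y < min 1 \<delta>"
    have "1 / (real j + 1) \<le> 1 / (real J + 1)" using j by (intro divide_left_mono) auto
    then have hj: "h j < \<delta>" using h_le[of j] J by linarith
    define F where "F i j z = W i j (fst z) (snd z)" for i j and z :: "real \<times> 'a"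
    have [measurable]: "F i j \<in> borel_measurable borel" for i j unfolding F_def by measurable
    let ?w = "indicator (cball 0 R) :: real \<times> 'a \<Rightarrow> ennreal"
    have "(\<integral>\<^sup>+z. ?w z * ennreal \<bar>F j j (z + y) - F j j z\<bar> \<partial>lborel) \<le> ennreal \<epsilon>"
    proof (rule nn_integral_abs_triangle3[where ?f2.0="\<lambda>z. F i j (z + y)" and ?f3.0="F i j"])
      have ij: "(\<integral>\<^sup>+z. indicator (cball 0 R') z * ennreal \<bar>F j j z - F i j z\<bar> \<partial>lborel) \<le> ennreal (\<epsilon> / 3)"
        unfolding F_def using i j by auto
      have "norm (z + y) \<le> R'" if "norm z \<le> R" for z
        using norm_triangle_ineq[of z y] y that R' by linarith
      then have "(\<integral>\<^sup>+z. ?w z * ennreal \<bar>F j j (z + y) - F i j (z + y)\<bar> \<partial>lborel) \<le>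
        (\<integral>\<^sup>+z. indicator (cball 0 R') (z + y) * ennreal \<bar>F j j (z + y) - F i j (z + y)\<bar> \<partial>lborel)"
        by (intro nn_integral_mono) (auto simp: indicator_def)
      also have "\<dots> = (\<integral>\<^sup>+z. indicator (cball 0 R') z * ennreal \<bar>F j j z - F i j z\<bar> \<partial>lborel)"
        by (rule nn_integral_lborel_shift[where f="\<lambda>z. indicator (cball 0 R') z * ennreal \<bar>F j j z - F i j z\<bar>"]) measurable
      also note ij
      finally show "(\<integral>\<^sup>+z. ?w z * ennreal \<bar>F j j (z + y) - F i j (z + y)\<bar> \<partial>lborel) \<le> ennreal (\<epsilon> / 3)" .
      have "(\<integral>\<^sup>+z. ?w z * ennreal \<bar>F j j z - F i j z\<bar> \<partial>lborel) \<le> ennreal (\<epsilon> / 3)"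
        by (rule nn_integral_indicator_mono[OF _ ij]) (use R' in auto)
      then show "(\<integral>\<^sup>+z. ?w z * ennreal \<bar>F i j z - F j j z\<bar> \<partial>lborel) \<le> ennreal (\<epsilon> / 3)"
        by (simp add: abs_minus_commute)
      have yy: "\<bar>fst y\<bar> < \<delta>" "norm (snd y) < \<delta>"
        using y norm_fst_le[of "fst y" "snd y"] norm_snd_le[of "snd y" "fst y"] by auto
      have "(\<integral>\<^sup>+z. indicator (cball 0 R') z * ennreal \<bar>F i j (z + y) - F i j z\<bar> \<partial>lborel) \<le> ennreal (2 * R' * e)"
      proof (rule nn_integral_slices_le)
        show "(\<integral>\<^sup>+x. indicator (cball 0 R') x * ennreal \<bar>F i j ((t, x) + y) - F i j (t, x)\<bar> \<partial>lborel) \<le> ennreal e"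
          if "\<bar>t\<bar> \<le> R'" for t
          using \<delta>(2)[OF h_pos hj yy that] by (simp add: F_def W_def)
      qed (use R' e in auto)
      moreover have "2 * R' * e = \<epsilon> / 3" using R' by (simp add: e_def)
      ultimately show "(\<integral>\<^sup>+z. ?w z * ennreal \<bar>F i j (z + y) - F i j z\<bar> \<partial>lborel) \<le> ennreal (\<epsilon> / 3)"
        by (intro nn_integral_indicator_mono[of "cball 0 R" "cball 0 R'"]) (use R' in auto)
    qed (use \<epsilon> in auto)
    then show "(\<integral>\<^sup>+z. ?w z * ennreal \<bar>W j j (fst (z + y)) (snd (z + y)) - W j j (fst z) (snd z)\<bar> \<partial>lborel) \<le> ennreal \<epsilon>"
      by (simp only: F_def)
  qed
qed

text \<open>Compactness in space-time determines \<open>F\<close> only up to null sets, so its value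
  at a prescribed time carries no information. The version \<open>w\<close> repairs this: at
  exceptional times it is the L1 limit of the schemes ahead of the front, which exists by comparison
  with nearby times. The estimate on time shifts survives the limit and makes \<open>w\<close>
  continuous in time there.\<close>

lemma limit_exists:
  obtains r :: "nat \<Rightarrow> nat" and F :: "real \<times> 'a \<Rightarrow> real" and w :: "real \<Rightarrow> 'a \<Rightarrow> real"
  where "strict_mono r" "F \<in> borel_measurable borel" "\<And>z. F z \<in> {a..b}"
    "AE z in lborel. (\<lambda>j. W (r j) (r j) (fst z) (snd z)) \<longlonglongrightarrow> F z"
    "\<And>t. w t \<in> borel_measurable borel" "\<And>t x. w t x \<in> {a..b}"
    "AE t in lborel. \<forall>x. w t x = F (t, x)"
    "AE x in lborel. 0 < \<theta> x \<longrightarrow> w 0 x = U0 x"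
    "\<And>R T \<epsilon>. 0 < \<epsilon> \<Longrightarrow> \<exists>\<delta>>0. \<forall>t s. \<bar>t\<bar> \<le> T \<longrightarrow> \<bar>s - t\<bar> < \<delta> \<longrightarrow>
      (\<integral>\<^sup>+x. indicator (cball 0 R \<inter> {x. t < \<theta> x \<and> s < \<theta> x}) x * ennreal \<bar>w s x - w t x\<bar> \<partial>lborel) \<le> ennreal \<epsilon>"
proof -
  have "\<exists>r F. strict_mono (r :: nat \<Rightarrow> nat) \<and> F \<in> borel_measurable borel \<and> (\<forall>z. F z \<in> {a..b}) \<and>
    (AE z in lborel. (\<lambda>j. W (r j) (r j) (fst z) (snd z)) \<longlonglongrightarrow> F z)"
    by (rule L1_loc_precompact[where f="\<lambda>j z. W j j (fst z) (snd z)"]) (rule W_meas_joint W_range joint_shift_close, assumption?)+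
  then obtain r F where r: "strict_mono (r :: nat \<Rightarrow> nat)" and Fm [measurable]: "F \<in> borel_measurable borel"
    and FI: "\<And>z. F z \<in> {a..b}"
    and lim: "AE z in lborel. (\<lambda>j. W (r j) (r j) (fst z) (snd z)) \<longlonglongrightarrow> F z"
    by blast
  define U where "U j = W (r j) (r j)" for j
  have Um [measurable]: "U j t \<in> borel_measurable borel" for j t by (simp add: U_def)
  have UI: "U j t x \<in> {a..b}" for j t x unfolding U_def by (rule W_range)
  have UC: "\<bar>U j t x\<bar> \<le> max \<bar>a\<bar> \<bar>b\<bar>" for j t x by (rule abs_le_of_range[OF UI])
  have rge: "j \<le> r j" for j by (rule seq_suble[OF r])
  define good where "good t \<longleftrightarrow> (AE x in lborel. (\<lambda>j. U j t x) \<longlonglongrightarrow> F (t, x))" for t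
  have "AE t in lborel. AE x in lborel. (\<lambda>j. U j (fst (t, x)) (snd (t, x))) \<longlonglongrightarrow> F (t, x)"
    by (rule lborel_pair.AE_pair) (unfold lborel_prod U_def, rule lim)
  then have good: "AE t in lborel. good t" by (simp add: good_def)
  have shift: "\<exists>\<delta>>0. \<exists>J. \<forall>j\<ge>J. \<forall>t s. \<bar>t\<bar> \<le> T \<longrightarrow> \<bar>s - t\<bar> < \<delta> \<longrightarrow>
    (\<integral>\<^sup>+x. indicator (cball 0 R \<inter> {x. t < \<theta> x \<and> s < \<theta> x}) x * ennreal \<bar>U j s x - U j t x\<bar> \<partial>lborel) \<le> ennreal \<epsilon>"
    if "0 < \<epsilon>" for T R \<epsilon>
    unfolding U_def using slice_shift_close[OF that, of T R] rge by (meson order_trans)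
  have good_near: "\<exists>s. good s \<and> t - \<delta> < s \<and> s < t" if "0 < \<delta>" for t \<delta>
  proof (rule ccontr)
    assume "\<not> ?thesis"
    then have no: "good s \<Longrightarrow> s \<notin> {t - \<delta><..<t}" for s by auto
    have "AE s in lborel. s \<notin> {t - \<delta><..<t}" using good by eventually_elim (rule no)
    then have "{t - \<delta><..<t} \<in> null_sets lborel" by (subst (asm) AE_iff_null_sets[symmetric]) auto
    then show False using that by (auto simp: null_sets_def)
  qed
  \<comment> \<open>At good times the slice of \<open>F\<close> is kept verbatim, so that
    \<open>w\<close> and \<open>F\<close> agree at almost every time; a new limit is constructed
    only at the other times.\<close>
  have ex: "\<exists>v. v \<in> borel_measurable borel \<and> (\<forall>x. v x \<in> {a..b}) \<and> (good t \<longrightarrow> (\<forall>x. v x = F (t, x))) \<and>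
    (\<forall>R \<epsilon>. 0 < \<epsilon> \<longrightarrow> (\<exists>J. \<forall>j\<ge>J. (\<integral>\<^sup>+x. indicator (cball 0 R \<inter> {x. t < \<theta> x}) x * ennreal \<bar>U j t x - v x\<bar> \<partial>lborel) \<le> ennreal \<epsilon>))" for t
  proof (cases "good t")
    case True
    have [measurable]: "(\<lambda>x. F (t, x)) \<in> borel_measurable borel" by measurable
    have "\<exists>J. \<forall>j\<ge>J. (\<integral>\<^sup>+x. indicator (cball 0 R \<inter> {x. t < \<theta> x}) x * ennreal \<bar>U j t x - F (t, x)\<bar> \<partial>lborel) \<le> ennreal \<epsilon>"
      if "0 < \<epsilon>" for R \<epsilon>
    proof -
      have "\<forall>\<^sub>F j in sequentially. (\<integral>\<^sup>+x. indicator (cball 0 R) x * ennreal \<bar>U j t x - F (t, x)\<bar> \<partial>lborel) < ennreal \<epsilon>"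
        by (rule order_tendstoD(2)[OF L1_loc_tendsto[where f="\<lambda>j. U j t", OF _ _ UC]])
           (use True that in \<open>auto simp: good_def\<close>)
      then obtain J where J: "\<And>j. j \<ge> J \<Longrightarrow> (\<integral>\<^sup>+x. indicator (cball 0 R) x * ennreal \<bar>U j t x - F (t, x)\<bar> \<partial>lborel) < ennreal \<epsilon>"
        unfolding eventually_sequentially by blast
      show ?thesis
      proof (intro exI[of _ J] allI impI)
        fix j assume "J \<le> j"
        show "(\<integral>\<^sup>+x. indicator (cball 0 R \<inter> {x. t < \<theta> x}) x * ennreal \<bar>U j t x - F (t, x)\<bar> \<partial>lborel) \<le> ennreal \<epsilon>"
          by (rule nn_integral_indicator_mono[OF Int_lower1 less_imp_le[OF J[OF \<open>J \<le> j\<close>]]])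
      qed
    qed
    then show ?thesis using FI by (intro exI[of _ "\<lambda>x. F (t, x)"]) simp
  next
    case False
    let ?f = "\<lambda>j x. if t < \<theta> x then U j t x else a"
    have "\<exists>v. v \<in> borel_measurable borel \<and> (\<forall>x. v x \<in> {a..b}) \<and>
      (\<forall>R \<epsilon>. 0 < \<epsilon> \<longrightarrow> (\<exists>J. \<forall>j\<ge>J. (\<integral>\<^sup>+x. indicator (cball 0 R) x * ennreal \<bar>?f j x - v x\<bar> \<partial>lborel) \<le> ennreal \<epsilon>))"
    proof (rule L1_loc_complete)
      show "?f j \<in> borel_measurable borel" for j by measurable
      show "?f j x \<in> {a..b}" for j x using UI[of j t x] ab by auto
      fix R \<epsilon> :: real assume \<epsilon>: "0 < \<epsilon>"
      have e3: "0 < \<epsilon> / 3" using \<epsilon> by simp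
      from shift[OF e3, of "\<bar>t\<bar>" R] obtain \<delta> J where \<delta>: "0 < \<delta>" "\<And>j s. j \<ge> J \<Longrightarrow> \<bar>s - t\<bar> < \<delta> \<Longrightarrow>
        (\<integral>\<^sup>+x. indicator (cball 0 R \<inter> {x. t < \<theta> x \<and> s < \<theta> x}) x * ennreal \<bar>U j s x - U j t x\<bar> \<partial>lborel) \<le> ennreal (\<epsilon> / 3)"
        by blast
      \<comment> \<open>At the good time \<open>s\<close> the slices are Cauchy, and the shift
        estimate transfers this to \<open>t\<close>. Choosing \<open>s < t\<close> guarantees that a
        point ahead at time \<open>t\<close> is ahead at time \<open>s\<close> too.\<close>
      obtain s where s: "good s" "t - \<delta> < s" "s < t" using good_near[OF \<delta>(1)] by blast
      have [measurable]: "(\<lambda>x. F (s, x)) \<in> borel_measurable borel" by measurable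
      have "\<exists>J. \<forall>i\<ge>J. \<forall>j\<ge>J. (\<integral>\<^sup>+x. indicator (cball 0 R) x * ennreal \<bar>U i s x - U j s x\<bar> \<partial>lborel) \<le> ennreal (\<epsilon> / 3)"
        by (rule L1_loc_Cauchy[where F="\<lambda>x. F (s, x)", OF _ _ UC _ e3]) (use s in \<open>auto simp: good_def\<close>)
      then obtain J' where J': "\<And>i j. i \<ge> J' \<Longrightarrow> j \<ge> J' \<Longrightarrow> (\<integral>\<^sup>+x. indicator (cball 0 R) x * ennreal \<bar>U i s x - U j s x\<bar> \<partial>lborel) \<le> ennreal (\<epsilon> / 3)"
        by blast
      show "\<exists>J. \<forall>i\<ge>J. \<forall>j\<ge>J. (\<integral>\<^sup>+x. indicator (cball 0 R) x * ennreal \<bar>?f i x - ?f j x\<bar> \<partial>lborel) \<le> ennreal \<epsilon>"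
      proof (intro exI[of _ "max J J'"] allI impI)
        fix i j assume ij: "max J J' \<le> i" "max J J' \<le> j"
        let ?w = "indicator (cball 0 R \<inter> {x. t < \<theta> x \<and> s < \<theta> x}) :: 'a \<Rightarrow> ennreal"
        have "(\<integral>\<^sup>+x. indicator (cball 0 R) x * ennreal \<bar>?f i x - ?f j x\<bar> \<partial>lborel) \<le> (\<integral>\<^sup>+x. ?w x * ennreal \<bar>U i t x - U j t x\<bar> \<partial>lborel)"
          using s by (intro nn_integral_mono) (auto simp: indicator_def)
        also have "\<dots> \<le> ennreal \<epsilon>"
        proof (rule nn_integral_abs_triangle3[where ?f2.0="U i s" and ?f3.0="U j s"])
          show "(\<integral>\<^sup>+x. ?w x * ennreal \<bar>U i s x - U j s x\<bar> \<partial>lborel) \<le> ennreal (\<epsilon> / 3)"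
            by (rule nn_integral_indicator_mono[OF _ J'[of i j]]) (use ij in auto)
          have "(\<integral>\<^sup>+x. ?w x * ennreal \<bar>U i s x - U i t x\<bar> \<partial>lborel) \<le> ennreal (\<epsilon> / 3)"
            by (rule \<delta>(2)) (use ij s in auto)
          then show "(\<integral>\<^sup>+x. ?w x * ennreal \<bar>U i t x - U i s x\<bar> \<partial>lborel) \<le> ennreal (\<epsilon> / 3)"
            by (simp only: abs_minus_commute)
          show "(\<integral>\<^sup>+x. ?w x * ennreal \<bar>U j s x - U j t x\<bar> \<partial>lborel) \<le> ennreal (\<epsilon> / 3)"
            by (rule \<delta>(2)) (use ij s in auto)
        qed (use \<epsilon> in auto)
        finally show "(\<integral>\<^sup>+x. indicator (cball 0 R) x * ennreal \<bar>?f i x - ?f j x\<bar> \<partial>lborel) \<le> ennreal \<epsilon>" .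
      qed
    qed
    then obtain v where v: "v \<in> borel_measurable borel" "\<forall>x. v x \<in> {a..b}"
      "\<And>R \<epsilon>. 0 < \<epsilon> \<Longrightarrow> \<exists>J. \<forall>j\<ge>J. (\<integral>\<^sup>+x. indicator (cball 0 R) x * ennreal \<bar>?f j x - v x\<bar> \<partial>lborel) \<le> ennreal \<epsilon>"
      by blast
    have "\<exists>J. \<forall>j\<ge>J. (\<integral>\<^sup>+x. indicator (cball 0 R \<inter> {x. t < \<theta> x}) x * ennreal \<bar>U j t x - v x\<bar> \<partial>lborel) \<le> ennreal \<epsilon>" if pos: "0 < \<epsilon>" for R \<epsilon>
    proof -
      obtain J where J: "\<And>j. j \<ge> J \<Longrightarrow> (\<integral>\<^sup>+x. indicator (cball 0 R) x * ennreal \<bar>?f j x - v x\<bar> \<partial>lborel) \<le> ennreal \<epsilon>"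
        using v(3)[OF pos] by blast
      show ?thesis
      proof (intro exI[of _ J] allI impI)
        fix j assume "J \<le> j"
        show "(\<integral>\<^sup>+x. indicator (cball 0 R \<inter> {x. t < \<theta> x}) x * ennreal \<bar>U j t x - v x\<bar> \<partial>lborel) \<le> ennreal \<epsilon>"
          by (rule order_trans[OF nn_integral_mono J[OF \<open>J \<le> j\<close>]]) (auto simp: indicator_def)
      qed
    qed
    then show ?thesis using v False by blast
  qed
  have "\<exists>w. \<forall>t. w t \<in> borel_measurable borel \<and> (\<forall>x. w t x \<in> {a..b}) \<and> (good t \<longrightarrow> (\<forall>x. w t x = F (t, x))) \<and>
    (\<forall>R \<epsilon>. 0 < \<epsilon> \<longrightarrow> (\<exists>J. \<forall>j\<ge>J. (\<integral>\<^sup>+x. indicator (cball 0 R \<inter> {x. t < \<theta> x}) x * ennreal \<bar>U j t x - w t x\<bar> \<partial>lborel) \<le> ennreal \<epsilon>))"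
    by (rule choice) (rule allI, rule ex)
  then obtain w where
    w: "\<And>t. w t \<in> borel_measurable borel" "\<And>t x. w t x \<in> {a..b}" "\<And>t x. good t \<Longrightarrow> w t x = F (t, x)"
      "\<And>t R \<epsilon>. 0 < \<epsilon> \<Longrightarrow> \<exists>J. \<forall>j\<ge>J. (\<integral>\<^sup>+x. indicator (cball 0 R \<inter> {x. t < \<theta> x}) x * ennreal \<bar>U j t x - w t x\<bar> \<partial>lborel) \<le> ennreal \<epsilon>"
    by blast
  note w(1) [measurable]
  show thesis
  proof
    show "strict_mono r" "F \<in> borel_measurable borel" by fact+
    show "F z \<in> {a..b}" for z by (rule FI)
    show "AE z in lborel. (\<lambda>j. W (r j) (r j) (fst z) (snd z)) \<longlonglongrightarrow> F z" by (rule lim)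
    show "w t \<in> borel_measurable borel" for t by (rule w(1))
    show "w t x \<in> {a..b}" for t x by (rule w(2))
    show "AE t in lborel. \<forall>x. w t x = F (t, x)" using good by eventually_elim (simp add: w(3))
  next
    \<comment> \<open>The summand 0 brings the bound into the form expected by
      \<open>ennreal_le_epsilon\<close>, which then yields that the integral vanishes.\<close>
    have z: "(\<integral>\<^sup>+x. indicator (cball 0 R \<inter> {x. 0 < \<theta> x}) x * ennreal \<bar>w 0 x - U0 x\<bar> \<partial>lborel) \<le> 0 + ennreal e"
      if "0 < e" for R e
    proof -
      have e2: "0 < e / 2" using that by simp
      let ?w = "indicator (cball 0 R \<inter> {x. 0 < \<theta> x}) :: 'a \<Rightarrow> ennreal"
      have U0e: "U j 0 x = u0s (r j) x" for j x by (simp add: U_def W_def sol_data G_init)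
      have "AE x in lborel. (\<lambda>j. U j 0 x) \<longlonglongrightarrow> U0 x"
        unfolding U0e using U0_lim by eventually_elim (use LIMSEQ_subseq_LIMSEQ[OF _ r] in \<open>force simp: o_def\<close>)
      then have "\<forall>\<^sub>F j in sequentially. (\<integral>\<^sup>+x. indicator (cball 0 R) x * ennreal \<bar>U j 0 x - U0 x\<bar> \<partial>lborel) < ennreal (e / 2)"
        using e2 by (intro order_tendstoD(2)[OF L1_loc_tendsto[where f="\<lambda>j. U j 0", OF _ _ UC]]) auto
      then obtain J where J: "\<And>j. j \<ge> J \<Longrightarrow> (\<integral>\<^sup>+x. indicator (cball 0 R) x * ennreal \<bar>U j 0 x - U0 x\<bar> \<partial>lborel) < ennreal (e / 2)"
        unfolding eventually_sequentially by blast
      obtain J' where J': "\<And>j. j \<ge> J' \<Longrightarrow> (\<integral>\<^sup>+x. ?w x * ennreal \<bar>U j 0 x - w 0 x\<bar> \<partial>lborel) \<le> ennreal (e / 2)"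
        using w(4)[OF e2] by blast
      let ?j = "max J J'"
      have "(\<integral>\<^sup>+x. ?w x * ennreal \<bar>w 0 x - U0 x\<bar> \<partial>lborel) \<le> (\<integral>\<^sup>+x. ?w x * ennreal \<bar>w 0 x - U ?j 0 x\<bar> \<partial>lborel) + (\<integral>\<^sup>+x. ?w x * ennreal \<bar>U ?j 0 x - U0 x\<bar> \<partial>lborel)"
        by (rule nn_integral_abs_triangle; measurable)
      also have "\<dots> \<le> ennreal (e / 2) + ennreal (e / 2)"
      proof (rule add_mono)
        show "(\<integral>\<^sup>+x. ?w x * ennreal \<bar>w 0 x - U ?j 0 x\<bar> \<partial>lborel) \<le> ennreal (e / 2)"
          using J'[of ?j] by (simp add: abs_minus_commute)
        show "(\<integral>\<^sup>+x. ?w x * ennreal \<bar>U ?j 0 x - U0 x\<bar> \<partial>lborel) \<le> ennreal (e / 2)"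
          by (rule nn_integral_indicator_mono[OF _ less_imp_le[OF J]]) auto
      qed
      also have "\<dots> = ennreal e" using that by (subst ennreal_plus[symmetric]) auto
      finally show ?thesis by simp
    qed
    have "AE x in lborel. indicator (cball 0 (real n) \<inter> {x. 0 < \<theta> x}) x * ennreal \<bar>w 0 x - U0 x\<bar> = 0" for n :: nat
    proof -
      have "(\<integral>\<^sup>+x. indicator (cball 0 (real n) \<inter> {x. 0 < \<theta> x}) x * ennreal \<bar>w 0 x - U0 x\<bar> \<partial>lborel) \<le> 0"
        by (rule ennreal_le_epsilon) (rule z)
      then show ?thesis by (subst nn_integral_0_iff_AE[symmetric]) auto
    qed
    then have "AE x in lborel. \<forall>n::nat. indicator (cball 0 (real n) \<inter> {x. 0 < \<theta> x}) x * ennreal \<bar>w 0 x - U0 x\<bar> = 0"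
      by (subst AE_all_countable) blast
    then show "AE x in lborel. 0 < \<theta> x \<longrightarrow> w 0 x = U0 x"
    proof eventually_elim
      case (elim x)
      obtain n :: nat where "norm x \<le> real n" using real_arch_simple by blast
      then show ?case using spec[OF elim, of n] by (auto simp: indicator_def)
    qed
  next
    fix R T \<epsilon> :: real assume \<epsilon>: "0 < \<epsilon>"
    have e3: "0 < \<epsilon> / 3" using \<epsilon> by simp
    from shift[OF e3, of T R] obtain \<delta> J where \<delta>: "0 < \<delta>" "\<And>j t s. j \<ge> J \<Longrightarrow> \<bar>t\<bar> \<le> T \<Longrightarrow> \<bar>s - t\<bar> < \<delta> \<Longrightarrow>
        (\<integral>\<^sup>+x. indicator (cball 0 R \<inter> {x. t < \<theta> x \<and> s < \<theta> x}) x * ennreal \<bar>U j s x - U j t x\<bar> \<partial>lborel) \<le> ennreal (\<epsilon> / 3)"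
        by blast
    show "\<exists>\<delta>>0. \<forall>t s. \<bar>t\<bar> \<le> T \<longrightarrow> \<bar>s - t\<bar> < \<delta> \<longrightarrow>
      (\<integral>\<^sup>+x. indicator (cball 0 R \<inter> {x. t < \<theta> x \<and> s < \<theta> x}) x * ennreal \<bar>w s x - w t x\<bar> \<partial>lborel) \<le> ennreal \<epsilon>"
    proof (intro exI[of _ \<delta>] conjI allI impI)
      show "0 < \<delta>" by fact
      fix t s assume t: "\<bar>t\<bar> \<le> T" and s: "\<bar>s - t\<bar> < \<delta>"
      obtain J1 where J1: "\<And>j. j \<ge> J1 \<Longrightarrow> (\<integral>\<^sup>+x. indicator (cball 0 R \<inter> {x. t < \<theta> x}) x * ennreal \<bar>U j t x - w t x\<bar> \<partial>lborel) \<le> ennreal (\<epsilon> / 3)"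
        using w(4)[OF e3] by blast
      obtain J2 where J2: "\<And>j. j \<ge> J2 \<Longrightarrow> (\<integral>\<^sup>+x. indicator (cball 0 R \<inter> {x. s < \<theta> x}) x * ennreal \<bar>U j s x - w s x\<bar> \<partial>lborel) \<le> ennreal (\<epsilon> / 3)"
        using w(4)[OF e3] by blast
      let ?j = "max J (max J1 J2)"
      let ?w = "indicator (cball 0 R \<inter> {x. t < \<theta> x \<and> s < \<theta> x}) :: 'a \<Rightarrow> ennreal"
      show "(\<integral>\<^sup>+x. ?w x * ennreal \<bar>w s x - w t x\<bar> \<partial>lborel) \<le> ennreal \<epsilon>"
      proof (rule nn_integral_abs_triangle3[where ?f2.0="U ?j s" and ?f3.0="U ?j t"])
        have "(\<integral>\<^sup>+x. ?w x * ennreal \<bar>U ?j s x - w s x\<bar> \<partial>lborel) \<le> ennreal (\<epsilon> / 3)"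
          by (rule nn_integral_indicator_mono[OF _ J2]) auto
        then show "(\<integral>\<^sup>+x. ?w x * ennreal \<bar>w s x - U ?j s x\<bar> \<partial>lborel) \<le> ennreal (\<epsilon> / 3)"
          by (simp add: abs_minus_commute)
        show "(\<integral>\<^sup>+x. ?w x * ennreal \<bar>U ?j t x - w t x\<bar> \<partial>lborel) \<le> ennreal (\<epsilon> / 3)"
          by (rule nn_integral_indicator_mono[OF _ J1]) auto
        show "(\<integral>\<^sup>+x. ?w x * ennreal \<bar>U ?j s x - U ?j t x\<bar> \<partial>lborel) \<le> ennreal (\<epsilon> / 3)"
          by (rule \<delta>(2)) (use t s in auto)
      qed (use \<epsilon> in auto)
    qed
  qed
qed

end

section \<open>Integrals and null sets in space-time\<close>

lemma integrable_bounded_support: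
  fixes F :: "'b::euclidean_space \<Rightarrow> real"
  assumes [measurable]: "F \<in> borel_measurable borel"
    and C: "\<And>z. \<bar>F z\<bar> \<le> C" and R: "\<And>z. R < norm z \<Longrightarrow> F z = 0"
  shows "integrable lborel F"
proof (rule Bochner_Integration.integrable_bound)
  have "integrable lborel (indicator (cball 0 R) :: 'b \<Rightarrow> real)"
    using emeasure_cball_lt_top[of "0::'b" R] by (subst integrable_indicator_iff) auto
  then show "integrable lborel (\<lambda>z. C * indicator (cball 0 R) (z::'b))"
    by (rule integrable_mult_right)
  show "AE z in lborel. norm (F z) \<le> norm (C * indicator (cball 0 R) z)"
  proof (rule AE_I2)
    fix z
    show "norm (F z) \<le> norm (C * indicator (cball 0 R) z)"
      using R[of z] C[of z] by (cases "norm z \<le> R") (auto simp: indicator_def)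
  qed
qed measurable

lemma integral_pair:
  fixes F :: "'b::euclidean_space \<times> 'c::euclidean_space \<Rightarrow> real"
  assumes [measurable]: "F \<in> borel_measurable borel"
    and C: "\<And>z. \<bar>F z\<bar> \<le> C" and R: "\<And>z. R < norm z \<Longrightarrow> F z = 0"
  shows "integral\<^sup>L lborel F = (\<integral>t. \<integral>y. F (t, y) \<partial>lborel \<partial>lborel)"
    and "integral\<^sup>L lborel F = (\<integral>y. \<integral>t. F (t, y) \<partial>lborel \<partial>lborel)"
proof -
  have i: "integrable (lborel \<Otimes>\<^sub>M lborel) F"
    unfolding lborel_prod by (rule integrable_bounded_support[OF assms])
  show "integral\<^sup>L lborel F = (\<integral>t. \<integral>y. F (t, y) \<partial>lborel \<partial>lborel)"
    using lborel_pair.integral_fst'[OF i] by (simp add: lborel_prod)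
  have i': "integrable (lborel \<Otimes>\<^sub>M lborel) (\<lambda>(t, y). F (t, y))" using i by simp
  show "integral\<^sup>L lborel F = (\<integral>y. \<integral>t. F (t, y) \<partial>lborel \<partial>lborel)"
    using lborel_pair.integral_snd[OF i'] by (simp add: lborel_prod)
qed

lemma integral_triple:
  fixes F :: "'b::euclidean_space \<times> 'c::euclidean_space \<times> 'd::euclidean_space \<Rightarrow> real"
  assumes F [measurable]: "F \<in> borel_measurable borel"
    and C: "\<And>z. \<bar>F z\<bar> \<le> C" and R: "\<And>z. R < norm z \<Longrightarrow> F z = 0"
  shows "integral\<^sup>L lborel F = (\<integral>z. \<integral>\<xi>. F (fst z, snd z, \<xi>) \<partial>lborel \<partial>lborel)"
proof -
  have n2: "norm x \<le> norm (t, x, \<xi>)" "norm \<xi> \<le> norm (t, x, \<xi>)" "norm (t, x) \<le> norm (t, x, \<xi>)" for t :: 'b and x :: 'c and \<xi> :: 'd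
    by (auto simp: norm_Pair intro!: real_le_rsqrt real_sqrt_le_mono)
  define R' where "R' = max 0 R"
  have R': "R' < norm z \<Longrightarrow> F z = 0" for z using R by (simp add: R'_def)
  define V where "V = measure lborel (cball (0::'d) R')"
  have inner_bd: "\<bar>\<integral>\<xi>. F (t, x, \<xi>) \<partial>lborel\<bar> \<le> C * V" for t x
  proof -
    have i: "integrable lborel (\<lambda>\<xi>. F (t, x, \<xi>))"
      by (rule integrable_bounded_support[where C=C and R=R'])
         (use C in \<open>auto intro!: R' intro: less_le_trans[OF _ n2(2)]\<close>)
    have i2: "integrable lborel (indicator (cball (0::'d) R') :: 'd \<Rightarrow> real)"
      using emeasure_cball_lt_top[of "0::'d" R'] by (subst integrable_indicator_iff) auto
    have "\<bar>\<integral>\<xi>. F (t, x, \<xi>) \<partial>lborel\<bar> \<le> (\<integral>\<xi>. \<bar>F (t, x, \<xi>)\<bar> \<partial>lborel)"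
      by (rule integral_abs_bound)
    also have "\<dots> \<le> (\<integral>\<xi>. C * indicator (cball (0::'d) R') \<xi> \<partial>lborel)"
    proof (rule integral_mono)
      fix \<xi> :: 'd
      have "F (t, x, \<xi>) = 0" if "R' < norm \<xi>" by (rule R') (use that n2(2)[of \<xi> t x] in linarith)
      then show "\<bar>F (t, x, \<xi>)\<bar> \<le> C * indicator (cball 0 R') \<xi>"
        using C[of "(t, x, \<xi>)"] by (cases "norm \<xi> \<le> R'") (auto simp: indicator_def)
    qed (use i i2 in auto)
    finally show ?thesis by (simp add: V_def)
  qed
  have "integral\<^sup>L lborel F = (\<integral>t. \<integral>y. F (t, y) \<partial>lborel \<partial>lborel)"
    by (rule integral_pair[OF F C R'])
  also have "\<dots> = (\<integral>t. \<integral>x. \<integral>\<xi>. F (t, x, \<xi>) \<partial>lborel \<partial>lborel \<partial>lborel)"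
  proof (rule Bochner_Integration.integral_cong[OF refl])
    fix t
    show "(\<integral>y. F (t, y) \<partial>lborel) = (\<integral>x. \<integral>\<xi>. F (t, x, \<xi>) \<partial>lborel \<partial>lborel)"
      using norm_snd_le by (intro integral_pair(1)[where C=C and R=R']) (auto intro!: C R' intro: less_le_trans)
  qed
  also have "\<dots> = (\<integral>z. \<integral>\<xi>. F (fst z, snd z, \<xi>) \<partial>lborel \<partial>lborel)"
  proof (rule trans[OF _ integral_pair(1)[symmetric]])
    show "\<bar>\<integral>\<xi>. F (fst z, snd z, \<xi>) \<partial>lborel\<bar> \<le> C * V" for z by (rule inner_bd)
    show "(\<integral>\<xi>. F (fst z, snd z, \<xi>) \<partial>lborel) = 0" if "R' < norm z" for z
    proof -
      have "F (fst z, snd z, \<xi>) = 0" for \<xi>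
        by (rule R') (use that n2(3)[of "fst z" "snd z" \<xi>] in simp)
      then show ?thesis by simp
    qed
  qed simp_all
  finally show ?thesis .
qed

text \<open>The change of variables \<open>(t, y)\<close> to \<open>(\<psi> y + h * t, y)\<close>,
  of Jacobian \<open>h\<close>. It blows layers of thickness of order \<open>h\<close> up to unit
  size, and with \<open>h = 1\<close> it parametrises space-time by the fronts of all levels
  \<open>q\<close>.\<close>

lemma nn_integral_shear:
  fixes f :: "real \<times> 'b::euclidean_space \<Rightarrow> ennreal"
  assumes [measurable]: "f \<in> borel_measurable borel" "\<psi> \<in> borel_measurable borel" and h: "0 < h"
  shows "(\<integral>\<^sup>+z. f z \<partial>lborel) = ennreal h * (\<integral>\<^sup>+z. f (\<psi> (snd z) + h * fst z, snd z) \<partial>lborel)"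
proof -
  have "(\<integral>\<^sup>+z. f z \<partial>lborel) = (\<integral>\<^sup>+y. \<integral>\<^sup>+t. f (t, y) \<partial>lborel \<partial>lborel)"
    by (subst nn_integral_spacetime) (auto intro!: lborel_pair.Fubini')
  also have "\<dots> = (\<integral>\<^sup>+y. ennreal h * (\<integral>\<^sup>+t. f (\<psi> y + h * t, y) \<partial>lborel) \<partial>lborel)"
  proof (rule nn_integral_cong)
    fix y
    show "(\<integral>\<^sup>+t. f (t, y) \<partial>lborel) = ennreal h * (\<integral>\<^sup>+t. f (\<psi> y + h * t, y) \<partial>lborel)"
      using h by (subst nn_integral_real_affine[where c=h and t="\<psi> y"]) auto
  qed
  also have "\<dots> = ennreal h * (\<integral>\<^sup>+y. \<integral>\<^sup>+t. f (\<psi> y + h * t, y) \<partial>lborel \<partial>lborel)"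
    by (rule nn_integral_cmult) measurable
  also have "(\<integral>\<^sup>+y. \<integral>\<^sup>+t. f (\<psi> y + h * t, y) \<partial>lborel \<partial>lborel) = (\<integral>\<^sup>+t. \<integral>\<^sup>+y. f (\<psi> y + h * t, y) \<partial>lborel \<partial>lborel)"
    by (rule lborel_pair.Fubini') measurable
  also have "\<dots> = (\<integral>\<^sup>+z. f (\<psi> (snd z) + h * fst z, snd z) \<partial>lborel)"
    by (subst nn_integral_spacetime) auto
  finally show ?thesis .
qed

lemma lborel_shear:
  fixes \<psi> :: "'b::euclidean_space \<Rightarrow> real"
  assumes [measurable]: "\<psi> \<in> borel_measurable borel" and h: "0 < h"
  shows "(lborel :: (real \<times> 'b) measure) = density (distr lborel borel (\<lambda>z. (\<psi> (snd z) + h * fst z, snd z))) (\<lambda>_. ennreal h)"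
    (is "_ = ?R")
proof (rule measure_eqI)
  fix A assume "A \<in> sets (lborel :: (real \<times> 'b) measure)"
  then have [measurable]: "A \<in> sets borel" by simp
  have T [measurable]: "(\<lambda>z. (\<psi> (snd z) + h * fst z, snd z)) \<in> borel \<rightarrow>\<^sub>M borel" by measurable
  have "emeasure lborel A = (\<integral>\<^sup>+z. indicator A z \<partial>lborel)" by simp
  also have "\<dots> = ennreal h * (\<integral>\<^sup>+z. indicator A (\<psi> (snd z) + h * fst z, snd z) \<partial>lborel)"
    by (rule nn_integral_shear[OF _ assms]) measurable
  also have "(\<integral>\<^sup>+z. indicator A (\<psi> (snd z) + h * fst z, snd z) \<partial>lborel)
      = (\<integral>\<^sup>+z. indicator A z \<partial>distr lborel borel (\<lambda>z. (\<psi> (snd z) + h * fst z, snd z)))"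
    by (subst nn_integral_distr) auto
  also have "ennreal h * \<dots> = emeasure ?R A"
    by (subst emeasure_density) (auto simp: nn_integral_cmult)
  finally show "emeasure lborel A = emeasure ?R A" .
qed simp

lemma integral_shear:
  fixes F :: "real \<times> 'b::euclidean_space \<Rightarrow> real"
  assumes [measurable]: "F \<in> borel_measurable borel" "\<psi> \<in> borel_measurable borel" and h: "0 < h"
  shows "integral\<^sup>L lborel F = h * (\<integral>z. F (\<psi> (snd z) + h * fst z, snd z) \<partial>lborel)"
proof -
  have [measurable]: "(\<lambda>z. (\<psi> (snd z) + h * fst z, snd z)) \<in> borel \<rightarrow>\<^sub>M borel" by measurable
  show ?thesis
    using h by (subst lborel_shear[OF assms(2) h]) (simp add: integral_density integral_distr)
qed

section \<open>Transport of null sets\<close>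

text \<open>Only a Borel null set covering the exceptional set is pulled back, so no measurability
  of \<open>P\<close> is required.\<close>

lemma AE_compose_null:
  assumes "\<And>N. N \<in> null_sets lborel \<Longrightarrow> AE z in M. T z \<notin> N" and "AE y in lborel. P y"
  shows "AE z in M. P (T z)"
proof -
  from assms(2) obtain N where N: "\<And>y. y \<notin> N \<Longrightarrow> P y" "N \<in> null_sets lborel"
    by (rule AE_E3) auto
  from assms(1)[OF N(2)] show ?thesis by eventually_elim (rule N(1))
qed

lemma AE_shear:
  fixes \<psi> :: "'b::euclidean_space \<Rightarrow> real"
  assumes [measurable]: "\<psi> \<in> borel_measurable borel" and h: "0 < h" and P: "AE z in lborel. P z"
  shows "AE z in lborel. P (\<psi> (snd z) + h * fst z, snd z)"
proof (rule AE_compose_null[OF _ P])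
  fix N :: "(real \<times> 'b) set" assume N: "N \<in> null_sets lborel"
  then have [measurable]: "N \<in> sets borel" by auto
  have [measurable]: "(\<lambda>z. (\<psi> (snd z) + h * fst z, snd z)) \<in> borel \<rightarrow>\<^sub>M borel" by measurable
  have "AE z in density (distr lborel borel (\<lambda>z. (\<psi> (snd z) + h * fst z, snd z))) (\<lambda>_. ennreal h). z \<notin> N"
    using AE_not_in[OF N] by (subst (asm) lborel_shear[OF assms(1) h])
  then show "AE z in lborel. (\<psi> (snd z) + h * fst z, snd z) \<notin> N"
    using h by (simp add: AE_density AE_distr_iff)
qed

lemma AE_pair_iff:
  assumes [measurable]: "Measurable.pred borel P"
  shows "(AE z in (lborel :: ('b::euclidean_space \<times> 'c::euclidean_space) measure). P z) \<longleftrightarrow> (AE t in lborel. AE y in lborel. P (t, y))"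
proof -
  have "{z \<in> space (lborel \<Otimes>\<^sub>M lborel). P z} \<in> sets (lborel \<Otimes>\<^sub>M lborel)"
    unfolding lborel_prod by measurable
  from lborel_pair.AE_pair_measure[OF this] lborel_pair.AE_pair[of P] show ?thesis
    unfolding lborel_prod by blast
qed

lemma AE_fst:
  assumes "AE t in lborel. P t"
  shows "AE z in (lborel :: ('b::euclidean_space \<times> 'c::euclidean_space) measure). P (fst z)"
proof (rule AE_compose_null[OF _ assms])
  fix N :: "'b set" assume N: "N \<in> null_sets lborel"
  then have [measurable]: "N \<in> sets borel" by auto
  show "AE z in (lborel :: ('b \<times> 'c) measure). fst z \<notin> N"
    by (subst AE_pair_iff) (use AE_not_in[OF N] in auto)
qed

lemma AE_snd:
  assumes "AE t in lborel. P t"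
  shows "AE z in (lborel :: ('b::euclidean_space \<times> 'c::euclidean_space) measure). P (snd z)"
proof (rule AE_compose_null[OF _ assms])
  fix N :: "'c set" assume N: "N \<in> null_sets lborel"
  then have [measurable]: "N \<in> sets borel" by auto
  show "AE z in (lborel :: ('b \<times> 'c) measure). snd z \<notin> N"
    by (subst AE_pair_iff) (use AE_not_in[OF N] in auto)
qed

lemma AE_time_shift:
  fixes \<Delta> :: real
  assumes "AE z in lborel. P z"
  shows "AE z in (lborel :: (real \<times> 'c::euclidean_space) measure). P (fst z + \<Delta>, snd z)"
  using AE_shear[of "\<lambda>_. \<Delta>" 1 P] assms by (simp add: add.commute)

text \<open>Shearing by \<open>x \<mapsto> p \<bullet> x\<close> turns \<open>(q, x)\<close> into
  space-time coordinates; Fubini then leaves almost every point of almost every front. Here a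
  generic \<open>q\<close> acquires its pointwise properties.\<close>

lemma AE_front:
  fixes P :: "real \<times> 'a::euclidean_space \<Rightarrow> bool"
  assumes "AE z in lborel. P z"
  shows "AE q in lborel. AE x in lborel. P (p \<bullet> x + q, x)"
proof -
  have "AE z in lborel. P (p \<bullet> snd z + 1 * fst z, snd z)"
    by (rule AE_shear[OF _ _ assms]) auto
  then have "AE z in lborel \<Otimes>\<^sub>M lborel. P (p \<bullet> snd z + 1 * fst z, snd z)" by (simp only: lborel_prod)
  from lborel_pair.AE_pair[OF this] show ?thesis by simp
qed

lemma AE_fst_fst_snd:
  fixes P :: "'b::euclidean_space \<times> 'c::euclidean_space \<Rightarrow> bool"
  assumes P: "AE z in lborel. P z"
  shows "AE w in (lborel :: ('b \<times> 'c \<times> 'd::euclidean_space) measure). P (fst w, fst (snd w))"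
proof (rule AE_compose_null[OF _ P])
  fix N :: "('b \<times> 'c) set" assume N: "N \<in> null_sets lborel"
  then have [measurable]: "N \<in> sets borel" by auto
  have "AE t in lborel. AE x in lborel. (t, x) \<notin> N"
    using AE_not_in[OF N] by (subst (asm) AE_pair_iff) auto
  then have "AE t in (lborel :: 'b measure). AE y in (lborel :: ('c \<times> 'd) measure). (t, fst y) \<notin> N"
    by eventually_elim (rule AE_fst)
  then show "AE w in (lborel :: ('b \<times> 'c \<times> 'd) measure). (fst w, fst (snd w)) \<notin> N"
    by (subst AE_pair_iff) auto
qed

text \<open>As a function of its second argument, \<open>sep \<xi>\<close> can jump only at
  \<open>\<xi>\<close>. Away from the graph of the limit it therefore passes to the limit.\<close>

lemma AE_not_on_graph:
  fixes F :: "'b::euclidean_space \<times> 'c::euclidean_space \<Rightarrow> real"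
  assumes [measurable]: "F \<in> borel_measurable borel"
  shows "AE w in lborel. snd (snd w) \<noteq> F (fst w, fst (snd w))"
proof -
  have "AE t in (lborel :: 'b measure). AE y in lborel. snd y \<noteq> F (t, fst y)"
  proof (rule AE_I2)
    fix t
    have "AE x in (lborel :: 'c measure). AE \<xi> in lborel. \<xi> \<noteq> F (t, x)"
      by (intro AE_I2 AE_lborel_singleton)
    then show "AE y in lborel. snd y \<noteq> F (t, fst y)" by (subst AE_pair_iff) auto
  qed
  then show ?thesis by (subst AE_pair_iff) auto
qed

section \<open>From Borel representatives to \<open>lebesgue_on\<close>\<close>

lemma measurable_lebesgue_on_AE:
  fixes U :: "'b::euclidean_space \<Rightarrow> real"
  assumes U: "U \<in> borel_measurable borel" and S: "S \<in> sets borel"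
    and eq: "AE z in lborel. z \<in> S \<longrightarrow> u z = U z"
  shows "u \<in> borel_measurable (lebesgue_on S)"
proof -
  have "U \<in> borel_measurable lebesgue" using U by (intro measurable_completion) simp
  moreover have "AE z in lebesgue. U z = (if z \<in> S then u z else U z)"
    using eq by (subst AE_completion_iff) (auto elim!: eventually_mono)
  ultimately have "(\<lambda>z. if z \<in> S then u z else U z) \<in> borel_measurable lebesgue"
    by (rule borel_measurable_AE)
  then have "(\<lambda>z. if z \<in> S then u z else U z) \<in> borel_measurable (lebesgue_on S)"
    by (rule measurable_restrict_space1)
  then show ?thesis
    by (rule measurable_cong[THEN iffD1, rotated]) simp
qed

lemma AE_lebesgue_on_I:
  fixes S :: "'b::euclidean_space set"
  assumes "S \<in> sets borel" "AE x in lborel. x \<in> S \<longrightarrow> P x"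
  shows "AE x in lebesgue_on S. P x"
proof -
  have "AE x in lebesgue. x \<in> S \<longrightarrow> P x" using assms(2) by (simp only: AE_completion_iff)
  then show ?thesis using assms(1) by (subst AE_restrict_space_iff) auto
qed

text \<open>The definitions of solutions integrate over \<open>lebesgue_on\<close>, the analysis is
  done with Borel representatives and \<open>lborel\<close>; this translates between the
  two.\<close>

lemma integral_lebesgue_on_eq_lborel:
  fixes H :: "'b::euclidean_space \<Rightarrow> real"
  assumes H [measurable]: "H \<in> borel_measurable borel" and S [measurable]: "S \<in> sets borel"
    and eq: "AE x in lborel. x \<in> S \<longrightarrow> h x = H x" and out: "\<And>x. x \<notin> S \<Longrightarrow> H x = 0"
  shows "integral\<^sup>L (lebesgue_on S) h = integral\<^sup>L lborel H"
proof -
  have Sl: "S \<in> sets lebesgue" using S by auto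
  have "integral\<^sup>L (lebesgue_on S) h = integral\<^sup>L (lebesgue_on S) H"
  proof (rule integral_cong_AE)
    show "h \<in> borel_measurable (lebesgue_on S)" by (rule measurable_lebesgue_on_AE[OF H S eq])
    show "H \<in> borel_measurable (lebesgue_on S)" by (rule measurable_lebesgue_on_AE[OF H S]) simp
    show "AE x in lebesgue_on S. h x = H x" by (rule AE_lebesgue_on_I[OF S eq])
  qed
  also have "\<dots> = (\<integral>z. indicator S z *\<^sub>R H z \<partial>lebesgue)"
    using Sl by (intro integral_restrict_space) simp
  also have "\<dots> = (\<integral>z. indicator S z *\<^sub>R H z \<partial>lborel)"
    by (rule integral_completion) measurable
  also have "\<dots> = integral\<^sup>L lborel H"
    using out by (intro Bochner_Integration.integral_cong) (auto simp: indicator_def)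
  finally show ?thesis .
qed

lemma nn_integral_triple:
  fixes F :: "'b::euclidean_space \<times> 'c::euclidean_space \<times> 'd::euclidean_space \<Rightarrow> ennreal"
  assumes [measurable]: "F \<in> borel_measurable borel"
  shows "(\<integral>\<^sup>+z. F z \<partial>lborel) = (\<integral>\<^sup>+t. \<integral>\<^sup>+x. \<integral>\<^sup>+\<xi>. F (t, x, \<xi>) \<partial>lborel \<partial>lborel \<partial>lborel)"
    and "(\<integral>\<^sup>+z. F z \<partial>lborel) = (\<integral>\<^sup>+\<xi>. \<integral>\<^sup>+x. \<integral>\<^sup>+t. F (t, x, \<xi>) \<partial>lborel \<partial>lborel \<partial>lborel)"
proof -
  have "(\<integral>\<^sup>+z. F z \<partial>lborel) = (\<integral>\<^sup>+t. \<integral>\<^sup>+y. F (t, y) \<partial>lborel \<partial>lborel)"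
    by (rule nn_integral_spacetime) measurable
  also have "\<dots> = (\<integral>\<^sup>+t. \<integral>\<^sup>+x. \<integral>\<^sup>+\<xi>. F (t, x, \<xi>) \<partial>lborel \<partial>lborel \<partial>lborel)"
    by (intro nn_integral_cong nn_integral_spacetime) measurable
  finally show "(\<integral>\<^sup>+z. F z \<partial>lborel) = (\<integral>\<^sup>+t. \<integral>\<^sup>+x. \<integral>\<^sup>+\<xi>. F (t, x, \<xi>) \<partial>lborel \<partial>lborel \<partial>lborel)" .
  have "(\<integral>\<^sup>+z. F z \<partial>lborel) = (\<integral>\<^sup>+t. \<integral>\<^sup>+y. F (t, y) \<partial>lborel \<partial>lborel)"
    by (rule nn_integral_spacetime) measurable
  also have "\<dots> = (\<integral>\<^sup>+y. \<integral>\<^sup>+t. F (t, y) \<partial>lborel \<partial>lborel)"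
    by (rule lborel_pair.Fubini') measurable
  also have "\<dots> = (\<integral>\<^sup>+x. \<integral>\<^sup>+\<xi>. \<integral>\<^sup>+t. F (t, x, \<xi>) \<partial>lborel \<partial>lborel \<partial>lborel)"
    by (rule nn_integral_spacetime) measurable
  also have "\<dots> = (\<integral>\<^sup>+\<xi>. \<integral>\<^sup>+x. \<integral>\<^sup>+t. F (t, x, \<xi>) \<partial>lborel \<partial>lborel \<partial>lborel)"
    by (rule lborel_pair.Fubini') measurable
  finally show "(\<integral>\<^sup>+z. F z \<partial>lborel) = (\<integral>\<^sup>+\<xi>. \<integral>\<^sup>+x. \<integral>\<^sup>+t. F (t, x, \<xi>) \<partial>lborel \<partial>lborel \<partial>lborel)" .
qed

text \<open>For fixed level \<open>\<xi>\<close> the map is a translation in time and space.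
  Integrating the level last makes translation invariance applicable fibre by fibre.\<close>

lemma nn_integral_transport:
  fixes F :: "real \<times> 'c::euclidean_space \<times> real \<Rightarrow> ennreal"
  assumes [measurable]: "F \<in> borel_measurable borel" "c \<in> borel_measurable borel"
  shows "(\<integral>\<^sup>+z. F (fst z + h, fst (snd z) + h *\<^sub>R c (snd (snd z)), snd (snd z)) \<partial>lborel) = (\<integral>\<^sup>+z. F z \<partial>lborel)"
proof -
  have "(\<integral>\<^sup>+z. F (fst z + h, fst (snd z) + h *\<^sub>R c (snd (snd z)), snd (snd z)) \<partial>lborel)
    = (\<integral>\<^sup>+\<xi>. \<integral>\<^sup>+x. \<integral>\<^sup>+t. F (t + h, x + h *\<^sub>R c \<xi>, \<xi>) \<partial>lborel \<partial>lborel \<partial>lborel)"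
    by (subst nn_integral_triple(2)) auto
  also have "\<dots> = (\<integral>\<^sup>+\<xi>. \<integral>\<^sup>+x. \<integral>\<^sup>+t. F (t, x, \<xi>) \<partial>lborel \<partial>lborel \<partial>lborel)"
  proof (rule nn_integral_cong)
    fix \<xi> :: real
    have "(\<integral>\<^sup>+x. \<integral>\<^sup>+t. F (t + h, x + h *\<^sub>R c \<xi>, \<xi>) \<partial>lborel \<partial>lborel) = (\<integral>\<^sup>+x. \<integral>\<^sup>+t. F (t, x + h *\<^sub>R c \<xi>, \<xi>) \<partial>lborel \<partial>lborel)"
    proof (rule nn_integral_cong)
      fix x :: 'c
      show "(\<integral>\<^sup>+t. F (t + h, x + h *\<^sub>R c \<xi>, \<xi>) \<partial>lborel) = (\<integral>\<^sup>+t. F (t, x + h *\<^sub>R c \<xi>, \<xi>) \<partial>lborel)"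
        by (rule nn_integral_lborel_shift[where f="\<lambda>t. F (t, x + h *\<^sub>R c \<xi>, \<xi>)"]) measurable
    qed
    also have "\<dots> = (\<integral>\<^sup>+x. \<integral>\<^sup>+t. F (t, x, \<xi>) \<partial>lborel \<partial>lborel)"
      by (rule nn_integral_lborel_shift[where f="\<lambda>x. \<integral>\<^sup>+t. F (t, x, \<xi>) \<partial>lborel"]) measurable
    finally show "(\<integral>\<^sup>+x. \<integral>\<^sup>+t. F (t + h, x + h *\<^sub>R c \<xi>, \<xi>) \<partial>lborel \<partial>lborel) = (\<integral>\<^sup>+x. \<integral>\<^sup>+t. F (t, x, \<xi>) \<partial>lborel \<partial>lborel)" .
  qed
  also have "\<dots> = (\<integral>\<^sup>+z. F z \<partial>lborel)"
    by (rule nn_integral_triple(2)[symmetric]) measurable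
  finally show ?thesis .
qed

section \<open>Test functions\<close>

text \<open>From a point with \<open>t = 0\<close> each coordinate direction, including forward
  time, can be followed for a short distance within the set. Hence even the one-sided derivative is
  unique, and it must agree with that of the zero function.\<close>

lemma test_gradient_zero:
  fixes \<Omega> :: "'a::euclidean_space set" and p :: "real \<times> 'a"
  assumes \<Omega>: "open \<Omega>" and K: "closed K" and p: "p \<in> {0..} \<times> \<Omega>" "p \<notin> K"
    and d: "(\<phi> has_derivative (\<lambda>h. inner g h)) (at p within {0..} \<times> \<Omega>)"
    and z: "\<forall>p\<in>{0..} \<times> \<Omega> - K. \<phi> p = (0::real)"
  shows "g = 0"
proof -
  let ?S = "{0::real..} \<times> \<Omega>"
  have nhd: "at p within ?S = at p within (?S - K)"
    by (rule at_within_nhd[where S="- K"]) (use p K in auto)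
  have "((\<lambda>_. 0) has_derivative (\<lambda>_. 0)) (at p within (?S - K))" by simp
  then have "(\<phi> has_derivative (\<lambda>_. 0)) (at p within (?S - K))"
    by (rule has_derivative_transform[rotated 2]) (use p z in auto)
  then have 0: "(\<phi> has_derivative (\<lambda>_. 0)) (at p within ?S)" by (simp add: nhd)
  have "(\<lambda>h. inner g h) = (\<lambda>_. 0)"
  proof (rule frechet_derivative_unique_within[OF d 0])
    fix i :: "real \<times> 'a" and e :: real assume i: "i \<in> Basis" and e: "0 < e"
    obtain t x where tx: "p = (t, x)" "0 \<le> t" "x \<in> \<Omega>" using p by auto
    obtain \<delta> where \<delta>: "0 < \<delta>" "ball x \<delta> \<subseteq> \<Omega>" using \<Omega> tx open_contains_ball by blast
    define d where "d = min e \<delta> / 2"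
    have d: "0 < d" "d < e" "d < \<delta>" using e \<delta> by (auto simp: d_def)
    from i consider "i = (1, 0)" | j where "i = (0, j)" "j \<in> Basis" by (auto simp: Basis_prod_def)
    then have "p + d *\<^sub>R i \<in> ?S"
    proof cases
      case 1
      then show ?thesis using tx d by simp
    next
      case 2
      then have "x + d *\<^sub>R j \<in> ball x \<delta>" using d by (auto simp: dist_norm)
      then show ?thesis using 2 tx \<delta> by auto
    qed
    then show "\<exists>d. 0 < \<bar>d\<bar> \<and> \<bar>d\<bar> < e \<and> p + d *\<^sub>R i \<in> ?S"
      using d by (intro exI[of _ d]) auto
  qed
  from fun_cong[OF this, of "g"] show ?thesis by simp
qed

text \<open>The support is a compact part of {0..} \<times> \<Omega>, so near every other point of
  the closed half-space the extension is zero. Working on the half-space gives a convex domain and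
  data without a spatial boundary.\<close>

lemma test_function_extend:
  fixes \<Omega> :: "'a::euclidean_space set"
  assumes \<Omega>: "open \<Omega>" and T: "test_function ({0..} \<times> \<Omega>) \<phi> G"
  shows "test_function ({0..} \<times> UNIV) (\<lambda>z. if z \<in> {0..} \<times> \<Omega> then \<phi> z else 0) (\<lambda>z. if z \<in> {0..} \<times> \<Omega> then G z else 0)"
    (is "test_function ?S' ?\<phi> ?G")
proof -
  let ?S = "{0::real..} \<times> \<Omega>"
  from T obtain K where d: "\<And>p. p \<in> ?S \<Longrightarrow> (\<phi> has_derivative (\<lambda>h. inner (G p) h)) (at p within ?S)"
    and G: "continuous_on ?S G" and K: "compact K" "K \<subseteq> ?S" "\<forall>p\<in>?S - K. \<phi> p = 0" and pos: "\<And>p. p \<in> ?S \<Longrightarrow> 0 \<le> \<phi> p"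
    unfolding test_function_def by blast
  have cK: "closed K" using K(1) by (rule compact_imp_closed)
  have G0: "G p = 0" if "p \<in> ?S" "p \<notin> K" for p
    by (rule test_gradient_zero[OF \<Omega> cK that d[OF that(1)] K(3)])
  have nhd1: "at p within ?S' = at p within ?S" if "p \<in> ?S" for p
    by (rule at_within_nhd[where S="UNIV \<times> \<Omega>"]) (use that \<Omega> in \<open>auto intro: open_Times\<close>)
  have nhd2: "at p within ?S' = at p within (?S' - K)" if "p \<notin> K" for p
    by (rule at_within_nhd[where S="- K"]) (use that cK in auto)
  have der: "(?\<phi> has_derivative (\<lambda>h. inner (?G p) h)) (at p within ?S')" if p: "p \<in> ?S'" for p
  proof (cases "p \<in> K")
    case True
    then have pS: "p \<in> ?S" using K by auto
    have "(?\<phi> has_derivative (\<lambda>h. inner (G p) h)) (at p within ?S)"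
      by (rule has_derivative_transform[OF pS _ d[OF pS]]) auto
    then show ?thesis using pS by (simp add: nhd1)
  next
    case False
    have "(?\<phi> has_derivative (\<lambda>_. 0)) (at p within (?S' - K))"
      by (rule has_derivative_transform[where f="\<lambda>_. 0"]) (use p False K(3) in auto)
    moreover have "?G p = 0" using G0 False by auto
    ultimately show ?thesis by (simp add: nhd2[OF False])
  qed
  have cont: "continuous_on ?S' ?G"
    unfolding continuous_on_eq_continuous_within
  proof
    fix p assume p: "p \<in> ?S'"
    show "continuous (at p within ?S') ?G"
    proof (cases "p \<in> ?S")
      case True
      then have "continuous (at p within ?S) G" using G unfolding continuous_on_eq_continuous_within by blast
      then have "continuous (at p within ?S) ?G"
        by (rule continuous_transform_within[where \<delta>=1]) (use True in auto)
      then show ?thesis by (simp add: nhd1[OF True] continuous_def)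
    next
      case False
      then have "p \<notin> K" using K by auto
      have "continuous (at p within (?S' - K)) ?G"
        by (rule continuous_transform_within[where f="\<lambda>_. 0" and \<delta>=1]) (use p G0 \<open>p \<notin> K\<close> in auto)
      then show ?thesis by (simp add: nhd2[OF \<open>p \<notin> K\<close>] continuous_def)
    qed
  qed
  have "K \<subseteq> ?S'" using K by auto
  moreover have "\<forall>p\<in>?S' - K. ?\<phi> p = 0" using K(3) by auto
  ultimately show ?thesis
    unfolding test_function_def using der cont K(1) pos by (intro conjI ballI exI[of _ K]) auto
qed

lemma test_function_halfspace_bounds:
  fixes \<phi> :: "real \<times> 'a::euclidean_space \<Rightarrow> real"
  assumes T: "test_function ({0..} \<times> UNIV) \<phi> G"
  obtains R C where "0 < R" "0 < C" "\<And>z. 0 \<le> fst z \<Longrightarrow> R < norm z \<Longrightarrow> \<phi> z = 0"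
    "\<And>z. 0 \<le> fst z \<Longrightarrow> R < norm z \<Longrightarrow> G z = 0"
    "\<And>z. 0 \<le> fst z \<Longrightarrow> 0 \<le> \<phi> z" "\<And>z. 0 \<le> fst z \<Longrightarrow> \<phi> z \<le> C" "\<And>z. 0 \<le> fst z \<Longrightarrow> norm (G z) \<le> C"
    "\<And>z z'. 0 \<le> fst z \<Longrightarrow> 0 \<le> fst z' \<Longrightarrow> \<bar>\<phi> z - \<phi> z'\<bar> \<le> C * norm (z - z')"
proof -
  let ?S = "{0::real..} \<times> (UNIV :: 'a set)"
  from T obtain K where d: "\<And>p. p \<in> ?S \<Longrightarrow> (\<phi> has_derivative (\<lambda>h. inner (G p) h)) (at p within ?S)"
    and G: "continuous_on ?S G" and K: "compact K" "K \<subseteq> ?S" "\<forall>p\<in>?S - K. \<phi> p = 0" and pos: "\<And>p. p \<in> ?S \<Longrightarrow> 0 \<le> \<phi> p"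
    unfolding test_function_def by blast
  have cK: "closed K" using K(1) by (rule compact_imp_closed)
  have G0: "G p = 0" if "p \<in> ?S" "p \<notin> K" for p
    by (rule test_gradient_zero[OF open_UNIV cK that d[OF that(1)] K(3)])
  obtain R where R: "0 < R" "\<And>z. z \<in> K \<Longrightarrow> norm z \<le> R"
    using compact_imp_bounded[OF K(1)] by (auto simp: bounded_pos)
  have "compact (G ` K)" by (rule compact_continuous_image[OF continuous_on_subset[OF G K(2)] K(1)])
  from compact_imp_bounded[OF this] obtain B where "0 < B" "\<forall>y\<in>G ` K. norm y \<le> B"
    unfolding bounded_pos by blast
  then have B: "0 < B" "\<And>z. z \<in> K \<Longrightarrow> norm (G z) \<le> B" by auto
  have "continuous_on ?S \<phi>" using d by (rule has_derivative_continuous_on)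
  then have "compact (\<phi> ` K)" by (intro compact_continuous_image[OF continuous_on_subset[OF _ K(2)] K(1)])
  from compact_imp_bounded[OF this] obtain B' where "0 < B'" "\<forall>y\<in>\<phi> ` K. norm y \<le> B'"
    unfolding bounded_pos by blast
  then have B': "0 < B'" "\<And>z. z \<in> K \<Longrightarrow> norm (\<phi> z) \<le> B'" by auto
  have GB: "norm (G z) \<le> B" if "z \<in> ?S" for z using B G0[OF that] by (cases "z \<in> K") auto
  \<comment> \<open>The mean value inequality needs a convex domain, which the half-space
    provides.\<close>
  have lip: "\<bar>\<phi> z - \<phi> z'\<bar> \<le> B * norm (z - z')" if "z \<in> ?S" "z' \<in> ?S" for z z'
  proof -
    have cx: "convex ?S" by (intro convex_Times convex_real_interval convex_UNIV)
    have "norm (\<phi> z - \<phi> z') \<le> B * norm (z - z')"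
    proof (rule differentiable_bound[OF cx d])
      show "onorm (\<lambda>h. inner (G x) h) \<le> B" if "x \<in> ?S" for x
        using GB[OF that] by (intro order_trans[OF onorm_le[where b="norm (G x)"]]) (auto simp: Cauchy_Schwarz_ineq2)
    qed (use that in auto)
    then show ?thesis by simp
  qed
  show thesis
  proof
    show "0 < R" by fact
    show "0 < max B B'" using B by simp
    fix z :: "real \<times> 'a" assume z: "0 \<le> fst z"
    then have zS: "z \<in> ?S" by (cases z) auto
    show "\<phi> z = 0" "G z = 0" if "R < norm z"
      using R(2)[of z] that K(3) G0[OF zS] zS by (auto simp: not_le[symmetric])
    show "0 \<le> \<phi> z" using pos zS by blast
    show "\<phi> z \<le> max B B'"
    proof (cases "z \<in> K")
      case True
      from B'(2)[OF this] show ?thesis by auto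
    next
      case False
      then have "\<phi> z = 0" using K(3) zS by blast
      then show ?thesis using B by simp
    qed
    show "norm (G z) \<le> max B B'" using GB[OF zS] by simp
    fix z' :: "real \<times> 'a" assume z': "0 \<le> fst z'"
    then have "z' \<in> ?S" by (cases z') auto
    from lip[OF zS this] show "\<bar>\<phi> z - \<phi> z'\<bar> \<le> max B B' * norm (z - z')"
      by (rule order_trans) (intro mult_right_mono, auto)
  qed
qed

lemma test_function_measurable:
  fixes \<phi> :: "real \<times> 'a::euclidean_space \<Rightarrow> real"
  assumes T: "test_function ({0..} \<times> UNIV) \<phi> G"
  shows "(\<lambda>z. if 0 \<le> fst z then \<phi> z else 0) \<in> borel_measurable borel"
    and "(\<lambda>z. if 0 \<le> fst z then G z else 0) \<in> borel_measurable borel"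
proof -
  let ?S = "{0::real..} \<times> (UNIV :: 'a set)"
  have S: "?S \<in> sets borel" by (intro borel_closed closed_Times) auto
  have d: "\<And>p. p \<in> ?S \<Longrightarrow> (\<phi> has_derivative (\<lambda>h. inner (G p) h)) (at p within ?S)" and G: "continuous_on ?S G"
    using T unfolding test_function_def by auto
  have "continuous_on ?S \<phi>" using d by (rule has_derivative_continuous_on)
  from borel_measurable_continuous_on_if[OF S this, of "\<lambda>_. 0"] borel_measurable_continuous_on_if[OF S G, of "\<lambda>_. 0"]
  show "(\<lambda>z. if 0 \<le> fst z then \<phi> z else 0) \<in> borel_measurable borel"
    "(\<lambda>z. if 0 \<le> fst z then G z else 0) \<in> borel_measurable borel"
    by (simp_all add: mem_Times_iff)
qed

text \<open>The given derivative is one-sided at time 0; restricted to positive times it is an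
  ordinary derivative, of which this is the sequential form.\<close>

lemma test_function_quotient:
  fixes \<phi> :: "real \<times> 'a::euclidean_space \<Rightarrow> real"
  assumes T: "test_function ({0..} \<times> UNIV) \<phi> G" and z: "0 < fst z"
    and e: "e \<longlonglongrightarrow> 0" "\<And>j. 0 < e j"
  shows "(\<lambda>j. (\<phi> (z + e j *\<^sub>R y) - \<phi> z) / e j) \<longlonglongrightarrow> inner (G z) y"
proof -
  let ?S = "{0::real..} \<times> (UNIV :: 'a set)" and ?S' = "{0::real<..} \<times> (UNIV :: 'a set)"
  have zS: "z \<in> ?S" "z \<in> ?S'" using z by (cases z, auto)+
  have "(\<phi> has_derivative (\<lambda>h. inner (G z) h)) (at z within ?S)"
    using T zS unfolding test_function_def by blast
  then have "(\<phi> has_derivative (\<lambda>h. inner (G z) h)) (at z within ?S')"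
    by (rule has_derivative_subset) auto
  then have d: "(\<phi> has_derivative (\<lambda>h. inner (G z) h)) (at z)"
    using zS by (subst (asm) at_within_open) (auto intro: open_Times)
  have "((\<lambda>s. z + s *\<^sub>R y) has_derivative (\<lambda>s. s *\<^sub>R y)) (at (0::real))"
    by (auto intro!: derivative_eq_intros)
  from has_derivative_compose[OF this, of \<phi> "\<lambda>h. inner (G z) h"] d
  have "((\<lambda>s. \<phi> (z + s *\<^sub>R y)) has_derivative (\<lambda>s. inner (G z) (s *\<^sub>R y))) (at 0)" by simp
  then have "((\<lambda>s. \<phi> (z + s *\<^sub>R y)) has_field_derivative (inner (G z) y)) (at 0)"
    by (simp add: has_field_derivative_def mult_commute_abs)
  then have lim: "((\<lambda>s. (\<phi> (z + s *\<^sub>R y) - \<phi> z) / s) \<longlongrightarrow> inner (G z) y) (at 0)"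
    by (simp add: DERIV_def)
  have "filterlim e (at 0) sequentially"
    using e by (auto simp: filterlim_at less_imp_neq[symmetric] intro!: always_eventually)
  from filterlim_compose[OF lim this] show ?thesis .
qed

section \<open>Entropy inequality ahead of the front\<close>

lemma sep_tendsto:
  assumes u: "u \<longlonglongrightarrow> u'" and ne: "\<xi> \<noteq> u'"
  shows "(\<lambda>j. sep \<xi> (u j) k) \<longlonglongrightarrow> sep \<xi> u' k"
proof (rule tendsto_eventually)
  show "\<forall>\<^sub>F j in sequentially. sep \<xi> (u j) k = sep \<xi> u' k"
  proof (cases "\<xi> < u'")
    case True
    from order_tendstoD(1)[OF u True] show ?thesis by eventually_elim (use True in \<open>simp add: sep_def\<close>)
  next
    case False
    then have "u' < \<xi>" using ne by simp
    from order_tendstoD(2)[OF u this] show ?thesis by eventually_elim (use False in \<open>simp add: sep_def\<close>)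
  qed
qed

lemma integral_tendsto_bounded_support:
  fixes f :: "nat \<Rightarrow> 'b::euclidean_space \<Rightarrow> real"
  assumes [measurable]: "\<And>j. f j \<in> borel_measurable borel" "F \<in> borel_measurable borel"
    and C: "\<And>j z. \<bar>f j z\<bar> \<le> C" and R: "\<And>j z. R < norm z \<Longrightarrow> f j z = 0"
    and lim: "AE z in lborel. (\<lambda>j. f j z) \<longlonglongrightarrow> F z"
  shows "(\<lambda>j. integral\<^sup>L lborel (f j)) \<longlonglongrightarrow> integral\<^sup>L lborel F"
proof (rule integral_dominated_convergence)
  have "integrable lborel (indicator (cball 0 R) :: 'b \<Rightarrow> real)"
    using emeasure_cball_lt_top[of "0::'b" R] by (subst integrable_indicator_iff) auto
  then show "integrable lborel (\<lambda>z. C * indicator (cball 0 R) (z::'b))"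
    by (rule integrable_mult_right)
  show "AE z in lborel. norm (f j z) \<le> C * indicator (cball 0 R) z" for j
  proof (rule AE_I2)
    fix z
    show "norm (f j z) \<le> C * indicator (cball 0 R) z"
      using R[of z j] C[of j z] by (cases "norm z \<le> R") (auto simp: indicator_def)
  qed
qed (use lim in auto)

lemma norm_triple_le: "norm (t :: real, x :: 'a::euclidean_space, \<xi> :: real) \<le> \<bar>t\<bar> + norm x + \<bar>\<xi>\<bar>"
  using norm_Pair_le[of t "(x, \<xi>)"] norm_Pair_le[of x \<xi>] by simp

locale flux_approx = approx c a b M p q \<kappa> N G u0s h U0 g Gl
  for c :: "real \<Rightarrow> 'a::euclidean_space" and a b M p q \<kappa> N G u0s h U0 g Gl +
  fixes f :: "real \<Rightarrow> 'a"
  assumes f_deriv: "\<And>u. (f has_vector_derivative c u) (at u)"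
    and U0_range: "\<And>x. U0 x \<in> {a..b}" and g_range: "\<And>x. g x \<in> {a..b}"
begin

lemma f_meas [measurable]: "f \<in> borel_measurable borel"
  by (rule borel_measurable_continuous_onI)
     (meson continuous_at_imp_continuous_on f_deriv has_vector_derivative_continuous)

text \<open>The kinetic form of Kruzhkov's flux: \<open>c\<close> is the derivative of
  \<open>f\<close>, so the fundamental theorem of calculus over the levels between \<open>u\<close>
  and \<open>k\<close> gives the difference of fluxes, with a sign according to their order.\<close>

lemma integral_sep_flux:
  assumes u: "u \<in> {a..b}" and k: "k \<in> {a..b}"
  shows "(\<integral>\<xi>. (if \<xi> \<in> {a..b} then sep \<xi> u k * (c \<xi> \<bullet> y) else 0) \<partial>lborel) = sgn (u - k) * ((f u - f k) \<bullet> y)"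
proof -
  have ftc: "(\<integral>\<xi>. (if \<xi> \<in> {a..b} then sep \<xi> u k * (c \<xi> \<bullet> y) else 0) \<partial>lborel) = f u' \<bullet> y - f k' \<bullet> y"
    if "k' \<le> u'" "{k', u'} = {k, u}" for u' k'
  proof -
    have "(\<integral>\<xi>. (if \<xi> \<in> {a..b} then sep \<xi> u k * (c \<xi> \<bullet> y) else 0) \<partial>lborel)
      = (\<integral>\<xi>. (c \<xi> \<bullet> y) * indicator {k'..u'} \<xi> \<partial>lborel)"
    proof (rule integral_cong_AE)
      \<comment> \<open>The levels form a half-open interval while the fundamental theorem uses the
        closed one; they differ by the point \<open>u'\<close>.\<close>
      show "AE \<xi> in lborel. (if \<xi> \<in> {a..b} then sep \<xi> u k * (c \<xi> \<bullet> y) else 0) = (c \<xi> \<bullet> y) * indicator {k'..u'} \<xi>"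
        using AE_lborel_singleton[of u']
        by eventually_elim (use that u k in \<open>auto simp: sep_def indicator_def doubleton_eq_iff\<close>)
    qed measurable
    also have "\<dots> = f u' \<bullet> y - f k' \<bullet> y"
    proof (rule integral_FTC_Icc_real[OF that(1)])
      show "DERIV (\<lambda>\<xi>. f \<xi> \<bullet> y) \<xi> :> c \<xi> \<bullet> y" for \<xi>
        using bounded_linear.has_vector_derivative[OF bounded_linear_inner_left f_deriv, of y \<xi>]
        by (simp add: has_real_derivative_iff_has_vector_derivative)
      show "isCont (\<lambda>\<xi>. c \<xi> \<bullet> y) \<xi>" for \<xi>
        using c_cont by (intro continuous_intros) (auto simp: continuous_on_eq_continuous_at)
    qed
    finally show ?thesis .
  qed
  consider "k < u" | "k = u" | "u < k" by linarith
  then show ?thesis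
  proof cases
    case 1 then show ?thesis using ftc[of k u] by (simp add: inner_diff_left)
  next
    case 2 then show ?thesis using ftc[of k u] by simp
  next
    case 3 then show ?thesis using ftc[of u k] by (simp add: inner_diff_left insert_commute)
  qed
qed

lemma integral_sep:
  assumes u: "u \<in> {a..b}" and k: "k \<in> {a..b}"
  shows "(\<integral>\<xi>. (if \<xi> \<in> {a..b} then sep \<xi> u k else 0) \<partial>lborel) = \<bar>u - k\<bar>"
proof -
  have "(\<integral>\<xi>. (if \<xi> \<in> {a..b} then sep \<xi> u k else 0) \<partial>lborel) = (\<integral>\<xi>. indicator {min u k..<max u k} \<xi> \<partial>lborel)"
    using u k by (intro Bochner_Integration.integral_cong) (auto simp: sep_def indicator_def)
  then show ?thesis by (simp add: max_def min_def)
qed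

lemma integrable_sep:
  "integrable lborel (\<lambda>\<xi>. if \<xi> \<in> {a..b} then sep \<xi> u k else 0)"
  "integrable lborel (\<lambda>\<xi>. if \<xi> \<in> {a..b} then sep \<xi> u k * (c \<xi> \<bullet> y) else 0)"
proof -
  have R: "max \<bar>a\<bar> \<bar>b\<bar> < norm \<xi> \<Longrightarrow> \<xi> \<notin> {a..b}" for \<xi> :: real by auto
  show "integrable lborel (\<lambda>\<xi>. if \<xi> \<in> {a..b} then sep \<xi> u k else 0)"
    by (rule integrable_bounded_support[where C=1 and R="max \<bar>a\<bar> \<bar>b\<bar>"])
       (use R in \<open>auto simp: sep_def\<close>)
  show "integrable lborel (\<lambda>\<xi>. if \<xi> \<in> {a..b} then sep \<xi> u k * (c \<xi> \<bullet> y) else 0)"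
  proof (rule integrable_bounded_support[where C="M * norm y" and R="max \<bar>a\<bar> \<bar>b\<bar>"])
    fix \<xi> :: real
    show "\<bar>if \<xi> \<in> {a..b} then sep \<xi> u k * (c \<xi> \<bullet> y) else 0\<bar> \<le> M * norm y"
    proof (cases "\<xi> \<in> {a..b}")
      case True
      have "\<bar>c \<xi> \<bullet> y\<bar> \<le> norm (c \<xi>) * norm y" by (rule Cauchy_Schwarz_ineq2)
      also have "\<dots> \<le> M * norm y" using c_le[OF True] by (intro mult_right_mono) auto
      finally show ?thesis using M_nonneg by (auto simp: sep_def)
    qed (use M_nonneg in auto)
  qed (use R in auto)
qed

section \<open>The discrete kinetic entropy inequality\<close>

definition ahead :: "real \<times> 'a \<Rightarrow> bool" where
  "ahead z \<longleftrightarrow> 0 < fst z \<and> fst z < \<theta> (snd z)"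

lemma ahead_measurable [measurable]: "Measurable.pred borel ahead"
  unfolding ahead_def by measurable

lemma W_meas_triple [measurable]:
  "(\<lambda>w. W i j (fst w) (fst (snd w))) \<in> borel_measurable (borel :: (real \<times> 'a \<times> real) measure)"
proof -
  have "(\<lambda>w. (fst w, fst (snd w))) \<in> (borel :: (real \<times> 'a \<times> real) measure) \<rightarrow>\<^sub>M borel" by measurable
  from measurable_compose[OF this W_meas_joint[of i j]] show ?thesis by simp
qed

text \<open>Since \<open>p \<bullet> c \<xi> \<ge> 1\<close>, \<open>\<theta> x - t\<close> does not
  decrease along characteristics. No mass is lost through the front, and departures from ahead enter
  as complete difference quotients.\<close>

lemma ahead_forward:
  assumes "ahead (t, x)" "\<xi> \<in> {a..b}" "0 < e"
  shows "ahead (t + e, x + e *\<^sub>R c \<xi>)"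
proof -
  have "1 \<le> p \<bullet> c \<xi>" using p_ge[OF assms(2)] kappa_pos by linarith
  then have "e \<le> e * (p \<bullet> c \<xi>)" using assms(3) by simp
  then show ?thesis using assms(1,3)
    unfolding ahead_def \<theta>_def fst_conv snd_conv inner_add_right inner_scaleR_right by linarith
qed

lemma norm_shift_le:
  assumes "\<xi> \<in> {a..b}" "0 \<le> e" "e \<le> 1"
  shows "norm (e *\<^sub>R c \<xi>) \<le> M"
proof -
  have "\<bar>e\<bar> * norm (c \<xi>) \<le> 1 * M"
    using assms c_le[OF assms(1)] by (intro mult_mono) auto
  then show ?thesis by simp
qed

lemma theta_shift: "\<theta> (x + e *\<^sub>R y) = \<theta> x + e * (p \<bullet> y)"
  by (simp add: \<theta>_def inner_add_right)

text \<open>The mass found at \<open>(t, x)\<close> after the collapse, tested at that same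
  point.\<close>

definition ent_in :: "nat \<Rightarrow> (real \<times> 'a \<Rightarrow> real) \<Rightarrow> real \<Rightarrow> real \<times> 'a \<times> real \<Rightarrow> real" where
  "ent_in j \<phi> k w = (if snd (snd w) \<in> {a..b} \<and> ahead (fst w, fst (snd w))
    then \<phi> (fst w, fst (snd w)) * sep (snd (snd w)) (W j j (fst w) (fst (snd w))) k else 0)"

text \<open>The same mass before its next step, tested at the point to which level \<xi> is
  transported. The cutoff by \<open>ahead\<close> is applied at the arrival point, so departures
  from before time 0 and from behind the front are included.\<close>

definition ent_out :: "nat \<Rightarrow> (real \<times> 'a \<Rightarrow> real) \<Rightarrow> real \<Rightarrow> real \<times> 'a \<times> real \<Rightarrow> real" where
  "ent_out j \<phi> k w = (if snd (snd w) \<in> {a..b} \<and> ahead (fst w + h j, fst (snd w) + h j *\<^sub>R c (snd (snd w)))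
    then \<phi> (fst w + h j, fst (snd w) + h j *\<^sub>R c (snd (snd w))) * sep (snd (snd w)) (W j j (fst w) (fst (snd w))) k else 0)"

text \<open>The constant \<open>k\<close> is a fixed point of the collapse, so the collapse does not
  increase the number of levels between the value and \<open>k\<close> at any point, while the
  transport preserves measure. A nonnegative weight \<open>\<phi>\<close> at the arrival point
  respects both facts.\<close>

lemma discrete_entropy:
  assumes [measurable]: "\<phi> \<in> borel_measurable borel" and \<phi>: "\<And>z. 0 \<le> \<phi> z" "\<And>z. \<phi> z \<le> C" "\<And>z. R < norm z \<Longrightarrow> \<phi> z = 0"
    and k: "k \<in> {a..b}"
  shows "integral\<^sup>L lborel (ent_in j \<phi> k) \<le> integral\<^sup>L lborel (ent_out j \<phi> k)"
    and "integrable lborel (ent_in j \<phi> k)" and "integrable lborel (ent_out j \<phi> k)"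
proof -
  let ?H = "h j"
  have Xm [measurable]: "ent_in j \<phi> k \<in> borel_measurable borel" unfolding ent_in_def by measurable
  have Ym [measurable]: "ent_out j \<phi> k \<in> borel_measurable borel" unfolding ent_out_def by measurable
  have C: "0 \<le> C" using \<phi>(1,2)[of 0] by linarith
  have bd: "\<bar>\<phi> z * sep \<xi> u k\<bar> \<le> C" for z \<xi> u
    using \<phi>(1,2)[of z] C by (auto simp: sep_def)
  have H: "0 < ?H" "?H \<le> 1" using h_pos[of j] h_le[of j] by (auto intro: order_trans)
  define R' where "R' = 2 * (\<bar>R\<bar> + 1 + M) + max \<bar>a\<bar> \<bar>b\<bar>"
  have Xs: "ent_in j \<phi> k w = 0" if "R' < norm w" for w
  proof (cases "snd (snd w) \<in> {a..b} \<and> norm (fst w, fst (snd w)) \<le> R")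
    case True
    then have "\<bar>fst w\<bar> \<le> R" "norm (fst (snd w)) \<le> R" "\<bar>snd (snd w)\<bar> \<le> max \<bar>a\<bar> \<bar>b\<bar>"
      using norm_fst_le[of "fst w" "fst (snd w)"] norm_snd_le[of "fst (snd w)" "fst w"] by auto
    then have "norm w \<le> R'" using norm_triple_le[of "fst w" "fst (snd w)" "snd (snd w)"] M_nonneg by (auto simp: R'_def)
    then show ?thesis using that by simp
  qed (use \<phi>(3) in \<open>auto simp: ent_in_def ent_out_def\<close>)
  have Ys: "ent_out j \<phi> k w = 0" if "R' < norm w" for w
  proof (cases "snd (snd w) \<in> {a..b} \<and> norm (fst w + ?H, fst (snd w) + ?H *\<^sub>R c (snd (snd w))) \<le> R")
    case True
    have "norm (?H *\<^sub>R c (snd (snd w))) \<le> M"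
      using H True by (intro norm_shift_le) auto
    then have "\<bar>fst w\<bar> \<le> \<bar>R\<bar> + 1" "norm (fst (snd w)) \<le> \<bar>R\<bar> + M" "\<bar>snd (snd w)\<bar> \<le> max \<bar>a\<bar> \<bar>b\<bar>"
      using True H norm_fst_le[of "fst w + ?H" "fst (snd w) + ?H *\<^sub>R c (snd (snd w))"]
        norm_snd_le[of "fst (snd w) + ?H *\<^sub>R c (snd (snd w))" "fst w + ?H"]
        norm_triangle_ineq4[of "fst (snd w) + ?H *\<^sub>R c (snd (snd w))" "?H *\<^sub>R c (snd (snd w))"] by auto
    then have "norm w \<le> R'" using norm_triple_le[of "fst w" "fst (snd w)" "snd (snd w)"] M_nonneg by (auto simp: R'_def)
    then show ?thesis using that by simp
  qed (use \<phi>(3) in \<open>auto simp: ent_in_def ent_out_def\<close>)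
  show i1: "integrable lborel (ent_in j \<phi> k)" by (rule integrable_bounded_support[OF Xm _ Xs, where C=C]) (use bd C in \<open>auto simp: ent_in_def ent_out_def\<close>)
  show i2: "integrable lborel (ent_out j \<phi> k)" by (rule integrable_bounded_support[OF Ym _ Ys, where C=C]) (use bd C in \<open>auto simp: ent_in_def ent_out_def\<close>)
  \<comment> \<open>\<open>ent_out\<close> expressed at the arrival point, so that both sides carry
    the common factor \<open>\<phi> (t, x)\<close> and can be compared at each point.\<close>
  let ?Z = "\<lambda>w. ent_out j \<phi> k (fst w - ?H, fst (snd w) - ?H *\<^sub>R c (snd (snd w)), snd (snd w))"
  have Zm [measurable]: "?Z \<in> borel_measurable borel"
    by (rule measurable_compose[OF _ Ym]) measurable
  have Y0: "0 \<le> ent_out j \<phi> k w" and X0: "0 \<le> ent_in j \<phi> k w" for w using \<phi>(1) sep_bounds(1) by (auto simp: ent_in_def ent_out_def)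
  have "(\<integral>\<^sup>+w. ennreal (ent_in j \<phi> k w) \<partial>lborel) = (\<integral>\<^sup>+t. \<integral>\<^sup>+x. \<integral>\<^sup>+\<xi>. ennreal (ent_in j \<phi> k (t, x, \<xi>)) \<partial>lborel \<partial>lborel \<partial>lborel)"
    by (rule nn_integral_triple) measurable
  also have "\<dots> \<le> (\<integral>\<^sup>+t. \<integral>\<^sup>+x. \<integral>\<^sup>+\<xi>. ennreal (?Z (t, x, \<xi>)) \<partial>lborel \<partial>lborel \<partial>lborel)"
  proof (rule nn_integral_mono, rule nn_integral_mono)
    fix t :: real and x :: 'a
    show "(\<integral>\<^sup>+\<xi>. ennreal (ent_in j \<phi> k (t, x, \<xi>)) \<partial>lborel) \<le> (\<integral>\<^sup>+\<xi>. ennreal (?Z (t, x, \<xi>)) \<partial>lborel)"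
    proof (cases "ahead (t, x)")
      case False
      then show ?thesis by (simp add: ent_in_def)
    next
      case True
      have [measurable]: "(\<lambda>\<xi>. W j j (t - ?H) (x - ?H *\<^sub>R c \<xi>)) \<in> borel_measurable borel"
        by (rule measurable_compose[OF _ W_meas]) measurable
      have "(\<integral>\<^sup>+\<xi>. ennreal (ent_in j \<phi> k (t, x, \<xi>)) \<partial>lborel) = (\<integral>\<^sup>+\<xi>. ennreal (\<phi> (t, x)) * (indicator {a..b} \<xi> * ennreal (sep \<xi> (W j j t x) k)) \<partial>lborel)"
        using True \<phi>(1) by (intro nn_integral_cong) (auto simp: ennreal_mult sep_bounds ent_in_def ent_out_def)
      also have "\<dots> = ennreal (\<phi> (t, x)) * (\<integral>\<^sup>+\<xi>. indicator {a..b} \<xi> * ennreal (sep \<xi> (W j j t x) k) \<partial>lborel)"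
        by (rule nn_integral_cmult) measurable
      also have "\<dots> \<le> ennreal (\<phi> (t, x)) * (\<integral>\<^sup>+\<xi>. indicator {a..b} \<xi> * ennreal (sep \<xi> (W j j (t - ?H) (x - ?H *\<^sub>R c \<xi>)) k) \<partial>lborel)"
      proof (rule mult_left_mono)
        \<comment> \<open>Writing \<open>k\<close> as its own collapse makes
          \<open>collapse_diff_le\<close> applicable.\<close>
        have e: "\<bar>W j j t x - k\<bar> = \<bar>collapse ?H (W j j (t - ?H)) x - collapse ?H (\<lambda>_. k) x\<bar>"
          using True sol_ahead[OF H(1), of t x "G j"] collapse_const[OF k] by (simp add: ahead_def W_def)
        show "(\<integral>\<^sup>+\<xi>. indicator {a..b} \<xi> * ennreal (sep \<xi> (W j j t x) k) \<partial>lborel) \<le>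
          (\<integral>\<^sup>+\<xi>. indicator {a..b} \<xi> * ennreal (sep \<xi> (W j j (t - ?H) (x - ?H *\<^sub>R c \<xi>)) k) \<partial>lborel)"
          unfolding nn_integral_sep[OF W_range k] e by (rule collapse_diff_le) auto
      qed simp
      also have "\<dots> = (\<integral>\<^sup>+\<xi>. ennreal (\<phi> (t, x)) * (indicator {a..b} \<xi> * ennreal (sep \<xi> (W j j (t - ?H) (x - ?H *\<^sub>R c \<xi>)) k)) \<partial>lborel)"
        by (rule nn_integral_cmult[symmetric]) measurable
      also have "\<dots> = (\<integral>\<^sup>+\<xi>. ennreal (?Z (t, x, \<xi>)) \<partial>lborel)"
        using True \<phi>(1) by (intro nn_integral_cong) (auto simp: ennreal_mult sep_bounds ent_in_def ent_out_def)
      finally show ?thesis .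
    qed
  qed
  also have "\<dots> = (\<integral>\<^sup>+w. ennreal (?Z w) \<partial>lborel)"
    by (rule nn_integral_triple(1)[symmetric]) measurable
  also have "\<dots> = (\<integral>\<^sup>+w. ennreal (ent_out j \<phi> k w) \<partial>lborel)"
    using nn_integral_transport[of "\<lambda>w. ennreal (?Z w)" c ?H] by simp
  finally have "ennreal (integral\<^sup>L lborel (ent_in j \<phi> k)) \<le> ennreal (integral\<^sup>L lborel (ent_out j \<phi> k))"
    using nn_integral_eq_integral[OF i1] nn_integral_eq_integral[OF i2] X0 Y0 by simp
  then show "integral\<^sup>L lborel (ent_in j \<phi> k) \<le> integral\<^sup>L lborel (ent_out j \<phi> k)"
    by (subst (asm) ennreal_le_iff) (auto intro!: Bochner_Integration.integral_nonneg Y0)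
qed

section \<open>Passage to the limit in the entropy inequality\<close>

lemma theta_level_null: "AE x in lborel. \<theta> x \<noteq> t"
proof -
  have "p \<noteq> 0" using p_ge[of a] ab kappa_pos by auto
  then have "negligible {x. p \<bullet> x = t - q}" by (intro negligible_hyperplane) auto
  moreover have "{x. p \<bullet> x = t - q} = {x. \<theta> x = t}" by (auto simp: \<theta>_def)
  ultimately have "{x. \<theta> x = t} \<in> null_sets lebesgue" by (simp add: negligible_iff_null_sets)
  moreover have "{x. \<theta> x = t} \<in> sets borel" by measurable
  ultimately have "{x. \<theta> x = t} \<in> null_sets lborel" by (auto simp: null_sets_def)
  from AE_not_in[OF this] show ?thesis by simp
qed

lemma theta_continuous: "x \<longlonglongrightarrow> y \<Longrightarrow> (\<lambda>j. \<theta> (x j)) \<longlonglongrightarrow> \<theta> y"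
  unfolding \<theta>_def by (intro tendsto_intros)

lemma h_tendsto: "h \<longlonglongrightarrow> 0"
proof (rule tendsto_sandwich[OF _ _ tendsto_const LIMSEQ_inverse_real_of_nat])
  show "\<forall>\<^sub>F j in sequentially. 0 \<le> h j" using h_pos by (auto intro: always_eventually less_imp_le)
  show "\<forall>\<^sub>F j in sequentially. h j \<le> inverse (real (Suc j))"
    using h_le by (auto intro!: always_eventually simp: inverse_eq_divide add.commute)
qed

text \<open>Departures from ahead of the front: arrival and departure both count, and their
  difference over \<open>h j\<close> is a difference quotient along the characteristic.\<close>

definition part_in :: "nat \<Rightarrow> (real \<times> 'a \<Rightarrow> real) \<Rightarrow> real \<Rightarrow> real \<times> 'a \<times> real \<Rightarrow> real" where
  "part_in j \<phi> k w = (case w of (t, x, \<xi>) \<Rightarrow> if \<xi> \<in> {a..b} \<and> ahead (t, x)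
    then sep \<xi> (W j j t x) k * ((\<phi> (t + h j, x + h j *\<^sub>R c \<xi>) - \<phi> (t, x)) / h j) else 0)"

text \<open>Departures from the last step before time 0, at time \<open>h j * (s - 1)\<close>. The
  rescaling absorbs the factor \<open>1 / h j\<close>, and arrival happens at time
  \<open>h j * s\<close>.\<close>

definition part_init :: "nat \<Rightarrow> (real \<times> 'a \<Rightarrow> real) \<Rightarrow> real \<Rightarrow> real \<times> 'a \<times> real \<Rightarrow> real" where
  "part_init j \<phi> k w = (case w of (s, x, \<xi>) \<Rightarrow> if \<xi> \<in> {a..b} \<and> 0 < s \<and> s \<le> 1 \<and> h j * s < \<theta> (x + h j *\<^sub>R c \<xi>)
    then sep \<xi> (u0s j x) k * \<phi> (h j * s, x + h j *\<^sub>R c \<xi>) else 0)"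

text \<open>Departures from the time \<open>\<theta> x + h j * s\<close>, on or behind the front.
  The condition \<open>s < p \<bullet> c \<xi> - 1\<close> says that one step overtakes the front;
  the length of this interval of delays is the relative speed, the source of the flux term.\<close>

definition part_side :: "nat \<Rightarrow> (real \<times> 'a \<Rightarrow> real) \<Rightarrow> real \<Rightarrow> real \<times> 'a \<times> real \<Rightarrow> real" where
  "part_side j \<phi> k w = (case w of (s, x, \<xi>) \<Rightarrow> if \<xi> \<in> {a..b} \<and> 0 < \<theta> x + h j * s \<and> 0 \<le> s \<and> s < p \<bullet> c \<xi> - 1
    then sep \<xi> (G j (\<theta> x + h j * s, x)) k * \<phi> (\<theta> x + h j * s + h j, x + h j *\<^sub>R c \<xi>) else 0)"

lemma part_measurable:
  assumes [measurable]: "\<phi> \<in> borel_measurable borel"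
  shows "part_in j \<phi> k \<in> borel_measurable borel" "part_init j \<phi> k \<in> borel_measurable borel"
    "part_side j \<phi> k \<in> borel_measurable borel"
  unfolding part_in_def part_init_def part_side_def split_beta by measurable

text \<open>The difference of \<open>ent_out\<close> and \<open>ent_in\<close>, divided by the step,
  is sorted by departure point: ahead, at nonpositive times, or behind the front at positive
  times.\<close>

lemma discrete_entropy_parts:
  assumes \<phi>m [measurable]: "\<phi> \<in> borel_measurable borel" and \<phi>: "\<And>z. 0 \<le> \<phi> z" "\<And>z. \<phi> z \<le> C" "\<And>z. R < norm z \<Longrightarrow> \<phi> z = 0"
    and k: "k \<in> {a..b}"
    and int: "integrable lborel (part_in j \<phi> k)"
  shows "0 \<le> integral\<^sup>L lborel (part_in j \<phi> k) + integral\<^sup>L lborel (part_init j \<phi> k) + integral\<^sup>L lborel (part_side j \<phi> k)"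
proof -
  let ?H = "h j"
  have H: "0 < ?H" by (rule h_pos)
  note part_measurable[OF \<phi>m, measurable]
  \<comment> \<open>\<open>D2\<close> and \<open>D3\<close> are the two layers before rescaling; at
    their departure points the scheme is still equal to its data.\<close>
  define D2 where "D2 w = (case w of (t, x, \<xi>) \<Rightarrow> if \<xi> \<in> {a..b} \<and> t \<le> 0 \<and> ahead (t + ?H, x + ?H *\<^sub>R c \<xi>)
    then sep \<xi> (u0s j x) k * \<phi> (t + ?H, x + ?H *\<^sub>R c \<xi>) / ?H else 0)" for w
  define D3 where "D3 w = (case w of (t, x, \<xi>) \<Rightarrow> if \<xi> \<in> {a..b} \<and> 0 < t \<and> \<theta> x \<le> t \<and> ahead (t + ?H, x + ?H *\<^sub>R c \<xi>)
    then sep \<xi> (G j (t, x)) k * \<phi> (t + ?H, x + ?H *\<^sub>R c \<xi>) / ?H else 0)" for w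
  have Dm [measurable]: "D2 \<in> borel_measurable borel" "D3 \<in> borel_measurable borel"
    unfolding D2_def D3_def split_beta by measurable
  have shear2: "?H * D2 (- ?H + ?H * fst w, snd w) = part_init j \<phi> k w" for w
    using H by (auto simp: D2_def part_init_def ahead_def split_beta mult_le_cancel_left1 zero_less_mult_iff)
  have shear3: "?H * D3 (\<theta> (fst (snd w)) + ?H * fst w, snd w) = part_side j \<phi> k w" for w
  proof -
    obtain s x \<xi> where w: "w = (s, x, \<xi>)" by (cases w)
    have "ahead (\<theta> x + ?H * s + ?H, x + ?H *\<^sub>R c \<xi>) \<longleftrightarrow> 0 < \<theta> x + ?H * s + ?H \<and> ?H * (s + 1) < ?H * (p \<bullet> c \<xi>)"
      by (simp add: ahead_def theta_shift algebra_simps)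
    then have 1: "ahead (\<theta> x + ?H * s + ?H, x + ?H *\<^sub>R c \<xi>) \<longleftrightarrow> 0 < \<theta> x + ?H * s + ?H \<and> s < p \<bullet> c \<xi> - 1"
      using H by auto
    have 2: "\<theta> x \<le> \<theta> x + ?H * s \<longleftrightarrow> 0 \<le> s" "0 \<le> ?H * s \<longleftrightarrow> 0 \<le> s" using H by (simp_all add: zero_le_mult_iff)
    show ?thesis using H unfolding w D3_def part_side_def by (auto simp: 1 2)
  qed
  have i2: "integral\<^sup>L lborel D2 = integral\<^sup>L lborel (part_init j \<phi> k)"
    using integral_shear[OF Dm(1), of "\<lambda>_. - ?H" ?H] H by (simp add: shear2[symmetric, abs_def])
  have i3: "integral\<^sup>L lborel D3 = integral\<^sup>L lborel (part_side j \<phi> k)"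
    using integral_shear[OF Dm(2), of "\<lambda>y. \<theta> (fst y)" ?H] H by (simp add: shear3[symmetric, abs_def])
  have pw: "(ent_out j \<phi> k w - ent_in j \<phi> k w) / ?H = part_in j \<phi> k w + D2 w + D3 w" for w
  proof -
    obtain t x \<xi> where w: "w = (t, x, \<xi>)" by (cases w)
    have fw: "ahead (t, x) \<Longrightarrow> \<xi> \<in> {a..b} \<Longrightarrow> ahead (t + ?H, x + ?H *\<^sub>R c \<xi>)" by (rule ahead_forward[OF _ _ H])
    consider "ahead (t, x)" | "t \<le> 0" | "0 < t" "\<theta> x \<le> t" unfolding ahead_def by fastforce
    then show ?thesis
    proof cases
      case 1
      then have nt: "\<not> t \<le> 0" "\<not> \<theta> x \<le> t" by (auto simp: ahead_def)
      show ?thesis using 1 fw nt by (auto simp: w ent_out_def ent_in_def part_in_def D2_def D3_def field_simps)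
    next
      case 2
      then have "W j j t x = u0s j x" "\<not> ahead (t, x)" by (auto simp: W_def sol_data G_init ahead_def)
      then show ?thesis using 2 by (auto simp: w ent_out_def ent_in_def part_in_def D2_def D3_def mult.commute)
    next
      case 3
      then have "W j j t x = G j (t, x)" "\<not> ahead (t, x)" by (auto simp: W_def sol_data ahead_def)
      then show ?thesis using 3 by (auto simp: w ent_out_def ent_in_def part_in_def D2_def D3_def mult.commute)
    qed
  qed
  note de = discrete_entropy[OF \<phi>m \<phi> k, where j=j]
  have tot: "integrable lborel (\<lambda>w. (ent_out j \<phi> k w - ent_in j \<phi> k w) / ?H)"
    using de by auto
  have S: "0 \<le> sep \<xi> u k * \<phi> z / ?H" for \<xi> u z using \<phi>(1) H by (auto simp: sep_bounds)
  have nn: "0 \<le> D2 w" "0 \<le> D3 w" for w using S by (auto simp: D2_def D3_def split_beta)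
  \<comment> \<open>The two layers need no estimates of their own: their sum is a difference of
    integrable functions, and both are nonnegative.\<close>
  have ip: "integrable lborel (\<lambda>w. D2 w + D3 w)"
  proof -
    have "integrable lborel (\<lambda>w. (ent_out j \<phi> k w - ent_in j \<phi> k w) / ?H - part_in j \<phi> k w)"
      using tot int by (rule Bochner_Integration.integrable_diff)
    then show ?thesis by (simp add: pw)
  qed
  have id2: "integrable lborel D2"
    by (rule Bochner_Integration.integrable_bound[OF ip]) (use nn in auto)
  have id3: "integrable lborel D3"
    by (rule Bochner_Integration.integrable_bound[OF ip]) (use nn in auto)
  have "0 \<le> (integral\<^sup>L lborel (ent_out j \<phi> k) - integral\<^sup>L lborel (ent_in j \<phi> k)) / ?H"
    using de(1) H by auto
  also have "\<dots> = (\<integral>w. (ent_out j \<phi> k w - ent_in j \<phi> k w) / ?H \<partial>lborel)"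
    using de(2,3) by simp
  also have "\<dots> = (\<integral>w. part_in j \<phi> k w + D2 w + D3 w \<partial>lborel)" by (simp only: pw)
  also have "\<dots> = integral\<^sup>L lborel (part_in j \<phi> k) + integral\<^sup>L lborel D2 + integral\<^sup>L lborel D3"
    using int id2 id3 by simp
  finally show ?thesis by (simp add: i2 i3)
qed

text \<open>Each of the three parts has bounds and a support independent of the step, and converges
  pointwise once \<xi> avoids the graphs of the limit functions. After dominated convergence,
  integrating out the delay and the level turns the kinetic limits into Kruzhkov's terms.\<close>

lemma entropy_limit:
  assumes r: "strict_mono r" and Fm [measurable]: "F \<in> borel_measurable borel" and FI: "\<And>z. F z \<in> {a..b}"
    and Flim: "AE z in lborel. (\<lambda>j. W (r j) (r j) (fst z) (snd z)) \<longlonglongrightarrow> F z"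
    and T: "test_function ({0..} \<times> UNIV) \<phi> D" and k: "k \<in> {a..b}"
  shows "0 \<le> (\<integral>z. (if ahead z then \<bar>F z - k\<bar> * fst (D z) + sgn (F z - k) * ((f (F z) - f k) \<bullet> snd (D z)) else 0) \<partial>lborel)
    + (\<integral>x. (if 0 < \<theta> x then \<bar>U0 x - k\<bar> * \<phi> (0, x) else 0) \<partial>lborel)
    + (\<integral>x. (if 0 < \<theta> x then \<phi> (\<theta> x, x) * (sgn (g x - k) * ((f (g x) - f k) \<bullet> p) - \<bar>g x - k\<bar>) else 0) \<partial>lborel)"
proof -
  obtain R C where R: "0 < R" and C: "0 < C" and supp: "\<And>z. 0 \<le> fst z \<Longrightarrow> R < norm z \<Longrightarrow> \<phi> z = 0"
    and D0: "\<And>z. 0 \<le> fst z \<Longrightarrow> R < norm z \<Longrightarrow> D z = 0"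
    and pos: "\<And>z. 0 \<le> fst z \<Longrightarrow> 0 \<le> \<phi> z" and \<phi>C: "\<And>z. 0 \<le> fst z \<Longrightarrow> \<phi> z \<le> C"
    and DC: "\<And>z. 0 \<le> fst z \<Longrightarrow> norm (D z) \<le> C"
    and lip: "\<And>z z'. 0 \<le> fst z \<Longrightarrow> 0 \<le> fst z' \<Longrightarrow> \<bar>\<phi> z - \<phi> z'\<bar> \<le> C * norm (z - z')"
    by (rule test_function_halfspace_bounds[OF T]) blast
  define \<phi>' where "\<phi>' z = (if 0 \<le> fst z then \<phi> z else 0)" for z
  define D' where "D' z = (if 0 \<le> fst z then D z else 0)" for z
  have \<phi>'m [measurable]: "\<phi>' \<in> borel_measurable borel" and [measurable]: "D' \<in> borel_measurable borel"
    using test_function_measurable[OF T] unfolding \<phi>'_def[abs_def] D'_def[abs_def] by auto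
  have \<phi>': "0 \<le> \<phi>' z" "\<phi>' z \<le> C" "R < norm z \<Longrightarrow> \<phi>' z = 0" for z
    using pos \<phi>C supp C by (auto simp: \<phi>'_def)
  have \<phi>'e: "0 \<le> fst z \<Longrightarrow> \<phi>' z = \<phi> z" for z by (simp add: \<phi>'_def)
  have \<phi>cont: "(\<lambda>j. \<phi>' (z j)) \<longlonglongrightarrow> \<phi>' z'" if "z \<longlonglongrightarrow> z'" "\<And>j. 0 \<le> fst (z j)" "0 \<le> fst z'" for z z'
  proof -
    have "(\<lambda>j. C * norm (z j - z')) \<longlonglongrightarrow> C * norm (z' - z')" by (intro tendsto_intros that)
    then have "(\<lambda>j. \<phi> (z j) - \<phi> z') \<longlonglongrightarrow> 0"
      by (intro Lim_null_comparison[where f="\<lambda>j. \<phi> (z j) - \<phi> z'" and g="\<lambda>j. C * norm (z j - z')"])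
         (use lip that in \<open>auto intro!: always_eventually\<close>)
    then show ?thesis using that by (simp add: \<phi>'e LIM_zero_iff)
  qed
  define B where "B = max \<bar>a\<bar> \<bar>b\<bar>"
  \<comment> \<open>One radius for all supports: undoing a step costs \<open>M\<close> in space and
    1 in time, the rescaled delay is at most \<open>N\<close>, and levels are at most
    \<open>B\<close>.\<close>
  define R1 where "R1 = 2 * (R + 1 + M) + N + 1 + B"
  have B: "\<bar>\<xi>\<bar> \<le> B" if "\<xi> \<in> {a..b}" for \<xi> using that by (auto simp: B_def)
  have hr: "(\<lambda>j. h (r j)) \<longlonglongrightarrow> 0" using LIMSEQ_subseq_LIMSEQ[OF h_tendsto r] by (simp add: o_def)
  have h1: "0 < h j" "h j \<le> 1" for j using h_pos[of j] h_le[of j] by (auto intro: order_trans)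
  have rge: "j \<le> r j" for j by (rule seq_suble[OF r])
  have sC: "\<bar>sep \<xi> u k * y\<bar> \<le> C'" if "\<bar>y\<bar> \<le> C'" for \<xi> u y C' using that by (auto simp: sep_def)
  have shift_norm: "norm x \<le> R + M \<and> \<bar>s\<bar> \<le> R + 1" if "norm (s + e, x + e *\<^sub>R c \<xi>) \<le> R" "\<xi> \<in> {a..b}" "0 \<le> e" "e \<le> 1" for s x \<xi> e
    using that(1) norm_shift_le[OF that(2-4)] norm_fst_le[of "s + e" "x + e *\<^sub>R c \<xi>"] norm_snd_le[of "x + e *\<^sub>R c \<xi>" "s + e"]
      norm_triangle_ineq4[of "x + e *\<^sub>R c \<xi>" "e *\<^sub>R c \<xi>"] that(3,4) by auto
  note part_measurable[OF \<phi>'m, measurable]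
  have in_C: "\<bar>part_in j \<phi>' k w\<bar> \<le> C * (1 + M)" for j w
  proof -
    obtain t x \<xi> where w: "w = (t, x, \<xi>)" by (cases w)
    show ?thesis
    proof (cases "\<xi> \<in> {a..b} \<and> ahead (t, x)")
      case True
      have "norm ((t + h j, x + h j *\<^sub>R c \<xi>) - (t, x)) \<le> norm (h j) + norm (h j *\<^sub>R c \<xi>)" using norm_Pair_le[of "h j" "h j *\<^sub>R c \<xi>"] by simp
      also have "\<dots> \<le> h j + h j * M" using h1[of j] c_le[of \<xi>] True by auto
      finally have "\<bar>\<phi>' (t + h j, x + h j *\<^sub>R c \<xi>) - \<phi>' (t, x)\<bar> \<le> C * (h j + h j * M)"
        using lip[of "(t + h j, x + h j *\<^sub>R c \<xi>)" "(t, x)"] True h1[of j] C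
        by (auto simp: \<phi>'e ahead_def intro: order_trans mult_left_mono)
      then have "\<bar>(\<phi>' (t + h j, x + h j *\<^sub>R c \<xi>) - \<phi>' (t, x)) / h j\<bar> \<le> C * (1 + M)"
        using h1[of j] by (simp add: field_simps)
      from sC[OF this] show ?thesis using True by (simp add: w part_in_def)
    qed (use C M_nonneg in \<open>auto simp: w part_in_def\<close>)
  qed
  have in_R: "part_in j \<phi>' k w = 0" if "R1 < norm w" for j w
  proof -
    obtain t x \<xi> where w: "w = (t, x, \<xi>)" by (cases w)
    show ?thesis
    proof (cases "\<xi> \<in> {a..b} \<and> \<phi>' (t + h j, x + h j *\<^sub>R c \<xi>) - \<phi>' (t, x) \<noteq> 0")
      case True
      then have "norm (t + h j, x + h j *\<^sub>R c \<xi>) \<le> R \<or> norm (t + 0, x + 0 *\<^sub>R c \<xi>) \<le> R"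
        using \<phi>'(3) by (smt (verit) add.right_neutral scaleR_zero_left)
      then have "norm x \<le> R + M \<and> \<bar>t\<bar> \<le> R + 1"
        using shift_norm[of t "h j" x \<xi>] shift_norm[of t 0 x \<xi>] True h1[of j] by auto
      then have "norm w \<le> R1" using norm_triple_le[of t x \<xi>] B[of \<xi>] True N_nonneg M_nonneg R by (auto simp: w R1_def)
      then show ?thesis using that by simp
    qed (auto simp: w part_in_def)
  qed
  have init_R: "part_init j \<phi>' k w = 0" if "R1 < norm w" for j w
  proof -
    obtain s x \<xi> where w: "w = (s, x, \<xi>)" by (cases w)
    show ?thesis
    proof (cases "\<xi> \<in> {a..b} \<and> 0 < s \<and> s \<le> 1 \<and> norm (h j * s, x + h j *\<^sub>R c \<xi>) \<le> R")
      case True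
      then have "norm x \<le> R + M"
        using shift_norm[of "h j * s - h j" "h j" x \<xi>] h1[of j] by auto
      then have "norm w \<le> R1" using norm_triple_le[of s x \<xi>] B[of \<xi>] True N_nonneg M_nonneg R by (auto simp: w R1_def)
      then show ?thesis using that by simp
    qed (use \<phi>'(3) in \<open>auto simp: w part_init_def\<close>)
  qed
  have side_R: "part_side j \<phi>' k w = 0" if "R1 < norm w" for j w
  proof -
    obtain s x \<xi> where w: "w = (s, x, \<xi>)" by (cases w)
    show ?thesis
    proof (cases "\<xi> \<in> {a..b} \<and> 0 \<le> s \<and> s < p \<bullet> c \<xi> - 1 \<and> norm (\<theta> x + h j * s + h j, x + h j *\<^sub>R c \<xi>) \<le> R")
      case True
      then have "norm x \<le> R + M" "s \<le> N"
        using shift_norm[of "\<theta> x + h j * s" "h j" x \<xi>] h1[of j] p_le[of \<xi>] by auto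
      then have "norm w \<le> R1" using norm_triple_le[of s x \<xi>] B[of \<xi>] True N_nonneg M_nonneg R by (auto simp: w R1_def)
      then show ?thesis using that by simp
    qed (use \<phi>'(3) in \<open>auto simp: w part_side_def\<close>)
  qed
  have \<phi>'C: "\<bar>\<phi>' z\<bar> \<le> C" for z using \<phi>'(1,2)[of z] by simp
  have init_C: "\<bar>part_init j \<phi>' k w\<bar> \<le> C" for j w
    using sC[OF \<phi>'C] C by (auto simp: part_init_def split_beta)
  have side_C: "\<bar>part_side j \<phi>' k w\<bar> \<le> C" for j w
    using sC[OF \<phi>'C] C by (auto simp: part_side_def split_beta)
  \<comment> \<open>The pointwise limits: a derivative along the characteristic direction
    \<open>(1, c \<xi>)\<close>, the initial datum, and the datum on the front, the latter two still
    with the rescaled delay \<open>s\<close>.\<close>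
  define L1 where "L1 w = (case w of (t, x, \<xi>) \<Rightarrow> if \<xi> \<in> {a..b} \<and> ahead (t, x)
    then sep \<xi> (F (t, x)) k * (D' (t, x) \<bullet> (1, c \<xi>)) else 0)" for w
  define L2 where "L2 w = (case w of (s, x, \<xi>) \<Rightarrow> if \<xi> \<in> {a..b} \<and> 0 < s \<and> s \<le> (1::real) \<and> 0 < \<theta> x
    then sep \<xi> (U0 x) k * \<phi>' (0, x) else 0)" for w
  define L3 where "L3 w = (case w of (s, x, \<xi>) \<Rightarrow> if \<xi> \<in> {a..b} \<and> 0 < \<theta> x \<and> 0 \<le> s \<and> s < p \<bullet> c \<xi> - 1
    then sep \<xi> (g x) k * \<phi>' (\<theta> x, x) else 0)" for w
  have Lm [measurable]: "L1 \<in> borel_measurable borel" "L2 \<in> borel_measurable borel" "L3 \<in> borel_measurable borel"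
    unfolding L1_def L2_def L3_def split_beta by measurable
  have lim1: "(\<lambda>j. integral\<^sup>L lborel (part_in (r j) \<phi>' k)) \<longlonglongrightarrow> integral\<^sup>L lborel L1"
  proof (rule integral_tendsto_bounded_support[OF _ _ in_C in_R])
    have "AE w in (lborel :: (real \<times> 'a \<times> real) measure). (\<lambda>j. W (r j) (r j) (fst w) (fst (snd w))) \<longlonglongrightarrow> F (fst w, fst (snd w))"
      using AE_fst_fst_snd[OF Flim, where ?'d=real] by simp
    moreover have "AE w in (lborel :: (real \<times> 'a \<times> real) measure). snd (snd w) \<noteq> F (fst w, fst (snd w))"
      by (rule AE_not_on_graph) measurable
    ultimately show "AE w in lborel. (\<lambda>j. part_in (r j) \<phi>' k w) \<longlonglongrightarrow> L1 w"
    proof eventually_elim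
      case (elim w)
      obtain t x \<xi> where w: "w = (t, x, \<xi>)" by (cases w)
      show ?case
      proof (cases "\<xi> \<in> {a..b} \<and> ahead (t, x)")
        case True
        have s: "(\<lambda>j. sep \<xi> (W (r j) (r j) t x) k) \<longlonglongrightarrow> sep \<xi> (F (t, x)) k"
          by (rule sep_tendsto) (use elim in \<open>simp_all add: w\<close>)
        have t0: "0 < t" using True by (simp add: ahead_def)
        have "(\<lambda>j. (\<phi> ((t, x) + h (r j) *\<^sub>R (1, c \<xi>)) - \<phi> (t, x)) / h (r j)) \<longlonglongrightarrow> D (t, x) \<bullet> (1, c \<xi>)"
          by (rule test_function_quotient[OF T _ hr]) (use h1 t0 in auto)
        also have "(\<lambda>j. (\<phi> ((t, x) + h (r j) *\<^sub>R (1, c \<xi>)) - \<phi> (t, x)) / h (r j)) =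
          (\<lambda>j. (\<phi>' (t + h (r j), x + h (r j) *\<^sub>R c \<xi>) - \<phi>' (t, x)) / h (r j))"
          using t0 h1 by (auto simp: fun_eq_iff \<phi>'_def less_imp_le intro: add_nonneg_nonneg)
        finally have quot: "(\<lambda>j. (\<phi>' (t + h (r j), x + h (r j) *\<^sub>R c \<xi>) - \<phi>' (t, x)) / h (r j)) \<longlonglongrightarrow> D (t, x) \<bullet> (1, c \<xi>)" .
        show ?thesis using True t0 tendsto_mult[OF s quot] by (simp add: w part_in_def L1_def D'_def)
      qed (auto simp: w part_in_def L1_def)
    qed
  qed measurable
  have lim2: "(\<lambda>j. integral\<^sup>L lborel (part_init (r j) \<phi>' k)) \<longlonglongrightarrow> integral\<^sup>L lborel L2"
  proof (rule integral_tendsto_bounded_support[OF _ _ init_C init_R])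
    have "AE w in (lborel :: (real \<times> 'a \<times> real) measure). (\<lambda>j. u0s j (fst (snd w))) \<longlonglongrightarrow> U0 (fst (snd w))"
      by (rule AE_snd[OF AE_fst[OF U0_lim]])
    moreover have "AE w in (lborel :: (real \<times> 'a \<times> real) measure). \<theta> (fst (snd w)) \<noteq> 0"
      by (rule AE_snd[OF AE_fst[OF theta_level_null]])
    moreover have "AE w in (lborel :: (real \<times> 'a \<times> real) measure). snd (snd w) \<noteq> U0 (fst (snd w))"
      using AE_not_on_graph[of "\<lambda>z. U0 (snd z)"] by simp
    ultimately show "AE w in lborel. (\<lambda>j. part_init (r j) \<phi>' k w) \<longlonglongrightarrow> L2 w"
    proof eventually_elim
      case (elim w)
      obtain s x \<xi> where w: "w = (s, x, \<xi>)" by (cases w)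
      show ?case
      proof (cases "\<xi> \<in> {a..b} \<and> 0 < s \<and> s \<le> 1")
        case True
        have t1: "(\<lambda>j. \<theta> (x + h (r j) *\<^sub>R c \<xi>) - h (r j) * s) \<longlonglongrightarrow> \<theta> (x + 0 *\<^sub>R c \<xi>) - 0 * s"
          by (intro tendsto_intros theta_continuous hr)
        show ?thesis
        proof (cases "0 < \<theta> x")
          case pos: True
          have ev: "\<forall>\<^sub>F j in sequentially. 0 < \<theta> (x + h (r j) *\<^sub>R c \<xi>) - h (r j) * s"
            by (rule order_tendstoD(1)[OF t1]) (use pos in simp)
          have "(\<lambda>j. sep \<xi> (u0s (r j) x) k) \<longlonglongrightarrow> sep \<xi> (U0 x) k"
            by (rule sep_tendsto) (use elim LIMSEQ_subseq_LIMSEQ[OF _ r] in \<open>force simp: w o_def\<close>)+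
          moreover have "(\<lambda>j. \<phi>' (h (r j) * s, x + h (r j) *\<^sub>R c \<xi>)) \<longlonglongrightarrow> \<phi>' (0 * s, x + 0 *\<^sub>R c \<xi>)"
          proof (rule \<phi>cont)
            show "(\<lambda>j. (h (r j) * s, x + h (r j) *\<^sub>R c \<xi>)) \<longlonglongrightarrow> (0 * s, x + 0 *\<^sub>R c \<xi>)"
              by (intro tendsto_intros hr)
          qed (use True h1 in \<open>auto simp: less_imp_le\<close>)
          ultimately have "(\<lambda>j. sep \<xi> (u0s (r j) x) k * \<phi>' (h (r j) * s, x + h (r j) *\<^sub>R c \<xi>)) \<longlonglongrightarrow> L2 w"
            using True pos by (auto simp: w L2_def dest: tendsto_mult)
          moreover have "\<forall>\<^sub>F j in sequentially. sep \<xi> (u0s (r j) x) k * \<phi>' (h (r j) * s, x + h (r j) *\<^sub>R c \<xi>) = part_init (r j) \<phi>' k w"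
            using ev by eventually_elim (use True in \<open>simp add: w part_init_def\<close>)
          ultimately show ?thesis by (rule Lim_transform_eventually)
        next
          \<comment> \<open>Here the front passes before time 0, so arrivals near \<open>x\<close>
            at small positive times are not ahead of it and the integrand vanishes
            eventually.\<close>
          case neg: False
          then have "\<theta> x < 0" using elim by (simp add: w)
          then have ev: "\<forall>\<^sub>F j in sequentially. \<theta> (x + h (r j) *\<^sub>R c \<xi>) - h (r j) * s < 0"
            by (intro order_tendstoD(2)[OF t1]) simp
          show ?thesis
            by (rule tendsto_eventually) (use ev in eventually_elim, use neg in \<open>simp add: w part_init_def L2_def\<close>)
        qed
      qed (auto simp: w part_init_def L2_def)
    qed
  qed measurable
  have lim3: "(\<lambda>j. integral\<^sup>L lborel (part_side (r j) \<phi>' k)) \<longlonglongrightarrow> integral\<^sup>L lborel L3"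
  proof (rule integral_tendsto_bounded_support[OF _ _ side_C side_R])
    have "AE w in (lborel :: (real \<times> 'a \<times> real) measure). (\<lambda>j. G j (\<theta> (fst (snd w)), fst (snd w))) \<longlonglongrightarrow> g (fst (snd w))"
      by (rule AE_snd[OF AE_fst[OF g_lim]])
    moreover have "AE w in (lborel :: (real \<times> 'a \<times> real) measure). \<theta> (fst (snd w)) \<noteq> 0"
      by (rule AE_snd[OF AE_fst[OF theta_level_null]])
    moreover have "AE w in (lborel :: (real \<times> 'a \<times> real) measure). snd (snd w) \<noteq> g (fst (snd w))"
      using AE_not_on_graph[of "\<lambda>z. g (snd z)"] by simp
    ultimately show "AE w in lborel. (\<lambda>j. part_side (r j) \<phi>' k w) \<longlonglongrightarrow> L3 w"
    proof eventually_elim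
      case (elim w)
      obtain s x \<xi> where w: "w = (s, x, \<xi>)" by (cases w)
      show ?case
      proof (cases "\<xi> \<in> {a..b} \<and> 0 \<le> s \<and> s < p \<bullet> c \<xi> - 1")
        case True
        have sN: "s \<le> N" using True p_le[of \<xi>] by auto
        have t1: "(\<lambda>j. \<theta> x + h (r j) * s) \<longlonglongrightarrow> \<theta> x + 0 * s" by (intro tendsto_intros hr)
        show ?thesis
        proof (cases "0 < \<theta> x")
          case pos: True
          have pos': "0 < \<theta> x + h (r j) * s" for j
            using pos True h1[of "r j"] by (intro add_pos_nonneg mult_nonneg_nonneg) auto
          have gl: "(\<lambda>j. G (r j) (\<theta> x, x)) \<longlonglongrightarrow> g x"
            using elim LIMSEQ_subseq_LIMSEQ[OF _ r] by (force simp: w o_def)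
          obtain n0 :: nat where n0: "norm x \<le> real n0" using real_arch_simple by blast
          \<comment> \<open>The data are known to converge on the front only; the fine choice of the
            steps extends this to delays up to \<open>h (r j) * N\<close>.\<close>
          have "(\<lambda>j. G (r j) (\<theta> x + h (r j) * s, x) - G (r j) (\<theta> x, x)) \<longlonglongrightarrow> 0"
          proof (rule Lim_null_comparison[OF _ LIMSEQ_inverse_real_of_nat])
            show "\<forall>\<^sub>F j in sequentially. norm (G (r j) (\<theta> x + h (r j) * s, x) - G (r j) (\<theta> x, x)) \<le> inverse (real (Suc j))"
              unfolding eventually_sequentially
            proof (intro exI[of _ n0] allI impI)
              fix j assume j: "n0 \<le> j"
              have "\<bar>G (r j) (\<theta> x + h (r j) * s, x) - G (r j) (\<theta> x, x)\<bar> \<le> 1 / (real (r j) + 1)"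
                by (rule h_fine) (use j n0 rge[of j] True sN h1[of "r j"] in \<open>auto intro: order_trans mult_left_mono\<close>)
              also have "\<dots> \<le> inverse (real (Suc j))"
                using rge[of j] by (simp add: inverse_eq_divide frac_le)
              finally show "norm (G (r j) (\<theta> x + h (r j) * s, x) - G (r j) (\<theta> x, x)) \<le> inverse (real (Suc j))" by simp
            qed
          qed
          from tendsto_add[OF this gl] have "(\<lambda>j. G (r j) (\<theta> x + h (r j) * s, x)) \<longlonglongrightarrow> g x" by simp
          then have "(\<lambda>j. sep \<xi> (G (r j) (\<theta> x + h (r j) * s, x)) k) \<longlonglongrightarrow> sep \<xi> (g x) k"
            by (rule sep_tendsto) (use elim in \<open>simp add: w\<close>)
          moreover have "(\<lambda>j. \<phi>' (\<theta> x + h (r j) * s + h (r j), x + h (r j) *\<^sub>R c \<xi>)) \<longlonglongrightarrow> \<phi>' (\<theta> x + 0 * s + 0, x + 0 *\<^sub>R c \<xi>)"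
          proof (rule \<phi>cont)
            show "(\<lambda>j. (\<theta> x + h (r j) * s + h (r j), x + h (r j) *\<^sub>R c \<xi>)) \<longlonglongrightarrow> (\<theta> x + 0 * s + 0, x + 0 *\<^sub>R c \<xi>)"
              by (intro tendsto_intros hr)
            show "0 \<le> fst (\<theta> x + h (r j) * s + h (r j), x + h (r j) *\<^sub>R c \<xi>)" for j
              using pos'[of j] h1[of "r j"] by simp
          qed (use pos in simp)
          ultimately have "(\<lambda>j. sep \<xi> (G (r j) (\<theta> x + h (r j) * s, x)) k * \<phi>' (\<theta> x + h (r j) * s + h (r j), x + h (r j) *\<^sub>R c \<xi>)) \<longlonglongrightarrow> L3 w"
            using True pos by (auto simp: w L3_def dest: tendsto_mult)
          then show ?thesis using True pos' by (simp add: w part_side_def)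
        next
          case neg: False
          then have "\<theta> x < 0" using elim by (simp add: w)
          then have ev: "\<forall>\<^sub>F j in sequentially. \<theta> x + h (r j) * s < 0"
            by (intro order_tendstoD(2)[OF t1]) simp
          show ?thesis
            by (rule tendsto_eventually) (use ev in eventually_elim, use neg in \<open>simp add: w part_side_def L3_def\<close>)
        qed
      qed (auto simp: w part_side_def L3_def)
    qed
  qed measurable
  have ge: "0 \<le> integral\<^sup>L lborel L1 + integral\<^sup>L lborel L2 + integral\<^sup>L lborel L3"
  proof (rule LIMSEQ_le_const[OF tendsto_add[OF tendsto_add[OF lim1 lim2] lim3]], intro exI[of _ 0] allI impI)
    fix j
    have ip: "integrable lborel (part_in (r j) \<phi>' k)"
      by (rule integrable_bounded_support[OF _ in_C in_R]) measurable
    show "0 \<le> integral\<^sup>L lborel (part_in (r j) \<phi>' k) + integral\<^sup>L lborel (part_init (r j) \<phi>' k) + integral\<^sup>L lborel (part_side (r j) \<phi>' k)"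
      by (rule discrete_entropy_parts[where R=R and C=C, OF \<phi>'m \<phi>'(1,2) _ k ip]) (rule \<phi>'(3))
  qed
  have L1_C: "\<bar>L1 w\<bar> \<le> C * (1 + M)" for w
  proof -
    obtain t x \<xi> where w: "w = (t, x, \<xi>)" by (cases w)
    show ?thesis
    proof (cases "\<xi> \<in> {a..b}")
      case True
      have "\<bar>D' (t, x) \<bullet> (1, c \<xi>)\<bar> \<le> norm (D' (t, x)) * norm (1 :: real, c \<xi>)" by (rule Cauchy_Schwarz_ineq2)
      also have "\<dots> \<le> C * (1 + M)"
        using DC[of "(t, x)"] norm_Pair_le[of "1::real" "c \<xi>"] c_le[OF True] C by (intro mult_mono) (auto simp: D'_def)
      finally show ?thesis using sC[of _ "C * (1 + M)"] C M_nonneg by (auto simp: w L1_def)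
    qed (use C M_nonneg in \<open>auto simp: w L1_def\<close>)
  qed
  have L1_R: "L1 w = 0" if "R1 < norm w" for w
  proof -
    obtain t x \<xi> where w: "w = (t, x, \<xi>)" by (cases w)
    show ?thesis
    proof (cases "\<xi> \<in> {a..b} \<and> norm (t, x) \<le> R")
      case True
      then have "norm w \<le> R1"
        using norm_triple_le[of t x \<xi>] B[of \<xi>] N_nonneg M_nonneg R norm_fst_le[of t x] norm_snd_le[of x t] by (auto simp: w R1_def)
      then show ?thesis using that by simp
    qed (use D0 in \<open>auto simp: w L1_def D'_def\<close>)
  qed
  have L2_C: "\<bar>L2 w\<bar> \<le> C" and L3_C: "\<bar>L3 w\<bar> \<le> C" for w
    using sC[OF \<phi>'C] C by (auto simp: L2_def L3_def split_beta)
  have L2_R: "L2 w = 0" if "R1 < norm w" for w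
  proof -
    obtain s x \<xi> where w: "w = (s, x, \<xi>)" by (cases w)
    show ?thesis
    proof (cases "\<xi> \<in> {a..b} \<and> 0 < s \<and> s \<le> 1 \<and> norm (0::real, x) \<le> R")
      case True
      then have "norm w \<le> R1"
        using norm_triple_le[of s x \<xi>] B[of \<xi>] N_nonneg M_nonneg R norm_snd_le[of x "0::real"] by (auto simp: w R1_def)
      then show ?thesis using that by simp
    qed (use \<phi>'(3) in \<open>auto simp: w L2_def\<close>)
  qed
  have L3_R: "L3 w = 0" if "R1 < norm w" for w
  proof -
    obtain s x \<xi> where w: "w = (s, x, \<xi>)" by (cases w)
    show ?thesis
    proof (cases "\<xi> \<in> {a..b} \<and> 0 \<le> s \<and> s < p \<bullet> c \<xi> - 1 \<and> norm (\<theta> x, x) \<le> R")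
      case True
      then have "norm w \<le> R1"
        using norm_triple_le[of s x \<xi>] B[of \<xi>] p_le[of \<xi>] N_nonneg M_nonneg R norm_snd_le[of x "\<theta> x"] by (auto simp: w R1_def)
      then show ?thesis using that by simp
    qed (use \<phi>'(3) in \<open>auto simp: w L3_def\<close>)
  qed
  have I1: "integral\<^sup>L lborel L1 = (\<integral>z. (if ahead z then \<bar>F z - k\<bar> * fst (D z) + sgn (F z - k) * ((f (F z) - f k) \<bullet> snd (D z)) else 0) \<partial>lborel)"
  proof -
    have "integral\<^sup>L lborel L1 = (\<integral>z. \<integral>\<xi>. L1 (fst z, snd z, \<xi>) \<partial>lborel \<partial>lborel)"
      by (rule integral_triple[OF _ L1_C L1_R]) measurable
    also have "\<dots> = (\<integral>z. (if ahead z then \<bar>F z - k\<bar> * fst (D z) + sgn (F z - k) * ((f (F z) - f k) \<bullet> snd (D z)) else 0) \<partial>lborel)"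
    proof (rule Bochner_Integration.integral_cong[OF refl])
      fix z
      show "(\<integral>\<xi>. L1 (fst z, snd z, \<xi>) \<partial>lborel) = (if ahead z then \<bar>F z - k\<bar> * fst (D z) + sgn (F z - k) * ((f (F z) - f k) \<bullet> snd (D z)) else 0)"
      proof (cases "ahead z")
        case True
        then have "D' z = D z" by (simp add: D'_def ahead_def)
        then have "L1 (fst z, snd z, \<xi>) = (if \<xi> \<in> {a..b} then sep \<xi> (F z) k else 0) * fst (D z)
            + (if \<xi> \<in> {a..b} then sep \<xi> (F z) k * (c \<xi> \<bullet> snd (D z)) else 0)" for \<xi>
          using True by (cases z, cases "D z") (simp add: L1_def algebra_simps inner_commute)
        then have "(\<integral>\<xi>. L1 (fst z, snd z, \<xi>) \<partial>lborel) = (\<integral>\<xi>. (if \<xi> \<in> {a..b} then sep \<xi> (F z) k else 0) * fst (D z)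
            + (if \<xi> \<in> {a..b} then sep \<xi> (F z) k * (c \<xi> \<bullet> snd (D z)) else 0) \<partial>lborel)" by (simp only:)
        also have "\<dots> = (\<integral>\<xi>. (if \<xi> \<in> {a..b} then sep \<xi> (F z) k else 0) * fst (D z) \<partial>lborel)
            + (\<integral>\<xi>. (if \<xi> \<in> {a..b} then sep \<xi> (F z) k * (c \<xi> \<bullet> snd (D z)) else 0) \<partial>lborel)"
          by (intro Bochner_Integration.integral_add integrable_mult_left integrable_sep)
        also have "\<dots> = \<bar>F z - k\<bar> * fst (D z) + sgn (F z - k) * ((f (F z) - f k) \<bullet> snd (D z))"
          by (simp only: integral_mult_left_zero integral_sep[OF FI k] integral_sep_flux[OF FI k])
        finally show ?thesis using True by simp
      next
        case False
        then show ?thesis by (simp add: L1_def)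
      qed
    qed
    finally show ?thesis .
  qed
  have slab: "(\<integral>s. (if s \<in> S then y else 0) \<partial>lborel) = measure lborel S * y" if "S \<in> sets borel" for S :: "real set" and y :: real
  proof -
    have "(\<integral>s. (if s \<in> S then y else 0) \<partial>lborel) = (\<integral>s. indicator S s * y \<partial>lborel)"
      by (intro Bochner_Integration.integral_cong) (auto simp: indicator_def)
    also have "\<dots> = (\<integral>s. indicator S s \<partial>lborel) * y" by (rule integral_mult_left_zero)
    finally show ?thesis by simp
  qed
  \<comment> \<open>The delay is integrated first because that integral is explicit;
    \<open>H\<close> names its value, on which boundedness and support are checked for the outer
    Fubini step.\<close>
  have flat: "integral\<^sup>L lborel L = (\<integral>x. \<integral>\<xi>. \<integral>s. L (s, x, \<xi>) \<partial>lborel \<partial>lborel \<partial>lborel)"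
    if [measurable]: "L \<in> borel_measurable borel" and L_C: "\<And>w. \<bar>L w\<bar> \<le> C" and L_R: "\<And>w. R1 < norm w \<Longrightarrow> L w = 0"
      and H: "\<And>x \<xi>. (\<integral>s. L (s, x, \<xi>) \<partial>lborel) = H (x, \<xi>)" "\<And>y. \<bar>H y\<bar> \<le> C * (N + 1)" "\<And>y. R1 < norm y \<Longrightarrow> H y = 0" for L H
  proof -
    have "H = (\<lambda>y. \<integral>s. L (s, y) \<partial>lborel)"
    proof
      fix y
      show "H y = (\<integral>s. L (s, y) \<partial>lborel)" by (cases y) (simp add: H(1))
    qed
    then have Hm: "H \<in> borel_measurable borel" by simp
    have "integral\<^sup>L lborel L = (\<integral>y. \<integral>s. L (s, y) \<partial>lborel \<partial>lborel)"
      by (rule integral_pair(2)[OF _ L_C L_R]) measurable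
    also have "\<dots> = integral\<^sup>L lborel H"
      by (rule Bochner_Integration.integral_cong[OF refl]) (use H(1) in auto)
    also have "\<dots> = (\<integral>x. \<integral>\<xi>. H (x, \<xi>) \<partial>lborel \<partial>lborel)"
      by (rule integral_pair(1)[OF Hm H(2,3)])
    finally show ?thesis by (simp only: H(1))
  qed
  have I2: "integral\<^sup>L lborel L2 = (\<integral>x. (if 0 < \<theta> x then \<bar>U0 x - k\<bar> * \<phi> (0, x) else 0) \<partial>lborel)"
  proof -
    have s2: "(\<integral>s. L2 (s, x, \<xi>) \<partial>lborel) = (if \<xi> \<in> {a..b} \<and> 0 < \<theta> x then sep \<xi> (U0 x) k * \<phi>' (0, x) else 0)" for x \<xi>
    proof -
      let ?y = "if \<xi> \<in> {a..b} \<and> 0 < \<theta> x then sep \<xi> (U0 x) k * \<phi>' (0, x) else 0"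
      have "(\<integral>s. L2 (s, x, \<xi>) \<partial>lborel) = (\<integral>s. (if s \<in> {0<..1::real} then ?y else 0) \<partial>lborel)"
        by (rule Bochner_Integration.integral_cong[OF refl]) (auto simp: L2_def)
      also have "\<dots> = measure lborel {0<..1::real} * ?y" by (rule slab) simp
      finally show ?thesis by simp
    qed
    have "integral\<^sup>L lborel L2 = (\<integral>x. \<integral>\<xi>. \<integral>s. L2 (s, x, \<xi>) \<partial>lborel \<partial>lborel \<partial>lborel)"
    proof (rule flat[of L2 "\<lambda>(x, \<xi>). if \<xi> \<in> {a..b} \<and> 0 < \<theta> x then sep \<xi> (U0 x) k * \<phi>' (0, x) else 0"])
      fix y :: "'a \<times> real"
      have CN: "C \<le> C * (N + 1)" using C N_nonneg by simp
      show "\<bar>case y of (x, \<xi>) \<Rightarrow> if \<xi> \<in> {a..b} \<and> 0 < \<theta> x then sep \<xi> (U0 x) k * \<phi>' (0, x) else 0\<bar> \<le> C * (N + 1)"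
        using order_trans[OF sC[OF \<phi>'C] CN] C N_nonneg by (auto simp: split_beta)
      show "(case y of (x, \<xi>) \<Rightarrow> if \<xi> \<in> {a..b} \<and> 0 < \<theta> x then sep \<xi> (U0 x) k * \<phi>' (0, x) else 0) = 0" if "R1 < norm y"
        using L2_R[of "(1, y)"] norm_snd_le[of y "1::real"] that by (auto simp: L2_def split_beta split: if_splits)
    qed (simp_all add: s2 L2_C L2_R)
    also have "\<dots> = (\<integral>x. (if 0 < \<theta> x then \<bar>U0 x - k\<bar> * \<phi> (0, x) else 0) \<partial>lborel)"
    proof (rule Bochner_Integration.integral_cong[OF refl])
      fix x
      have "(\<integral>\<xi>. \<integral>s. L2 (s, x, \<xi>) \<partial>lborel \<partial>lborel) = (\<integral>\<xi>. (if \<xi> \<in> {a..b} then sep \<xi> (U0 x) k else 0) * (if 0 < \<theta> x then \<phi>' (0, x) else 0) \<partial>lborel)"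
        unfolding s2 by (intro Bochner_Integration.integral_cong) auto
      also have "\<dots> = \<bar>U0 x - k\<bar> * (if 0 < \<theta> x then \<phi>' (0, x) else 0)"
        by (simp only: integral_mult_left_zero integral_sep[OF U0_range k])
      finally show "(\<integral>\<xi>. \<integral>s. L2 (s, x, \<xi>) \<partial>lborel \<partial>lborel) = (if 0 < \<theta> x then \<bar>U0 x - k\<bar> * \<phi> (0, x) else 0)"
        by (simp add: \<phi>'_def)
    qed
    finally show ?thesis .
  qed
  have I3: "integral\<^sup>L lborel L3 = (\<integral>x. (if 0 < \<theta> x then \<phi> (\<theta> x, x) * (sgn (g x - k) * ((f (g x) - f k) \<bullet> p) - \<bar>g x - k\<bar>) else 0) \<partial>lborel)"
  proof -
    \<comment> \<open>The delays fill an interval of length \<open>p \<bullet> c \<xi> - 1\<close>,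
      nonnegative by \<open>p_ge\<close>. Integrated over the levels, this factor gives the normal
      flux minus the entropy.\<close>
    have s3: "(\<integral>s. L3 (s, x, \<xi>) \<partial>lborel) = (if \<xi> \<in> {a..b} \<and> 0 < \<theta> x then (p \<bullet> c \<xi> - 1) * (sep \<xi> (g x) k * \<phi>' (\<theta> x, x)) else 0)" for x \<xi>
    proof (cases "\<xi> \<in> {a..b} \<and> 0 < \<theta> x")
      case True
      have "1 \<le> p \<bullet> c \<xi>" using p_ge[of \<xi>] True kappa_pos by auto
      moreover have "(\<integral>s. L3 (s, x, \<xi>) \<partial>lborel) = (\<integral>s. (if s \<in> {0..<p \<bullet> c \<xi> - 1} then sep \<xi> (g x) k * \<phi>' (\<theta> x, x) else 0) \<partial>lborel)"
        by (rule Bochner_Integration.integral_cong[OF refl]) (use True in \<open>auto simp: L3_def\<close>)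
      moreover have "\<dots> = measure lborel {0..<p \<bullet> c \<xi> - 1} * (sep \<xi> (g x) k * \<phi>' (\<theta> x, x))" by (rule slab) simp
      ultimately show ?thesis using True by simp
    next
      case False
      then show ?thesis by (simp add: L3_def) auto
    qed
    have "integral\<^sup>L lborel L3 = (\<integral>x. \<integral>\<xi>. \<integral>s. L3 (s, x, \<xi>) \<partial>lborel \<partial>lborel \<partial>lborel)"
    proof (rule flat[of L3 "\<lambda>(x, \<xi>). if \<xi> \<in> {a..b} \<and> 0 < \<theta> x then (p \<bullet> c \<xi> - 1) * (sep \<xi> (g x) k * \<phi>' (\<theta> x, x)) else 0"])
      fix y :: "'a \<times> real"
      obtain x \<xi> where y: "y = (x, \<xi>)" by (cases y)
      have "\<bar>(p \<bullet> c \<xi> - 1) * (sep \<xi> (g x) k * \<phi>' (\<theta> x, x))\<bar> \<le> (N + 1) * C" if "\<xi> \<in> {a..b}"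
        unfolding abs_mult[of "p \<bullet> c \<xi> - 1"]
        by (rule mult_mono[OF _ sC[OF \<phi>'C]]) (use p_ge[OF that] p_le[OF that] kappa_pos N_nonneg in auto)
      then show "\<bar>case y of (x, \<xi>) \<Rightarrow> if \<xi> \<in> {a..b} \<and> 0 < \<theta> x then (p \<bullet> c \<xi> - 1) * (sep \<xi> (g x) k * \<phi>' (\<theta> x, x)) else 0\<bar> \<le> C * (N + 1)"
        using C N_nonneg by (auto simp: y mult.commute)
      show "(case y of (x, \<xi>) \<Rightarrow> if \<xi> \<in> {a..b} \<and> 0 < \<theta> x then (p \<bullet> c \<xi> - 1) * (sep \<xi> (g x) k * \<phi>' (\<theta> x, x)) else 0) = 0" if "R1 < norm y"
        using L3_R[of "(0, y)"] norm_snd_le[of y "0::real"] that p_ge[of \<xi>] kappa_pos by (auto simp: y L3_def split: if_splits)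
    qed (simp_all add: s3 L3_C L3_R)
    also have "\<dots> = (\<integral>x. (if 0 < \<theta> x then \<phi> (\<theta> x, x) * (sgn (g x - k) * ((f (g x) - f k) \<bullet> p) - \<bar>g x - k\<bar>) else 0) \<partial>lborel)"
    proof (rule Bochner_Integration.integral_cong[OF refl])
      fix x
      let ?m = "if 0 < \<theta> x then \<phi>' (\<theta> x, x) else 0"
      have "(\<integral>\<xi>. \<integral>s. L3 (s, x, \<xi>) \<partial>lborel \<partial>lborel) = (\<integral>\<xi>. ((if \<xi> \<in> {a..b} then sep \<xi> (g x) k * (c \<xi> \<bullet> p) else 0)
          - (if \<xi> \<in> {a..b} then sep \<xi> (g x) k else 0)) * ?m \<partial>lborel)"
        unfolding s3 by (intro Bochner_Integration.integral_cong) (auto simp: algebra_simps inner_commute)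
      also have "\<dots> = ((\<integral>\<xi>. (if \<xi> \<in> {a..b} then sep \<xi> (g x) k * (c \<xi> \<bullet> p) else 0) \<partial>lborel)
          - (\<integral>\<xi>. (if \<xi> \<in> {a..b} then sep \<xi> (g x) k else 0) \<partial>lborel)) * ?m"
        by (simp only: integral_mult_left_zero Bochner_Integration.integral_diff[OF integrable_sep(2) integrable_sep(1)])
      also have "\<dots> = (sgn (g x - k) * ((f (g x) - f k) \<bullet> p) - \<bar>g x - k\<bar>) * ?m"
        by (simp only: integral_sep[OF g_range k] integral_sep_flux[OF g_range k])
      finally show "(\<integral>\<xi>. \<integral>s. L3 (s, x, \<xi>) \<partial>lborel \<partial>lborel) = (if 0 < \<theta> x then \<phi> (\<theta> x, x) * (sgn (g x - k) * ((f (g x) - f k) \<bullet> p) - \<bar>g x - k\<bar>) else 0)"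
        by (simp add: \<phi>'_def)
    qed
    finally show ?thesis .
  qed
  show ?thesis using ge unfolding I1 I2 I3 .
qed

end

section \<open>Strong values on almost every front\<close>

text \<open>Off a negligible set a measurable function is a limit of continuous functions on the
  whole space. Clipping to {a..b} keeps continuity and convergence and makes the range condition
  hold everywhere.\<close>

lemma borel_continuous_approx:
  fixes g :: "'b::euclidean_space \<Rightarrow> real"
  assumes S: "S \<in> sets borel" and g: "g \<in> borel_measurable (lebesgue_on S)"
    and I: "AE x in lebesgue_on S. g x \<in> {a..b}" and ab: "a \<le> b"
  obtains V G where "V \<in> borel_measurable borel" "\<And>x. V x \<in> {a..b}"
    "\<And>i. continuous_on UNIV (G i)" "\<And>i x. G i x \<in> {a..b}"
    "AE x in lborel. (\<lambda>i. G i x) \<longlonglongrightarrow> V x" "AE x in lborel. x \<in> S \<longrightarrow> V x = g x"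
proof -
  have Sl: "S \<in> sets lebesgue" using S by auto
  have "g measurable_on S" using g by (simp add: measurable_on_iff_borel_measurable[OF Sl])
  then obtain N G0 where N: "negligible N" and G0: "\<And>n. continuous_on UNIV (G0 n)"
    and lim: "\<And>x. x \<notin> N \<Longrightarrow> (\<lambda>n. G0 n x) \<longlonglongrightarrow> (if x \<in> S then g x else 0)"
    unfolding measurable_on_def by blast
  define clip where "clip y = max a (min b y)" for y
  have clipI: "clip y \<in> {a..b}" for y using ab by (auto simp: clip_def)
  have clipid: "y \<in> {a..b} \<Longrightarrow> clip y = y" for y by (auto simp: clip_def)
  define G where "G n x = clip (G0 n x)" for n x
  have Gc: "continuous_on UNIV (G n)" for n
    unfolding G_def clip_def by (intro continuous_intros G0)
  have [measurable]: "G n \<in> borel_measurable borel" for n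
    using Gc by (rule borel_measurable_continuous_onI)
  have [measurable]: "(\<lambda>x. lim (\<lambda>n. G n x)) \<in> borel_measurable borel"
    by (rule borel_measurable_lim_metric) simp
  define V where "V x = clip (lim (\<lambda>n. G n x))" for x
  have Vm: "V \<in> borel_measurable borel" unfolding V_def clip_def by measurable
  have lim': "(\<lambda>n. G n x) \<longlonglongrightarrow> clip (if x \<in> S then g x else 0)" if "x \<notin> N" for x
    unfolding G_def clip_def by (intro tendsto_intros lim that)
  have V: "V x = clip (if x \<in> S then g x else 0)" if "x \<notin> N" for x
    using limI[OF lim'[OF that]] clipid[OF clipI] by (simp add: V_def)
  have "AE x in lebesgue. x \<notin> N" using N by (intro AE_not_in) (simp add: negligible_iff_null_sets)
  then have N': "AE x in lborel. x \<notin> N" by (simp add: AE_completion_iff)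
  have "AE x in lebesgue. x \<in> S \<longrightarrow> g x \<in> {a..b}"
    using I Sl by (subst (asm) AE_restrict_space_iff) auto
  then have I': "AE x in lborel. x \<in> S \<longrightarrow> g x \<in> {a..b}" by (simp add: AE_completion_iff)
  show thesis
  proof
    show "V x \<in> {a..b}" for x unfolding V_def by (rule clipI)
    show "G i x \<in> {a..b}" for i x unfolding G_def by (rule clipI)
    show "AE x in lborel. (\<lambda>i. G i x) \<longlonglongrightarrow> V x"
      using N'
    proof eventually_elim
      case (elim x)
      show ?case using lim'[OF elim] by (simp only: V[OF elim])
    qed
    show "AE x in lborel. x \<in> S \<longrightarrow> V x = g x"
      using N' I' by eventually_elim (simp add: V clipid)
  qed (rule Vm Gc)+
qed

text \<open>A continuous approximant is handled by uniform continuity, and the approximation errors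
  of the function and of its translate are the same integral up to a shift, on a ball enlarged by
  1.\<close>

lemma L1_loc_translation:
  fixes V :: "'b::euclidean_space \<Rightarrow> real"
  assumes Vm [measurable]: "V \<in> borel_measurable borel"
    and Gc: "\<And>i. continuous_on UNIV (G i)" and GI: "\<And>i x. G i x \<in> {a..b}"
    and lim: "AE x in lborel. (\<lambda>i. G i x) \<longlonglongrightarrow> V x" and \<epsilon>: "0 < \<epsilon>"
  shows "\<exists>\<delta>>0. \<forall>y. norm y < \<delta> \<longrightarrow> (\<integral>\<^sup>+z. indicator (cball 0 R) z * ennreal \<bar>V (z + y) - V z\<bar> \<partial>lborel) \<le> ennreal \<epsilon>"
proof -
  have Gm [measurable]: "G n \<in> borel_measurable borel" for n
    using Gc by (rule borel_measurable_continuous_onI)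
  define R' where "R' = \<bar>R\<bar> + 1"
  have GC: "\<bar>G j z\<bar> \<le> max \<bar>a\<bar> \<bar>b\<bar>" for j z using GI[of j z] by auto
  have "\<forall>\<^sub>F j in sequentially. (\<integral>\<^sup>+z. indicator (cball 0 R') z * ennreal \<bar>G j z - V z\<bar> \<partial>lborel) < ennreal (\<epsilon> / 3)"
    by (rule order_tendstoD(2)[OF L1_loc_tendsto[OF Gm Vm GC lim]]) (use \<epsilon> in auto)
  then obtain i where i: "(\<integral>\<^sup>+z. indicator (cball 0 R') z * ennreal \<bar>G i z - V z\<bar> \<partial>lborel) < ennreal (\<epsilon> / 3)"
    unfolding eventually_sequentially by blast
  define v where "v = measure lborel (cball (0::'b) R')"
  have v0: "0 \<le> v" by (simp add: v_def)
  have vE: "emeasure lborel (cball (0::'b) R') = ennreal v"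
    unfolding v_def using emeasure_cball_lt_top[of "0::'b" R'] by (simp add: emeasure_eq_ennreal_measure top.not_eq_extremum)
  define e where "e = \<epsilon> / (3 * (v + 1))"
  have e: "0 < e" using \<epsilon> v0 by (simp add: e_def)
  have ev: "e * v \<le> \<epsilon> / 3"
  proof -
    have "e * v = \<epsilon> / 3 * (v / (v + 1))" by (simp add: e_def)
    also have "\<dots> \<le> \<epsilon> / 3 * 1" using \<epsilon> v0 by (intro mult_left_mono) auto
    finally show ?thesis by simp
  qed
  have uc: "uniformly_continuous_on (cball 0 R') (G i)"
    by (rule compact_uniformly_continuous[OF continuous_on_subset[OF Gc subset_UNIV] compact_cball])
  from uc[unfolded uniformly_continuous_on_def, THEN spec, THEN mp, OF e]
  obtain \<eta> where \<eta>: "0 < \<eta>" "\<forall>z\<in>cball 0 R'. \<forall>z'\<in>cball 0 R'. dist z' z < \<eta> \<longrightarrow> dist (G i z') (G i z) < e"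
    by (elim exE conjE) rule
  show ?thesis
  proof (intro exI[of _ "min 1 \<eta>"] conjI allI impI)
    show "0 < min 1 \<eta>" using \<eta> by simp
    fix y :: 'b assume y: "norm y < min 1 \<eta>"
    have in': "norm (z + y) \<le> R' \<and> norm z \<le> R'" if "norm z \<le> R" for z
      using norm_triangle_ineq[of z y] y that by (auto simp: R'_def)
    show "(\<integral>\<^sup>+z. indicator (cball 0 R) z * ennreal \<bar>V (z + y) - V z\<bar> \<partial>lborel) \<le> ennreal \<epsilon>"
    proof (rule nn_integral_abs_triangle3[where ?f2.0="\<lambda>z. G i (z + y)" and ?f3.0="G i"])
      have "(\<integral>\<^sup>+z. indicator (cball 0 R) z * ennreal \<bar>V (z + y) - G i (z + y)\<bar> \<partial>lborel) \<le>
        (\<integral>\<^sup>+z. indicator (cball 0 R') (z + y) * ennreal \<bar>G i (z + y) - V (z + y)\<bar> \<partial>lborel)"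
        using in' by (intro nn_integral_mono) (auto simp: indicator_def abs_minus_commute)
      also have "\<dots> = (\<integral>\<^sup>+z. indicator (cball 0 R') z * ennreal \<bar>G i z - V z\<bar> \<partial>lborel)"
        by (rule nn_integral_lborel_shift[where f="\<lambda>z. indicator (cball 0 R') z * ennreal \<bar>G i z - V z\<bar>"]) measurable
      also have "\<dots> \<le> ennreal (\<epsilon> / 3)" using i by simp
      finally show "(\<integral>\<^sup>+z. indicator (cball 0 R) z * ennreal \<bar>V (z + y) - G i (z + y)\<bar> \<partial>lborel) \<le> ennreal (\<epsilon> / 3)" .
      show "(\<integral>\<^sup>+z. indicator (cball 0 R) z * ennreal \<bar>G i z - V z\<bar> \<partial>lborel) \<le> ennreal (\<epsilon> / 3)"
        by (rule order_trans[OF nn_integral_mono less_imp_le[OF i]]) (use in' in \<open>auto simp: indicator_def\<close>)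
      have "(\<integral>\<^sup>+z. indicator (cball 0 R) z * ennreal \<bar>G i (z + y) - G i z\<bar> \<partial>lborel) \<le> (\<integral>\<^sup>+z. indicator (cball (0::'b) R') z * ennreal e \<partial>lborel)"
      proof (rule nn_integral_mono)
        fix z
        have "\<bar>G i (z + y) - G i z\<bar> \<le> e" if "norm z \<le> R"
        proof -
          have "z \<in> cball 0 R'" "z + y \<in> cball 0 R'" using in'[OF that] by auto
          moreover have "dist (z + y) z < \<eta>" using y by (simp add: dist_norm)
          ultimately have "dist (G i (z + y)) (G i z) < e" using \<eta>(2) by blast
          then show ?thesis by (simp add: dist_real_def)
        qed
        then show "indicator (cball 0 R) z * ennreal \<bar>G i (z + y) - G i z\<bar> \<le> indicator (cball (0::'b) R') z * ennreal e"
          using in'[of z] by (auto simp: indicator_def intro!: ennreal_leI)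
      qed
      also have "\<dots> = ennreal (e * v)"
        using vE e v0 by (subst nn_integral_multc) (auto simp: ennreal_mult mult.commute)
      also have "\<dots> \<le> ennreal (\<epsilon> / 3)" using ev by (rule ennreal_leI)
      finally show "(\<integral>\<^sup>+z. indicator (cball 0 R) z * ennreal \<bar>G i (z + y) - G i z\<bar> \<partial>lborel) \<le> ennreal (\<epsilon> / 3)" .
    qed (use \<epsilon> in auto)
  qed
qed

text \<open>Oscillation of \<open>V\<close> in the layer of thickness \<open>e\<close> behind the
  front, with the delay rescaled to {0..1}. That it tends to 0 with \<open>e\<close> expresses a
  strong trace of \<open>V\<close> on the front.\<close>

definition front_osc :: "(real \<times> 'a::euclidean_space \<Rightarrow> real) \<Rightarrow> 'a \<Rightarrow> real \<Rightarrow> real \<Rightarrow> real \<Rightarrow> ennreal" where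
  "front_osc V p R e q = (\<integral>\<^sup>+w. indicator (cball 0 R \<times> {0..1}) w * ennreal \<bar>V (p \<bullet> fst w + q + e * snd w, fst w) - V (p \<bullet> fst w + q, fst w)\<bar> \<partial>lborel)"

text \<open>Integrated over \<open>q\<close>, the oscillation becomes an L1 norm of a time
  translation of \<open>V\<close>. Scales are chosen so that these norms are summable in
  \<open>k\<close>, hence for almost every \<open>q\<close> the oscillations are summable and tend
  to 0. The sequence \<open>e\<close> is independent of \<open>q\<close>, so \<open>q\<close> can be
  selected afterwards.\<close>

lemma good_front_scale:
  fixes V :: "real \<times> 'a::euclidean_space \<Rightarrow> real"
  assumes Vm [measurable]: "V \<in> borel_measurable borel" and VI: "\<And>x. V x \<in> {a..b}"
    and Gc: "\<And>i. continuous_on UNIV (G i)" and GI: "\<And>i x. G i x \<in> {a..b}"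
    and lim: "AE x in lborel. (\<lambda>i. G i x) \<longlonglongrightarrow> V x"
  obtains e :: "nat \<Rightarrow> real" where "\<And>k. 0 < e k" "e \<longlonglongrightarrow> 0"
    "AE q in lborel. \<forall>R. (\<lambda>k. front_osc V p R (e k) q) \<longlonglongrightarrow> 0"
proof -
  \<comment> \<open>The radius contains every \<open>(p \<bullet> x + q, x)\<close> with
    \<open>norm x\<close> and \<bar>q\<bar> at most \<open>k\<close>. Radius and accuracy both
    improve with \<open>k\<close>, so that the countably many conditions cover all of
    space-time.\<close>
  have "\<forall>k. \<exists>\<delta>>0. \<forall>y. norm y < \<delta> \<longrightarrow> (\<integral>\<^sup>+z. indicator (cball 0 ((2 + norm p) * real k)) z * ennreal \<bar>V (z + y) - V z\<bar> \<partial>lborel) \<le> ennreal ((1/2)^k)"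
    by (rule allI, rule L1_loc_translation[OF Vm Gc GI lim]) simp
  from choice[OF this] obtain \<delta> where \<delta>: "\<And>k. 0 < \<delta> k" "\<And>k y. norm y < \<delta> k \<Longrightarrow> (\<integral>\<^sup>+z. indicator (cball 0 ((2 + norm p) * real k)) z * ennreal \<bar>V (z + y) - V z\<bar> \<partial>lborel) \<le> ennreal ((1/2)^k)"
    by blast
  define e where "e k = min (\<delta> k) (inverse (real (Suc k))) / 2" for k
  have e: "0 < e k" "e k < \<delta> k" "e k \<le> inverse (real (Suc k))" for k
  proof -
    have "0 < min (\<delta> k) (inverse (real (Suc k)))" using \<delta>(1)[of k] by simp
    moreover have "min (\<delta> k) (inverse (real (Suc k))) \<le> \<delta> k" "min (\<delta> k) (inverse (real (Suc k))) \<le> inverse (real (Suc k))"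
      by (rule min.cobounded1, rule min.cobounded2)
    ultimately show "0 < e k" "e k < \<delta> k" "e k \<le> inverse (real (Suc k))" unfolding e_def by linarith+
  qed
  let ?d = "\<lambda>k q x s. ennreal \<bar>V (p \<bullet> x + q + e k * s, x) - V (p \<bullet> x + q, x)\<bar>"
  define Q where "Q k q = indicator {- real k..real k} q * front_osc V p (real k) (e k) q" for k q
  have [measurable]: "cball (0::'a) R \<times> {0..1::real} \<in> sets borel" for R
    by (intro borel_closed closed_Times) auto
  have meas [measurable]: "(\<lambda>q. front_osc V p R r q) \<in> borel_measurable borel" for R r
    unfolding front_osc_def by measurable
  have [measurable]: "Q k \<in> borel_measurable borel" for k unfolding Q_def by measurable
  have Qk: "(\<integral>\<^sup>+q. Q k q \<partial>lborel) \<le> ennreal ((1/2)^k)" for k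
  proof -
    let ?B = "cball (0::'a) (real k)" and ?I = "{- real k..real k}"
    have "(\<integral>\<^sup>+q. Q k q \<partial>lborel) = (\<integral>\<^sup>+q. \<integral>\<^sup>+w. indicator ?I q * (indicator (?B \<times> {0..1}) w * ?d k q (fst w) (snd w)) \<partial>lborel \<partial>lborel)"
      unfolding Q_def front_osc_def by (intro nn_integral_cong nn_integral_cmult[symmetric]) measurable
    also have "\<dots> = (\<integral>\<^sup>+w. \<integral>\<^sup>+q. indicator ?I q * (indicator (?B \<times> {0..1}) w * ?d k q (fst w) (snd w)) \<partial>lborel \<partial>lborel)"
      by (rule lborel_pair.Fubini') measurable
    also have "\<dots> = (\<integral>\<^sup>+x. \<integral>\<^sup>+s. \<integral>\<^sup>+q. indicator ?I q * (indicator (?B \<times> {0..1}) (x, s) * ?d k q x s) \<partial>lborel \<partial>lborel \<partial>lborel)"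
      by (subst nn_integral_spacetime) auto
    also have "\<dots> = (\<integral>\<^sup>+s. \<integral>\<^sup>+x. \<integral>\<^sup>+q. indicator ?I q * (indicator (?B \<times> {0..1}) (x, s) * ?d k q x s) \<partial>lborel \<partial>lborel \<partial>lborel)"
      by (rule lborel_pair.Fubini') measurable
    also have "\<dots> \<le> (\<integral>\<^sup>+s. indicator {0..1::real} s * ennreal ((1/2)^k) \<partial>lborel)"
    proof (rule nn_integral_mono)
      fix s :: real
      show "(\<integral>\<^sup>+x. \<integral>\<^sup>+q. indicator ?I q * (indicator (?B \<times> {0..1}) (x, s) * ?d k q x s) \<partial>lborel \<partial>lborel) \<le> indicator {0..1} s * ennreal ((1/2)^k)"
      proof (cases "s \<in> {0..1}")
        case True
        \<comment> \<open>For fixed \<open>s\<close> the delay is a pure time translation of length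
          \<open>e k * s\<close>, below \<open>\<delta> k\<close>.\<close>
        let ?y = "(e k * s, 0 :: 'a)" and ?R = "(2 + norm p) * real k"
        have "norm ?y = e k * s" using True e(1)[of k] by simp
        also have "\<dots> \<le> e k * 1" using True e(1)[of k] by (intro mult_left_mono) auto
        finally have y: "norm ?y < \<delta> k" using e(2)[of k] by simp
        have "(\<integral>\<^sup>+x. \<integral>\<^sup>+q. indicator ?I q * (indicator (?B \<times> {0..1}) (x, s) * ?d k q x s) \<partial>lborel \<partial>lborel)
          \<le> (\<integral>\<^sup>+x. \<integral>\<^sup>+q. indicator (cball 0 ?R) (p \<bullet> x + q, x) * ennreal \<bar>V ((p \<bullet> x + q, x) + ?y) - V (p \<bullet> x + q, x)\<bar> \<partial>lborel \<partial>lborel)"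
        proof (rule nn_integral_mono, rule nn_integral_mono)
          fix x :: 'a and q :: real
          have "norm (p \<bullet> x + q, x) \<le> ?R" if "norm x \<le> real k" "\<bar>q\<bar> \<le> real k"
          proof -
            have "\<bar>p \<bullet> x\<bar> \<le> norm p * norm x" by (rule Cauchy_Schwarz_ineq2)
            also have "\<dots> \<le> norm p * real k" using that by (intro mult_left_mono) auto
            finally show ?thesis using norm_Pair_le[of "p \<bullet> x + q" x] that by (auto simp: algebra_simps)
          qed
          then show "indicator ?I q * (indicator (?B \<times> {0..1}) (x, s) * ?d k q x s) \<le>
            indicator (cball 0 ?R) (p \<bullet> x + q, x) * ennreal \<bar>V ((p \<bullet> x + q, x) + ?y) - V (p \<bullet> x + q, x)\<bar>"
            by (auto simp: indicator_def abs_le_iff)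
        qed
        also have "\<dots> = (\<integral>\<^sup>+q. \<integral>\<^sup>+x. indicator (cball 0 ?R) (p \<bullet> x + q, x) * ennreal \<bar>V ((p \<bullet> x + q, x) + ?y) - V (p \<bullet> x + q, x)\<bar> \<partial>lborel \<partial>lborel)"
          by (rule lborel_pair.Fubini') measurable
        \<comment> \<open>Varying \<open>q\<close> together with \<open>x\<close> fills space-time;
          the shear with factor 1 restores the standard coordinates.\<close>
        also have "\<dots> = (\<integral>\<^sup>+z. indicator (cball 0 ?R) (p \<bullet> snd z + 1 * fst z, snd z) * ennreal \<bar>V ((p \<bullet> snd z + 1 * fst z, snd z) + ?y) - V (p \<bullet> snd z + 1 * fst z, snd z)\<bar> \<partial>lborel)"
          by (subst nn_integral_spacetime) auto
        also have "\<dots> = (\<integral>\<^sup>+z. indicator (cball 0 ?R) z * ennreal \<bar>V (z + ?y) - V z\<bar> \<partial>lborel)"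
          using nn_integral_shear[of "\<lambda>z. indicator (cball 0 ?R) z * ennreal \<bar>V (z + ?y) - V z\<bar>" "\<lambda>x. p \<bullet> x" 1] by simp
        also have "\<dots> \<le> ennreal ((1/2)^k)" by (rule \<delta>(2)[OF y])
        finally show ?thesis using True by simp
      qed simp
    qed
    also have "\<dots> = ennreal ((1/2)^k)" by (subst nn_integral_multc) auto
    finally show ?thesis .
  qed
  have "(\<integral>\<^sup>+q. (\<Sum>k. Q k q) \<partial>lborel) = (\<Sum>k. \<integral>\<^sup>+q. Q k q \<partial>lborel)"
    by (rule nn_integral_suminf) measurable
  also have "\<dots> \<le> (\<Sum>n. ennreal ((1/2)^n))"
    by (intro suminf_le Qk) auto
  also have "\<dots> = ennreal (\<Sum>n. (1/2)^n)"
    by (intro suminf_ennreal2) (auto intro: summable_geometric)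
  also have "\<dots> < \<infinity>" by simp
  finally have "AE q in lborel. (\<Sum>k. Q k q) \<noteq> \<infinity>"
    by (intro nn_integral_PInf_AE) auto
  then have "AE q in lborel. \<forall>R. (\<lambda>k. front_osc V p R (e k) q) \<longlonglongrightarrow> 0"
  proof eventually_elim
    case (elim q)
    have Q0: "(\<lambda>k. Q k q) \<longlonglongrightarrow> 0"
    proof -
      have "Q k q < top" for k
        using elim sum_le_suminf[of "\<lambda>k. Q k q" "{k}"] by (auto simp: top_unique less_top)
      then have eq: "Q k q = ennreal (enn2real (Q k q))" for k by (rule ennreal_enn2real[symmetric])
      have "summable (\<lambda>k. enn2real (Q k q))"
        by (rule summable_suminf_not_top) (use elim eq in auto)
      from tendsto_ennrealI[OF summable_LIMSEQ_zero[OF this]] show ?thesis using eq by simp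
    qed
    show ?case
    proof
      fix R
      \<comment> \<open>The restriction to \<bar>q\<bar> and radius at most \<open>k\<close> becomes
        harmless from \<open>n0\<close> on, for a fixed \<open>q\<close> and a fixed
        \<open>R\<close>.\<close>
      obtain n0 :: nat where n0: "\<bar>q\<bar> + \<bar>R\<bar> \<le> real n0" using real_arch_simple by blast
      have "\<forall>\<^sub>F k in sequentially. front_osc V p R (e k) q \<le> Q k q"
        unfolding eventually_sequentially
      proof (intro exI[of _ n0] allI impI)
        fix k assume k: "n0 \<le> k"
        then have kk: "\<bar>q\<bar> + \<bar>R\<bar> \<le> real k" using n0 by linarith
        then have "q \<in> {- real k..real k}" by auto
        then have "Q k q = front_osc V p (real k) (e k) q" by (simp add: Q_def)
        then show "front_osc V p R (e k) q \<le> Q k q"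
          unfolding front_osc_def using kk by (auto intro!: nn_integral_mono simp: indicator_def)
      qed
      then show "(\<lambda>k. front_osc V p R (e k) q) \<longlonglongrightarrow> 0"
        by (intro tendsto_sandwich[OF _ _ tendsto_const Q0]) (auto intro: always_eventually)
    qed
  qed
  moreover have "e \<longlonglongrightarrow> 0"
    by (rule tendsto_sandwich[OF _ _ tendsto_const LIMSEQ_inverse_real_of_nat])
       (use e in \<open>auto intro: always_eventually less_imp_le\<close>)
  ultimately show thesis using that e(1) by blast
qed

section \<open>Entropy inequality behind the front\<close>

text \<open>A \<open>C\<^sup>1\<close> ramp from 0 at 0 to 1 at 1, with derivative \<open>tent\<close>, cuts test functions off at the
  front.\<close>

definition ramp :: "real \<Rightarrow> real" where
  "ramp r = 2 * ((max 0 r)\<^sup>2 - 2 * (max 0 (r - 1/2))\<^sup>2 + (max 0 (r - 1))\<^sup>2)"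

definition tent :: "real \<Rightarrow> real" where
  "tent r = 4 * (max 0 r - 2 * max 0 (r - 1/2) + max 0 (r - 1))"

lemma DERIV_pos_part_square: "((\<lambda>r::real. (max 0 r)\<^sup>2) has_real_derivative 2 * max 0 r) (at r)"
proof -
  consider "r < 0" | "r = 0" | "0 < r" by linarith
  then show ?thesis
  proof cases
    case 1
    have "((\<lambda>_. 0) has_real_derivative 2 * max 0 r) (at r)" using 1 by simp
    then show ?thesis
      by (rule has_field_derivative_transform_within_open[where S="{..<0}"]) (use 1 in auto)
  next
    case 2
    have "((\<lambda>h::real. (max 0 h)\<^sup>2 / h) \<longlongrightarrow> 0) (at 0)"
    proof (rule Lim_null_comparison[where g="\<lambda>h. \<bar>h\<bar>"])
      show "\<forall>\<^sub>F h::real in at 0. norm ((max 0 h)\<^sup>2 / h) \<le> \<bar>h\<bar>"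
        by (rule always_eventually) (auto simp: max_def power2_eq_square)
      show "((\<lambda>h::real. \<bar>h\<bar>) \<longlongrightarrow> 0) (at 0)"
        using tendsto_rabs[OF tendsto_ident_at[of "0::real" UNIV]] by simp
    qed
    then show ?thesis using 2 by (simp add: DERIV_def)
  next
    case 3
    have "((\<lambda>r. r\<^sup>2) has_real_derivative 2 * max 0 r) (at r)" using 3 by (auto intro!: derivative_eq_intros)
    then show ?thesis
      by (rule has_field_derivative_transform_within_open[where S="{0<..}"]) (use 3 in auto)
  qed
qed

lemma DERIV_ramp: "(ramp has_real_derivative tent r) (at r)"
proof -
  have s: "((\<lambda>r. (max 0 (r - c))\<^sup>2) has_real_derivative 2 * max 0 (r - c)) (at r)" for c
  proof -
    have "((\<lambda>r. r - c) has_real_derivative 1) (at r)" by (auto intro!: derivative_eq_intros)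
    from DERIV_chain2[OF DERIV_pos_part_square this] show ?thesis by simp
  qed
  show ?thesis
    unfolding ramp_def[abs_def] tent_def
    by (rule derivative_eq_intros DERIV_pos_part_square s refl)+ simp
qed

lemma ramp_simps: "r \<le> 0 \<Longrightarrow> ramp r = 0" "1 \<le> r \<Longrightarrow> ramp r = 1"
  by (auto simp: ramp_def max_def power2_eq_square algebra_simps)

lemma tent_zero: "r \<le> 0 \<or> 1 \<le> r \<Longrightarrow> tent r = 0"
  by (auto simp: tent_def max_def)

lemma tent_bounds: "0 \<le> tent r" "tent r \<le> 2"
  by (auto simp: tent_def max_def)

lemma ramp_bounds: "0 \<le> ramp r" "ramp r \<le> 1"
proof -
  have mono: "ramp x \<le> ramp y" if "x \<le> y" for x y
    by (rule DERIV_nonneg_imp_nondecreasing[OF that]) (use DERIV_ramp tent_bounds(1) in blast)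
  show "0 \<le> ramp r" using mono[of "min r 0" r] ramp_simps(1)[of "min r 0"] by simp
  show "ramp r \<le> 1" using mono[of r "max r 1"] ramp_simps(2)[of "max r 1"] by simp
qed

lemma tent_continuous: "continuous_on A tent"
  unfolding tent_def by (intro continuous_intros)

lemma tent_measurable [measurable]: "tent \<in> borel_measurable borel"
  by (rule borel_measurable_continuous_onI[OF tent_continuous])

lemma ramp_continuous: "continuous_on A ramp"
  unfolding ramp_def by (intro continuous_intros)

lemma ramp_measurable [measurable]: "ramp \<in> borel_measurable borel"
  by (rule borel_measurable_continuous_onI[OF ramp_continuous])

lemma integral_tent: "(\<integral>r. tent r \<partial>lborel) = 1"
proof -
  have "(\<integral>r. tent r \<partial>lborel) = (\<integral>r. tent r * indicator {0..1} r \<partial>lborel)"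
  proof (rule Bochner_Integration.integral_cong[OF refl])
    fix r :: real
    show "tent r = tent r * indicator {0..1} r"
      using tent_zero[of r] by (cases "r \<in> {0..1}") auto
  qed
  also have "\<dots> = ramp 1 - ramp 0"
    by (rule integral_FTC_Icc_real)
       (use DERIV_ramp tent_continuous[of UNIV] in \<open>auto simp: continuous_on_eq_continuous_at\<close>)
  finally show ?thesis by (simp add: ramp_simps)
qed

section \<open>The Kruzhkov pairing and the cutoff at the front\<close>

text \<open>The Kruzhkov entropy pair of \<open>k\<close>, paired with a space-time vector
  \<open>y\<close>. Linearity in \<open>y\<close> lets the gradient of a product be split.\<close>

definition kr :: "(real \<Rightarrow> 'a::euclidean_space) \<Rightarrow> real \<Rightarrow> real \<Rightarrow> real \<times> 'a \<Rightarrow> real" where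
  "kr f k u y = \<bar>u - k\<bar> * fst y + sgn (u - k) * ((f u - f k) \<bullet> snd y)"

lemma kr_measurable [measurable (raw)]:
  fixes f :: "real \<Rightarrow> 'a::euclidean_space"
  assumes [measurable]: "f \<in> borel_measurable borel" "u \<in> borel_measurable M" "y \<in> borel_measurable M"
  shows "(\<lambda>x. kr f k (u x) (y x)) \<in> borel_measurable M"
proof -
  have [measurable]: "(\<lambda>x. fst (y x)) \<in> borel_measurable M" "(\<lambda>x. snd (y x)) \<in> borel_measurable M"
    using measurable_compose[OF assms(3) borel_fst_snd(1)] measurable_compose[OF assms(3) borel_fst_snd(2)] by auto
  have [measurable]: "(sgn :: real \<Rightarrow> real) \<in> borel_measurable borel"
    unfolding sgn_if[abs_def] by measurable
  have [measurable]: "(\<lambda>x. f (u x)) \<in> borel_measurable M"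
    using measurable_compose[OF assms(2,1)] .
  show ?thesis unfolding kr_def by measurable
qed

lemma kr_zero [simp]: "kr f k u 0 = 0"
  by (simp add: kr_def)

text \<open>\<open>(1, - p)\<close> is the gradient of the function
  \<open>t - (p \<bullet> x + q)\<close> that defines the front, so the second term is the
  contribution of a cutoff across it.\<close>

lemma kr_combination: "kr f k u (\<alpha> *\<^sub>R y + m *\<^sub>R (1, - p)) = \<alpha> * kr f k u y - m * (sgn (u - k) * ((f u - f k) \<bullet> p) - \<bar>u - k\<bar>)"
  by (simp add: kr_def algebra_simps inner_add_right)

lemma kruzhkov_lborel:
  fixes f :: "real \<Rightarrow> 'a::euclidean_space"
  assumes \<Omega>: "open \<Omega>" and fm [measurable]: "f \<in> borel_measurable borel"
    and Um [measurable]: "U \<in> borel_measurable borel" and Dm [measurable]: "D' \<in> borel_measurable borel"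
    and uU: "AE z in lborel. z \<in> {0<..} \<times> \<Omega> \<longrightarrow> u (fst z) (snd z) = U z"
    and D: "\<And>z. z \<in> {0<..} \<times> \<Omega> \<Longrightarrow> D' z = D z"
  shows "kruzhkov_integral f \<Omega> u k D = (\<integral>z. (if z \<in> {0<..} \<times> \<Omega> then kr f k (U z) (D' z) else 0) \<partial>lborel)"
proof -
  have S [measurable]: "{0::real<..} \<times> \<Omega> \<in> sets borel" using \<Omega> by (intro borel_open open_Times) auto
  have "kruzhkov_integral f \<Omega> u k D = (\<integral>z. kr f k (u (fst z) (snd z)) (D z) \<partial>lebesgue_on ({0<..} \<times> \<Omega>))"
    unfolding kruzhkov_integral_def kr_def by (intro Bochner_Integration.integral_cong) (auto simp: inner_commute)
  also have "\<dots> = (\<integral>z. (if z \<in> {0<..} \<times> \<Omega> then kr f k (U z) (D' z) else 0) \<partial>lborel)"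
  proof (rule integral_lebesgue_on_eq_lborel[OF _ S])
    show "AE z in lborel. z \<in> {0<..} \<times> \<Omega> \<longrightarrow> kr f k (u (fst z) (snd z)) (D z) = (if z \<in> {0<..} \<times> \<Omega> then kr f k (U z) (D' z) else 0)"
      using uU by eventually_elim (auto simp: D)
    show "(\<lambda>z. if z \<in> {0<..} \<times> \<Omega> then kr f k (U z) (D' z) else 0) \<in> borel_measurable borel" by measurable
  qed (rule if_not_P)
  finally show ?thesis .
qed

text \<open>The clock of \<open>v\<close> runs ahead by \<Delta>. The cutoff vanishes near every
  point where \<open>\<rho>\<close> is negative, and elsewhere the shifted time is positive by the
  first positivity hypothesis; so \<phi> is only ever needed inside its domain, and the product
  vanishes near time 0 in the clock of \<phi>.\<close>

lemma cutoff_test_function: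
  fixes \<Omega> :: "'a::euclidean_space set" and p :: 'a and q \<Delta> e :: real
  defines "\<rho> \<equiv> \<lambda>z. (fst z - \<Delta> - (p \<bullet> snd z + q)) / e"
  assumes \<Omega>: "open \<Omega>" and e: "0 < e" and T: "test_function ({0..} \<times> \<Omega>) \<phi> D"
    and pos: "\<And>x. x \<in> \<Omega> \<Longrightarrow> 0 < p \<bullet> x + q" "\<And>x. x \<in> \<Omega> \<Longrightarrow> 0 < p \<bullet> x + q + \<Delta>"
  shows "test_function ({0<..} \<times> \<Omega>) (\<lambda>z. \<phi> (fst z - \<Delta>, snd z) * ramp (\<rho> z))
    (\<lambda>z. ramp (\<rho> z) *\<^sub>R D (fst z - \<Delta>, snd z) + (\<phi> (fst z - \<Delta>, snd z) * tent (\<rho> z) / e) *\<^sub>R (1, - p))"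
    (is "test_function ?S ?\<phi> ?D")
proof -
  let ?A = "{0::real..} \<times> \<Omega>"
  let ?sh = "\<lambda>z :: real \<times> 'a. (fst z - \<Delta>, snd z)"
  from T obtain K where d: "\<And>z. z \<in> ?A \<Longrightarrow> (\<phi> has_derivative (\<lambda>h. inner (D z) h)) (at z within ?A)"
    and D: "continuous_on ?A D" and K: "compact K" "K \<subseteq> ?A" "\<forall>z\<in>?A - K. \<phi> z = 0" and nn: "\<And>z. z \<in> ?A \<Longrightarrow> 0 \<le> \<phi> z"
    unfolding test_function_def by blast
  have oS: "open ?S" using \<Omega> by (auto intro: open_Times)
  have d1: "(\<phi> has_derivative (\<lambda>h. inner (D z) h)) (at z)" if "z \<in> ?S" for z
  proof -
    have "(\<phi> has_derivative (\<lambda>h. inner (D z) h)) (at z within ?S)"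
      by (rule has_derivative_subset[OF d]) (use that in auto)
    then show ?thesis by (simp only: at_within_open[OF that oS])
  qed
  have D1: "continuous (at z) D" if "z \<in> ?S" for z
  proof -
    have "continuous_on ?S D" by (rule continuous_on_subset[OF D]) auto
    then show ?thesis using that unfolding continuous_on_eq_continuous_at[OF oS] by blast
  qed
  have \<phi>1: "continuous (at z) \<phi>" if "z \<in> ?S" for z
    by (rule has_derivative_continuous[OF d1[OF that]])
  have \<rho>d: "(\<rho> has_derivative (\<lambda>h. inner ((1, - p) /\<^sub>R e) h)) (at z)" for z
    unfolding \<rho>_def using e
    by (auto intro!: derivative_eq_intros simp: fun_eq_iff divide_inverse inner_Pair_0 algebra_simps inner_prod_def)
  have \<rho>c: "continuous (at z) \<rho>" for z by (rule has_derivative_continuous[OF \<rho>d])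
  have far: "\<exists>W. open W \<and> z \<in> W \<and> (\<forall>w\<in>W. \<rho> w < 0)" if "\<rho> z < 0" for z
  proof (intro exI conjI)
    have "continuous_on UNIV \<rho>" using \<rho>c by (simp add: continuous_at_imp_continuous_on)
    then show "open {w. \<rho> w < 0}" by (intro open_Collect_less) auto
  qed (use that in auto)
  have behind: "?sh z \<in> ?S" if "z \<in> ?S" "0 \<le> \<rho> z" for z
  proof -
    have "snd z \<in> \<Omega>" using that by auto
    moreover have "p \<bullet> snd z + q \<le> fst z - \<Delta>" using that(2) e by (simp add: \<rho>_def zero_le_divide_iff)
    ultimately show ?thesis using pos(1)[of "snd z"] by auto
  qed
  have rb: "ramp (\<rho> w) = 0" "tent (\<rho> w) = 0" if "\<rho> w < 0" for w
    using that by (auto simp: ramp_simps tent_zero)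
  have der: "(?\<phi> has_derivative (\<lambda>h. inner (?D z) h)) (at z within ?S)" if z: "z \<in> ?S" for z
  proof (cases "\<rho> z < 0")
    case True
    from far[OF True] obtain W where W: "open W" "z \<in> W" "\<And>w. w \<in> W \<Longrightarrow> \<rho> w < 0" by blast
    have "?D z = 0" using rb[OF True] by (simp add: zero_prod_def)
    then have "((\<lambda>_. 0) has_derivative (\<lambda>h. inner (?D z) h)) (at z)" by simp
    then have "(?\<phi> has_derivative (\<lambda>h. inner (?D z) h)) (at z)"
      by (rule has_derivative_transform_within_open[OF _ W(1,2)]) (use rb W(3) in auto)
    then show ?thesis by (rule has_derivative_at_withinI)
  next
    case False
    then have s1: "?sh z \<in> ?S" using behind z by auto
    have "(?sh has_derivative (\<lambda>h. h)) (at z)"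
      by (auto intro!: derivative_eq_intros simp: fun_eq_iff)
    from has_derivative_compose[OF this, of \<phi>] d1[OF s1]
    have a: "((\<lambda>z. \<phi> (?sh z)) has_derivative (\<lambda>h. inner (D (?sh z)) h)) (at z)" by simp
    have "(ramp has_derivative (\<lambda>h. tent (\<rho> z) * h)) (at (\<rho> z))"
      using DERIV_ramp by (simp add: has_field_derivative_def)
    from has_derivative_compose[OF \<rho>d this]
    have b: "((\<lambda>z. ramp (\<rho> z)) has_derivative (\<lambda>h. tent (\<rho> z) * inner ((1, - p) /\<^sub>R e) h)) (at z)" .
    have "(?\<phi> has_derivative (\<lambda>h. \<phi> (?sh z) * (tent (\<rho> z) * inner ((1, - p) /\<^sub>R e) h) + inner (D (?sh z)) h * ramp (\<rho> z))) (at z)"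
      by (rule has_derivative_mult[OF a b])
    also have "(\<lambda>h. \<phi> (?sh z) * (tent (\<rho> z) * inner ((1, - p) /\<^sub>R e) h) + inner (D (?sh z)) h * ramp (\<rho> z)) = (\<lambda>h. inner (?D z) h)"
      by (simp add: fun_eq_iff inner_add_left divide_inverse right_diff_distrib mult_ac)
    finally show ?thesis by (rule has_derivative_at_withinI)
  qed
  have cont: "continuous_on ?S ?D"
    unfolding continuous_on_eq_continuous_at[OF oS]
  proof
    fix z assume z: "z \<in> ?S"
    show "continuous (at z) ?D"
    proof (cases "\<rho> z < 0")
      case True
      from far[OF True] obtain W where W: "open W" "z \<in> W" "\<And>w. w \<in> W \<Longrightarrow> \<rho> w < 0" by blast
      have "continuous_on W (\<lambda>_. 0 :: real \<times> 'a)" by simp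
      then have "continuous_on W ?D" by (rule continuous_on_eq) (simp add: rb W(3) zero_prod_def)
      then show ?thesis using W by (auto simp: continuous_on_eq_continuous_at)
    next
      case False
      then have s1: "?sh z \<in> ?S" using behind z by auto
      have sc: "continuous (at z) ?sh" by (intro continuous_intros)
      have "continuous (at z) (\<lambda>z. D (?sh z))"
        by (rule isCont_o2[OF sc D1[OF s1]])
      moreover have "continuous (at z) (\<lambda>z. \<phi> (?sh z))"
        by (rule isCont_o2[OF sc \<phi>1[OF s1]])
      moreover have "continuous (at z) (\<lambda>z. ramp (\<rho> z))"
        using isCont_o2[OF \<rho>c, where g=ramp] ramp_continuous[of UNIV] by (auto simp: continuous_on_eq_continuous_at)
      moreover have "continuous (at z) (\<lambda>z. tent (\<rho> z))"
        using isCont_o2[OF \<rho>c, where g=tent] tent_continuous[of UNIV] by (auto simp: continuous_on_eq_continuous_at)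
      ultimately show ?thesis using e by (intro continuous_intros) auto
    qed
  qed
  \<comment> \<open>The part of the support behind the front, moved to the clock of
    \<open>v\<close>. Its times are at least \<open>p \<bullet> x + q + \<Delta>\<close>, hence
    positive, as a test function on {0<..} requires.\<close>
  define K' where "K' = (\<lambda>z. (fst z + \<Delta>, snd z)) ` (K \<inter> {z. p \<bullet> snd z + q \<le> fst z})"
  have cK: "compact K'"
    unfolding K'_def
    by (intro compact_continuous_image compact_Int_closed[OF K(1)] closed_Collect_le continuous_intros)
  have K'S: "K' \<subseteq> ?S"
  proof
    fix w assume "w \<in> K'"
    then obtain z where z: "z \<in> K" "p \<bullet> snd z + q \<le> fst z" "w = (fst z + \<Delta>, snd z)" unfolding K'_def by auto
    then have "snd z \<in> \<Omega>" using K(2) by auto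
    then show "w \<in> ?S" using pos(2)[of "snd z"] z by auto
  qed
  have zero: "?\<phi> z = 0" if "z \<in> ?S - K'" for z
  proof (cases "\<rho> z < 0")
    case True
    then show ?thesis by (simp add: rb)
  next
    case False
    then have "?sh z \<in> ?S" using behind that by auto
    moreover have "?sh z \<notin> K"
    proof
      assume "?sh z \<in> K"
      moreover have "p \<bullet> snd z + q \<le> fst z - \<Delta>" using False e by (simp add: \<rho>_def divide_less_0_iff not_less)
      ultimately have "z \<in> K'" unfolding K'_def by (intro image_eqI[of _ _ "?sh z"]) auto
      then show False using that by simp
    qed
    ultimately have "\<phi> (?sh z) = 0" using K(3) by auto
    then show ?thesis by simp
  qed
  have nn': "0 \<le> ?\<phi> z" if "z \<in> ?S" for z
  proof (cases "\<rho> z < 0")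
    case True
    then show ?thesis by (simp add: rb)
  next
    case False
    then have "?sh z \<in> ?A" using behind[OF that] by auto
    then show ?thesis using nn ramp_bounds(1) by (intro mult_nonneg_nonneg) auto
  qed
  show ?thesis
    unfolding test_function_def using der cont cK K'S zero nn' by (intro conjI ballI exI[of _ K']) auto
qed

context flux_approx
begin

text \<open>The entropy flux through the front in the direction \<open>(-1, p)\<close>, which points
  from behind to ahead.\<close>

definition front_flux :: "real \<Rightarrow> real \<Rightarrow> real" where
  "front_flux k u = sgn (u - k) * ((f u - f k) \<bullet> p) - \<bar>u - k\<bar>"

text \<open>In kinetic form the flux integrates \<open>sep\<close> against the relative speed
  \<open>c \<xi> \<bullet> p - 1\<close>, which lies between 0 and \<open>N\<close>; replacing
  \<open>u\<close> by \<open>u'\<close> changes only the levels between them.\<close>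

lemma front_flux_lipschitz:
  assumes u: "u \<in> {a..b}" and u': "u' \<in> {a..b}" and k: "k \<in> {a..b}"
  shows "\<bar>front_flux k u - front_flux k u'\<bar> \<le> N * \<bar>u - u'\<bar>"
proof -
  let ?s = "\<lambda>u k \<xi>. if \<xi> \<in> {a..b} then sep \<xi> u k else 0"
  let ?t = "\<lambda>u k \<xi>. if \<xi> \<in> {a..b} then sep \<xi> u k * (c \<xi> \<bullet> p) else 0"
  have b: "front_flux k u = (\<integral>\<xi>. ?t u k \<xi> - ?s u k \<xi> \<partial>lborel)" if "u \<in> {a..b}" for u
    unfolding front_flux_def using integral_sep[OF that k] integral_sep_flux[OF that k, of p] integrable_sep[of u k]
    by (subst Bochner_Integration.integral_diff) auto
  have i: "integrable lborel (\<lambda>\<xi>. ?t u k \<xi> - ?s u k \<xi>)" for u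
    by (intro Bochner_Integration.integrable_diff integrable_sep)
  have "\<bar>front_flux k u - front_flux k u'\<bar> = \<bar>\<integral>\<xi>. (?t u k \<xi> - ?s u k \<xi>) - (?t u' k \<xi> - ?s u' k \<xi>) \<partial>lborel\<bar>"
    unfolding b[OF u] b[OF u'] by (subst Bochner_Integration.integral_diff[OF i i]) simp
  also have "\<dots> \<le> (\<integral>\<xi>. \<bar>(?t u k \<xi> - ?s u k \<xi>) - (?t u' k \<xi> - ?s u' k \<xi>)\<bar> \<partial>lborel)"
    by (rule integral_abs_bound)
  also have "\<dots> \<le> (\<integral>\<xi>. N * ?s u u' \<xi> \<partial>lborel)"
  proof (rule integral_mono)
    show "integrable lborel (\<lambda>\<xi>. \<bar>(?t u k \<xi> - ?s u k \<xi>) - (?t u' k \<xi> - ?s u' k \<xi>)\<bar>)"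
      by (intro integrable_abs Bochner_Integration.integrable_diff i)
    show "integrable lborel (\<lambda>\<xi>. N * ?s u u' \<xi>)"
      by (intro integrable_mult_right integrable_sep)
    fix \<xi> :: real
    show "\<bar>(?t u k \<xi> - ?s u k \<xi>) - (?t u' k \<xi> - ?s u' k \<xi>)\<bar> \<le> N * ?s u u' \<xi>"
    proof (cases "\<xi> \<in> {a..b}")
      case True
      have n: "0 \<le> c \<xi> \<bullet> p - 1" "c \<xi> \<bullet> p - 1 \<le> N"
        using p_ge[OF True] p_le[OF True] kappa_pos by (auto simp: inner_commute)
      have "(?t u k \<xi> - ?s u k \<xi>) - (?t u' k \<xi> - ?s u' k \<xi>) = (sep \<xi> u k - sep \<xi> u' k) * (c \<xi> \<bullet> p - 1)"
        using True by (simp add: algebra_simps)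
      also have "\<bar>\<dots>\<bar> = \<bar>sep \<xi> u k - sep \<xi> u' k\<bar> * (c \<xi> \<bullet> p - 1)" using n by (simp add: abs_mult)
      also have "\<dots> \<le> sep \<xi> u u' * N" using n by (intro mult_mono) (auto simp: sep_def)
      finally show ?thesis using True by (simp add: mult.commute)
    next
      case False
      then show ?thesis by (simp del: atLeastAtMost_iff)
    qed
  qed
  also have "\<dots> = N * \<bar>u - u'\<bar>"
    by (simp only: integral_mult_right_zero integral_sep[OF u u'])
  finally show ?thesis .
qed

lemma front_flux_bound: "u \<in> {a..b} \<Longrightarrow> k \<in> {a..b} \<Longrightarrow> \<bar>front_flux k u\<bar> \<le> N * (b - a)"
proof -
  assume u: "u \<in> {a..b}" and k: "k \<in> {a..b}"
  have "\<bar>front_flux k u - front_flux k k\<bar> \<le> N * \<bar>u - k\<bar>" by (rule front_flux_lipschitz[OF u k k])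
  also have "\<dots> \<le> N * (b - a)" using u k N_nonneg by (intro mult_left_mono) auto
  finally show ?thesis by (simp add: front_flux_def)
qed

lemma front_flux_measurable [measurable]: "front_flux k \<in> borel_measurable borel"
proof -
  have [measurable]: "(sgn :: real \<Rightarrow> real) \<in> borel_measurable borel"
    unfolding sgn_if[abs_def] by measurable
  show ?thesis unfolding front_flux_def by measurable
qed

lemma f_bounded: obtains B where "0 \<le> B" "\<And>u k. u \<in> {a..b} \<Longrightarrow> k \<in> {a..b} \<Longrightarrow> norm (f u - f k) \<le> B"
proof -
  have "continuous_on {a..b} f"
    by (meson continuous_at_imp_continuous_on f_deriv has_vector_derivative_continuous)
  then have "compact (f ` {a..b})" by (rule compact_continuous_image) simp
  from compact_imp_bounded[OF this] obtain B where B: "0 < B" "\<forall>y\<in>f ` {a..b}. norm y \<le> B"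
    unfolding bounded_pos by blast
  have "norm (f u - f k) \<le> 2 * B" if "u \<in> {a..b}" "k \<in> {a..b}" for u k
  proof -
    have "norm (f u) \<le> B" "norm (f k) \<le> B" using B(2) that by blast+
    then show ?thesis using norm_triangle_ineq4[of "f u" "f k"] by linarith
  qed
  then show thesis using that[of "2 * B"] B(1) by simp
qed

lemma kr_bounded: 
  obtains B where "0 \<le> B" "\<And>u k y. u \<in> {a..b} \<Longrightarrow> k \<in> {a..b} \<Longrightarrow> \<bar>kr f k u y\<bar> \<le> B * norm y"
proof -
  obtain B where B: "0 \<le> B" "\<And>u k. u \<in> {a..b} \<Longrightarrow> k \<in> {a..b} \<Longrightarrow> norm (f u - f k) \<le> B"
    by (rule f_bounded) blast
  have "\<bar>kr f k u y\<bar> \<le> (b - a + B) * norm y" if u: "u \<in> {a..b}" and k: "k \<in> {a..b}" for u k and y :: "real \<times> 'a"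
  proof -
    have "\<bar>kr f k u y\<bar> \<le> \<bar>\<bar>u - k\<bar> * fst y\<bar> + \<bar>sgn (u - k) * ((f u - f k) \<bullet> snd y)\<bar>"
      unfolding kr_def by (rule abs_triangle_ineq)
    also have "\<bar>\<bar>u - k\<bar> * fst y\<bar> \<le> (b - a) * norm y"
      unfolding abs_mult using u k norm_fst_le[of "fst y" "snd y"] by (intro mult_mono) auto
    also have "\<bar>sgn (u - k) * ((f u - f k) \<bullet> snd y)\<bar> \<le> 1 * \<bar>(f u - f k) \<bullet> snd y\<bar>"
      unfolding abs_mult by (intro mult_right_mono) (auto simp: abs_sgn_eq)
    also have "\<bar>(f u - f k) \<bullet> snd y\<bar> \<le> norm (f u - f k) * norm (snd y)" by (rule Cauchy_Schwarz_ineq2)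
    also have "\<dots> \<le> B * norm y" using B u k norm_snd_le[of "snd y" "fst y"] by (intro mult_mono) auto
    finally show ?thesis by (simp add: algebra_simps)
  qed
  then show thesis using that[of "b - a + B"] B(1) ab by auto
qed

text \<open>The entropy inequality of \<open>v\<close> is tested with a cutoff of width
  \<open>e n\<close> behind the front. The derivative of the cutoff acts as an approximate delta on
  the front; the vanishing oscillation and the Lipschitz bound of \<open>front_flux\<close> identify
  its limit as the flux of \<open>g\<close>.\<close>

lemma behind_entropy:
  fixes \<Omega> :: "'a set" and \<Delta> :: real and \<phi> :: "real \<times> 'a \<Rightarrow> real" and D :: "real \<times> 'a \<Rightarrow> real \<times> 'a"
  defines "\<phi>' \<equiv> \<lambda>z. if z \<in> {0..} \<times> \<Omega> then \<phi> z else 0" and "D' \<equiv> \<lambda>z. if z \<in> {0..} \<times> \<Omega> then D z else 0"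
  assumes \<Omega>: "open \<Omega>" and T: "test_function ({0..} \<times> \<Omega>) \<phi> D"
    and pos: "\<And>x. x \<in> \<Omega> \<Longrightarrow> 0 < \<theta> x" "\<And>x. x \<in> \<Omega> \<Longrightarrow> 0 < \<theta> x + \<Delta>"
    and ent: "\<And>\<phi> D. test_function ({0<..} \<times> \<Omega>) \<phi> D \<Longrightarrow> 0 \<le> kruzhkov_integral f \<Omega> v k D"
    and Vm [measurable]: "V \<in> borel_measurable borel" and VI: "\<And>z. V z \<in> {a..b}"
    and vV: "AE z in lborel. z \<in> {0<..} \<times> \<Omega> \<longrightarrow> v (fst z) (snd z) = V (fst z - \<Delta>, snd z)"
    and gV: "\<And>x. x \<in> \<Omega> \<Longrightarrow> g x = V (\<theta> x, x)"
    and e: "\<And>n. 0 < e n" "e \<longlonglongrightarrow> 0" and osc: "\<And>R. (\<lambda>n. front_osc V p R (e n) q) \<longlonglongrightarrow> 0"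
    and k: "k \<in> {a..b}"
  shows "0 \<le> (\<integral>z. (if \<theta> (snd z) < fst z then kr f k (V z) (D' z) else 0) \<partial>lborel) - (\<integral>x. \<phi>' (\<theta> x, x) * front_flux k (g x) \<partial>lborel)"
proof -
  have T': "test_function ({0..} \<times> UNIV) \<phi>' D'"
    unfolding \<phi>'_def D'_def by (rule test_function_extend[OF \<Omega> T])
  obtain R C where R: "0 < R" and C: "0 < C" and supp: "\<And>z. 0 \<le> fst z \<Longrightarrow> R < norm z \<Longrightarrow> \<phi>' z = 0"
    and D0: "\<And>z. 0 \<le> fst z \<Longrightarrow> R < norm z \<Longrightarrow> D' z = 0"
    and pos': "\<And>z. 0 \<le> fst z \<Longrightarrow> 0 \<le> \<phi>' z" and \<phi>C: "\<And>z. 0 \<le> fst z \<Longrightarrow> \<phi>' z \<le> C"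
    and DC: "\<And>z. 0 \<le> fst z \<Longrightarrow> norm (D' z) \<le> C"
    and lip: "\<And>z z'. 0 \<le> fst z \<Longrightarrow> 0 \<le> fst z' \<Longrightarrow> \<bar>\<phi>' z - \<phi>' z'\<bar> \<le> C * norm (z - z')"
    by (rule test_function_halfspace_bounds[OF T']) blast
  have ext: "(\<lambda>z. if 0 \<le> fst z then \<phi>' z else 0) = \<phi>'" "(\<lambda>z. if 0 \<le> fst z then D' z else 0) = D'"
    by (auto simp: \<phi>'_def D'_def fun_eq_iff)
  have [measurable]: "\<phi>' \<in> borel_measurable borel" "D' \<in> borel_measurable borel"
    using test_function_measurable[OF T'] unfolding ext by auto
  have neg: "\<phi>' z = 0" "D' z = 0" if "fst z < 0" for z using that by (auto simp: \<phi>'_def D'_def)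
  have out: "\<phi>' z = 0" "D' z = 0" if "snd z \<notin> \<Omega>" for z using that by (auto simp: \<phi>'_def D'_def)
  have \<phi>R: "\<phi>' z = 0" and DR: "D' z = 0" if "R < norm z" for z
    using supp[of z] D0[of z] neg[of z] that by (cases "0 \<le> fst z"; simp)+
  have \<phi>A: "\<bar>\<phi>' z\<bar> \<le> C" and DA: "norm (D' z) \<le> C" for z
    using pos'[of z] \<phi>C[of z] DC[of z] neg[of z] C by (cases "0 \<le> fst z"; simp)+
  obtain B where B: "0 \<le> B" "\<And>u k y. u \<in> {a..b} \<Longrightarrow> k \<in> {a..b} \<Longrightarrow> \<bar>kr f k u y\<bar> \<le> B * norm y"
    by (rule kr_bounded) blast
  have krC: "\<bar>kr f k (V z) (D' z)\<bar> \<le> B * C" for z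
    using order_trans[OF B(2)[OF VI k] mult_left_mono[OF DA B(1)]] .
  \<comment> \<open>\<open>X1\<close> carries the gradient of the test function and
    \<open>X2\<close> that of the cutoff. \<open>Y\<close> is \<open>X2\<close> after the shear,
    which cancels the factor \<open>1 / e n\<close>.\<close>
  define X1 where "X1 n z = ramp ((fst z - \<theta> (snd z)) / e n) * kr f k (V z) (D' z)" for n z
  define X2 where "X2 n z = \<phi>' z * tent ((fst z - \<theta> (snd z)) / e n) / e n * front_flux k (V z)" for n z
  define Y where "Y n z = \<phi>' (\<theta> (snd z) + e n * fst z, snd z) * tent (fst z) * front_flux k (V (\<theta> (snd z) + e n * fst z, snd z))" for n and z :: "real \<times> 'a"
  have [measurable]: "X1 n \<in> borel_measurable borel" "X2 n \<in> borel_measurable borel" "Y n \<in> borel_measurable borel" for n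
    unfolding X1_def X2_def Y_def by measurable
  have X1C: "\<bar>X1 n z\<bar> \<le> B * C" for n z
  proof -
    have "\<bar>X1 n z\<bar> \<le> 1 * (B * C)" unfolding X1_def abs_mult using ramp_bounds krC by (intro mult_mono) auto
    then show ?thesis by simp
  qed
  have X1R: "X1 n z = 0" if "R < norm z" for n z using DR[OF that] by (simp add: X1_def)
  have i1: "integrable lborel (X1 n)" for n
    by (rule integrable_bounded_support[OF _ X1C X1R]) measurable
  have X2C: "\<bar>X2 n z\<bar> \<le> C * 2 / e n * (N * (b - a))" for n z
  proof -
    let ?r = "(fst z - \<theta> (snd z)) / e n"
    have "\<bar>\<phi>' z\<bar> * \<bar>tent ?r\<bar> \<le> C * 2" using tent_bounds \<phi>A C by (intro mult_mono) auto
    then have "\<bar>\<phi>' z * tent ?r / e n\<bar> \<le> C * 2 / e n"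
      using e(1)[of n] by (simp add: abs_mult divide_right_mono)
    then show ?thesis
      unfolding X2_def abs_mult[of _ "front_flux k (V z)"] using front_flux_bound[OF VI k] C e(1)[of n] by (intro mult_mono) auto
  qed
  have X2R: "X2 n z = 0" if "R < norm z" for n z using \<phi>R[OF that] by (simp add: X2_def)
  have i2: "integrable lborel (X2 n)" for n
    by (rule integrable_bounded_support[OF _ X2C X2R]) measurable
  have X2Y: "integral\<^sup>L lborel (X2 n) = integral\<^sup>L lborel (Y n)" for n
  proof -
    have "integral\<^sup>L lborel (X2 n) = e n * (\<integral>z. X2 n (\<theta> (snd z) + e n * fst z, snd z) \<partial>lborel)"
      by (rule integral_shear[OF _ _ e(1)]) measurable
    also have "\<dots> = (\<integral>z. e n * X2 n (\<theta> (snd z) + e n * fst z, snd z) \<partial>lborel)" by simp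
    also have "(\<lambda>z. e n * X2 n (\<theta> (snd z) + e n * fst z, snd z)) = Y n"
      using e(1)[of n] by (auto simp: X2_def Y_def fun_eq_iff)
    finally show ?thesis .
  qed
  have main: "0 \<le> integral\<^sup>L lborel (X1 n) - integral\<^sup>L lborel (Y n)" for n
  proof -
    let ?\<rho> = "\<lambda>z :: real \<times> 'a. (fst z - \<Delta> - (p \<bullet> snd z + q)) / e n"
    let ?Dt = "\<lambda>z. ramp (?\<rho> z) *\<^sub>R D (fst z - \<Delta>, snd z) + (\<phi> (fst z - \<Delta>, snd z) * tent (?\<rho> z) / e n) *\<^sub>R (1, - p)"
    let ?Db = "\<lambda>z. ramp (?\<rho> z) *\<^sub>R D' (fst z - \<Delta>, snd z) + (\<phi>' (fst z - \<Delta>, snd z) * tent (?\<rho> z) / e n) *\<^sub>R (1, - p)"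
    have "test_function ({0<..} \<times> \<Omega>) (\<lambda>z. \<phi> (fst z - \<Delta>, snd z) * ramp (?\<rho> z)) ?Dt"
      by (rule cutoff_test_function[OF \<Omega> e(1) T]) (use pos in \<open>auto simp: \<theta>_def\<close>)
    from ent[OF this] have "0 \<le> kruzhkov_integral f \<Omega> v k ?Dt" .
    also have "\<dots> = (\<integral>z. (if z \<in> {0<..} \<times> \<Omega> then kr f k (V (fst z - \<Delta>, snd z)) (?Db z) else 0) \<partial>lborel)"
    proof (rule kruzhkov_lborel[OF \<Omega> f_meas _ _ vV])
      fix z :: "real \<times> 'a" assume z: "z \<in> {0<..} \<times> \<Omega>"
      show "?Db z = ?Dt z"
      proof (cases "0 \<le> fst z - \<Delta>")
        case True
        then show ?thesis using z by (auto simp: \<phi>'_def D'_def)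
      next
        case False
        then have "?\<rho> z < 0" using pos(1)[of "snd z"] z e(1)[of n] by (auto simp: divide_less_0_iff \<theta>_def)
        then have "ramp (?\<rho> z) = 0" "tent (?\<rho> z) = 0" by (auto simp: ramp_simps tent_zero)
        then show ?thesis by simp
      qed
    qed measurable
    also have "\<dots> = 1 * (\<integral>z. (if (\<Delta> + 1 * fst z, snd z) \<in> {0<..} \<times> \<Omega> then kr f k (V (fst (\<Delta> + 1 * fst z, snd z) - \<Delta>, snd (\<Delta> + 1 * fst z, snd z))) (?Db (\<Delta> + 1 * fst z, snd z)) else 0) \<partial>lborel)"
    proof (rule integral_shear)
      have [measurable]: "{0::real<..} \<times> \<Omega> \<in> sets borel" using \<Omega> by (intro borel_open open_Times) auto
      show "(\<lambda>z. if z \<in> {0<..} \<times> \<Omega> then kr f k (V (fst z - \<Delta>, snd z)) (?Db z) else 0) \<in> borel_measurable borel"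
        by measurable
    qed auto
    also have "\<dots> = (\<integral>z. X1 n z - X2 n z \<partial>lborel)"
      unfolding mult_1
    proof (rule Bochner_Integration.integral_cong[OF refl])
      fix z :: "real \<times> 'a"
      obtain t x where z: "z = (t, x)" by (cases z)
      let ?r = "(t - \<theta> x) / e n"
      have x: "kr f k (V z) (ramp ?r *\<^sub>R D' z + (\<phi>' z * tent ?r / e n) *\<^sub>R (1, - p)) = X1 n z - X2 n z"
        unfolding kr_combination X1_def X2_def front_flux_def z by simp
      have "X1 n z - X2 n z = 0" if "\<not> (0 < \<Delta> + t \<and> x \<in> \<Omega>)"
      proof (cases "x \<in> \<Omega>")
        case True
        then have "?r < 0" using that pos(2)[OF True] e(1)[of n] by (auto simp: divide_less_0_iff)
        then have "ramp ?r = 0" "tent ?r = 0" by (auto simp: ramp_simps tent_zero)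
        then show ?thesis by (simp add: X1_def X2_def z)
      next
        case False
        then show ?thesis using out[of z] by (simp add: X1_def X2_def z)
      qed
      then show "(if (\<Delta> + fst z, snd z) \<in> {0<..} \<times> \<Omega> then kr f k (V (fst (\<Delta> + fst z, snd z) - \<Delta>, snd (\<Delta> + fst z, snd z))) (?Db (\<Delta> + fst z, snd z)) else 0) = X1 n z - X2 n z"
        using x by (auto simp: z \<theta>_def)
    qed
    also have "\<dots> = integral\<^sup>L lborel (X1 n) - integral\<^sup>L lborel (Y n)"
      using i1 i2 by (simp add: X2Y)
    finally show ?thesis .
  qed
  let ?L1 = "\<lambda>z. if \<theta> (snd z) < fst z then kr f k (V z) (D' z) else 0"
  have lim1: "(\<lambda>n. integral\<^sup>L lborel (X1 n)) \<longlonglongrightarrow> integral\<^sup>L lborel ?L1"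
  proof (rule integral_tendsto_bounded_support[OF _ _ X1C X1R])
    show "AE z in lborel. (\<lambda>n. X1 n z) \<longlonglongrightarrow> ?L1 z"
    proof (rule AE_I2)
      fix z :: "real \<times> 'a"
      show "(\<lambda>n. X1 n z) \<longlonglongrightarrow> ?L1 z"
      proof (cases "\<theta> (snd z) < fst z")
        case True
        have "\<forall>\<^sub>F n in sequentially. e n < fst z - \<theta> (snd z)"
          by (rule order_tendstoD(2)[OF e(2)]) (use True in simp)
        then have "\<forall>\<^sub>F n in sequentially. X1 n z = ?L1 z"
        proof eventually_elim
          case (elim n)
          then have "1 \<le> (fst z - \<theta> (snd z)) / e n" using e(1)[of n] by simp
          then show ?case using True by (simp add: X1_def ramp_simps)
        qed
        then show ?thesis by (rule tendsto_eventually)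
      next
        case False
        then have "(fst z - \<theta> (snd z)) / e n \<le> 0" for n using e(1)[of n] by (simp add: divide_le_0_iff)
        then show ?thesis using False by (simp add: X1_def ramp_simps)
      qed
    qed
  qed measurable
  \<comment> \<open>\<open>Y\<close> with the value of \<open>V\<close> frozen on the front, so that
    only the Lipschitz test function still varies with \<open>n\<close>; the price of freezing is
    estimated in \<open>limY\<close>.\<close>
  define A where "A n z = \<phi>' (\<theta> (snd z) + e n * fst z, snd z) * tent (fst z) * front_flux k (g (snd z))" for n and z :: "real \<times> 'a"
  define L2 where "L2 z = \<phi>' (\<theta> (snd z), snd z) * tent (fst z) * front_flux k (g (snd z))" for z :: "real \<times> 'a"
  have [measurable]: "A n \<in> borel_measurable borel" "L2 \<in> borel_measurable borel" for n
    unfolding A_def L2_def by measurable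
  have far: "\<phi>' (t, x) * tent s = 0" if "R + 1 < norm (s, x)" for t s x
  proof (cases "s \<in> {0..1}")
    case True
    then have "R < norm x" using that norm_Pair_le[of s x] by auto
    then have "R < norm (t, x)" using norm_snd_le[of x t] by simp
    then show ?thesis using \<phi>R by simp
  qed (auto simp: tent_zero)
  have bd: "\<bar>\<phi>' w * tent s * front_flux k u\<bar> \<le> C * 2 * (N * (b - a))" if "u \<in> {a..b}" for w s u
    unfolding abs_mult using \<phi>A tent_bounds front_flux_bound[OF that k] C by (intro mult_mono) auto
  have iA: "integrable lborel (A n)" and iY: "integrable lborel (Y n)" for n
    by (rule integrable_bounded_support[where C="C * 2 * (N * (b - a))" and R="R + 1"];
        use bd g_range VI far in \<open>auto simp: A_def Y_def\<close>)+
  have limA: "(\<lambda>n. integral\<^sup>L lborel (A n)) \<longlonglongrightarrow> integral\<^sup>L lborel L2"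
  proof (rule integral_tendsto_bounded_support[where C="C * 2 * (N * (b - a))" and R="R + 1"])
    show "AE z in lborel. (\<lambda>n. A n z) \<longlonglongrightarrow> L2 z"
    proof (rule AE_I2)
      fix z :: "real \<times> 'a"
      obtain s x where z: "z = (s, x)" by (cases z)
      show "(\<lambda>n. A n z) \<longlonglongrightarrow> L2 z"
      proof (cases "x \<in> \<Omega> \<and> 0 \<le> s \<and> s \<le> 1")
        case True
        have tp: "0 < \<theta> x" using pos(1) True by simp
        have "(\<lambda>n. \<phi>' (\<theta> x + e n * s, x) - \<phi>' (\<theta> x, x)) \<longlonglongrightarrow> 0"
        proof (rule Lim_null_comparison)
          show "\<forall>\<^sub>F n in sequentially. norm (\<phi>' (\<theta> x + e n * s, x) - \<phi>' (\<theta> x, x)) \<le> C * (e n * s)"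
          proof (rule always_eventually, rule allI)
            fix n
            have "0 \<le> e n * s" using e(1)[of n] True by simp
            then show "norm (\<phi>' (\<theta> x + e n * s, x) - \<phi>' (\<theta> x, x)) \<le> C * (e n * s)"
              using lip[of "(\<theta> x + e n * s, x)" "(\<theta> x, x)"] tp by (simp add: norm_Pair)
          qed
          have "(\<lambda>n. C * (e n * s)) \<longlonglongrightarrow> C * (0 * s)" by (intro tendsto_intros e)
          then show "(\<lambda>n. C * (e n * s)) \<longlonglongrightarrow> 0" by simp
        qed
        then have "(\<lambda>n. \<phi>' (\<theta> x + e n * s, x)) \<longlonglongrightarrow> \<phi>' (\<theta> x, x)" by (simp add: LIM_zero_iff)
        then show ?thesis unfolding A_def L2_def z by (auto intro!: tendsto_intros)
      next
        case False
        then have "A n z = 0" "L2 z = 0" for n using out tent_zero[of s] by (auto simp: A_def L2_def z)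
        then show ?thesis by simp
      qed
    qed
  qed (use bd g_range far in \<open>auto simp: A_def\<close>)
  have limY: "(\<lambda>n. integral\<^sup>L lborel (Y n) - integral\<^sup>L lborel (A n)) \<longlonglongrightarrow> 0"
  proof -
    \<comment> \<open>The constant combines the bound \<open>C\<close> of the test function, the
      bound 2 of \<open>tent\<close> and the Lipschitz constant \<open>N\<close> of
      \<open>front_flux\<close>.\<close>
    have est: "ennreal \<bar>integral\<^sup>L lborel (Y n) - integral\<^sup>L lborel (A n)\<bar> \<le> ennreal (C * 2 * N) * front_osc V p R (e n) q" for n
    proof -
      let ?I = "\<lambda>z :: 'a \<times> real. indicator (cball 0 R \<times> {0..1}) z * ennreal \<bar>V (p \<bullet> fst z + q + e n * snd z, fst z) - V (p \<bullet> fst z + q, fst z)\<bar>"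
      have [measurable]: "cball (0::'a) R \<times> {0..1::real} \<in> sets borel" by (intro borel_closed closed_Times) auto
      have "integral\<^sup>L lborel (Y n) - integral\<^sup>L lborel (A n) = (\<integral>z. Y n z - A n z \<partial>lborel)"
        using iA iY by simp
      then have "ennreal \<bar>integral\<^sup>L lborel (Y n) - integral\<^sup>L lborel (A n)\<bar> \<le> (\<integral>\<^sup>+z. ennreal \<bar>Y n z - A n z\<bar> \<partial>lborel)"
        using ennreal_abs_integral_le[OF Bochner_Integration.integrable_diff[OF iY iA], of n n] by simp
      also have "\<dots> \<le> (\<integral>\<^sup>+z. ennreal (C * 2 * N) * ?I (snd z, fst z) \<partial>lborel)"
      proof (rule nn_integral_mono)
        fix z :: "real \<times> 'a"
        obtain s x where z: "z = (s, x)" by (cases z)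
        let ?V = "V (\<theta> x + e n * s, x)" and ?ph = "\<phi>' (\<theta> x + e n * s, x)"
        have eq: "Y n z - A n z = ?ph * tent s * (front_flux k ?V - front_flux k (g x))"
          by (simp add: Y_def A_def z algebra_simps)
        show "ennreal \<bar>Y n z - A n z\<bar> \<le> ennreal (C * 2 * N) * ?I (snd z, fst z)"
        proof (cases "norm x \<le> R \<and> s \<in> {0..1} \<and> x \<in> \<Omega>")
          case True
          have "\<bar>Y n z - A n z\<bar> \<le> C * 2 * (N * \<bar>?V - g x\<bar>)"
            unfolding eq abs_mult using \<phi>A tent_bounds front_flux_lipschitz[OF VI g_range k] C
            by (intro mult_mono) auto
          then have "ennreal \<bar>Y n z - A n z\<bar> \<le> ennreal (C * 2 * N * \<bar>?V - g x\<bar>)"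
            by (intro ennreal_leI) (simp add: mult.assoc)
          also have "\<dots> = ennreal (C * 2 * N) * ennreal \<bar>?V - g x\<bar>"
            using C N_nonneg by (intro ennreal_mult) auto
          finally show ?thesis using True by (simp add: z gV \<theta>_def)
        next
          case False
          have "?ph * tent s = 0"
          proof (cases "norm x \<le> R")
            case x: True
            show ?thesis
            proof (cases "x \<in> \<Omega>")
              case True
              then show ?thesis using x False tent_zero[of s] by auto
            next
              case False
              then show ?thesis using out by simp
            qed
          next
            case False
            then have "R < norm (\<theta> x + e n * s, x)" using norm_snd_le[of x "\<theta> x + e n * s"] by simp
            then show ?thesis using \<phi>R by simp
          qed
          then have "Y n z - A n z = 0" unfolding eq by (simp only: mult_zero_left)
          then show ?thesis by simp
        qed
      qed
      also have "\<dots> = ennreal (C * 2 * N) * (\<integral>\<^sup>+z. ?I (snd z, fst z) \<partial>(lborel :: (real \<times> 'a) measure))"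
        by (rule nn_integral_cmult) measurable
      also have "(\<integral>\<^sup>+z. ?I (snd z, fst z) \<partial>(lborel :: (real \<times> 'a) measure)) = (\<integral>\<^sup>+s. \<integral>\<^sup>+x. ?I (x, s) \<partial>lborel \<partial>lborel)"
        by (subst nn_integral_spacetime) auto
      also have "\<dots> = (\<integral>\<^sup>+x. \<integral>\<^sup>+s. ?I (x, s) \<partial>lborel \<partial>lborel)"
        by (rule lborel_pair.Fubini') measurable
      also have "\<dots> = (\<integral>\<^sup>+z. ?I z \<partial>lborel)"
        by (rule nn_integral_spacetime[symmetric]) measurable
      finally show ?thesis unfolding front_osc_def .
    qed
    have "(\<lambda>n. ennreal (C * 2 * N) * front_osc V p R (e n) q) \<longlonglongrightarrow> ennreal (C * 2 * N) * 0"
      by (rule ennreal_tendsto_cmult[OF _ osc]) simp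
    then have up: "(\<lambda>n. ennreal (C * 2 * N) * front_osc V p R (e n) q) \<longlonglongrightarrow> 0" by simp
    have "(\<lambda>n. ennreal \<bar>integral\<^sup>L lborel (Y n) - integral\<^sup>L lborel (A n)\<bar>) \<longlonglongrightarrow> ennreal 0"
      unfolding ennreal_0
      by (rule tendsto_sandwich[OF always_eventually always_eventually tendsto_const up]) (use est in simp_all)
    then have "(\<lambda>n. \<bar>integral\<^sup>L lborel (Y n) - integral\<^sup>L lborel (A n)\<bar>) \<longlonglongrightarrow> 0"
      by (subst (asm) tendsto_ennreal_iff) auto
    then show ?thesis by (rule tendsto_rabs_zero_cancel)
  qed
  have L2i: "integral\<^sup>L lborel L2 = (\<integral>x. \<phi>' (\<theta> x, x) * front_flux k (g x) \<partial>lborel)"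
  proof -
    have "integral\<^sup>L lborel L2 = (\<integral>x. \<integral>s. L2 (s, x) \<partial>lborel \<partial>lborel)"
      by (rule integral_pair(2)[where C="C * 2 * (N * (b - a))" and R="R + 1"])
         (use bd g_range far in \<open>auto simp: L2_def\<close>)
    also have "\<dots> = (\<integral>x. \<phi>' (\<theta> x, x) * front_flux k (g x) \<partial>lborel)"
    proof (rule Bochner_Integration.integral_cong[OF refl])
      fix x
      have "(\<integral>s. L2 (s, x) \<partial>lborel) = (\<integral>s. tent s * (\<phi>' (\<theta> x, x) * front_flux k (g x)) \<partial>lborel)"
        by (intro Bochner_Integration.integral_cong) (auto simp: L2_def)
      also have "\<dots> = \<phi>' (\<theta> x, x) * front_flux k (g x)" by (simp add: integral_tent)
      finally show "(\<integral>s. L2 (s, x) \<partial>lborel) = \<phi>' (\<theta> x, x) * front_flux k (g x)" .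
    qed
    finally show ?thesis .
  qed
  from tendsto_add[OF limY limA] have "(\<lambda>n. integral\<^sup>L lborel (Y n)) \<longlonglongrightarrow> integral\<^sup>L lborel L2" by simp
  from tendsto_diff[OF lim1 this] have "0 \<le> integral\<^sup>L lborel ?L1 - integral\<^sup>L lborel L2"
    by (rule LIMSEQ_le_const) (use main in auto)
  then show ?thesis by (simp only: L2i)
qed

end

section \<open>Gluing along the front\<close>

text \<open>For a given \<open>j\<close> only the finitely many functions \<open>G i\<close> with
  \<open>i \<le> j\<close> on a compact set matter, so the least of their moduli of uniform
  continuity is positive.\<close>

lemma fine_steps_exist:
  fixes G :: "nat \<Rightarrow> real \<times> 'a::euclidean_space \<Rightarrow> real"
  assumes G: "\<And>j. continuous_on UNIV (G j)" and N: "0 \<le> N"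
  obtains h :: "nat \<Rightarrow> real" where "\<And>j. 0 < h j" "\<And>j. h j \<le> 1 / (real j + 1)"
    "\<And>i j x r. i \<le> j \<Longrightarrow> norm x \<le> real j \<Longrightarrow> 0 \<le> r \<Longrightarrow> r \<le> h j * N \<Longrightarrow>
      \<bar>G i (p \<bullet> x + q + r, x) - G i (p \<bullet> x + q, x)\<bar> \<le> 1 / (real j + 1)"
proof -
  have step: "\<exists>d>0. \<forall>x r. norm x \<le> real j \<longrightarrow> 0 \<le> r \<longrightarrow> r \<le> d \<longrightarrow> \<bar>G i (p \<bullet> x + q + r, x) - G i (p \<bullet> x + q, x)\<bar> \<le> 1 / (real j + 1)" for i j
  proof -
    define R where "R = (norm p + 1) * real j + \<bar>q\<bar> + 1"
    have "uniformly_continuous_on (cball 0 R) (G i)"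
      by (rule compact_uniformly_continuous[OF continuous_on_subset[OF G subset_UNIV] compact_cball])
    then have "\<forall>e>0. \<exists>d>0. \<forall>x\<in>cball 0 R. \<forall>x'\<in>cball 0 R. dist x' x < d \<longrightarrow> dist (G i x') (G i x) < e"
      by (simp only: uniformly_continuous_on_def)
    moreover have "0 < 1 / (real j + 1)" by simp
    ultimately obtain d where d: "0 < d" "\<forall>x\<in>cball 0 R. \<forall>x'\<in>cball 0 R. dist x' x < d \<longrightarrow> dist (G i x') (G i x) < 1 / (real j + 1)"
      by blast
    show ?thesis
    proof (intro exI[of _ "min 1 (d / 2)"] conjI allI impI)
      show "0 < min 1 (d / 2)" using d by simp
      fix x :: 'a and r :: real assume x: "norm x \<le> real j" and r: "0 \<le> r" "r \<le> min 1 (d / 2)"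
      have "\<bar>p \<bullet> x\<bar> \<le> norm p * norm x" by (rule Cauchy_Schwarz_ineq2)
      also have "\<dots> \<le> norm p * real j" using x by (intro mult_left_mono) auto
      finally have px: "\<bar>p \<bullet> x\<bar> \<le> norm p * real j" .
      have in1: "(p \<bullet> x + q + s, x) \<in> cball 0 R" if "0 \<le> s" "s \<le> 1" for s
        using norm_Pair_le[of "p \<bullet> x + q + s" x] px x that by (simp add: R_def algebra_simps)
      have "dist (p \<bullet> x + q + r, x) (p \<bullet> x + q, x) = \<bar>r\<bar>" by (simp add: dist_Pair_Pair dist_real_def)
      also have "\<dots> < d" using r d by simp
      finally have "dist (G i (p \<bullet> x + q + r, x)) (G i (p \<bullet> x + q, x)) < 1 / (real j + 1)"
        using d(2) in1[of 0] in1[of r] r by auto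
      then show "\<bar>G i (p \<bullet> x + q + r, x) - G i (p \<bullet> x + q, x)\<bar> \<le> 1 / (real j + 1)"
        by (simp add: dist_real_def)
    qed
  qed
  have "\<forall>ij. \<exists>d>0. \<forall>x r. norm x \<le> real (snd ij) \<longrightarrow> 0 \<le> r \<longrightarrow> r \<le> d \<longrightarrow> \<bar>G (fst ij) (p \<bullet> x + q + r, x) - G (fst ij) (p \<bullet> x + q, x)\<bar> \<le> 1 / (real (snd ij) + 1)"
    using step by blast
  from choice[OF this] obtain d0 where d0: "\<And>ij. 0 < d0 ij \<and> (\<forall>x r. norm x \<le> real (snd ij) \<longrightarrow> 0 \<le> r \<longrightarrow> r \<le> d0 ij \<longrightarrow> \<bar>G (fst ij) (p \<bullet> x + q + r, x) - G (fst ij) (p \<bullet> x + q, x)\<bar> \<le> 1 / (real (snd ij) + 1))"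
    by blast
  define d where "d i j = d0 (i, j)" for i j
  have d: "0 < d i j" "\<And>x r. norm x \<le> real j \<Longrightarrow> 0 \<le> r \<Longrightarrow> r \<le> d i j \<Longrightarrow> \<bar>G i (p \<bullet> x + q + r, x) - G i (p \<bullet> x + q, x)\<bar> \<le> 1 / (real j + 1)" for i j
    using d0[of "(i, j)"] by (auto simp: d_def)
  define m where "m j = Min ((\<lambda>i. d i j) ` {..j})" for j
  have m: "0 < m j" "i \<le> j \<Longrightarrow> m j \<le> d i j" for i j
    unfolding m_def by (auto simp: d)
  \<comment> \<open>Division by \<open>N + 1\<close> rather than \<open>N\<close> covers the case
    \<open>N = 0\<close>.\<close>
  define h where "h j = min (1 / (real j + 1)) (m j / (N + 1))" for j
  have h0: "0 < h j" for j using m(1)[of j] N by (simp add: h_def)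
  show thesis
  proof
    show "0 < h j" for j by (rule h0)
    show "h j \<le> 1 / (real j + 1)" for j by (simp add: h_def)
    fix i j :: nat and x :: 'a and r :: real
    assume ij: "i \<le> j" and x: "norm x \<le> real j" and r: "0 \<le> r" "r \<le> h j * N"
    have "h j * N \<le> h j * (N + 1)" using h0[of j] by simp
    also have "\<dots> \<le> m j / (N + 1) * (N + 1)" using N by (intro mult_right_mono) (auto simp: h_def)
    also have "\<dots> = m j" using N by simp
    also have "\<dots> \<le> d i j" by (rule m(2)[OF ij])
    finally have "r \<le> d i j" using r(2) by simp
    then show "\<bar>G i (p \<bullet> x + q + r, x) - G i (p \<bullet> x + q, x)\<bar> \<le> 1 / (real j + 1)"
      by (rule d(2)[OF x r(1)])
  qed
qed

text \<open>Constants \<open>k\<close> outside \<open>I\<close> change the entropy inequality only by an exact divergence.\<close>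

lemma test_function_divergence:
  fixes \<phi> :: "real \<times> 'a::euclidean_space \<Rightarrow> real"
  assumes T: "test_function ({0..} \<times> UNIV) \<phi> D" and y: "0 \<le> fst y"
  shows "(\<integral>z. (if 0 < fst z then D z \<bullet> y else 0) \<partial>lborel) + fst y * (\<integral>x. \<phi> (0, x) \<partial>lborel) = 0"
proof -
  obtain R C where R: "0 < R" and C: "0 < C" and supp: "\<And>z. 0 \<le> fst z \<Longrightarrow> R < norm z \<Longrightarrow> \<phi> z = 0"
    and D0: "\<And>z. 0 \<le> fst z \<Longrightarrow> R < norm z \<Longrightarrow> D z = 0"
    and pos: "\<And>z. 0 \<le> fst z \<Longrightarrow> 0 \<le> \<phi> z" and \<phi>C: "\<And>z. 0 \<le> fst z \<Longrightarrow> \<phi> z \<le> C"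
    and DC: "\<And>z. 0 \<le> fst z \<Longrightarrow> norm (D z) \<le> C"
    and lip: "\<And>z z'. 0 \<le> fst z \<Longrightarrow> 0 \<le> fst z' \<Longrightarrow> \<bar>\<phi> z - \<phi> z'\<bar> \<le> C * norm (z - z')"
    by (rule test_function_halfspace_bounds[OF T]) blast
  define \<phi>' where "\<phi>' z = (if 0 \<le> fst z then \<phi> z else 0)" for z
  define D' where "D' z = (if 0 \<le> fst z then D z else 0)" for z
  have [measurable]: "\<phi>' \<in> borel_measurable borel" "D' \<in> borel_measurable borel"
    using test_function_measurable[OF T] unfolding \<phi>'_def[abs_def] D'_def[abs_def] by auto
  have \<phi>A: "\<bar>\<phi>' z\<bar> \<le> C" and \<phi>R: "R < norm z \<Longrightarrow> \<phi>' z = 0" for z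
    using pos \<phi>C supp C by (auto simp: \<phi>'_def)
  define e where "e n = inverse (real (Suc n))" for n
  have e: "0 < e n" "e n \<le> 1" "e \<longlonglongrightarrow> 0" for n
  proof -
    show "0 < e n" "e n \<le> 1" by (auto simp: e_def inverse_le_1_iff)
    show "e \<longlonglongrightarrow> 0" unfolding e_def[abs_def] by (rule LIMSEQ_inverse_real_of_nat)
  qed
  let ?y1 = "fst y"
  \<comment> \<open>A difference quotient along the constant vector \<open>y\<close>;
    \<open>0 \<le> fst y\<close> keeps the translated point in the half-space. \<open>P\<close> is
    the slab near time 0 that the translated half-space misses, rescaled in time by
    \<open>e n\<close>.\<close>
  define Q where "Q n z = (if 0 < fst z then (\<phi>' (z + e n *\<^sub>R y) - \<phi>' z) / e n else 0)" for n z
  define P where "P n z = (if 0 < fst z \<and> fst z \<le> ?y1 then \<phi>' (e n * fst z, snd z) else 0)" for n z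
  have [measurable]: "Q n \<in> borel_measurable borel" "P n \<in> borel_measurable borel" for n
    unfolding Q_def P_def by measurable
  have limQ: "(\<lambda>n. integral\<^sup>L lborel (Q n)) \<longlonglongrightarrow> (\<integral>z. (if 0 < fst z then D' z \<bullet> y else 0) \<partial>lborel)"
  proof (rule integral_tendsto_bounded_support[where C="C * norm y" and R="R + norm y"])
    fix n and z :: "real \<times> 'a"
    show "\<bar>Q n z\<bar> \<le> C * norm y"
    proof (cases "0 < fst z")
      case True
      then have "0 \<le> fst (z + e n *\<^sub>R y)" using y e(1)[of n] by simp
      then have "\<bar>\<phi>' (z + e n *\<^sub>R y) - \<phi>' z\<bar> \<le> C * (e n * norm y)"
        using lip[of "z + e n *\<^sub>R y" z] True e(1)[of n] by (simp add: \<phi>'_def)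
      then show ?thesis using True e(1)[of n] by (simp add: Q_def field_simps)
    qed (use C in \<open>simp add: Q_def\<close>)
    show "Q n z = 0" if "R + norm y < norm z"
    proof -
      have "norm (e n *\<^sub>R y) \<le> 1 * norm y" using e(2)[of n] e(1)[of n] by (auto simp: mult_left_le_one_le)
      then have "R < norm (z + e n *\<^sub>R y)" using that norm_triangle_ineq4[of "z + e n *\<^sub>R y" "e n *\<^sub>R y"] by simp
      moreover have "R < norm z" using that by (rule le_less_trans[rotated]) simp
      ultimately show ?thesis by (simp add: Q_def \<phi>R)
    qed
  next
    show "AE z in lborel. (\<lambda>n. Q n z) \<longlonglongrightarrow> (if 0 < fst z then D' z \<bullet> y else 0)"
    proof (rule AE_I2)
      fix z :: "real \<times> 'a"
      show "(\<lambda>n. Q n z) \<longlonglongrightarrow> (if 0 < fst z then D' z \<bullet> y else 0)"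
      proof (cases "0 < fst z")
        case True
        have "0 \<le> fst z + e n * fst y" for n using True y e(1)[of n] by simp
        then have "Q n z = (\<phi> (z + e n *\<^sub>R y) - \<phi> z) / e n" for n using True by (simp add: Q_def \<phi>'_def)
        then show ?thesis using test_function_quotient[OF T True e(3) e(1), of y] True by (simp add: D'_def)
      qed (simp add: Q_def)
    qed
  qed measurable
  have limP: "(\<lambda>n. integral\<^sup>L lborel (P n)) \<longlonglongrightarrow> (\<integral>z. (if 0 < fst z \<and> fst z \<le> ?y1 then \<phi>' (0, snd z) else 0) \<partial>lborel)"
  proof (rule integral_tendsto_bounded_support[where C=C and R="R + ?y1"])
    fix n and z :: "real \<times> 'a"
    show "\<bar>P n z\<bar> \<le> C" using \<phi>A C by (simp add: P_def)
    show "P n z = 0" if "R + ?y1 < norm z"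
    proof (cases "0 < fst z \<and> fst z \<le> ?y1")
      case True
      then have "R < norm (snd z)" using that norm_Pair_le[of "fst z" "snd z"] by simp
      then have "R < norm (e n * fst z, snd z)" using norm_snd_le[of "snd z" "e n * fst z"] by simp
      then show ?thesis by (simp add: P_def \<phi>R)
    qed (auto simp: P_def)
  next
    show "AE z in lborel. (\<lambda>n. P n z) \<longlonglongrightarrow> (if 0 < fst z \<and> fst z \<le> ?y1 then \<phi>' (0, snd z) else 0)"
    proof (rule AE_I2)
      fix z :: "real \<times> 'a"
      show "(\<lambda>n. P n z) \<longlonglongrightarrow> (if 0 < fst z \<and> fst z \<le> ?y1 then \<phi>' (0, snd z) else 0)"
      proof (cases "0 < fst z \<and> fst z \<le> ?y1")
        case True
        have "(\<lambda>n. \<phi>' (e n * fst z, snd z) - \<phi>' (0, snd z)) \<longlonglongrightarrow> 0"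
        proof (rule Lim_null_comparison)
          show "\<forall>\<^sub>F n in sequentially. norm (\<phi>' (e n * fst z, snd z) - \<phi>' (0, snd z)) \<le> C * (e n * fst z)"
          proof (rule always_eventually, rule allI)
            fix n
            have "0 \<le> e n * fst z" using e(1)[of n] True by simp
            then show "norm (\<phi>' (e n * fst z, snd z) - \<phi>' (0, snd z)) \<le> C * (e n * fst z)"
              using lip[of "(e n * fst z, snd z)" "(0, snd z)"] by (simp add: \<phi>'_def norm_Pair)
          qed
          have "(\<lambda>n. C * (e n * fst z)) \<longlonglongrightarrow> C * (0 * fst z)" by (intro tendsto_intros e)
          then show "(\<lambda>n. C * (e n * fst z)) \<longlonglongrightarrow> 0" by simp
        qed
        then have "(\<lambda>n. \<phi>' (e n * fst z, snd z)) \<longlonglongrightarrow> \<phi>' (0, snd z)" by (simp add: LIM_zero_iff)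
        then show ?thesis using True by (simp add: P_def)
      next
        case False
        then show ?thesis unfolding P_def by (simp only: if_False tendsto_const)
      qed
    qed
  qed measurable
  have QP: "integral\<^sup>L lborel (Q n) = - integral\<^sup>L lborel (P n)" for n
  proof -
    let ?v = "e n *\<^sub>R y"
    \<comment> \<open>By translation invariance the shifted function has the integral of
      \<open>B\<close>, taken over times beyond \<open>fst ?v\<close>. Compared with
      \<open>A\<close>, only the slab \<open>H\<close> remains, with a negative sign.\<close>
    define A where "A z = (if 0 < fst z then \<phi>' z else 0)" for z
    define B where "B z = (if fst ?v < fst z then \<phi>' z else 0)" for z
    define H where "H z = (if 0 < fst z \<and> fst z \<le> fst ?v then \<phi>' z else 0)" for z
    have [measurable]: "A \<in> borel_measurable borel" "B \<in> borel_measurable borel" "H \<in> borel_measurable borel"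
      unfolding A_def B_def H_def by measurable
    have iA: "integrable lborel A" and iB: "integrable lborel B" and iH: "integrable lborel H"
      by (rule integrable_bounded_support[where C=C and R=R]; use \<phi>A \<phi>R C in \<open>auto simp: A_def B_def H_def\<close>)+
    have v1: "0 \<le> fst ?v" using y e(1)[of n] by simp
    have shift: "(\<integral>z. B (z + ?v) \<partial>lborel) = integral\<^sup>L lborel B" and iB': "integrable lborel (\<lambda>z. B (z + ?v))"
    proof -
      have "integral\<^sup>L lborel B = integral\<^sup>L (distr lborel borel ((+) ?v)) B" by (simp add: lborel_distr_plus)
      also have "\<dots> = (\<integral>z. B (?v + z) \<partial>lborel)" by (rule integral_distr) measurable
      finally show "(\<integral>z. B (z + ?v) \<partial>lborel) = integral\<^sup>L lborel B" by (simp add: add.commute)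
      have "integrable (distr lborel borel ((+) ?v)) B" using iB by (simp add: lborel_distr_plus)
      then show "integrable lborel (\<lambda>z. B (z + ?v))" by (subst (asm) integrable_distr_eq) (auto simp: add.commute)
    qed
    have "Q n z = (B (z + ?v) - A z) / e n" for z
      by (auto simp: Q_def A_def B_def)
    then have "integral\<^sup>L lborel (Q n) = (\<integral>z. (B (z + ?v) - A z) / e n \<partial>lborel)" by (intro Bochner_Integration.integral_cong) auto
    also have "\<dots> = (integral\<^sup>L lborel B - integral\<^sup>L lborel A) / e n" using iB' iA shift by simp
    also have "integral\<^sup>L lborel A = integral\<^sup>L lborel (\<lambda>z. B z + H z)"
      using v1 by (intro Bochner_Integration.integral_cong) (auto simp: A_def B_def H_def)
    also have "\<dots> = integral\<^sup>L lborel B + integral\<^sup>L lborel H" using iB iH by simp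
    also have "integral\<^sup>L lborel H = e n * (\<integral>z. H (0 + e n * fst z, snd z) \<partial>lborel)"
      by (rule integral_shear[of H "\<lambda>_. 0" "e n"]) (use e(1) in auto)
    also have "(\<lambda>z. H (0 + e n * fst z, snd z)) = P n"
      using e(1)[of n] by (auto simp: H_def P_def fun_eq_iff zero_less_mult_iff)
    finally show ?thesis using e(1)[of n] by simp
  qed
  have lim0: "(\<integral>z. (if 0 < fst z \<and> fst z \<le> ?y1 then \<phi>' (0, snd z) else 0) \<partial>lborel) = ?y1 * (\<integral>x. \<phi>' (0, x) \<partial>lborel)"
  proof -
    let ?K = "\<lambda>z. if 0 < fst z \<and> fst z \<le> ?y1 then \<phi>' (0, snd z) else 0"
    have "integral\<^sup>L lborel ?K = (\<integral>x. \<integral>t. ?K (t, x) \<partial>lborel \<partial>lborel)"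
    proof (rule integral_pair(2)[where C=C and R="R + ?y1"])
      fix z :: "real \<times> 'a"
      show "\<bar>?K z\<bar> \<le> C" using \<phi>A C by simp
      show "?K z = 0" if "R + ?y1 < norm z"
      proof (cases "0 < fst z \<and> fst z \<le> ?y1")
        case True
        then have "R < norm (snd z)" using that norm_Pair_le[of "fst z" "snd z"] by simp
        then have "R < norm (0::real, snd z)" by simp
        then show ?thesis by (simp add: \<phi>R)
      qed auto
    qed measurable
    also have "\<dots> = (\<integral>x. ?y1 * \<phi>' (0, x) \<partial>lborel)"
    proof (rule Bochner_Integration.integral_cong[OF refl])
      fix x
      have "(\<integral>t. ?K (t, x) \<partial>lborel) = (\<integral>t. indicator {0<..?y1} t * \<phi>' (0, x) \<partial>lborel)"
        by (intro Bochner_Integration.integral_cong) (auto simp: indicator_def)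
      also have "\<dots> = measure lborel {0<..?y1} * \<phi>' (0, x)" by simp
      finally show "(\<integral>t. ?K (t, x) \<partial>lborel) = ?y1 * \<phi>' (0, x)" using y by simp
    qed
    finally show ?thesis by simp
  qed
  have "(\<lambda>n. integral\<^sup>L lborel (Q n)) \<longlonglongrightarrow> - (?y1 * (\<integral>x. \<phi>' (0, x) \<partial>lborel))"
    using tendsto_minus[OF limP] by (simp only: QP lim0)
  from LIMSEQ_unique[OF limQ this] have "(\<integral>z. (if 0 < fst z then D' z \<bullet> y else 0) \<partial>lborel) = - (?y1 * (\<integral>x. \<phi>' (0, x) \<partial>lborel))" .
  moreover have "(\<lambda>z. if 0 < fst z then D' z \<bullet> y else 0) = (\<lambda>z. if 0 < fst z then D z \<bullet> y else 0)" by (auto simp: D'_def fun_eq_iff)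
  moreover have "(\<lambda>x. \<phi>' (0, x)) = (\<lambda>x. \<phi> (0, x))" by (auto simp: \<phi>'_def fun_eq_iff)
  ultimately show ?thesis by simp
qed

section \<open>The entropy inequality of the glued function\<close>

context flux_approx
begin

lemma front_null: "AE z in lborel. fst z \<noteq> \<theta> (snd z)"
proof -
  have "AE z in (lborel :: (real \<times> 'a) measure). fst z \<noteq> 0"
    by (rule AE_fst) (rule AE_lborel_singleton)
  from AE_shear[OF _ _ this, where \<psi>="\<lambda>x. - \<theta> x" and h=1]
  have "AE z in (lborel :: (real \<times> 'a) measure). - \<theta> (snd z) + 1 * fst z \<noteq> 0" by simp
  then show ?thesis by eventually_elim simp
qed

text \<open>For \<open>u\<close> in {a..b} other than the nearest endpoint, the sign of
  \<open>u - k\<close> agrees with that of \<open>u\<close> minus this endpoint; at the endpoint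
  itself its pairing vanishes. The remainder is thus independent of \<open>u\<close> and linear in
  \<open>y\<close>.\<close>

lemma kr_outside:
  assumes u: "u \<in> {a..b}"
  shows "k < a \<Longrightarrow> kr f k u y = kr f a u y + y \<bullet> (a - k, f a - f k)"
    and "b < k \<Longrightarrow> kr f k u y = kr f b u y + y \<bullet> (k - b, f k - f b)"
proof -
  show "kr f k u y = kr f a u y + y \<bullet> (a - k, f a - f k)" if "k < a"
    using u that by (cases "u = a") (auto simp: kr_def sgn_if inner_prod_def inner_diff_left inner_commute algebra_simps)
  show "kr f k u y = kr f b u y + y \<bullet> (k - b, f k - f b)" if "b < k"
    using u that by (cases "u = b") (auto simp: kr_def sgn_if inner_prod_def inner_diff_left inner_commute algebra_simps)
qed

lemma kr_integrable:
  assumes T: "test_function ({0..} \<times> UNIV) \<phi> D" and neg: "\<And>z. fst z < 0 \<Longrightarrow> D z = 0"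
    and k: "k \<in> {a..b}" and [measurable]: "U \<in> borel_measurable borel" and U: "\<And>z. U z \<in> {a..b}" 
    and [measurable]: "Measurable.pred borel P"
  shows "integrable lborel (\<lambda>z. if P z then kr f k (U z) (D z) else 0)"
proof -
  obtain R C where C: "0 < C"
    and D0: "\<And>z. 0 \<le> fst z \<Longrightarrow> R < norm z \<Longrightarrow> D z = 0"
    and DC: "\<And>z. 0 \<le> fst z \<Longrightarrow> norm (D z) \<le> C"
    by (rule test_function_halfspace_bounds[OF T]) blast
  have "(\<lambda>z. if 0 \<le> fst z then D z else 0) = D" using neg by (auto simp: fun_eq_iff not_le)
  with test_function_measurable(2)[OF T] have [measurable]: "D \<in> borel_measurable borel" by simp
  have DR: "D z = 0" if "R < norm z" for z
    using D0[of z] neg[of z] that by (cases "0 \<le> fst z") auto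
  have DA: "norm (D z) \<le> C" for z
    using DC[of z] neg[of z] C by (cases "0 \<le> fst z") auto
  obtain B where B: "0 \<le> B" "\<And>u k y. u \<in> {a..b} \<Longrightarrow> k \<in> {a..b} \<Longrightarrow> \<bar>kr f k u y\<bar> \<le> B * norm y"
    by (rule kr_bounded) blast
  have krC: "\<bar>kr f k (U z) (D z)\<bar> \<le> B * C" for z
    using order_trans[OF B(2)[OF U k] mult_left_mono[OF DA B(1)]] .
  show ?thesis
  proof (rule integrable_bounded_support[where C="B * C" and R=R])
    show "\<bar>if P z then kr f k (U z) (D z) else 0\<bar> \<le> B * C" for z using krC[of z] B(1) C by auto
    show "(if P z then kr f k (U z) (D z) else 0) = 0" if "R < norm z" for z using DR[OF that] by simp
  qed measurable
qed

text \<open>The front itself is a null set, so the interior integrals of the two sides add up to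
  that of the glued function, and the two flux terms on the front cancel.\<close>

lemma glued_entropy_range:
  fixes \<Omega> :: "'a set"
  assumes \<Omega>: "open \<Omega>" and T: "test_function ({0..} \<times> UNIV) \<phi> D"
    and out: "\<And>z. z \<notin> {0..} \<times> \<Omega> \<Longrightarrow> \<phi> z = 0" "\<And>z. z \<notin> {0..} \<times> \<Omega> \<Longrightarrow> D z = 0"
    and pos: "\<And>x. x \<in> \<Omega> \<Longrightarrow> 0 < \<theta> x"
    and Fm [measurable]: "F \<in> borel_measurable borel" and FI: "\<And>z. F z \<in> {a..b}"
    and Vm [measurable]: "V \<in> borel_measurable borel" and VI: "\<And>z. V z \<in> {a..b}"
    and k: "k \<in> {a..b}"
    and ah: "0 \<le> (\<integral>z. (if ahead z then \<bar>F z - k\<bar> * fst (D z) + sgn (F z - k) * ((f (F z) - f k) \<bullet> snd (D z)) else 0) \<partial>lborel)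
      + (\<integral>x. (if 0 < \<theta> x then \<bar>U0 x - k\<bar> * \<phi> (0, x) else 0) \<partial>lborel)
      + (\<integral>x. (if 0 < \<theta> x then \<phi> (\<theta> x, x) * (sgn (g x - k) * ((f (g x) - f k) \<bullet> p) - \<bar>g x - k\<bar>) else 0) \<partial>lborel)"
    and be: "0 \<le> (\<integral>z. (if \<theta> (snd z) < fst z then kr f k (V z) (D z) else 0) \<partial>lborel) - (\<integral>x. \<phi> (\<theta> x, x) * front_flux k (g x) \<partial>lborel)"
  shows "0 \<le> (\<integral>z. (if z \<in> {0<..} \<times> \<Omega> then kr f k (if fst z < \<theta> (snd z) then F z else V z) (D z) else 0) \<partial>lborel) + (\<integral>x. \<bar>U0 x - k\<bar> * \<phi> (0, x) \<partial>lborel)"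
proof -
  have S [measurable]: "{0::real<..} \<times> \<Omega> \<in> sets borel" using \<Omega> by (intro borel_open open_Times) auto
  have neg: "D z = 0" if "fst z < 0" for z using that out(2)[of z] by (cases z) auto
  have "(\<lambda>z. if 0 \<le> fst z then D z else 0) = D" using neg by (auto simp: fun_eq_iff not_le)
  with test_function_measurable(2)[OF T] have [measurable]: "D \<in> borel_measurable borel" by simp
  have am [measurable]: "Measurable.pred borel ahead" unfolding ahead_def[abs_def] by measurable
  let ?U = "\<lambda>z. if fst z < \<theta> (snd z) then F z else V z"
  have i1: "integrable lborel (\<lambda>z. if ahead z then kr f k (F z) (D z) else 0)"
    by (rule kr_integrable[OF T neg k Fm FI am])
  have i2: "integrable lborel (\<lambda>z. if \<theta> (snd z) < fst z then kr f k (V z) (D z) else 0)"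
    by (rule kr_integrable[OF T neg k Vm VI]) measurable
  have "(\<integral>z. (if z \<in> {0<..} \<times> \<Omega> then kr f k (?U z) (D z) else 0) \<partial>lborel)
    = (\<integral>z. (if ahead z then kr f k (F z) (D z) else 0) + (if \<theta> (snd z) < fst z then kr f k (V z) (D z) else 0) \<partial>lborel)"
  proof (rule integral_cong_AE)
    show "AE z in lborel. (if z \<in> {0<..} \<times> \<Omega> then kr f k (?U z) (D z) else 0)
      = (if ahead z then kr f k (F z) (D z) else 0) + (if \<theta> (snd z) < fst z then kr f k (V z) (D z) else 0)"
    proof -
      have "AE z in (lborel :: (real \<times> 'a) measure). fst z \<noteq> 0"
        by (rule AE_fst) (rule AE_lborel_singleton)
      with front_null show ?thesis
      proof eventually_elim
        case (elim z)
        show ?case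
        proof (cases "z \<in> {0<..} \<times> \<Omega>")
          case True
          then show ?thesis using elim by (auto simp: ahead_def)
        next
          case False
          then have "D z = 0" using out(2)[of z] elim by (cases z) auto
          then show ?thesis using False by simp
        qed
      qed
    qed
  qed measurable
  also have "\<dots> = (\<integral>z. (if ahead z then kr f k (F z) (D z) else 0) \<partial>lborel) + (\<integral>z. (if \<theta> (snd z) < fst z then kr f k (V z) (D z) else 0) \<partial>lborel)"
    by (rule Bochner_Integration.integral_add[OF i1 i2])
  finally have A: "(\<integral>z. (if z \<in> {0<..} \<times> \<Omega> then kr f k (?U z) (D z) else 0) \<partial>lborel) = (\<integral>z. (if ahead z then kr f k (F z) (D z) else 0) \<partial>lborel) + (\<integral>z. (if \<theta> (snd z) < fst z then kr f k (V z) (D z) else 0) \<partial>lborel)" .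
  have z0: "\<phi> (t, x) = 0" if "\<not> 0 < \<theta> x" for t x using out(1)[of "(t, x)"] pos[of x] that by auto
  have B: "(\<lambda>x. if 0 < \<theta> x then \<bar>U0 x - k\<bar> * \<phi> (0, x) else 0) = (\<lambda>x. \<bar>U0 x - k\<bar> * \<phi> (0, x))"
    "(\<lambda>x. if 0 < \<theta> x then \<phi> (\<theta> x, x) * (sgn (g x - k) * ((f (g x) - f k) \<bullet> p) - \<bar>g x - k\<bar>) else 0) = (\<lambda>x. \<phi> (\<theta> x, x) * front_flux k (g x))"
    using z0 by (auto simp: fun_eq_iff front_flux_def)
  have C: "(\<lambda>z. if ahead z then \<bar>F z - k\<bar> * fst (D z) + sgn (F z - k) * ((f (F z) - f k) \<bullet> snd (D z)) else 0) = (\<lambda>z. if ahead z then kr f k (F z) (D z) else 0)"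
    by (simp add: kr_def fun_eq_iff)
  show ?thesis using ah be unfolding A B C by linarith
qed

text \<open>The remainder \<open>z \<bullet> y\<close> is paired with the gradient of the test
  function only, so it integrates to a boundary term at time 0, compensated exactly by the change
  \<open>fst y\<close> in the initial term.\<close>

lemma glued_entropy_outside:
  fixes \<Omega> :: "'a set"
  assumes \<Omega>: "open \<Omega>" and T: "test_function ({0..} \<times> UNIV) \<phi> D"
    and out: "\<And>z. z \<notin> {0..} \<times> \<Omega> \<Longrightarrow> \<phi> z = 0" "\<And>z. z \<notin> {0..} \<times> \<Omega> \<Longrightarrow> D z = 0"
    and Um [measurable]: "U \<in> borel_measurable borel" and UI: "\<And>z. U z \<in> {a..b}"
    and k': "k' \<in> {a..b}" and y: "0 \<le> fst y"
    and kr: "\<And>u z. u \<in> {a..b} \<Longrightarrow> kr f k u z = kr f k' u z + z \<bullet> y"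
    and U0k: "\<And>x. \<bar>U0 x - k\<bar> = \<bar>U0 x - k'\<bar> + fst y"
    and ent: "0 \<le> (\<integral>z. (if z \<in> {0<..} \<times> \<Omega> then kr f k' (U z) (D z) else 0) \<partial>lborel) + (\<integral>x. \<bar>U0 x - k'\<bar> * \<phi> (0, x) \<partial>lborel)"
  shows "0 \<le> (\<integral>z. (if z \<in> {0<..} \<times> \<Omega> then kr f k (U z) (D z) else 0) \<partial>lborel) + (\<integral>x. \<bar>U0 x - k\<bar> * \<phi> (0, x) \<partial>lborel)"
proof -
  have S [measurable]: "{0::real<..} \<times> \<Omega> \<in> sets borel" using \<Omega> by (intro borel_open open_Times) auto
  have neg: "\<phi> z = 0" "D z = 0" if "fst z < 0" for z using that out[of z] by (cases z; auto)+
  have "(\<lambda>z. if 0 \<le> fst z then D z else 0) = D" "(\<lambda>z. if 0 \<le> fst z then \<phi> z else 0) = \<phi>" using neg by (auto simp: fun_eq_iff not_le)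
  with test_function_measurable[OF T] have [measurable]: "D \<in> borel_measurable borel" "\<phi> \<in> borel_measurable borel" by simp_all
  obtain R C where C: "0 < C"
    and supp: "\<And>z. 0 \<le> fst z \<Longrightarrow> R < norm z \<Longrightarrow> \<phi> z = 0"
    and D0: "\<And>z. 0 \<le> fst z \<Longrightarrow> R < norm z \<Longrightarrow> D z = 0"
    and pos: "\<And>z. 0 \<le> fst z \<Longrightarrow> 0 \<le> \<phi> z" and \<phi>C: "\<And>z. 0 \<le> fst z \<Longrightarrow> \<phi> z \<le> C"
    and DC: "\<And>z. 0 \<le> fst z \<Longrightarrow> norm (D z) \<le> C"
    by (rule test_function_halfspace_bounds[OF T]) blast
  have i1: "integrable lborel (\<lambda>z. if z \<in> {0<..} \<times> \<Omega> then kr f k' (U z) (D z) else 0)"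
    by (rule kr_integrable[OF T neg(2) k' Um UI]) measurable
  have i2: "integrable lborel (\<lambda>z. if 0 < fst z then D z \<bullet> y else 0)"
  proof (rule integrable_bounded_support[where C="C * norm y" and R=R])
    show "\<bar>if 0 < fst z then D z \<bullet> y else 0\<bar> \<le> C * norm y" for z
      using order_trans[OF Cauchy_Schwarz_ineq2[of "D z" y] mult_right_mono[OF DC[of z]]] C by auto
    show "(if 0 < fst z then D z \<bullet> y else 0) = 0" if "R < norm z" for z using D0[of z] that by auto
  qed measurable
  obtain A where A: "\<And>x. \<bar>U0 x - k'\<bar> \<le> A" 
    by (rule that[of "b - a"]) (use U0_range k' in \<open>auto simp: abs_le_iff intro: diff_mono\<close>)
  have A0: "0 \<le> A" using A[of undefined] by linarith
  have i3: "integrable lborel (\<lambda>x. \<bar>U0 x - k'\<bar> * \<phi> (0, x))"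
  proof (rule integrable_bounded_support[where C="A * C" and R=R])
    show "\<bar>\<bar>U0 x - k'\<bar> * \<phi> (0, x)\<bar> \<le> A * C" for x
      unfolding abs_mult abs_abs using A A0 pos[of "(0, x)"] \<phi>C[of "(0, x)"] by (intro mult_mono) auto
    show "\<bar>U0 x - k'\<bar> * \<phi> (0, x) = 0" if "R < norm x" for x using supp[of "(0, x)"] that by simp
  qed measurable
  have i4: "integrable lborel (\<lambda>x. fst y * \<phi> (0, x))"
  proof (rule integrable_mult_right, rule integrable_bounded_support[where C=C and R=R])
    show "\<bar>\<phi> (0, x)\<bar> \<le> C" for x using pos[of "(0, x)"] \<phi>C[of "(0, x)"] by auto
    show "\<phi> (0, x) = 0" if "R < norm x" for x using supp[of "(0, x)"] that by simp
  qed measurable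
  have "(\<integral>z. (if z \<in> {0<..} \<times> \<Omega> then kr f k (U z) (D z) else 0) \<partial>lborel) = (\<integral>z. (if z \<in> {0<..} \<times> \<Omega> then kr f k' (U z) (D z) else 0) + (if 0 < fst z then D z \<bullet> y else 0) \<partial>lborel)"
  proof (rule Bochner_Integration.integral_cong[OF refl])
    fix z
    show "(if z \<in> {0<..} \<times> \<Omega> then kr f k (U z) (D z) else 0) = (if z \<in> {0<..} \<times> \<Omega> then kr f k' (U z) (D z) else 0) + (if 0 < fst z then D z \<bullet> y else 0)"
    proof (cases "z \<in> {0<..} \<times> \<Omega>")
      case True
      then show ?thesis using kr[OF UI[of z]] by auto
    next
      case False
      then have "0 < fst z \<Longrightarrow> D z = 0" using out(2)[of z] by (cases z) auto
      then show ?thesis using False by auto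
    qed
  qed
  also have "\<dots> = (\<integral>z. (if z \<in> {0<..} \<times> \<Omega> then kr f k' (U z) (D z) else 0) \<partial>lborel) + (\<integral>z. (if 0 < fst z then D z \<bullet> y else 0) \<partial>lborel)"
    by (rule Bochner_Integration.integral_add[OF i1 i2])
  moreover have "(\<integral>x. \<bar>U0 x - k\<bar> * \<phi> (0, x) \<partial>lborel) = (\<integral>x. \<bar>U0 x - k'\<bar> * \<phi> (0, x) \<partial>lborel) + fst y * (\<integral>x. \<phi> (0, x) \<partial>lborel)"
    unfolding U0k distrib_right using Bochner_Integration.integral_add[OF i3 i4] by simp
  ultimately show ?thesis using ent test_function_divergence[OF T y] by linarith
qed

lemma glued_entropy:
  fixes \<Omega> :: "'a set" and \<Delta> :: real and \<phi> :: "real \<times> 'a \<Rightarrow> real" and D :: "real \<times> 'a \<Rightarrow> real \<times> 'a"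
  defines "\<phi>' \<equiv> \<lambda>z. if z \<in> {0..} \<times> \<Omega> then \<phi> z else 0" and "D' \<equiv> \<lambda>z. if z \<in> {0..} \<times> \<Omega> then D z else 0"
  assumes r: "strict_mono r" and Fm [measurable]: "F \<in> borel_measurable borel" and FI: "\<And>z. F z \<in> {a..b}"
    and Flim: "AE z in lborel. (\<lambda>j. W (r j) (r j) (fst z) (snd z)) \<longlonglongrightarrow> F z"
    and \<Omega>: "open \<Omega>" and T: "test_function ({0..} \<times> \<Omega>) \<phi> D"
    and pos: "\<And>x. x \<in> \<Omega> \<Longrightarrow> 0 < \<theta> x" "\<And>x. x \<in> \<Omega> \<Longrightarrow> 0 < \<theta> x + \<Delta>"
    and ent: "\<And>k \<phi> D. test_function ({0<..} \<times> \<Omega>) \<phi> D \<Longrightarrow> 0 \<le> kruzhkov_integral f \<Omega> v k D"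
    and Vm [measurable]: "V \<in> borel_measurable borel" and VI: "\<And>z. V z \<in> {a..b}"
    and vV: "AE z in lborel. z \<in> {0<..} \<times> \<Omega> \<longrightarrow> v (fst z) (snd z) = V (fst z - \<Delta>, snd z)"
    and gV: "\<And>x. x \<in> \<Omega> \<Longrightarrow> g x = V (\<theta> x, x)"
    and e: "\<And>n. 0 < e n" "e \<longlonglongrightarrow> 0" and osc: "\<And>R. (\<lambda>n. front_osc V p R (e n) q) \<longlonglongrightarrow> 0"
  shows "0 \<le> (\<integral>z. (if z \<in> {0<..} \<times> \<Omega> then kr f k (if fst z < \<theta> (snd z) then F z else V z) (D' z) else 0) \<partial>lborel) + (\<integral>x. \<bar>U0 x - k\<bar> * \<phi>' (0, x) \<partial>lborel)"
    (is "0 \<le> ?E k")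
proof -
  have T': "test_function ({0..} \<times> UNIV) \<phi>' D'"
    unfolding \<phi>'_def D'_def by (rule test_function_extend[OF \<Omega> T])
  have out: "\<phi>' z = 0" "D' z = 0" if "z \<notin> {0..} \<times> \<Omega>" for z using that by (simp_all only: \<phi>'_def D'_def if_False)
  let ?U = "\<lambda>z. if fst z < \<theta> (snd z) then F z else V z"
  have Um: "?U \<in> borel_measurable borel" by measurable
  have UI: "?U z \<in> {a..b}" for z using FI[of z] VI[of z] by simp
  have range: "0 \<le> ?E k" if k: "k \<in> {a..b}" for k
  proof -
    have "0 \<le> (\<integral>z. (if \<theta> (snd z) < fst z then kr f k (V z) (D' z) else 0) \<partial>lborel) - (\<integral>x. \<phi>' (\<theta> x, x) * front_flux k (g x) \<partial>lborel)"
      unfolding \<phi>'_def D'_def by (rule behind_entropy[OF \<Omega> T pos ent Vm VI vV gV e osc k])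
    from glued_entropy_range[OF \<Omega> T' out pos(1) Fm FI Vm VI k entropy_limit[OF r Fm FI Flim T' k] this]
    show ?thesis by blast
  qed
  have ka: "a \<in> {a..b}" and kb: "b \<in> {a..b}" using ab by auto
  consider "k < a" | "k \<in> {a..b}" | "b < k" by force
  then show ?thesis
  proof cases
    case 1
    show ?thesis
    proof (rule glued_entropy_outside[OF \<Omega> T' out Um UI ka _ _ _ range[OF ka]])
      show "kr f k u z = kr f a u z + z \<bullet> (a - k, f a - f k)" if "u \<in> {a..b}" for u z by (rule kr_outside(1)[OF that 1])
      show "\<bar>U0 x - k\<bar> = \<bar>U0 x - a\<bar> + fst (a - k, f a - f k)" for x using U0_range[of x] 1 by auto
    qed (use 1 in auto)
  next
    case 3
    show ?thesis
    proof (rule glued_entropy_outside[OF \<Omega> T' out Um UI kb _ _ _ range[OF kb]])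
      show "kr f k u z = kr f b u z + z \<bullet> (k - b, f k - f b)" if "u \<in> {a..b}" for u z by (rule kr_outside(2)[OF that 3])
      show "\<bar>U0 x - k\<bar> = \<bar>U0 x - b\<bar> + fst (k - b, f k - f b)" for x using U0_range[of x] 3 by auto
    qed (use 3 in auto)
  qed (rule range)
qed

end

section \<open>Continuity in time of the glued function\<close>

lemma bounded_borel_integrable_on_compact:
  fixes H :: "'b::euclidean_space \<Rightarrow> real"
  assumes H [measurable]: "H \<in> borel_measurable borel" and K: "compact K" and C: "\<And>x. \<bar>H x\<bar> \<le> C"
  shows "integrable (lebesgue_on K) H"
proof -
  have "K \<in> lmeasurable" using K by (rule lmeasurable_compact)
  then have "finite_measure (lebesgue_on K)" by (rule finite_measure_lebesgue_on)
  moreover have "H \<in> borel_measurable (lebesgue_on K)"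
    using H by (intro measurable_restrict_space1 measurable_completion) simp
  ultimately show ?thesis
    using C by (intro finite_measure.integrable_const_bound[where B=C]) auto
qed

lemma integrable_lebesgue_on_subset:
  fixes h :: "'b::euclidean_space \<Rightarrow> real"
  assumes h: "integrable (lebesgue_on S) h" and S: "S \<in> sets lebesgue" and K: "K \<in> sets lebesgue" "K \<subseteq> S"
  shows "integrable (lebesgue_on K) h"
    and "(\<And>x. x \<in> S \<Longrightarrow> 0 \<le> h x) \<Longrightarrow> integral\<^sup>L (lebesgue_on K) h \<le> integral\<^sup>L (lebesgue_on S) h"
proof -
  have iS: "integrable lebesgue (\<lambda>x. indicator S x *\<^sub>R h x)" using h S by (subst (asm) integrable_restrict_space) auto
  have iK: "integrable lebesgue (\<lambda>x. indicator K x *\<^sub>R h x)"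
  proof -
    have "integrable lebesgue (\<lambda>x. indicator K x *\<^sub>R (indicator S x *\<^sub>R h x))"
      using iS K(1) by (rule integrable_mult_indicator[rotated])
    also have "(\<lambda>x. indicator K x *\<^sub>R (indicator S x *\<^sub>R h x)) = (\<lambda>x. indicator K x *\<^sub>R h x)"
      using K(2) by (auto simp: fun_eq_iff indicator_def)
    finally show ?thesis .
  qed
  then show "integrable (lebesgue_on K) h" using K by (subst integrable_restrict_space) auto
  assume p: "\<And>x. x \<in> S \<Longrightarrow> 0 \<le> h x"
  have "integral\<^sup>L lebesgue (\<lambda>x. indicator K x *\<^sub>R h x) \<le> integral\<^sup>L lebesgue (\<lambda>x. indicator S x *\<^sub>R h x)"
    by (rule integral_mono[OF iK iS]) (use K p in \<open>auto simp: indicator_def\<close>)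
  then show "integral\<^sup>L (lebesgue_on K) h \<le> integral\<^sup>L (lebesgue_on S) h"
    using S K by (simp add: integral_restrict_space)
qed

lemma nn_integral_bound_lebesgue_on:
  fixes H :: "'b::euclidean_space \<Rightarrow> real"
  assumes H [measurable]: "H \<in> borel_measurable borel" and K: "compact K" and C: "\<And>x. \<bar>H x\<bar> \<le> C" and p: "\<And>x. 0 \<le> H x"
    and le: "(\<integral>\<^sup>+x. indicator K x * ennreal (H x) \<partial>lborel) \<le> ennreal \<epsilon>" and \<epsilon>: "0 \<le> \<epsilon>"
  shows "integral\<^sup>L (lebesgue_on K) H \<le> \<epsilon>"
proof -
  have Kb [measurable]: "K \<in> sets borel" using K by (intro borel_closed compact_imp_closed)
  have Kl: "K \<in> sets lebesgue" using Kb by auto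
  have "ennreal (integral\<^sup>L (lebesgue_on K) H) = (\<integral>\<^sup>+x. ennreal (H x) \<partial>lebesgue_on K)"
    by (rule nn_integral_eq_integral[symmetric, OF bounded_borel_integrable_on_compact[OF H K C]]) (use p in auto)
  also have "\<dots> = (\<integral>\<^sup>+x. ennreal (H x) * indicator K x \<partial>lebesgue)"
    using Kl by (intro nn_integral_restrict_space) simp
  also have "\<dots> = (\<integral>\<^sup>+x. ennreal (H x) * indicator K x \<partial>lborel)"
    by (rule nn_integral_completion) 
  also have "\<dots> \<le> ennreal \<epsilon>" using le by (simp only: mult.commute)
  finally show ?thesis using \<epsilon> by (simp add: ennreal_le_iff)
qed

lemma glued_integrable:
  fixes \<theta> w v :: "'a::euclidean_space \<Rightarrow> real"
  assumes K: "compact K" and \<theta>m [measurable]: "\<theta> \<in> borel_measurable borel" and wm: "w \<in> borel_measurable borel" and wC: "\<And>x. \<bar>w x\<bar> \<le> C"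
    and v: "integrable (lebesgue_on K) v"
  shows "integrable (lebesgue_on K) (\<lambda>x. if t < \<theta> x then w x else v x)"
proof -
  have ms [measurable]: "\<theta> \<in> borel_measurable (lebesgue_on K)" "w \<in> borel_measurable (lebesgue_on K)"
    using wm \<theta>m by (auto intro!: measurable_restrict_space1 measurable_completion)
  have iw: "integrable (lebesgue_on K) w" by (rule bounded_borel_integrable_on_compact[OF wm K wC])
  have [measurable]: "v \<in> borel_measurable (lebesgue_on K)" using v by auto
  show ?thesis
    by (rule Bochner_Integration.integrable_bound[OF Bochner_Integration.integrable_add[OF integrable_abs[OF iw] integrable_abs[OF v]]]) auto
qed

text \<open>Between two times a point is ahead of the front at both, behind it at both, or swept by
  it. The first kind is controlled by the modulus of \<open>w\<close>, the second by the continuity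
  of \<open>v\<close>, and the third disappears because the level sets of \<theta> are null.\<close>

lemma glued_continuous:
  fixes \<theta> :: "'a::euclidean_space \<Rightarrow> real" and \<Delta> :: real and w v :: "real \<Rightarrow> 'a \<Rightarrow> real"
  assumes \<Omega>: "open \<Omega>" and \<theta>c: "continuous_on UNIV \<theta>" and level: "\<And>t. AE x in lborel. \<theta> x \<noteq> t"
    and pos: "\<And>x. x \<in> \<Omega> \<Longrightarrow> 0 < \<theta> x + \<Delta>"
    and wm [measurable]: "\<And>t. w t \<in> borel_measurable borel" and wC: "\<And>t x. \<bar>w t x\<bar> \<le> C"
    and mod: "\<And>R T \<epsilon>. 0 < \<epsilon> \<Longrightarrow> \<exists>\<delta>>0. \<forall>t s. \<bar>t\<bar> \<le> T \<longrightarrow> \<bar>s - t\<bar> < \<delta> \<longrightarrow>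
      (\<integral>\<^sup>+x. indicator (cball 0 R \<inter> {x. t < \<theta> x \<and> s < \<theta> x}) x * ennreal \<bar>w s x - w t x\<bar> \<partial>lborel) \<le> ennreal \<epsilon>"
    and v: "continuous_in_L1 {0<..} \<Omega> v"
  shows "continuous_in_L1_loc {0..} \<Omega> (\<lambda>t x. if t < \<theta> x then w t x else v (t + \<Delta>) x)"
  unfolding continuous_in_L1_loc_def
proof (intro allI impI)
  fix K assume "compact K \<and> K \<subseteq> \<Omega>"
  then have K: "compact K" and K\<Omega>: "K \<subseteq> \<Omega>" by auto
  let ?u = "\<lambda>t x. if t < \<theta> x then w t x else v (t + \<Delta>) x"
  have \<theta>m [measurable]: "\<theta> \<in> borel_measurable borel" using \<theta>c by (rule borel_measurable_continuous_onI)
  have Kb [measurable]: "K \<in> sets borel" using K by (intro borel_closed compact_imp_closed)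
  have Kl: "K \<in> sets lebesgue" and \<Omega>l: "\<Omega> \<in> sets lebesgue" using Kb \<Omega> by auto
  have C0: "0 \<le> C" using wC[of 0 undefined] by linarith
  have vt: "integrable (lebesgue_on \<Omega>) (v t)" if "0 < t" for t
    using v that by (simp add: continuous_in_L1_def)
  have vK: "integrable (lebesgue_on K) (v t)" if "0 < t" for t
    by (rule integrable_lebesgue_on_subset(1)[OF vt[OF that] \<Omega>l Kl K\<Omega>])
  \<comment> \<open>If \<open>t + \<Delta> \<le> 0\<close>, every point of \<Omega> is ahead of the
    front at time \<open>t\<close>, so the filler 0 is never read by the glued function.\<close>
  define z where "z t = (if 0 < t + \<Delta> then v (t + \<Delta>) else (\<lambda>_. 0))" for t
  have zK: "integrable (lebesgue_on K) (z t)" for t using vK by (simp add: z_def)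
  have uz: "?u t x = (if t < \<theta> x then w t x else z t x)" if "x \<in> K" for t x
    using pos[of x] that K\<Omega> by (auto simp: z_def)
  have uK: "integrable (lebesgue_on K) (?u t)" for t
  proof -
    have "integrable (lebesgue_on K) (\<lambda>x. if t < \<theta> x then w t x else z t x)"
      by (rule glued_integrable[OF K \<theta>m wm wC zK])
    then show ?thesis by (rule Bochner_Integration.integrable_cong[THEN iffD1, rotated 2]) (auto simp: uz)
  qed
  define Z where "Z s t x = (if t < \<theta> x \<and> s < \<theta> x then \<bar>w s x - w t x\<bar> else 0)" for s t x
  have Zm [measurable]: "Z s t \<in> borel_measurable borel" for s t unfolding Z_def by measurable
  have ZC: "\<bar>Z s t x\<bar> \<le> 2 * C" for s t x
    using wC[of s x] wC[of t x] C0 by (auto simp: Z_def)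
  have iZ: "integrable (lebesgue_on K) (Z s t)" for s t
    by (rule bounded_borel_integrable_on_compact[OF Zm K ZC])
  obtain R where R: "K \<subseteq> cball 0 R" using compact_imp_bounded[OF K] unfolding bounded_iff by (auto simp: subset_iff)
  show "continuous_in_L1 {0..} K ?u"
    unfolding continuous_in_L1_def
  proof (intro ballI conjI uK)
    fix t :: real assume t0: "t \<in> {0..}"
    show "((\<lambda>s. \<integral>x. \<bar>?u s x - ?u t x\<bar> \<partial>lebesgue_on K) \<longlongrightarrow> 0) (at t within {0..})"
      unfolding tendsto_at_iff_sequentially comp_def
    proof (intro allI impI)
      fix X :: "nat \<Rightarrow> real" assume X: "\<forall>i. X i \<in> {0..} - {t}" and Xt: "X \<longlonglongrightarrow> t"
      have limZ: "(\<lambda>n. integral\<^sup>L (lebesgue_on K) (Z (X n) t)) \<longlonglongrightarrow> 0"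
      proof (rule LIMSEQ_I)
        fix \<epsilon> :: real assume \<epsilon>: "0 < \<epsilon>"
        then obtain \<delta> where \<delta>: "0 < \<delta>" "\<And>s. \<bar>s - t\<bar> < \<delta> \<Longrightarrow>
          (\<integral>\<^sup>+x. indicator (cball 0 R \<inter> {x. t < \<theta> x \<and> s < \<theta> x}) x * ennreal \<bar>w s x - w t x\<bar> \<partial>lborel) \<le> ennreal (\<epsilon> / 2)"
          using mod[of "\<epsilon> / 2" "\<bar>t\<bar>" R] by (auto simp del: ennreal_divide_numeral)
        obtain n0 where n0: "\<And>n. n0 \<le> n \<Longrightarrow> \<bar>X n - t\<bar> < \<delta>"
          using LIMSEQ_D[OF Xt \<delta>(1)] by auto
        have "norm (integral\<^sup>L (lebesgue_on K) (Z (X n) t) - 0) < \<epsilon>" if n: "n0 \<le> n" for n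
        proof -
          have "(\<integral>\<^sup>+x. indicator K x * ennreal (Z (X n) t x) \<partial>lborel) \<le> (\<integral>\<^sup>+x. indicator (cball 0 R \<inter> {x. t < \<theta> x \<and> X n < \<theta> x}) x * ennreal \<bar>w (X n) x - w t x\<bar> \<partial>lborel)"
            by (rule nn_integral_mono) (use R in \<open>auto simp: Z_def indicator_def\<close>)
          also have "\<dots> \<le> ennreal (\<epsilon> / 2)" by (rule \<delta>(2)[OF n0[OF n]])
          finally have "integral\<^sup>L (lebesgue_on K) (Z (X n) t) \<le> \<epsilon> / 2"
            by (rule nn_integral_bound_lebesgue_on[OF Zm K ZC, rotated 1]) (use \<epsilon> in \<open>auto simp: Z_def\<close>)
          moreover have "0 \<le> integral\<^sup>L (lebesgue_on K) (Z (X n) t)"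
            by (rule Bochner_Integration.integral_nonneg) (simp add: Z_def)
          ultimately show ?thesis using \<epsilon> by simp
        qed
        then show "\<exists>n0. \<forall>n\<ge>n0. norm (integral\<^sup>L (lebesgue_on K) (Z (X n) t) - 0) < \<epsilon>" by blast
      qed
      \<comment> \<open>The swept points. The bound involves only \<open>z t\<close>, so one
        integrable function dominates all \<open>n\<close>; together with \<bar>z (X n) x - z t
        x\<bar> it covers sweeps in either direction.\<close>
      define Y where "Y n x = (if (X n < \<theta> x) \<noteq> (t < \<theta> x) then C + \<bar>z t x\<bar> else 0)" for n x
      have ms [measurable]: "\<theta> \<in> borel_measurable (lebesgue_on K)"
        using \<theta>m by (intro measurable_restrict_space1 measurable_completion) simp
      have [measurable]: "z t \<in> borel_measurable (lebesgue_on K)" using zK by auto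
      have Ym [measurable]: "Y n \<in> borel_measurable (lebesgue_on K)" for n unfolding Y_def by measurable
      have iD: "integrable (lebesgue_on K) (\<lambda>x. C + \<bar>z t x\<bar>)"
        by (intro Bochner_Integration.integrable_add integrable_abs zK bounded_borel_integrable_on_compact[OF _ K, where C=C]) (use C0 in auto)
      have iY: "integrable (lebesgue_on K) (Y n)" for n
        by (rule Bochner_Integration.integrable_bound[OF iD]) (use C0 in \<open>auto simp: Y_def\<close>)
      have limY: "(\<lambda>n. integral\<^sup>L (lebesgue_on K) (Y n)) \<longlonglongrightarrow> integral\<^sup>L (lebesgue_on K) (\<lambda>_. 0)"
      proof (rule integral_dominated_convergence[OF _ _ iD])
        have "AE x in lborel. x \<in> K \<longrightarrow> (\<lambda>n. Y n x) \<longlonglongrightarrow> 0"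
          using level[of t]
        proof eventually_elim
          case (elim x)
          have "\<forall>\<^sub>F n in sequentially. (X n < \<theta> x) = (t < \<theta> x)"
          proof (cases "t < \<theta> x")
            case True
            then show ?thesis using order_tendstoD(2)[OF Xt True] by (auto elim: eventually_mono)
          next
            case False
            then have "\<theta> x < t" using elim by simp
            from order_tendstoD(1)[OF Xt this] show ?thesis by eventually_elim (use False in auto)
          qed
          then have "\<forall>\<^sub>F n in sequentially. 0 = Y n x" by eventually_elim (simp add: Y_def)
          then show ?case using tendsto_cong[of "\<lambda>_. 0" "\<lambda>n. Y n x" sequentially] by auto
        qed
        then show "AE x in lebesgue_on K. (\<lambda>n. Y n x) \<longlonglongrightarrow> 0" by (rule AE_lebesgue_on_I[OF Kb])
      qed (use C0 in \<open>auto simp: Y_def\<close>)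
      \<comment> \<open>If the shifted time is not positive, continuity of \<open>v\<close> gives
        nothing; then \<theta> attains on the compact set \<open>K\<close> a minimum above
        \<open>t\<close>, and all of \<open>K\<close> stays ahead for times close to
        \<open>t\<close>.\<close>
      have limV: "(\<lambda>n. \<integral>x. \<bar>z (X n) x - z t x\<bar> \<partial>lebesgue_on K) \<longlonglongrightarrow> 0 \<and> 0 < t + \<Delta> \<or> (\<forall>\<^sub>F n in sequentially. \<forall>x\<in>K. X n < \<theta> x \<and> t < \<theta> x)"
      proof (cases "0 < t + \<Delta>")
        case True
        have ev: "\<forall>\<^sub>F n in sequentially. 0 < X n + \<Delta>"
          using order_tendstoD(1)[OF Xt, of "- \<Delta>"] True by (auto elim: eventually_mono)
        have "((\<lambda>s. \<integral>x. \<bar>v s x - v (t + \<Delta>) x\<bar> \<partial>lebesgue_on \<Omega>) \<longlongrightarrow> 0) (at (t + \<Delta>) within {0<..})"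
          using v True by (simp add: continuous_in_L1_def)
        moreover have "filterlim (\<lambda>n. X n + \<Delta>) (at (t + \<Delta>) within {0<..}) sequentially"
        proof (rule filterlim_at_withinI)
          show "((\<lambda>n. X n + \<Delta>) \<longlongrightarrow> t + \<Delta>) sequentially" by (intro tendsto_intros Xt)
          show "\<forall>\<^sub>F n in sequentially. X n + \<Delta> \<in> {0<..} - {t + \<Delta>}" using ev X by (auto elim: eventually_mono)
        qed
        ultimately have lim\<Omega>: "(\<lambda>n. \<integral>x. \<bar>v (X n + \<Delta>) x - v (t + \<Delta>) x\<bar> \<partial>lebesgue_on \<Omega>) \<longlonglongrightarrow> 0"
          by (rule filterlim_compose)
        have "(\<lambda>n. \<integral>x. \<bar>z (X n) x - z t x\<bar> \<partial>lebesgue_on K) \<longlonglongrightarrow> 0"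
        proof (rule tendsto_sandwich[OF _ _ tendsto_const lim\<Omega>])
          show "\<forall>\<^sub>F n in sequentially. 0 \<le> (\<integral>x. \<bar>z (X n) x - z t x\<bar> \<partial>lebesgue_on K)" by simp
          show "\<forall>\<^sub>F n in sequentially. (\<integral>x. \<bar>z (X n) x - z t x\<bar> \<partial>lebesgue_on K) \<le> (\<integral>x. \<bar>v (X n + \<Delta>) x - v (t + \<Delta>) x\<bar> \<partial>lebesgue_on \<Omega>)"
            using ev
          proof eventually_elim
            case (elim n)
            have "integrable (lebesgue_on \<Omega>) (\<lambda>x. \<bar>v (X n + \<Delta>) x - v (t + \<Delta>) x\<bar>)"
              by (intro integrable_abs Bochner_Integration.integrable_diff vt elim True)
            from integrable_lebesgue_on_subset(2)[OF this \<Omega>l Kl K\<Omega>] show ?case using elim True by (simp add: z_def)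
          qed
        qed
        then show ?thesis using True by blast
      next
        case False
        show ?thesis
        proof (cases "K = {}")
          case False
          obtain x0 where x0: "x0 \<in> K" "\<And>x. x \<in> K \<Longrightarrow> \<theta> x0 \<le> \<theta> x"
            using continuous_attains_inf[OF K False continuous_on_subset[OF \<theta>c subset_UNIV]] by blast
          have t: "t < \<theta> x0" using pos[of x0] x0(1) K\<Omega> \<open>\<not> 0 < t + \<Delta>\<close> by auto
          have "\<forall>\<^sub>F n in sequentially. \<forall>x\<in>K. X n < \<theta> x \<and> t < \<theta> x"
            using order_tendstoD(2)[OF Xt t] by eventually_elim (use x0 t in force)
          then show ?thesis by blast
        qed simp
      qed
      have nn: "\<forall>\<^sub>F n in sequentially. 0 \<le> (\<integral>x. \<bar>?u (X n) x - ?u t x\<bar> \<partial>lebesgue_on K)" by simp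
      from limV show "(\<lambda>n. \<integral>x. \<bar>?u (X n) x - ?u t x\<bar> \<partial>lebesgue_on K) \<longlonglongrightarrow> 0"
      proof
        assume "(\<lambda>n. \<integral>x. \<bar>z (X n) x - z t x\<bar> \<partial>lebesgue_on K) \<longlonglongrightarrow> 0 \<and> 0 < t + \<Delta>"
        then have lim: "(\<lambda>n. integral\<^sup>L (lebesgue_on K) (Z (X n) t) + (\<integral>x. \<bar>z (X n) x - z t x\<bar> \<partial>lebesgue_on K) + integral\<^sup>L (lebesgue_on K) (Y n)) \<longlonglongrightarrow> 0 + 0 + integral\<^sup>L (lebesgue_on K) (\<lambda>_. 0)"
          by (intro tendsto_add limZ limY) auto
        have le: "(\<integral>x. \<bar>?u (X n) x - ?u t x\<bar> \<partial>lebesgue_on K) \<le> integral\<^sup>L (lebesgue_on K) (Z (X n) t) + (\<integral>x. \<bar>z (X n) x - z t x\<bar> \<partial>lebesgue_on K) + integral\<^sup>L (lebesgue_on K) (Y n)" for n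
        proof -
          have iz: "integrable (lebesgue_on K) (\<lambda>x. \<bar>z (X n) x - z t x\<bar>)" by (intro integrable_abs Bochner_Integration.integrable_diff zK)
          have "(\<integral>x. \<bar>?u (X n) x - ?u t x\<bar> \<partial>lebesgue_on K) \<le> (\<integral>x. Z (X n) t x + \<bar>z (X n) x - z t x\<bar> + Y n x \<partial>lebesgue_on K)"
          proof (rule integral_mono)
            show "integrable (lebesgue_on K) (\<lambda>x. \<bar>?u (X n) x - ?u t x\<bar>)" by (intro integrable_abs Bochner_Integration.integrable_diff uK)
            show "integrable (lebesgue_on K) (\<lambda>x. Z (X n) t x + \<bar>z (X n) x - z t x\<bar> + Y n x)" by (intro Bochner_Integration.integrable_add iZ iz iY)
            fix x assume "x \<in> space (lebesgue_on K)"
            then have x: "x \<in> K" by simp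
            have "\<bar>(if X n < \<theta> x then w (X n) x else z (X n) x) - (if t < \<theta> x then w t x else z t x)\<bar> \<le> Z (X n) t x + \<bar>z (X n) x - z t x\<bar> + Y n x"
              using wC[of "X n" x] wC[of t x] by (auto simp: Z_def Y_def)
            then show "\<bar>?u (X n) x - ?u t x\<bar> \<le> Z (X n) t x + \<bar>z (X n) x - z t x\<bar> + Y n x"
              unfolding uz[OF x] .
          qed
          also have "\<dots> = integral\<^sup>L (lebesgue_on K) (Z (X n) t) + (\<integral>x. \<bar>z (X n) x - z t x\<bar> \<partial>lebesgue_on K) + integral\<^sup>L (lebesgue_on K) (Y n)"
            using iZ iz iY by simp
          finally show ?thesis .
        qed
        show ?thesis
          by (rule tendsto_sandwich[OF nn _ tendsto_const]) (use lim le in auto)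
      next
        assume ev: "\<forall>\<^sub>F n in sequentially. \<forall>x\<in>K. X n < \<theta> x \<and> t < \<theta> x"
        have "\<forall>\<^sub>F n in sequentially. integral\<^sup>L (lebesgue_on K) (Z (X n) t) = (\<integral>x. \<bar>?u (X n) x - ?u t x\<bar> \<partial>lebesgue_on K)"
          using ev by eventually_elim (auto intro!: Bochner_Integration.integral_cong simp: Z_def)
        then show ?thesis using limZ by (rule Lim_transform_eventually[rotated])
      qed
    qed
  qed
qed

section \<open>Choice of the front and conclusion\<close>

lemma AE_lborel_obtain:
  assumes "AE q in lborel. P q" and "\<alpha> < (\<beta>::real)"
  obtains q where "\<alpha> < q" "q < \<beta>" "P q"
proof -
  from assms(1) obtain N where N: "\<And>q. q \<notin> N \<Longrightarrow> P q" "N \<in> null_sets lborel"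
    by (rule AE_E3) auto
  have "\<not> {\<alpha><..<\<beta>} \<subseteq> N"
  proof
    assume "{\<alpha><..<\<beta>} \<subseteq> N"
    then have "{\<alpha><..<\<beta>} \<in> null_sets lborel" by (intro null_sets_subset[OF N(2)]) auto
    then show False using assms(2) by (simp add: null_sets_def)
  qed
  then obtain q where "q \<in> {\<alpha><..<\<beta>}" "q \<notin> N" by blast
  then show thesis using N(1)[of q] that by auto
qed

lemma replacement_slab:
  assumes "replacement_condition f \<Omega> I \<tau>"
  obtains w c m where "0 < c" "0 < \<tau>" "\<And>x. x \<in> \<Omega> \<Longrightarrow> m \<le> w \<bullet> x" "\<And>x. x \<in> \<Omega> \<Longrightarrow> w \<bullet> x \<le> m + c * \<tau>"
    "\<And>\<xi>. \<xi> \<in> I \<Longrightarrow> c \<le> w \<bullet> vector_derivative f (at \<xi>)"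
proof -
  from assms obtain w c where \<tau>: "0 < \<tau>" and c: "0 < c" 
    and L: "(SUP x\<in>\<Omega>. ereal (inner w x)) - (INF x\<in>\<Omega>. ereal (inner w x)) < \<infinity>"
    and der: "\<And>z. z \<in> I \<Longrightarrow> c \<le> inner (vector_derivative f (at z)) w"
    and \<tau>L: "ereal \<tau> = ((SUP x\<in>\<Omega>. ereal (inner w x)) - (INF x\<in>\<Omega>. ereal (inner w x))) / ereal c"
    unfolding replacement_condition_def Let_def by blast
  define S where "S = (SUP x\<in>\<Omega>. ereal (inner w x))"
  define J where "J = (INF x\<in>\<Omega>. ereal (inner w x))"
  have SJ: "S - J < \<infinity>" "ereal \<tau> = (S - J) / ereal c" using L \<tau>L by (simp_all only: S_def J_def)
  have up: "ereal (inner w x) \<le> S" and lo: "J \<le> ereal (inner w x)" if "x \<in> \<Omega>" for x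
    using that by (auto simp: S_def J_def intro: SUP_upper INF_lower)
  have "\<Omega> \<noteq> {}"
  proof
    \<comment> \<open>Over the empty set the supremum is -infinity and the infimum is infinity, so
      the quotient cannot be the real number \<tau>.\<close>
    assume "\<Omega> = {}"
    then have "S = -\<infinity>" "J = \<infinity>" by (simp_all add: S_def J_def bot_ereal_def top_ereal_def)
    then show False using SJ(2) c by simp
  qed
  then obtain x0 where x0: "x0 \<in> \<Omega>" by blast
  have "\<exists>s m. S = ereal s \<and> J = ereal m"
    using up[OF x0] lo[OF x0] SJ(1) by (cases S; cases J) auto
  then obtain s m where sm: "S = ereal s" "J = ereal m" by blast
  have "s = m + c * \<tau>" using SJ(2) c by (simp add: sm field_simps)
  with up lo der show thesis
    by (intro that[of c m w] c \<tau>) (auto simp: sm inner_commute)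
qed

text \<open>The direction \<open>w\<close> is scaled so that the front moves with parameter
  \<open>c' < c\<close>: a slower front gains a positive relative speed at the price of a longer
  sweep, which still fits before \<open>T1\<close> and \<open>T2\<close>.\<close>

lemma replacement_front:
  assumes R: "replacement_condition f \<Omega> I \<tau>" and T: "\<tau> < T1" "\<tau> < T2"
  obtains p \<kappa> \<alpha> \<beta> where "0 < \<kappa>" "\<alpha> < \<beta>" "\<And>\<xi>. \<xi> \<in> I \<Longrightarrow> 1 + \<kappa> \<le> p \<bullet> vector_derivative f (at \<xi>)"
    "\<And>q. \<alpha> < q \<Longrightarrow> q < \<beta> \<Longrightarrow> \<exists>q0>0. \<forall>x\<in>\<Omega>. q0 \<le> p \<bullet> x + q \<and> 0 < p \<bullet> x + q + (T2 - T1) \<and> p \<bullet> x + q < T1"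
proof -
  obtain w c m where c: "0 < c" and \<tau>: "0 < \<tau>" and lo: "\<And>x. x \<in> \<Omega> \<Longrightarrow> m \<le> w \<bullet> x" and up: "\<And>x. x \<in> \<Omega> \<Longrightarrow> w \<bullet> x \<le> m + c * \<tau>"
    and der: "\<And>\<xi>. \<xi> \<in> I \<Longrightarrow> c \<le> w \<bullet> vector_derivative f (at \<xi>)"
    by (rule replacement_slab[OF R]) blast
  \<comment> \<open>A sweep time strictly between \<tau> and both target times. The gap above \<tau>
    becomes \<kappa>, the gap below becomes the room for \<open>q\<close>.\<close>
  define s where "s = (\<tau> + min T1 T2) / 2"
  have s: "\<tau> < s" "s < T1" "s < T2" using T by (auto simp: s_def)
  \<comment> \<open>The slab has width at most \<open>c * \<tau>\<close> in the direction
    \<open>w\<close>, so this speed sweeps it within time \<open>s\<close>; the relative speed is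
    \<open>c / c' - 1 = s / \<tau> - 1\<close>.\<close>
  define c' where "c' = c * \<tau> / s"
  have s0: "0 < s" using s \<tau> by linarith
  have c': "0 < c'" using c \<tau> s0 by (simp add: c'_def)
  have cs: "c * \<tau> / c' = s" using c \<tau> s0 by (simp add: c'_def)
  show thesis
  proof
    show "0 < s / \<tau> - 1" using s \<tau> by simp
    \<comment> \<open>On \<Omega> the front times lie between \<open>q + m / c'\<close> and
      \<open>q + m / c' + s\<close>. They have to exceed both 0 and \<open>T1 - T2\<close> and stay
      below \<open>T1\<close>, which leaves an interval because \<open>s < T1\<close> and
      \<open>s < T2\<close>.\<close>
    show "max 0 (T1 - T2) - m / c' < T1 - s - m / c'" using s by auto
    fix \<xi> assume "\<xi> \<in> I"
    then have "c / c' \<le> (w \<bullet> vector_derivative f (at \<xi>)) / c'" using der c' by (intro divide_right_mono) auto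
    moreover have "c / c' = 1 + (s / \<tau> - 1)" using c \<tau> s0 by (simp add: c'_def)
    ultimately show "1 + (s / \<tau> - 1) \<le> (w /\<^sub>R c') \<bullet> vector_derivative f (at \<xi>)" by (simp add: divide_inverse mult.commute)
  next
    fix q assume q: "max 0 (T1 - T2) - m / c' < q" "q < T1 - s - m / c'"
    have x: "m / c' \<le> (w /\<^sub>R c') \<bullet> x \<and> (w /\<^sub>R c') \<bullet> x \<le> m / c' + s" if "x \<in> \<Omega>" for x
    proof -
      have "m / c' \<le> (w \<bullet> x) / c'" "(w \<bullet> x) / c' \<le> (m + c * \<tau>) / c'"
        using lo[OF that] up[OF that] c' by (auto intro: divide_right_mono)
      moreover have "(m + c * \<tau>) / c' = m / c' + s" using cs by (simp add: add_divide_distrib)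
      moreover have "(w /\<^sub>R c') \<bullet> x = (w \<bullet> x) / c'" by (simp add: divide_inverse mult.commute)
      ultimately show ?thesis by simp
    qed
    show "\<exists>q0>0. \<forall>x\<in>\<Omega>. q0 \<le> (w /\<^sub>R c') \<bullet> x + q \<and> 0 < (w /\<^sub>R c') \<bullet> x + q + (T2 - T1) \<and> (w /\<^sub>R c') \<bullet> x + q < T1"
    proof (intro exI[of _ "q + m / c'"] conjI ballI)
      fix y assume "y \<in> \<Omega>"
      note y = x[OF this]
      show "q + m / c' \<le> (w /\<^sub>R c') \<bullet> y + q" "0 < (w /\<^sub>R c') \<bullet> y + q + (T2 - T1)" "(w /\<^sub>R c') \<bullet> y + q < T1"
        using y q by auto
    qed (use q in auto)
  qed
qed

context flux_approx
begin

text \<open>Two versions of the same function: \<open>u\<close>, built from \<open>w\<close>, has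
  meaningful values at every time and yields continuity and the values at times 0 and
  \<open>T1\<close>; \<open>U\<close>, built from \<open>F\<close>, is Borel in space-time and
  carries the entropy inequality. They agree almost everywhere over \<Omega>.\<close>

lemma glued_solution:
  fixes \<Omega> :: "'a set" and T1 T2 :: real and v :: "real \<Rightarrow> 'a \<Rightarrow> real"
  assumes \<Omega>: "open \<Omega>" and pos: "\<And>x. x \<in> \<Omega> \<Longrightarrow> 0 < \<theta> x" "\<And>x. x \<in> \<Omega> \<Longrightarrow> 0 < \<theta> x + (T2 - T1)"
    and T1: "\<And>x. x \<in> \<Omega> \<Longrightarrow> \<theta> x < T1"
    and ent: "entropy_solution f \<Omega> v" and vc: "continuous_in_L1 {0<..} \<Omega> v"
    and Vm [measurable]: "V \<in> borel_measurable borel" and VI: "\<And>z. V z \<in> {a..b}"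
    and vV: "AE z in lborel. z \<in> {0<..} \<times> \<Omega> \<longrightarrow> v (fst z) (snd z) = V (fst z - (T2 - T1), snd z)"
    and gV: "\<And>x. x \<in> \<Omega> \<Longrightarrow> g x = V (\<theta> x, x)"
    and e: "\<And>n. 0 < e n" "e \<longlonglongrightarrow> 0" and osc: "\<And>R. (\<lambda>n. front_osc V p R (e n) q) \<longlonglongrightarrow> 0"
    and u0: "AE x in lborel. x \<in> \<Omega> \<longrightarrow> u0 x = U0 x"
  shows "\<exists>u. entropy_solution_from f \<Omega> u0 u \<and> continuous_in_L1_loc {0..} \<Omega> u \<and>
    (AE x in lebesgue_on \<Omega>. u 0 x = u0 x) \<and> (AE x in lebesgue_on \<Omega>. u T1 x = v T2 x)"
proof -
  define \<Delta> where "\<Delta> = T2 - T1"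
  obtain r F w where r: "strict_mono r" and Fm [measurable]: "F \<in> borel_measurable borel" and FI: "\<And>z. F z \<in> {a..b}"
    and Flim: "AE z in lborel. (\<lambda>j. W (r j) (r j) (fst z) (snd z)) \<longlonglongrightarrow> F z"
    and wm: "\<And>t. w t \<in> borel_measurable borel" and wI: "\<And>t x. w t x \<in> {a..b}"
    and wF: "AE t in lborel. \<forall>x. w t x = F (t, x)"
    and w0: "AE x in lborel. 0 < \<theta> x \<longrightarrow> w 0 x = U0 x"
    and mod: "\<And>R T \<epsilon>. 0 < \<epsilon> \<Longrightarrow> \<exists>\<delta>>0. \<forall>t s. \<bar>t\<bar> \<le> T \<longrightarrow> \<bar>s - t\<bar> < \<delta> \<longrightarrow>
      (\<integral>\<^sup>+x. indicator (cball 0 R \<inter> {x. t < \<theta> x \<and> s < \<theta> x}) x * ennreal \<bar>w s x - w t x\<bar> \<partial>lborel) \<le> ennreal \<epsilon>"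
    by (rule limit_exists) (rule that; assumption)
  define u where "u t x = (if t < \<theta> x then w t x else v (t + \<Delta>) x)" for t x
  define U where "U z = (if fst z < \<theta> (snd z) then F z else V z)" for z
  have Um [measurable]: "U \<in> borel_measurable borel" unfolding U_def by measurable
  have UI: "U z \<in> {a..b}" for z using FI[of z] VI[of z] by (simp add: U_def)
  have \<Omega>b [measurable]: "\<Omega> \<in> sets borel" using \<Omega> by simp
  have S: "{0::real..} \<times> \<Omega> \<in> sets borel"
  proof -
    have "{0::real..} \<times> \<Omega> \<in> sets (borel \<Otimes>\<^sub>M borel)" by measurable
    then show ?thesis by (simp only: borel_prod)
  qed
  have uU: "AE z in lborel. snd z \<in> \<Omega> \<longrightarrow> u (fst z) (snd z) = U z"
  proof -
    have "AE z in (lborel :: (real \<times> 'a) measure). \<forall>x. w (fst z) x = F (fst z, x)" by (rule AE_fst[OF wF])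
    moreover have "AE z in (lborel :: (real \<times> 'a) measure). (fst z + \<Delta>, snd z) \<in> {0<..} \<times> \<Omega> \<longrightarrow> v (fst (fst z + \<Delta>, snd z)) (snd (fst z + \<Delta>, snd z)) = V (fst (fst z + \<Delta>, snd z) - \<Delta>, snd (fst z + \<Delta>, snd z))"
      by (rule AE_time_shift[OF vV[folded \<Delta>_def]])
    ultimately show ?thesis
    proof eventually_elim
      case (elim z)
      show ?case
      proof
        assume z: "snd z \<in> \<Omega>"
        show "u (fst z) (snd z) = U z"
          using elim pos(2)[OF z] z by (auto simp: u_def U_def \<Delta>_def)
      qed
    qed
  qed
  have uU': "AE z in lborel. z \<in> S \<longrightarrow> u (fst z) (snd z) = U z" if "S \<subseteq> UNIV \<times> \<Omega>" for S
    using uU by eventually_elim (use that in auto)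
  have Linf: "L_infinity ({0..} \<times> \<Omega>) (\<lambda>(t, x). u t x)"
    unfolding L_infinity_def case_prod_unfold
  proof (intro conjI exI)
    show "(\<lambda>z. u (fst z) (snd z)) \<in> borel_measurable (lebesgue_on ({0..} \<times> \<Omega>))"
      by (rule measurable_lebesgue_on_AE[OF Um S uU']) auto
    have "AE z in lborel. z \<in> {0..} \<times> \<Omega> \<longrightarrow> \<bar>u (fst z) (snd z)\<bar> \<le> max \<bar>a\<bar> \<bar>b\<bar>"
      using uU
    proof eventually_elim
      case (elim z)
      then show ?case using UI[of z] by (cases z) auto
    qed
    then show "AE z in lebesgue_on ({0..} \<times> \<Omega>). \<bar>u (fst z) (snd z)\<bar> \<le> max \<bar>a\<bar> \<bar>b\<bar>"
      by (rule AE_lebesgue_on_I[OF S])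
  qed
  have vent: "0 \<le> kruzhkov_integral f \<Omega> v k D" if "test_function ({0<..} \<times> \<Omega>) \<phi> D" for k \<phi> D
    using ent that unfolding entropy_solution_def by blast
  have entu: "0 \<le> kruzhkov_integral f \<Omega> u k D + (\<integral>x. \<bar>u0 x - k\<bar> * \<phi> (0, x) \<partial>lebesgue_on \<Omega>)"
    if T: "test_function ({0..} \<times> \<Omega>) \<phi> D" for k \<phi> D
  proof -
    let ?\<phi> = "\<lambda>z. if z \<in> {0..} \<times> \<Omega> then \<phi> z else 0" and ?D = "\<lambda>z. if z \<in> {0..} \<times> \<Omega> then D z else 0"
    have T': "test_function ({0..} \<times> UNIV) ?\<phi> ?D" by (rule test_function_extend[OF \<Omega> T])
    have "(\<lambda>z. if 0 \<le> fst z then ?D z else 0) = ?D" "(\<lambda>z. if 0 \<le> fst z then ?\<phi> z else 0) = ?\<phi>" by (auto simp: fun_eq_iff)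
    with test_function_measurable[OF T'] have ms [measurable]: "?D \<in> borel_measurable borel" "?\<phi> \<in> borel_measurable borel" by simp_all
    have "kruzhkov_integral f \<Omega> u k D = (\<integral>z. (if z \<in> {0<..} \<times> \<Omega> then kr f k (U z) (?D z) else 0) \<partial>lborel)"
    proof (rule kruzhkov_lborel[OF \<Omega> f_meas Um ms(1)])
      show "AE z in lborel. z \<in> {0<..} \<times> \<Omega> \<longrightarrow> u (fst z) (snd z) = U z" by (rule uU') auto
      show "?D z = D z" if "z \<in> {0<..} \<times> \<Omega>" for z using that by auto
    qed
    moreover have "(\<integral>x. \<bar>u0 x - k\<bar> * \<phi> (0, x) \<partial>lebesgue_on \<Omega>) = (\<integral>x. \<bar>U0 x - k\<bar> * ?\<phi> (0, x) \<partial>lborel)"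
    proof (rule integral_lebesgue_on_eq_lborel[OF _ \<Omega>b])
      have "(\<lambda>x. ?\<phi> (0, x)) \<in> borel_measurable borel" by (rule measurable_compose[OF _ ms(2)]) measurable
      then show "(\<lambda>x. \<bar>U0 x - k\<bar> * ?\<phi> (0, x)) \<in> borel_measurable borel" by measurable
      show "AE x in lborel. x \<in> \<Omega> \<longrightarrow> \<bar>u0 x - k\<bar> * \<phi> (0, x) = \<bar>U0 x - k\<bar> * ?\<phi> (0, x)"
        using u0 by eventually_elim auto
    qed auto
    moreover have "0 \<le> (\<integral>z. (if z \<in> {0<..} \<times> \<Omega> then kr f k (U z) (?D z) else 0) \<partial>lborel) + (\<integral>x. \<bar>U0 x - k\<bar> * ?\<phi> (0, x) \<partial>lborel)"
      unfolding U_def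
      by (rule glued_entropy[OF r Fm FI Flim \<Omega> T pos vent Vm VI vV gV e osc])
    ultimately show ?thesis by simp
  qed
  have cont: "continuous_in_L1_loc {0..} \<Omega> u"
    unfolding u_def[abs_def]
  proof (rule glued_continuous[OF \<Omega> _ _ _ wm _ mod vc])
    show "continuous_on UNIV \<theta>" unfolding \<theta>_def by (intro continuous_intros)
    show "AE x in lborel. \<theta> x \<noteq> t" for t by (rule theta_level_null)
    show "0 < \<theta> x + \<Delta>" if "x \<in> \<Omega>" for x using pos(2)[OF that] by (simp add: \<Delta>_def)
    show "\<bar>w t x\<bar> \<le> max \<bar>a\<bar> \<bar>b\<bar>" for t x using wI[of t x] by auto
  qed
  have "AE x in lborel. x \<in> \<Omega> \<longrightarrow> u 0 x = u0 x"
    using w0 u0 by eventually_elim (use pos(1) in \<open>auto simp: u_def\<close>)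
  then have "AE x in lebesgue_on \<Omega>. u 0 x = u0 x" by (rule AE_lebesgue_on_I[OF \<Omega>b])
  moreover have "AE x in lebesgue_on \<Omega>. u T1 x = v T2 x"
  proof (rule AE_I2)
    fix x assume "x \<in> space (lebesgue_on \<Omega>)"
    then have "\<theta> x < T1" using T1 by simp
    then show "u T1 x = v T2 x" by (simp add: u_def \<Delta>_def)
  qed
  ultimately show ?thesis using Linf entu cont unfolding entropy_solution_from_def by blast
qed

end

theorem theorem1:
  fixes \<Omega> :: "'a::euclidean_space set"
    and f :: "real \<Rightarrow> 'a"
    and v :: "real \<Rightarrow> 'a \<Rightarrow> real"
    and u0 :: "'a \<Rightarrow> real"
    and a b \<tau> T1 T2 :: real
    and I :: "real set"
  assumes "open \<Omega>" and "C2_boundary \<Omega>"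
    and "f C1_differentiable_on UNIV"
    and "continuous_in_L1 {0<..} \<Omega> v"
    and "L_infinity ({0<..} \<times> \<Omega>) (\<lambda>(t, x). v t x)"
    and "entropy_solution f \<Omega> v"
    and "L_infinity \<Omega> u0"
    and "a \<le> b" and "I = {a..b}"
    and "AE x in lebesgue_on \<Omega>. u0 x \<in> I"
    and "AE (t, x) in lebesgue_on ({0<..} \<times> \<Omega>). v t x \<in> I"
    and "replacement_condition f \<Omega> I \<tau>"
    and "nondegenerate_flux f"
    and "\<tau> < T1" and "\<tau> < T2"
  shows "\<exists>u. entropy_solution_from f \<Omega> u0 u \<and>
             continuous_in_L1_loc {0..} \<Omega> u \<and>
             (AE x in lebesgue_on \<Omega>. u 0 x = u0 x) \<and>
             (AE x in lebesgue_on \<Omega>. u T1 x = v T2 x)"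
proof -
  note \<Omega> = assms(1) and ab = \<open>a \<le> b\<close>
  define c where "c \<xi> = vector_derivative f (at \<xi>)" for \<xi>
  have cc: "continuous_on UNIV c" and fd: "(f has_vector_derivative c u) (at u)" for u
    using assms(3) unfolding C1_differentiable_on_eq c_def[abs_def] by (auto simp: vector_derivative_works)
  obtain p \<kappa> \<alpha> \<beta> where \<kappa>: "0 < \<kappa>" and \<alpha>\<beta>: "\<alpha> < \<beta>" and p: "\<And>\<xi>. \<xi> \<in> {a..b} \<Longrightarrow> 1 + \<kappa> \<le> p \<bullet> c \<xi>"
    and front: "\<And>q. \<alpha> < q \<Longrightarrow> q < \<beta> \<Longrightarrow> \<exists>q0>0. \<forall>x\<in>\<Omega>. q0 \<le> p \<bullet> x + q \<and> 0 < p \<bullet> x + q + (T2 - T1) \<and> p \<bullet> x + q < T1"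
    using replacement_front[OF assms(12,14,15)] unfolding \<open>I = {a..b}\<close> c_def by metis
  have "compact (c ` {a..b})"
    by (rule compact_continuous_image[OF continuous_on_subset[OF cc]]) auto
  from compact_imp_bounded[OF this] obtain M where M: "0 < M" "\<And>\<xi>. \<xi> \<in> {a..b} \<Longrightarrow> norm (c \<xi>) \<le> M"
    unfolding bounded_pos by blast
  \<comment> \<open>By Cauchy-Schwarz this already bounds \<open>p \<bullet> c \<xi>\<close>, hence
    also the relative speed.\<close>
  define N where "N = norm p * M"
  have N: "0 \<le> N" using M(1) by (simp add: N_def)
  have pN: "p \<bullet> c \<xi> \<le> 1 + N" if "\<xi> \<in> {a..b}" for \<xi>
  proof -
    have "p \<bullet> c \<xi> \<le> norm p * norm (c \<xi>)" by (rule norm_cauchy_schwarz)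
    also have "\<dots> \<le> N" unfolding N_def using M(2)[OF that] by (intro mult_left_mono) auto
    finally show ?thesis by simp
  qed
  have \<Omega>b: "\<Omega> \<in> sets borel" and Sb: "{0::real<..} \<times> \<Omega> \<in> sets borel"
    using \<Omega> by (auto intro!: borel_open open_Times)
  obtain U0 u0s where U0m [measurable]: "U0 \<in> borel_measurable borel" and U0I: "\<And>x. U0 x \<in> {a..b}"
    and u0c: "\<And>i. continuous_on UNIV (u0s i)" and u0I: "\<And>i x. u0s i x \<in> {a..b}"
    and u0lim: "AE x in lborel. (\<lambda>i. u0s i x) \<longlonglongrightarrow> U0 x" and u0eq: "AE x in lborel. x \<in> \<Omega> \<longrightarrow> U0 x = u0 x"
    using borel_continuous_approx[OF \<Omega>b _ _ ab, of u0] assms(7,10) \<open>I = {a..b}\<close> unfolding L_infinity_def by blast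
  have vI: "AE z in lebesgue_on ({0<..} \<times> \<Omega>). v (fst z) (snd z) \<in> {a..b}"
    using assms(11) \<open>I = {a..b}\<close> by (simp only: case_prod_unfold)
  have vm: "(\<lambda>z. v (fst z) (snd z)) \<in> borel_measurable (lebesgue_on ({0<..} \<times> \<Omega>))"
    using assms(5) unfolding L_infinity_def by (simp only: case_prod_unfold)
  obtain Vs vs where Vsm [measurable]: "Vs \<in> borel_measurable borel" and VsI: "\<And>z. Vs z \<in> {a..b}"
    and vsc: "\<And>i. continuous_on UNIV (vs i)" and vsI: "\<And>i z. vs i z \<in> {a..b}"
    and vslim: "AE z in lborel. (\<lambda>i. vs i z) \<longlonglongrightarrow> Vs z"
    and vseq: "AE z in lborel. z \<in> {0<..} \<times> \<Omega> \<longrightarrow> Vs z = v (fst z) (snd z)"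
    by (rule borel_continuous_approx[OF Sb vm vI ab]) blast
  \<comment> \<open>\<open>v\<close> in the clock of the new solution: time \<open>T1\<close> here
    is time \<open>T2\<close> for \<open>v\<close>.\<close>
  define V where "V z = Vs (fst z + (T2 - T1), snd z)" for z
  define Vi where "Vi i z = vs i (fst z + (T2 - T1), snd z)" for i z
  have Vm [measurable]: "V \<in> borel_measurable borel" unfolding V_def by measurable
  have VI: "V z \<in> {a..b}" and ViI: "Vi i z \<in> {a..b}" for i z using VsI vsI by (auto simp: V_def Vi_def)
  have Vic: "continuous_on UNIV (Vi i)" for i
    unfolding Vi_def by (rule continuous_on_compose2[OF vsc]) (auto intro!: continuous_intros)
  have Vlim: "AE z in lborel. (\<lambda>i. Vi i z) \<longlonglongrightarrow> V z"
    unfolding V_def Vi_def by (rule AE_time_shift[OF vslim])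
  obtain e where e: "\<And>k. 0 < e k" "e \<longlonglongrightarrow> 0" and osc: "AE q in lborel. \<forall>R. (\<lambda>k. front_osc V p R (e k) q) \<longlonglongrightarrow> 0"
    by (rule good_front_scale[OF Vm VI Vic ViI Vlim]) blast
  \<comment> \<open>Two generic properties of the front: a strong trace of \<open>V\<close> along
    the scales \<open>e\<close>, and convergence of the continuous approximants at almost every
    point of the front. A common \<open>q\<close> is then picked from the admissible
    interval.\<close>
  have "AE q in lborel. (\<forall>R. (\<lambda>k. front_osc V p R (e k) q) \<longlonglongrightarrow> 0) \<and> (AE x in lborel. (\<lambda>i. Vi i (p \<bullet> x + q, x)) \<longlonglongrightarrow> V (p \<bullet> x + q, x))"
    using osc AE_front[OF Vlim, of p] by eventually_elim blast
  then obtain q where q: "\<alpha> < q" "q < \<beta>" and oscq: "\<And>R. (\<lambda>k. front_osc V p R (e k) q) \<longlonglongrightarrow> 0"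
    and Vlimq: "AE x in lborel. (\<lambda>i. Vi i (p \<bullet> x + q, x)) \<longlonglongrightarrow> V (p \<bullet> x + q, x)"
    using AE_lborel_obtain[OF _ \<alpha>\<beta>] by blast
  obtain q0 where q0: "0 < q0" and slab: "\<And>x. x \<in> \<Omega> \<Longrightarrow> q0 \<le> p \<bullet> x + q" "\<And>x. x \<in> \<Omega> \<Longrightarrow> 0 < p \<bullet> x + q + (T2 - T1)" "\<And>x. x \<in> \<Omega> \<Longrightarrow> p \<bullet> x + q < T1"
    using front[OF q] by blast
  \<comment> \<open>The datum on the front is \<open>V\<close>; blending it with \<open>u0\<close> before the front reaches \<open>\<Omega>\<close> makes \<open>G\<close>
    continuous up to time 0.\<close>
  define \<zeta> where "\<zeta> t = max 0 (min 1 (t / q0))" for t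
  have \<zeta>: "0 \<le> \<zeta> t" "\<zeta> t \<le> 1" "t \<le> 0 \<Longrightarrow> \<zeta> t = 0" "q0 \<le> t \<Longrightarrow> \<zeta> t = 1" for t
    using q0 divide_nonpos_pos[of t q0] by (auto simp: \<zeta>_def min_def max_def)
  have \<zeta>c: "continuous_on UNIV \<zeta>" unfolding \<zeta>_def using q0 by (auto intro!: continuous_intros)
  have [measurable]: "\<zeta> \<in> borel_measurable borel" by (rule borel_measurable_continuous_onI[OF \<zeta>c])
  have mix: "(1 - \<zeta> t) * y + \<zeta> t * y' \<in> {a..b}" if "y \<in> {a..b}" "y' \<in> {a..b}" for t y y'
    using convexD[OF convex_real_interval(5)[of a b] that, of "1 - \<zeta> t" "\<zeta> t"] \<zeta>[of t] by simp
  define G where "G j z = (1 - \<zeta> (fst z)) * u0s j (snd z) + \<zeta> (fst z) * Vi j z" for j z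
  define Gl where "Gl z = (1 - \<zeta> (fst z)) * U0 (snd z) + \<zeta> (fst z) * V z" for z
  \<comment> \<open>Over \<Omega> the front time is at least \<open>q0\<close>, where the blending
    factor is 1, so there \<open>g\<close> is the trace of \<open>V\<close>; elsewhere it only has
    to be measurable with values in {a..b}.\<close>
  define g where "g x = Gl (p \<bullet> x + q, x)" for x
  have Gc: "continuous_on UNIV (G j)" for j
    unfolding G_def
    by (intro continuous_intros Vic continuous_on_compose2[OF \<zeta>c] continuous_on_compose2[OF u0c]) auto
  have Glm [measurable]: "Gl \<in> borel_measurable borel" unfolding Gl_def by measurable
  have gm: "g \<in> borel_measurable borel" unfolding g_def by measurable
  obtain h where h: "\<And>j. 0 < h j" "\<And>j. h j \<le> 1 / (real j + 1)"
    "\<And>i j x r. i \<le> j \<Longrightarrow> norm x \<le> real j \<Longrightarrow> 0 \<le> r \<Longrightarrow> r \<le> h j * N \<Longrightarrow>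
      \<bar>G i (p \<bullet> x + q + r, x) - G i (p \<bullet> x + q, x)\<bar> \<le> 1 / (real j + 1)"
    by (rule fine_steps_exist[where G=G and p=p and q=q, OF Gc N]) blast
  interpret front c a b M p q \<kappa> N
    by unfold_locales (use cc ab M \<kappa> N p pN in auto)
  interpret flux_approx c a b M p q \<kappa> N G u0s h U0 g Gl f
  proof
    show "G j z \<in> {a..b}" for j z unfolding G_def by (rule mix[OF u0I ViI])
    show "G j (t, x) = u0s j x" if "t \<le> 0" for j t x using \<zeta>(3)[OF that] by (simp add: G_def)
    show "AE x in lborel. (\<lambda>j. G j (\<theta> x, x)) \<longlonglongrightarrow> g x"
      using u0lim Vlimq
    proof eventually_elim
      case (elim x)
      then show ?case unfolding G_def g_def Gl_def \<theta>_def by (auto intro!: tendsto_intros)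
    qed
    show "AE z in lborel. (\<lambda>j. G j z) \<longlonglongrightarrow> Gl z"
      using AE_snd[OF u0lim] Vlim
    proof eventually_elim
      case (elim z)
      then show ?case unfolding G_def Gl_def by (auto intro!: tendsto_intros)
    qed
    show "g x \<in> {a..b}" for x unfolding g_def Gl_def by (rule mix[OF U0I VI])
  qed (use Gc U0m gm Glm u0lim h fd U0I in \<open>simp_all only: \<theta>_def\<close>)
  show ?thesis
  proof (rule glued_solution[OF \<Omega> _ _ _ assms(6,4) Vm VI _ _ e oscq])
    show "0 < \<theta> x" "0 < \<theta> x + (T2 - T1)" "\<theta> x < T1" if "x \<in> \<Omega>" for x
      using slab[OF that] q0 by (simp_all add: \<theta>_def)
    show "AE z in lborel. z \<in> {0<..} \<times> \<Omega> \<longrightarrow> v (fst z) (snd z) = V (fst z - (T2 - T1), snd z)"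
      using vseq by eventually_elim (simp add: V_def)
    show "g x = V (\<theta> x, x)" if "x \<in> \<Omega>" for x
      using \<zeta>(4)[OF slab(1)[OF that]] by (simp add: g_def Gl_def \<theta>_def)
    show "AE x in lborel. x \<in> \<Omega> \<longrightarrow> u0 x = U0 x" using u0eq by eventually_elim simp
  qed
qed

end
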